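(* Let $L$ be an oriented link diagram and let $C$ be an admissible cut of $L$, with surgeries $L_1^{\mathcal{A}}$, $L_2^{\mathcal{B}}$ ($\mathcal{A},\mathcal{B}\in NC_n$). Then there is a double chain complex of $q$-graded vector spaces whose rows are linear combinations of the Khovanov complexes $\mathcal{C}(L_1^{\mathcal{A}})$, $\mathcal{A}\in NC_n$, and whose columns are linear combinations of the Khovanov complexes $\mathcal{C}(L_2^{\mathcal{B}})$, $\mathcal{B}\in NC_n$, such that its total complex is homotopy equivalent to the Khovanov complex $\mathcal{C}(L)$.
   Context: **Khovanov complex.** Fix a field $k$. Let $V=\langle v_-\rangle\oplus\langle v_+\rangle$ be the $q$-graded $k$-vector space with $\deg_q v_\pm=\pm1$. Shifts: $W\{l\}_m=W_{m-l}$ for $q$-graded spaces, $\mathcal{C}[s]^m=\mathcal{C}^{m-s}$ for complexes. Let $L$ be an oriented link diagram with set of crossings $\chi$. At a positive crossing the $0$-smoothing is the orientation-consistent smoothing and the $1$-smoothing is the other one; at a negative crossing the roles are exchanged. A state $\alpha\in\{0,1\}^\chi$ yields the smoothing $\mathcal{S}_\alpha(L)$, a set of disjoint circles; $r(\alpha)=\sum_c\alpha(c)$. Put $F(\mathcal{S}_\alpha(L))=\bigotimes_{\text{circles}}V$ and $[\![L]\!]^r=\bigoplus_{r(\alpha)=r}F(\mathcal{S}_\alpha(L))\{r\}$. An arrow $a\in\{0,1,*\}^\chi$ (with $*$ occurring exactly once) goes from the state $a(0)$ to $a(1)$ and merges two circles or splits one; $d_a$ is correspondingly the multiplication $m$ ($v_+v_\pm=v_\pm$,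 $v_-v_+=v_-$, $v_-v_-=0$) or comultiplication $\Delta$ ($v_+\mapsto v_+\otimes v_-+v_-\otimes v_+$, $v_-\mapsto v_-\otimes v_-$), tensored with the identity on the other circles. With a total order on $\chi$, the differential is $\sum_a(-1)^{sg(a)}d_a$, where $sg(a)$ is the sum of the $a(j)$ over the crossings $j$ preceding the position of $*$. If $l^\pm$ is the number of positive/negative crossings, then $\mathcal{C}(L)=[\![L]\!][-l^-]\{l^+-2l^-\}$. **Cuts and surgeries.** Diagrams are regarded on $S^2=\mathbb{R}^2\cup\{\infty\}$. An admissible cut of $L$ is a Jordan curve $C$ in the plane, transversal to $L$ (in particular avoiding the crossings), such that, walking along $C$, the directions in which $L$ crosses $C$ at the successive intersection points alternate. There are then $2n$ intersection points. Orient $C$, choose a base point on $C$, and label the points $a_1,b_1,a_2,b_2,\dots,a_n,b_n$ in the order met; let $R_1,R_2$ be the two closed discs of $S^2$ bounded by $C$, the choices being made so that $L$ enters $R_1$ (leaves $R_2$) at each $a_i$ and leaves $R_1$ (enters $R_2$) at each $b_i$. $NC_n$ is the set of non crossing partitions of $\{1,\dots,n\}$: partitions such that the convex hulls of the images of distinct blocks under $m\mapsto e^{2\pi i m/n}$ are disjoint ($NC_0$ has exactly one element). For $\mathcal{A}\in NC_n$, let $\vec{\mathcal{A}}$ be the system of disjoint oriented chords of a disc (with the points $a_1,b_1,\dots,a_n,b_n$ placed cyclically on its boundary) consisting, for each block $i_1<\dots<i_k$ of $\mathcal{A}$, of chords from $b_{i_1}$ to $a_{i_2}$, from $b_{i_2}$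 to $a_{i_3}$, ..., from $b_{i_k}$ to $a_{i_1}$ (for $k=1$: from $b_{i_1}$ to $a_{i_1}$). The surgery $L_1^{\mathcal{A}}$ is $L\cap R_1$ closed up by a copy of $\vec{\mathcal{A}}$ in $R_2$; the surgery $L_2^{\mathcal{A}}$ is $L\cap R_2$ closed up by a copy of $\vec{\mathcal{A}}$ with reversed orientation in $R_1$. **Conventions.** A double complex $A=(A^{p,q},d_{hor},d_{vert})$ has commuting differentials; its rows are the complexes $A^{\bullet,q}$ and its columns the complexes $A^{p,\bullet}$; $Tot(A)^m=\bigoplus_{p+q=m}A^{p,q}$ with differential $d_{hor}+(-1)^pd_{vert}$. A linear combination of complexes $\mathcal{C}(L_i^{\mathcal{A}})$ means a complex isomorphic to $\bigoplus_{\mathcal{A}\in NC_n}W_{\mathcal{A}}\otimes\mathcal{C}(L_i^{\mathcal{A}})$ for some finite dimensional $q$-graded vector spaces $W_{\mathcal{A}}$ (which depend on the row or column). *)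

theory Defs
  imports "HOL-Analysis.Analysis"
begin

section \<open>Complexes of graded vector spaces\<close>

text \<open>
  All vector spaces that occur are finite dimensional. A \<open>q\<close>-graded vector space is presented by a
  finite homogeneous basis, and a linear map \<open>f\<close> by its matrix: \<open>f b c\<close> is the coefficient of the
  basis vector \<open>c\<close> in the image of the basis vector \<open>b\<close>.
\<close>

record 'w graded =
  gbasis :: "'w set"
  gdeg :: "'w \<Rightarrow> int"

record ('b, 'k) cpx =
  gens :: "'b set"
  hdeg :: "'b \<Rightarrow> int"
  qdeg :: "'b \<Rightarrow> int"
  bd :: "'b \<Rightarrow> 'b \<Rightarrow> 'k"

text \<open>\<open>mcomp B f g\<close> is \<open>f\<close> followed by \<open>g\<close>, where \<open>B\<close> is the basis of the middle space.\<close>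

definition mcomp :: "'b set \<Rightarrow> ('a \<Rightarrow> 'b \<Rightarrow> 'k::field) \<Rightarrow> ('b \<Rightarrow> 'c \<Rightarrow> 'k) \<Rightarrow> 'a \<Rightarrow> 'c \<Rightarrow> 'k" where
  "mcomp B f g = (\<lambda>a c. \<Sum>b\<in>B. f a b * g b c)"

definition idmat :: "'b set \<Rightarrow> 'b \<Rightarrow> 'b \<Rightarrow> 'k::field" where
  "idmat B = (\<lambda>b c. if b \<in> B \<and> b = c then 1 else 0)"

text \<open>Homogeneous linear maps of homological degree \<open>s\<close> and \<open>q\<close>-degree 0.\<close>

definition graded_map ::
    "int \<Rightarrow> ('b, 'k::field) cpx \<Rightarrow> ('c, 'k) cpx \<Rightarrow> ('b \<Rightarrow> 'c \<Rightarrow> 'k) \<Rightarrow> bool" where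
  "graded_map s X Y f \<longleftrightarrow>
     (\<forall>b c. f b c \<noteq> 0 \<longrightarrow>
        b \<in> gens X \<and> c \<in> gens Y \<and> hdeg Y c = hdeg X b + s \<and> qdeg Y c = qdeg X b)"

definition chain_complex :: "('b, 'k::field) cpx \<Rightarrow> bool" where
  "chain_complex X \<longleftrightarrow>
     finite (gens X) \<and> graded_map 1 X X (bd X) \<and> mcomp (gens X) (bd X) (bd X) = (\<lambda>b c. 0)"

definition chain_map ::
    "('b, 'k::field) cpx \<Rightarrow> ('c, 'k) cpx \<Rightarrow> ('b \<Rightarrow> 'c \<Rightarrow> 'k) \<Rightarrow> bool" where
  "chain_map X Y f \<longleftrightarrow>
     graded_map 0 X Y f \<and> mcomp (gens X) (bd X) f = mcomp (gens Y) f (bd Y)"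

definition cpx_iso :: "('b, 'k::field) cpx \<Rightarrow> ('c, 'k) cpx \<Rightarrow> bool" where
  "cpx_iso X Y \<longleftrightarrow>
     chain_complex X \<and> chain_complex Y \<and>
     (\<exists>f g. chain_map X Y f \<and> chain_map Y X g \<and>
        mcomp (gens Y) f g = idmat (gens X) \<and> mcomp (gens X) g f = idmat (gens Y))"

definition null_homotopic :: "('b, 'k::field) cpx \<Rightarrow> ('b \<Rightarrow> 'b \<Rightarrow> 'k) \<Rightarrow> bool" where
  "null_homotopic X f \<longleftrightarrow>
     (\<exists>h. graded_map (- 1) X X h \<and>
        (\<forall>b c. f b c = mcomp (gens X) (bd X) h b c + mcomp (gens X) h (bd X) b c))"

definition homotopy_equivalent_cpx :: "('b, 'k::field) cpx \<Rightarrow> ('c, 'k) cpx \<Rightarrow> bool" where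
  "homotopy_equivalent_cpx X Y \<longleftrightarrow>
     chain_complex X \<and> chain_complex Y \<and>
     (\<exists>f g. chain_map X Y f \<and> chain_map Y X g \<and>
        null_homotopic X (\<lambda>b c. mcomp (gens Y) f g b c - idmat (gens X) b c) \<and>
        null_homotopic Y (\<lambda>b c. mcomp (gens X) g f b c - idmat (gens Y) b c))"

definition tensor_cpx :: "'w graded \<Rightarrow> ('b, 'k::field) cpx \<Rightarrow> ('w \<times> 'b, 'k) cpx" where
  "tensor_cpx W X =
     \<lparr> gens = gbasis W \<times> gens X,
       hdeg = (\<lambda>(w, b). hdeg X b),
       qdeg = (\<lambda>(w, b). gdeg W w + qdeg X b),
       bd = (\<lambda>(w, b) (w', b'). if w \<in> gbasis W \<and> w = w' then bd X b b' else 0) \<rparr>"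

definition direct_sum_cpx :: "'i set \<Rightarrow> ('i \<Rightarrow> ('b, 'k::field) cpx) \<Rightarrow> ('i \<times> 'b, 'k) cpx" where
  "direct_sum_cpx I X =
     \<lparr> gens = (SIGMA i:I. gens (X i)),
       hdeg = (\<lambda>(i, b). hdeg (X i) b),
       qdeg = (\<lambda>(i, b). qdeg (X i) b),
       bd = (\<lambda>(i, b) (i', b'). if i \<in> I \<and> i = i' then bd (X i) b b' else 0) \<rparr>"

text \<open>Bases of the coefficient spaces are labelled by natural numbers, which is no restriction.\<close>

definition linear_combination ::
    "'i set \<Rightarrow> ('i \<Rightarrow> ('b, 'k::field) cpx) \<Rightarrow> ('c, 'k) cpx \<Rightarrow> bool" where
  "linear_combination I X Y \<longleftrightarrow>
     (\<exists>W :: 'i \<Rightarrow> nat graded.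
        (\<forall>i\<in>I. finite (gbasis (W i))) \<and>
        cpx_iso Y (direct_sum_cpx I (\<lambda>i. tensor_cpx (W i) (X i))))"

text \<open>A basis vector \<open>b\<close> of a double complex lies in \<open>A\<^bsup>p,q\<^esup>\<close> for \<open>p = pdeg A b\<close>, \<open>q = vdeg A b\<close>.\<close>

record ('b, 'k) dcpx =
  dgens :: "'b set"
  pdeg :: "'b \<Rightarrow> int"
  vdeg :: "'b \<Rightarrow> int"
  dqdeg :: "'b \<Rightarrow> int"
  dhor :: "'b \<Rightarrow> 'b \<Rightarrow> 'k"
  dvert :: "'b \<Rightarrow> 'b \<Rightarrow> 'k"

definition double_complex :: "('b, 'k::field) dcpx \<Rightarrow> bool" where
  "double_complex A \<longleftrightarrow>
     finite (dgens A) \<and>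
     (\<forall>b c. dhor A b c \<noteq> 0 \<longrightarrow> b \<in> dgens A \<and> c \<in> dgens A \<and>
        pdeg A c = pdeg A b + 1 \<and> vdeg A c = vdeg A b \<and> dqdeg A c = dqdeg A b) \<and>
     (\<forall>b c. dvert A b c \<noteq> 0 \<longrightarrow> b \<in> dgens A \<and> c \<in> dgens A \<and>
        pdeg A c = pdeg A b \<and> vdeg A c = vdeg A b + 1 \<and> dqdeg A c = dqdeg A b) \<and>
     mcomp (dgens A) (dhor A) (dhor A) = (\<lambda>b c. 0) \<and>
     mcomp (dgens A) (dvert A) (dvert A) = (\<lambda>b c. 0) \<and>
     mcomp (dgens A) (dhor A) (dvert A) = mcomp (dgens A) (dvert A) (dhor A)"

definition restrict_mat :: "'b set \<Rightarrow> ('b \<Rightarrow> 'b \<Rightarrow> 'k::field) \<Rightarrow> 'b \<Rightarrow> 'b \<Rightarrow> 'k" where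
  "restrict_mat B f = (\<lambda>b c. if b \<in> B \<and> c \<in> B then f b c else 0)"

definition row_cpx :: "('b, 'k::field) dcpx \<Rightarrow> int \<Rightarrow> ('b, 'k) cpx" where
  "row_cpx A q =
     \<lparr> gens = {b \<in> dgens A. vdeg A b = q}, hdeg = pdeg A, qdeg = dqdeg A,
       bd = restrict_mat {b \<in> dgens A. vdeg A b = q} (dhor A) \<rparr>"

definition column_cpx :: "('b, 'k::field) dcpx \<Rightarrow> int \<Rightarrow> ('b, 'k) cpx" where
  "column_cpx A p =
     \<lparr> gens = {b \<in> dgens A. pdeg A b = p}, hdeg = vdeg A, qdeg = dqdeg A,
       bd = restrict_mat {b \<in> dgens A. pdeg A b = p} (dvert A) \<rparr>"

definition total_complex :: "('b, 'k::field) dcpx \<Rightarrow> ('b, 'k) cpx" where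
  "total_complex A =
     \<lparr> gens = dgens A, hdeg = (\<lambda>b. pdeg A b + vdeg A b), qdeg = dqdeg A,
       bd = (\<lambda>b c. dhor A b c + (- 1) powi pdeg A b * dvert A b c) \<rparr>"


section \<open>Oriented link diagrams\<close>

text \<open>
  A diagram is given as a plane graph. The edges are oriented regular arcs; the vertices are the
  crossings together with some auxiliary bivalent vertices, where the diagram just continues (it may
  have a corner there). Bivalent vertices can be inserted anywhere: each closed curve of the diagram
  is cut up into arcs by the crossings and the bivalent vertices, and the Khovanov complex below
  does not depend on this subdivision. The list of crossings fixes the total order on them, and the
  last four fields name the incoming and outgoing edges of the over and the under strand at a crossing.
\<close>

record diagram =
  edges :: "(real \<Rightarrow> complex) set"
  crossings :: "complex list"
  over_in :: "complex \<Rightarrow> real \<Rightarrow> complex"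
  over_out :: "complex \<Rightarrow> real \<Rightarrow> complex"
  under_in :: "complex \<Rightarrow> real \<Rightarrow> complex"
  under_out :: "complex \<Rightarrow> real \<Rightarrow> complex"

definition regular_arc :: "(real \<Rightarrow> complex) \<Rightarrow> bool" where
  "regular_arc g \<longleftrightarrow>
     arc g \<and> g C1_differentiable_on {0..1} \<and> (\<forall>t\<in>{0..1}. vector_derivative g (at t) \<noteq> 0)"

definition support :: "diagram \<Rightarrow> complex set" where
  "support D = (\<Union>e\<in>edges D. path_image e)"

definition vertices :: "diagram \<Rightarrow> complex set" where
  "vertices D = pathstart ` edges D \<union> pathfinish ` edges D"

text \<open>The tangent directions of the over and the under strand at a crossing.\<close>

definition over_dir :: "diagram \<Rightarrow> complex \<Rightarrow> complex" where
  "over_dir D x = vector_derivative (over_in D x) (at 1)"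

definition under_dir :: "diagram \<Rightarrow> complex \<Rightarrow> complex" where
  "under_dir D x = vector_derivative (under_in D x) (at 1)"

text \<open>
  \<open>Im (cnj v * w)\<close> is the determinant of the pair of plane vectors \<open>(v, w)\<close>. A crossing is positive
  iff (over, under) is a positively oriented frame.
\<close>

definition proper_crossing :: "diagram \<Rightarrow> complex \<Rightarrow> bool" where
  "proper_crossing D x \<longleftrightarrow>
     {e \<in> edges D. pathfinish e = x} = {over_in D x, under_in D x} \<and>
     {e \<in> edges D. pathstart e = x} = {over_out D x, under_out D x} \<and>
     over_in D x \<noteq> under_in D x \<and> over_out D x \<noteq> under_out D x \<and>
     (\<exists>r>0. vector_derivative (over_out D x) (at 0) = r *\<^sub>R over_dir D x) \<and>
     (\<exists>r>0. vector_derivative (under_out D x) (at 0) = r *\<^sub>R under_dir D x) \<and>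
     Im (cnj (over_dir D x) * under_dir D x) \<noteq> 0"

definition link_diagram :: "diagram \<Rightarrow> bool" where
  "link_diagram D \<longleftrightarrow>
     finite (edges D) \<and> (\<forall>e\<in>edges D. regular_arc e) \<and>
     (\<forall>e\<in>edges D. \<forall>f\<in>edges D. e \<noteq> f \<longrightarrow>
        path_image e \<inter> path_image f \<subseteq>
          {pathstart e, pathfinish e} \<inter> {pathstart f, pathfinish f}) \<and>
     distinct (crossings D) \<and> (\<forall>x\<in>set (crossings D). proper_crossing D x) \<and>
     (\<forall>p\<in>vertices D - set (crossings D).
        (\<exists>!e. e \<in> edges D \<and> pathfinish e = p) \<and> (\<exists>!e. e \<in> edges D \<and> pathstart e = p))"

definition positive_crossing :: "diagram \<Rightarrow> complex \<Rightarrow> bool" where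
  "positive_crossing D x \<longleftrightarrow> Im (cnj (over_dir D x) * under_dir D x) > 0"

definition lpos :: "diagram \<Rightarrow> nat" where
  "lpos D = card {x \<in> set (crossings D). positive_crossing D x}"

definition lneg :: "diagram \<Rightarrow> nat" where
  "lneg D = card {x \<in> set (crossings D). \<not> positive_crossing D x}"


section \<open>The Khovanov complex\<close>

text \<open>
  A state in \<open>{0,1}\<^bsup>\<chi>\<^esup>\<close> is encoded by the set \<open>\<alpha>\<close> of crossings where it takes the value 1, an arrow by
  its source \<open>\<alpha>\<close> and the crossing \<open>x \<notin> \<alpha>\<close> at which the \<open>*\<close> stands. The smoothing is consistent with
  the orientation at \<open>x\<close> iff \<open>x\<close> is positive and \<open>\<alpha>(x) = 0\<close> or \<open>x\<close> is negative and \<open>\<alpha>(x) = 1\<close>; it then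
  joins the incoming edge of each strand to the outgoing edge of the other one. The other smoothing
  joins the two incoming edges and the two outgoing edges.
\<close>

definition joined :: "diagram \<Rightarrow> complex set \<Rightarrow> ((real \<Rightarrow> complex) \<times> (real \<Rightarrow> complex)) set" where
  "joined D \<alpha> =
     {(e, f). e \<in> edges D \<and> f \<in> edges D \<and> pathfinish e = pathstart f \<and>
        pathfinish e \<notin> set (crossings D)}
     \<union> (\<Union>x\<in>set (crossings D).
          if positive_crossing D x \<longleftrightarrow> x \<notin> \<alpha>
          then {(over_in D x, under_out D x), (under_in D x, over_out D x)}
          else {(over_in D x, under_in D x), (over_out D x, under_out D x)})"

text \<open>
  A circle of the smoothing is given by the set of points of the diagram it runs through. (The
  two branches at a smoothed crossing are not pulled apart, so circles may still touch there.)
\<close>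

definition circles :: "diagram \<Rightarrow> complex set \<Rightarrow> complex set set" where
  "circles D \<alpha> =
     (\<lambda>Z. \<Union>e\<in>Z. path_image e) ` (edges D // (joined D \<alpha> \<union> (joined D \<alpha>)\<inverse>)\<^sup>*)"

datatype vgen = vminus | vplus

fun vdegree :: "vgen \<Rightarrow> int" where
  "vdegree vminus = - 1"
| "vdegree vplus = 1"

text \<open>
  The structure constants of \<open>m\<close> and \<open>\<Delta>\<close> are 0 or 1: \<open>mult_term u v w\<close> says that \<open>w\<close> occurs in
  \<open>m(u \<otimes> v)\<close>, and \<open>comult_term u v w\<close> that \<open>v \<otimes> w\<close> occurs in \<open>\<Delta>(u)\<close>.
\<close>

definition mult_term :: "vgen \<Rightarrow> vgen \<Rightarrow> vgen \<Rightarrow> bool" where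
  "mult_term u v w \<longleftrightarrow>
     (u, v, w) \<in> {(vplus, vplus, vplus), (vplus, vminus, vminus), (vminus, vplus, vminus)}"

definition comult_term :: "vgen \<Rightarrow> vgen \<Rightarrow> vgen \<Rightarrow> bool" where
  "comult_term u v w \<longleftrightarrow>
     (u, v, w) \<in> {(vplus, vplus, vminus), (vplus, vminus, vplus), (vminus, vminus, vminus)}"

text \<open>
  The matrix entries of \<open>d\<^sub>a\<close>. A basis vector of a tensor product over circles is a labelling \<open>s\<close> of the
  circles; since \<open>m\<close> is commutative and \<open>\<Delta>\<close> cocommutative, the order of \<open>X\<close> and \<open>Y\<close> is immaterial.
\<close>

definition arrow_coeff ::
    "complex set set \<Rightarrow> complex set set \<Rightarrow> (complex set \<Rightarrow> vgen) \<Rightarrow> (complex set \<Rightarrow> vgen) \<Rightarrow> 'k::field"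
where
  "arrow_coeff A B s t =
     (if (\<forall>Z\<in>A \<inter> B. s Z = t Z) \<and>
         ((\<exists>X Y Z. X \<noteq> Y \<and> A - B = {X, Y} \<and> B - A = {Z} \<and> mult_term (s X) (s Y) (t Z)) \<or>
          (\<exists>X Y Z. X \<noteq> Y \<and> A - B = {Z} \<and> B - A = {X, Y} \<and> comult_term (s Z) (t X) (t Y)))
      then 1 else 0)"

definition sg :: "diagram \<Rightarrow> complex set \<Rightarrow> complex \<Rightarrow> nat" where
  "sg D \<alpha> x = length (filter (\<lambda>y. y \<in> \<alpha>) (takeWhile (\<lambda>y. y \<noteq> x) (crossings D)))"

definition khovanov_gens :: "diagram \<Rightarrow> (complex set \<times> (complex set \<Rightarrow> vgen)) set" where
  "khovanov_gens D = (SIGMA \<alpha>:Pow (set (crossings D)). circles D \<alpha> \<rightarrow>\<^sub>E UNIV)"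

definition khovanov :: "diagram \<Rightarrow> (complex set \<times> (complex set \<Rightarrow> vgen), 'k::field) cpx" where
  "khovanov D =
     \<lparr> gens = khovanov_gens D,
       hdeg = (\<lambda>(\<alpha>, s). int (card \<alpha>) - int (lneg D)),
       qdeg = (\<lambda>(\<alpha>, s). (\<Sum>Z\<in>circles D \<alpha>. vdegree (s Z)) + int (card \<alpha>)
                           + int (lpos D) - 2 * int (lneg D)),
       bd = restrict_mat (khovanov_gens D)
              (\<lambda>(\<alpha>, s) (\<beta>, t). \<Sum>x\<in>{x \<in> set (crossings D) - \<alpha>. \<beta> = insert x \<alpha>}.
                 (- 1) ^ sg D \<alpha> x * arrow_coeff (circles D \<alpha>) (circles D \<beta>) s t) \<rparr>"


section \<open>Cuts and surgeries\<close>

text \<open>\<open>D\<close> runs through the vertex \<open>p\<close> from the region \<open>R\<close> into the region \<open>R'\<close>.\<close>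

definition passes :: "diagram \<Rightarrow> complex \<Rightarrow> complex set \<Rightarrow> complex set \<Rightarrow> bool" where
  "passes D p R R' \<longleftrightarrow>
     (\<exists>e\<in>edges D. \<exists>f\<in>edges D.
        pathfinish e = p \<and> pathstart f = p \<and> path_image e \<subseteq> R \<and> path_image f \<subseteq> R')"

text \<open>
  The two closed discs bounded by the Jordan curve \<open>C\<close>, seen in the plane: the outer one contains
  the point at infinity in addition, which diagrams never meet.
\<close>

definition inner_disc :: "(real \<Rightarrow> complex) \<Rightarrow> complex set" where
  "inner_disc C = path_image C \<union> inside (path_image C)"

definition outer_disc :: "(real \<Rightarrow> complex) \<Rightarrow> complex set" where
  "outer_disc C = path_image C \<union> outside (path_image C)"

definition cut_times :: "diagram \<Rightarrow> (real \<Rightarrow> complex) \<Rightarrow> real list" where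
  "cut_times D C = sorted_list_of_set {t \<in> {0..<1}. C t \<in> support D}"

text \<open>
  The parametrization of \<open>C\<close> fixes its orientation and its base point. The points of intersection
  with the diagram are required to be among the bivalent vertices of the latter, which is achieved by
  subdividing edges; each edge then lies in one of the two discs. Transversality is used in its
  topological form: at each point of intersection the diagram changes from one side to the other.
\<close>

definition transversal_cut :: "diagram \<Rightarrow> (real \<Rightarrow> complex) \<Rightarrow> bool" where
  "transversal_cut D C \<longleftrightarrow>
     simple_path C \<and> pathfinish C = pathstart C \<and>
     path_image C \<inter> support D \<subseteq> vertices D - set (crossings D) \<and>
     (\<forall>p\<in>path_image C \<inter> support D.
        passes D p (inner_disc C) (outer_disc C) \<or> passes D p (outer_disc C) (inner_disc C))"

definition admissible_cut :: "diagram \<Rightarrow> (real \<Rightarrow> complex) \<Rightarrow> bool" where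
  "admissible_cut D C \<longleftrightarrow>
     transversal_cut D C \<and>
     (let ts = cut_times D C in
        \<forall>k<length ts.
          passes D (C (ts ! k)) (inner_disc C) (outer_disc C) \<longleftrightarrow>
          passes D (C (ts ! (Suc k mod length ts))) (outer_disc C) (inner_disc C))"

text \<open>The points of intersection are \<open>a 1, b 1, \<dots>, a n, b n\<close> with \<open>n = cut_size D C\<close>.\<close>

definition cut_size :: "diagram \<Rightarrow> (real \<Rightarrow> complex) \<Rightarrow> nat" where
  "cut_size D C = length (cut_times D C) div 2"

definition cut_a :: "diagram \<Rightarrow> (real \<Rightarrow> complex) \<Rightarrow> nat \<Rightarrow> complex" where
  "cut_a D C i = C (cut_times D C ! (2 * i - 2))"

definition cut_b :: "diagram \<Rightarrow> (real \<Rightarrow> complex) \<Rightarrow> nat \<Rightarrow> complex" where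
  "cut_b D C i = C (cut_times D C ! (2 * i - 1))"

text \<open>
  For \<open>n > 0\<close> and an admissible cut exactly one of the two ways to name the discs is compatible
  with the directions; for \<open>n = 0\<close> both are.
\<close>

definition cut_discs ::
    "diagram \<Rightarrow> (real \<Rightarrow> complex) \<Rightarrow> complex set \<Rightarrow> complex set \<Rightarrow> bool" where
  "cut_discs D C R1 R2 \<longleftrightarrow>
     (R1 = inner_disc C \<and> R2 = outer_disc C \<or> R1 = outer_disc C \<and> R2 = inner_disc C) \<and>
     (\<forall>i\<in>{1..cut_size D C}. passes D (cut_a D C i) R2 R1 \<and> passes D (cut_b D C i) R1 R2)"

definition NC :: "nat \<Rightarrow> nat set set set" where
  "NC n = {P. partition_on {1..n} P \<and>
     (\<forall>B\<in>P. \<forall>B'\<in>P. B \<noteq> B' \<longrightarrow>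
        convex hull ((\<lambda>m. cis (2 * pi * real m / real n)) ` B) \<inter>
        convex hull ((\<lambda>m. cis (2 * pi * real m / real n)) ` B') = {})}"

text \<open>The cyclic successor of \<open>i\<close> in its block of the partition \<open>P\<close>.\<close>

definition block_succ :: "nat set set \<Rightarrow> nat \<Rightarrow> nat" where
  "block_succ P i =
     (let B = (THE B. B \<in> P \<and> i \<in> B) in
        if \<exists>j\<in>B. i < j then Min {j \<in> B. i < j} else Min B)"

text \<open>
  A copy, in the closed disc \<open>R\<close> bounded by \<open>C\<close>, of the oriented chord system of \<open>P\<close>: disjoint arcs
  in \<open>R\<close> with the prescribed endpoints and otherwise not meeting \<open>C\<close>.
\<close>

definition chord_system ::
    "diagram \<Rightarrow> (real \<Rightarrow> complex) \<Rightarrow> complex set \<Rightarrow> nat set set \<Rightarrow> (nat \<Rightarrow> real \<Rightarrow> complex) \<Rightarrow> bool"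
where
  "chord_system D C R P \<sigma> \<longleftrightarrow>
     (\<forall>i\<in>{1..cut_size D C}.
        regular_arc (\<sigma> i) \<and>
        pathstart (\<sigma> i) = cut_b D C i \<and> pathfinish (\<sigma> i) = cut_a D C (block_succ P i) \<and>
        path_image (\<sigma> i) \<subseteq> R \<and>
        path_image (\<sigma> i) \<inter> path_image C = {pathstart (\<sigma> i), pathfinish (\<sigma> i)}) \<and>
     (\<forall>i\<in>{1..cut_size D C}. \<forall>j\<in>{1..cut_size D C}.
        i \<noteq> j \<longrightarrow> path_image (\<sigma> i) \<inter> path_image (\<sigma> j) = {})"

text \<open>
  \<open>D'\<close> consists of the part of \<open>D\<close> in \<open>R\<close> and the additional edges \<open>E\<close>. The order of its crossings
  may be chosen freely.
\<close>

definition closed_up_by :: "diagram \<Rightarrow> complex set \<Rightarrow> (real \<Rightarrow> complex) set \<Rightarrow> diagram \<Rightarrow> bool" where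
  "closed_up_by D R E D' \<longleftrightarrow>
     edges D' = {e \<in> edges D. path_image e \<subseteq> R} \<union> E \<and>
     distinct (crossings D') \<and> set (crossings D') = set (crossings D) \<inter> R \<and>
     (\<forall>x\<in>set (crossings D').
        over_in D' x = over_in D x \<and> over_out D' x = over_out D x \<and>
        under_in D' x = under_in D x \<and> under_out D' x = under_out D x)"

definition surgery1 ::
    "diagram \<Rightarrow> (real \<Rightarrow> complex) \<Rightarrow> complex set \<Rightarrow> complex set \<Rightarrow> nat set set \<Rightarrow> diagram \<Rightarrow> bool" where
  "surgery1 D C R1 R2 P D' \<longleftrightarrow>
     (\<exists>\<sigma>. chord_system D C R2 P \<sigma> \<and> closed_up_by D R1 (\<sigma> ` {1..cut_size D C}) D')"

definition surgery2 ::
    "diagram \<Rightarrow> (real \<Rightarrow> complex) \<Rightarrow> complex set \<Rightarrow> complex set \<Rightarrow> nat set set \<Rightarrow> diagram \<Rightarrow> bool" where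
  "surgery2 D C R1 R2 P D' \<longleftrightarrow>
     (\<exists>\<sigma>. chord_system D C R1 P \<sigma> \<and>
        closed_up_by D R2 ((\<lambda>i. reversepath (\<sigma> i)) ` {1..cut_size D C}) D')"

end

theory Submission
  imports Defs "HOL-Complex_Analysis.Winding_Numbers"
begin

text \<open>
  Group the generators of the Khovanov complex by the state \<open>(\<alpha>, \<beta>)\<close>, where \<open>\<alpha>\<close> concerns the crossings in \<open>R1\<close>
  and \<open>\<beta>\<close> those in \<open>R2\<close>. Up to signs, which only depend on the chosen order of the crossings, the differential is
  that of the total complex of a double complex: the horizontal arrows change \<open>\<alpha>\<close> and the vertical ones \<open>\<beta>\<close>.

  For a fixed \<open>\<beta>\<close> the smoothed tangle in \<open>R2\<close> consists of closed circles and of disjoint strands which match the points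
  of the cut. By the Jordan curve theorem these strands do not interleave on \<open>C\<close>; hence the gap between the
  two ends of a strand contains an even number of points, each strand joins some \<open>b\<^sub>i\<close> to some \<open>a\<^sub>j\<close>, and the cycles of
  \<open>i \<mapsto> j\<close> form a non crossing partition \<open>P\<close>. The circles of the state \<open>(\<alpha>, \<beta>)\<close> of \<open>L\<close> then correspond
  to those of the state \<open>\<alpha>\<close> of the surgery \<open>L1 P\<close> together with the closed circles in \<open>R2\<close>, which are inert along
  horizontal arrows. So a row is the sum over \<open>\<beta>\<close> of shifted copies of the complexes of these surgeries,
  tensored with the labellings of the closed circles; the columns are treated symmetrically.

  That each arrow merges two circles or splits one is again a consequence of planarity: the ends of the over and of the
  under strand alternate around a crossing, so outside the crossing no strand joins the two ends of the over strand,
  which is what it would take for a circle to be turned into a single circle.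
\<close>

section \<open>Chords of a disc bounded by a Jordan curve\<close>

text \<open>Circles are sets of points of the unsmoothed diagram, so two strands of a smoothing may
  touch at a crossing and are not disjoint arcs, as a Jordan argument would like. One strand is
  therefore taken as a path, the other as a connected set avoiding it: its open edges, linked near
  each vertex by a small connected set that misses all other edges. At a crossing this is a half
  disc, available since every smoothing pairs an over end with an under end. The resulting statement
  on strands serves twice: for a tangle, with the cut as curve, and at a crossing, with a small
  round circle as curve and the edges shortened to its outside.

  Merging and splitting are one symmetric notion with one rule for the matrix entries, so a
  composite of two arrows depends only on its first and last system of circles; this makes the faces
  of the cube commute. All identifications of complexes are bijections of bases with signs. They
  carry the complex property along, so the sums of complexes of surgeries inherit it from the
  rows.\<close>

lemma winding_number_eq_across:
  assumes "path \<Gamma>" "pathfinish \<Gamma> = pathstart \<Gamma>"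
    and "connected K" "K \<inter> path_image \<Gamma> = {}" "connected K'" "K' \<inter> path_image \<Gamma> = {}"
    and "q \<in> closure K" "q \<in> closure K'" "q \<notin> path_image \<Gamma>" "z \<in> K" "z' \<in> K'"
  shows "winding_number \<Gamma> z = winding_number \<Gamma> z'"
proof -
  have "open (- path_image \<Gamma>)"
    using assms(1) by (simp add: closed_path_image open_Compl)
  then obtain r where r: "r > 0" "ball q r \<subseteq> - path_image \<Gamma>"
    using assms(9) by (metis ComplI open_contains_ball)
  have "q \<in> ball q r" using r by auto
  then have "ball q r \<inter> K \<noteq> {}" "ball q r \<inter> K' \<noteq> {}"
    using assms(7,8) by (meson closure_iff_nhds_not_empty open_ball order_refl disjoint_iff)+
  then have "connected (K \<union> ball q r)" "(K \<union> ball q r) \<inter> K' \<noteq> {}"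
    using assms(3) by (auto intro!: connected_Un)
  then have "connected ((K \<union> ball q r) \<union> K')"
    using assms(5) connected_Un by blast
  then show ?thesis
    by (rule winding_number_eq[OF assms(1,2), rotated 2]) (use assms r in auto)
qed

text \<open>Closing \<open>\<gamma>\<close> along either of the two arcs of \<open>C\<close> between
  its ends gives two loops whose winding numbers differ by that of \<open>C\<close>. One loop does
  not separate \<open>K\<close> from the other side of \<open>C\<close> near \<open>C t2\<close>,
  the other does not near \<open>C t1\<close>; so the winding number of \<open>C\<close> would be
  the same inside and outside. \<open>K\<close> only has to accumulate at the two points of
  \<open>C\<close>, which later permits open edges.\<close>

lemma chords_do_not_interleave:
  fixes C :: "real \<Rightarrow> complex"
  assumes C: "simple_path C" "pathfinish C = pathstart C"
    and S: "S = inside (path_image C) \<or> S = outside (path_image C)"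
    and \<gamma>: "path \<gamma>" "path_image \<gamma> \<subseteq> S \<union> path_image C" "pathstart \<gamma> = C s1" "pathfinish \<gamma> = C s2"
    and s: "0 \<le> s1" "s1 < s2" "s2 \<le> 1"
    and K: "connected K" "K \<subseteq> S" "K \<inter> path_image \<gamma> = {}"
    and t1: "s1 < t1" "t1 < s2" "C t1 \<in> closure K" "C t1 \<notin> path_image \<gamma>"
    and t2: "t2 < s1 \<or> s2 < t2" "t2 \<in> {0..1}" "C t2 \<in> closure K" "C t2 \<notin> path_image \<gamma>"
  shows False
proof -
  have pC: "path C" using C(1) by (simp add: simple_path_imp_path)
  note J = Jordan_inside_outside[OF C]
  obtain S' where S': "S' = outside (path_image C) \<and> S = inside (path_image C) \<or>
      S' = inside (path_image C) \<and> S = outside (path_image C)"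
    using S by blast
  have "inside (path_image C) \<inter> outside (path_image C) = {}"
    "inside (path_image C) \<inter> path_image C = {}" "outside (path_image C) \<inter> path_image C = {}"
    by (simp_all add: inside_Int_outside inside_no_overlap outside_no_overlap)
  then have disj: "S' \<inter> S = {}" and disjC: "S' \<inter> path_image C = {}" "S \<inter> path_image C = {}"
    using S' by blast+
  have conn': "connected S'" "S' \<noteq> {}" "frontier S' = path_image C"
    using J S' by auto
  have inS': "C t \<in> closure S'" if "t \<in> {0..1}" for t
    using conn'(3) that by (auto simp: frontier_def path_image_def)
  have loop: "C 0 = C 1" using C(2) by (simp add: pathfinish_def pathstart_def)
  have inj: "C x = C y \<Longrightarrow> x = y \<or> x = 0 \<and> y = 1 \<or> x = 1 \<and> y = 0"
    if "x \<in> {0..1}" "y \<in> {0..1}" for x y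
    using C(1) that unfolding simple_path_def loop_free_def by blast
  \<comment> \<open>Both arcs run from \<open>C s2\<close> to \<open>C s1\<close>: \<open>A\<close>
    against the direction of \<open>C\<close>, and \<open>B\<close> along it, through the base point
    \<open>C 0 = C 1\<close>. Hence \<open>B\<close> minus \<open>A\<close> is one full turn of
    \<open>C\<close>.\<close>
  define A where "A = subpath s2 s1 C"
  define B where "B = subpath s2 1 C +++ subpath 0 s1 C"
  have A: "path A" "pathstart A = C s2" "pathfinish A = C s1" "path_image A = C ` {s1..s2}"
    using s pC by (auto simp: A_def path_image_subpath)
  have B: "path B" "pathstart B = C s2" "pathfinish B = C s1" "path_image B = C ` {s2..1} \<union> C ` {0..s1}"
    using s pC loop by (auto simp: B_def path_image_subpath path_image_join)
  have subC: "path_image A \<subseteq> path_image C" "path_image B \<subseteq> path_image C"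
    using s unfolding A(4) B(4) unfolding path_image_def by (auto intro!: imageI)
  have "C t1 \<noteq> C s" if "s \<in> {0..s1} \<union> {s2..1}" for s
    using inj[of t1 s] t1 s that by auto
  then have t1B: "C t1 \<notin> path_image B" unfolding B(4) by (metis UnE UnCI imageE)
  have "C t2 \<noteq> C s" if "s \<in> {s1..s2}" for s
  proof
    assume "C t2 = C s"
    then have *: "t2 = s \<or> t2 = 0 \<and> s = 1 \<or> t2 = 1 \<and> s = 0"
      using inj[of t2 s] t2 s that by auto
    \<comment> \<open>The identification of the times 0 and 1 can only bring \<open>s\<close> to an
      end of \<open>{s1..s2}\<close>, and the corresponding points lie on
      \<open>\<gamma>\<close>.\<close>
    have "C t2 \<noteq> C s1" "C t2 \<noteq> C s2"
      using t2(4) \<gamma> by (metis pathstart_in_path_image pathfinish_in_path_image)+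
    then have "s \<noteq> s1" "s \<noteq> s2" using \<open>C t2 = C s\<close> by auto
    with * show False using that t2(1,2) s by auto
  qed
  then have t2A: "C t2 \<notin> path_image A" unfolding A(4) by (metis imageE)
  obtain z where z: "z \<in> K" using t1(3) by fastforce
  obtain z' where z': "z' \<in> S'" using conn'(2) by blast
  have gA: "path (\<gamma> +++ A)" "pathfinish (\<gamma> +++ A) = pathstart (\<gamma> +++ A)"
      "path_image (\<gamma> +++ A) = path_image \<gamma> \<union> path_image A"
    and gB: "path (\<gamma> +++ B)" "pathfinish (\<gamma> +++ B) = pathstart (\<gamma> +++ B)"
      "path_image (\<gamma> +++ B) = path_image \<gamma> \<union> path_image B"
    using \<gamma>(1,3,4) A(1-3) B(1-3) by (simp_all add: path_image_join)
  have KA: "K \<inter> path_image (\<gamma> +++ A) = {}" "S' \<inter> path_image (\<gamma> +++ A) = {}"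
    and KB: "K \<inter> path_image (\<gamma> +++ B) = {}" "S' \<inter> path_image (\<gamma> +++ B) = {}"
    unfolding gA gB using K(2,3) disj disjC subC \<gamma>(2) by blast+
  have tA: "C t2 \<notin> path_image (\<gamma> +++ A)" and tB: "C t1 \<notin> path_image (\<gamma> +++ B)"
    unfolding gA gB using t1(4) t2(4) t1B t2A by blast+
  have "t1 \<in> {0..1}" using s t1 by simp
  \<comment> \<open>The loop with \<open>A\<close> is compared across \<open>C t2\<close>, which is
    not on \<open>A\<close>, and the loop with \<open>B\<close> across \<open>C t1\<close>, which is
    not on \<open>B\<close>.\<close>
  note wA = winding_number_eq_across[OF gA(1,2) K(1) KA(1) conn'(1) KA(2) t2(3) inS'[OF t2(2)] tA z z']
  note wB = winding_number_eq_across[OF gB(1,2) K(1) KB(1) conn'(1) KB(2) t1(3) inS'[OF \<open>t1 \<in> {0..1}\<close>] tB z z']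
  have diff: "winding_number (\<gamma> +++ B) w - winding_number (\<gamma> +++ A) w = winding_number C w"
    if w: "w \<notin> path_image \<gamma>" "w \<notin> path_image C" for w
  proof -
    have "w \<notin> path_image A" "w \<notin> path_image B" using w subC by blast+
    then have "winding_number (\<gamma> +++ B) w = winding_number \<gamma> w + winding_number B w"
      "winding_number (\<gamma> +++ A) w = winding_number \<gamma> w + winding_number A w"
      using w(1) \<gamma>(1,3,4) A(1-3) B(1-3) by (simp_all add: winding_number_join)
    moreover have "winding_number B w = winding_number (subpath s2 1 C) w + winding_number (subpath 0 s1 C) w"
    proof -
      have "path_image (subpath s2 1 C) \<subseteq> path_image C" "path_image (subpath 0 s1 C) \<subseteq> path_image C"
        using s by (simp_all add: path_image_subpath_subset)
      with w(2) show ?thesis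
        unfolding B_def using s pC loop by (intro winding_number_join) auto
    qed
    moreover have "winding_number (subpath 0 s2 C) w =
        winding_number (subpath 0 s1 C) w + winding_number (subpath s1 s2 C) w"
      using w s pC by (intro winding_number_subpath_combine[symmetric]) auto
    moreover have "winding_number C w = winding_number (subpath 0 s2 C) w + winding_number (subpath s2 1 C) w"
      using winding_number_subpath_combine[OF pC w(2), of 0 s2 1] s by simp
    moreover have "winding_number (subpath s2 s1 C) w = - winding_number (subpath s1 s2 C) w"
    proof -
      have "winding_number (subpath s1 s2 C) w + winding_number (subpath s2 s1 C) w =
        winding_number (subpath s1 s1 C) w"
        using w s pC by (intro winding_number_subpath_combine) auto
      moreover have "C s1 \<noteq> w" using w s by (auto simp: path_image_def)
      ultimately show ?thesis by (simp add: add_eq_0_iff)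
    qed
    ultimately show ?thesis unfolding A_def by simp
  qed
  have "winding_number C z = winding_number C z'"
  proof -
    have "z \<notin> path_image \<gamma>" "z \<notin> path_image C" "z' \<notin> path_image \<gamma>" "z' \<notin> path_image C"
      using z z' K disj disjC \<gamma>(2) by blast+
    then show ?thesis using diff[of z] diff[of z'] wA wB by metis
  qed
  moreover have "norm (winding_number C w) = 1" if "w \<in> inside (path_image C)" for w
    using simple_closed_path_norm_winding_number_inside[OF C(1) that] .
  moreover have "winding_number C w = 0" if "w \<in> outside (path_image C)" for w
    using winding_number_zero_in_outside[OF pC C(2) that] .
  ultimately show False
    using S' z z' K(2) by (metis norm_zero subsetD zero_neq_one)
qed

section \<open>Non crossing matchings and partitions\<close>

lemma even_card_involution:
  assumes "finite A" "\<And>x. x \<in> A \<Longrightarrow> f x \<in> A" "\<And>x. x \<in> A \<Longrightarrow> f (f x) = x" "\<And>x. x \<in> A \<Longrightarrow> f x \<noteq> x"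
  shows "even (card A)"
proof -
  have "2 * card ((\<lambda>x. {x, f x}) ` A) = card (\<Union> ((\<lambda>x. {x, f x}) ` A))"
  proof (rule card_partition)
    show "finite ((\<lambda>x. {x, f x}) ` A)" using assms(1) by simp
    show "finite (\<Union> ((\<lambda>x. {x, f x}) ` A))" using assms(1) by simp
    show "card c = 2" if "c \<in> (\<lambda>x. {x, f x}) ` A" for c
      using that assms(4) by (metis (no_types, lifting) card_2_iff imageE)
    fix c1 c2 assume c: "c1 \<in> (\<lambda>x. {x, f x}) ` A" "c2 \<in> (\<lambda>x. {x, f x}) ` A" "c1 \<noteq> c2"
    have *: "c = {z, f z}" if "c \<in> (\<lambda>x. {x, f x}) ` A" "z \<in> c" for c z
      using that assms(3) by auto
    show "c1 \<inter> c2 = {}"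
    proof (rule ccontr)
      assume "c1 \<inter> c2 \<noteq> {}"
      then obtain z where "z \<in> c1" "z \<in> c2" by blast
      then show False using *[OF c(1)] *[OF c(2)] c(3) by metis
    qed
  qed
  moreover have "\<Union> ((\<lambda>x. {x, f x}) ` A) = A" using assms(2) by auto
  ultimately show ?thesis by (metis dvd_triv_left)
qed

text \<open>With \<open>c\<close> the middle angle of the arc from index \<open>u\<close> to index
  \<open>v\<close> and \<open>h\<close> half of its angular width, the line
  \<open>p \<bullet> z = cos h\<close> separates the roots of unity with index in
  \<open>{u..v}\<close> from the others.\<close>

lemma convex_hull_roots_disjoint:
  fixes S T :: "nat set" and n u v :: nat
  assumes S: "S \<subseteq> {u..v}" and T: "T \<subseteq> {1..n} - {u..v}" and uv: "1 \<le> u" "v \<le> n"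
  shows "convex hull ((\<lambda>m. cis (2 * pi * real m / real n)) ` S) \<inter>
    convex hull ((\<lambda>m. cis (2 * pi * real m / real n)) ` T) = {}"
proof (cases "S = {} \<or> T = {}")
  case False
  then have le: "u \<le> v" "n \<ge> 1" using S T by auto
  let ?e = "\<lambda>m. cis (2 * pi * real m / real n)"
  define c where "c = pi * (real u + real v) / real n"
  define h where "h = pi * (real v - real u) / real n"
  define p where "p = cis c"
  have inner: "p \<bullet> ?e m = cos (2 * pi * real m / real n - c)" for m
    by (simp add: p_def inner_complex_def cos_diff mult.commute)
  have h0: "0 \<le> h" "h \<le> pi"
  proof -
    show "0 \<le> h" using le by (simp add: h_def)
    have "(real v - real u) / real n \<le> 1" using le uv by (simp add: field_simps)
    then have "pi * ((real v - real u) / real n) \<le> pi * 1" by (intro mult_left_mono) auto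
    then show "h \<le> pi" by (simp add: h_def)
  qed
  have eq: "2 * pi * real m / real n - c = pi * (2 * real m - real u - real v) / real n" for m
    by (simp add: c_def diff_divide_distrib[symmetric] algebra_simps)
  have "?e ` S \<subseteq> {z. p \<bullet> z \<ge> cos h}"
  proof clarsimp
    fix m assume "m \<in> S"
    then have m: "u \<le> m" "m \<le> v" using S by auto
    have "\<bar>2 * real m - real u - real v\<bar> \<le> real v - real u" using m by linarith
    then have "pi * \<bar>2 * real m - real u - real v\<bar> / real n \<le> h"
      unfolding h_def by (intro divide_right_mono mult_left_mono) auto
    then have "\<bar>2 * pi * real m / real n - c\<bar> \<le> h" unfolding eq by (simp add: abs_mult)
    then have "cos h \<le> cos \<bar>2 * pi * real m / real n - c\<bar>" using h0 by (intro cos_monotone_0_pi_le) auto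
    then show "cos h \<le> p \<bullet> ?e m" unfolding inner by simp
  qed
  then have 1: "convex hull (?e ` S) \<subseteq> {z. p \<bullet> z \<ge> cos h}"
    by (rule hull_minimal) (rule convex_halfspace_ge)
  have "?e ` T \<subseteq> {z. p \<bullet> z < cos h}"
  proof clarsimp
    fix m assume "m \<in> T"
    then have m: "m < u \<or> v < m" "1 \<le> m" "m \<le> n" using T by auto
    let ?d = "\<bar>2 * real m - real u - real v\<bar>"
    have d: "real v - real u < ?d" "?d < 2 * real n - (real v - real u)" using m uv le by linarith+
    let ?t = "2 * pi * real m / real n - c"
    have t: "\<bar>?t\<bar> = pi * ?d / real n" unfolding eq by (simp add: abs_mult)
    have 1: "h < \<bar>?t\<bar>" unfolding t h_def using d le by (intro divide_strict_right_mono mult_strict_left_mono) auto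
    have "pi * ?d / real n < pi * (2 * real n - (real v - real u)) / real n"
      using d le by (intro divide_strict_right_mono mult_strict_left_mono) auto
    also have "\<dots> = 2 * pi - h" using le by (simp add: h_def field_simps)
    finally have 2: "\<bar>?t\<bar> < 2 * pi - h" unfolding t .
    have "cos \<bar>?t\<bar> < cos h"
    \<comment> \<open>The cosine decreases only up to \<open>pi\<close>; a larger angle is reflected
      to \<open>2 * pi - \<bar>?t\<bar>\<close>, which still exceeds \<open>h\<close>.\<close>
    proof (cases "\<bar>?t\<bar> \<le> pi")
      case True
      then show ?thesis using 1 h0 by (intro cos_monotone_0_pi) auto
    next
      case False
      have "cos (2 * pi - \<bar>?t\<bar>) < cos h" using False 2 h0 by (intro cos_monotone_0_pi) auto
      then show ?thesis by (simp add: cos_diff)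
    qed
    then show "p \<bullet> ?e m < cos h" unfolding inner by simp
  qed
  then have 2: "convex hull (?e ` T) \<subseteq> {z. p \<bullet> z < cos h}"
    by (rule hull_minimal) (rule convex_halfspace_lt)
  show ?thesis using 1 2 by fastforce
qed auto

text \<open>The condition \<open>noncrossing\<close> looks at a chord from its smaller end only,
  since \<open>k < l\<close> and \<open>l < \<pi> k\<close> force \<open>k < \<pi> k\<close>;
  \<open>between\<close> is the symmetric form.\<close>

locale noncrossing_matching =
  fixes n :: nat and \<pi> :: "nat \<Rightarrow> nat"
  assumes in_range: "k < 2 * n \<Longrightarrow> \<pi> k < 2 * n"
    and involution: "k < 2 * n \<Longrightarrow> \<pi> (\<pi> k) = k"
    and no_fixpoint: "k < 2 * n \<Longrightarrow> \<pi> k \<noteq> k"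
    and noncrossing: "k < 2 * n \<Longrightarrow> k < l \<Longrightarrow> l < \<pi> k \<Longrightarrow> k < \<pi> l \<and> \<pi> l < \<pi> k"
begin

lemma between:
  assumes "k < 2 * n" "min k (\<pi> k) < l" "l < max k (\<pi> k)"
  shows "min k (\<pi> k) < \<pi> l" "\<pi> l < max k (\<pi> k)"
proof -
  have "min k (\<pi> k) < \<pi> l \<and> \<pi> l < max k (\<pi> k)"
  proof (cases "k < \<pi> k")
    case True
    then show ?thesis using noncrossing[of k l] assms by auto
  next
    case False
    then have "\<pi> k < k" using no_fixpoint assms by force
    then show ?thesis using noncrossing[of "\<pi> k" l] in_range[of k] involution[of k] assms by auto
  qed
  then show "min k (\<pi> k) < \<pi> l" "\<pi> l < max k (\<pi> k)" by auto
qed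

lemma parity:
  assumes "k < 2 * n"
  shows "even k \<longleftrightarrow> odd (\<pi> k)"
proof -
  let ?a = "min k (\<pi> k)" and ?b = "max k (\<pi> k)"
  have ab: "?a < ?b" "?b < 2 * n" using no_fixpoint[OF assms] in_range[OF assms] assms by auto
  have "even (card {?a<..<?b})"
    by (rule even_card_involution[where f=\<pi>])
       (use between[OF assms] involution no_fixpoint ab in auto)
  then have "even (?b - ?a - 1)" by simp
  then have "odd (?b - ?a)" using ab by (metis Suc_pred' even_Suc zero_less_diff diff_Suc_eq_diff_pred)
  then show ?thesis using ab by (auto simp: min_def max_def even_diff_nat split: if_splits)
qed

text \<open>The position \<open>2i-1\<close> belongs to \<open>b\<^sub>i\<close> and the position \<open>2i-2\<close> to \<open>a\<^sub>i\<close>.\<close>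

definition target :: "nat \<Rightarrow> nat" where
  "target i = \<pi> (2 * i - 1) div 2 + 1"

lemma target:
  assumes "i \<in> {1..n}"
  shows "target i \<in> {1..n}" "\<pi> (2 * i - 1) = 2 * target i - 2"
proof -
  have i: "2 * i - 1 < 2 * n" "odd (2 * i - 1)" using assms by auto
  then have "even (\<pi> (2 * i - 1))" using parity by blast
  then show "\<pi> (2 * i - 1) = 2 * target i - 2" by (auto simp: target_def)
  show "target i \<in> {1..n}" using in_range[OF i(1)] by (auto simp: target_def)
qed

lemma target_inj: "inj_on target {1..n}"
proof (rule inj_onI)
  fix i j assume ij: "i \<in> {1..n}" "j \<in> {1..n}" "target i = target j"
  then have "\<pi> (2 * i - 1) = \<pi> (2 * j - 1)" using target(2) by metis
  moreover have "2 * i - 1 < 2 * n" "2 * j - 1 < 2 * n" using ij by auto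
  ultimately have "2 * i - 1 = 2 * j - 1" by (metis involution)
  then show "i = j" using ij by auto
qed

text \<open>For \<open>i < j\<close>, the positions strictly between \<open>2i-1\<close> and
  \<open>2j-2\<close> are both points of each index in \<open>{i<..<j}\<close> and no others. For
  \<open>j \<le> i\<close>, as in \<open>target_down\<close>, the end positions themselves belong to
  the indices \<open>j\<close> to \<open>i\<close>, whence the closed interval there.\<close>

lemma target_up:
  assumes i: "i \<in> {1..n}" "i < target i" and k: "k \<in> {i<..<target i}"
  shows "target k \<in> {i<..<target i}"
proof -
  have kn: "k \<in> {1..n}" using k i target(1)[OF i(1)] by auto
  have "min (2 * i - 1) (\<pi> (2 * i - 1)) < 2 * k - 1" "2 * k - 1 < max (2 * i - 1) (\<pi> (2 * i - 1))"
    unfolding target(2)[OF i(1)] using k i by auto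
  then have "2 * i - 1 < \<pi> (2 * k - 1)" "\<pi> (2 * k - 1) < 2 * target i - 2"
    using between[of "2 * i - 1" "2 * k - 1"] i target(2)[OF i(1)] by auto
  then show ?thesis using target[OF kn] i by auto
qed

lemma target_down:
  assumes i: "i \<in> {1..n}" "target i \<le> i" and k: "k \<in> {target i..i}"
  shows "target k \<in> {target i..i}"
proof (cases "k = i")
  case True then show ?thesis using i by auto
next
  case False
  have kn: "k \<in> {1..n}" using k i target(1)[OF i(1)] by auto
  have "min (2 * i - 1) (\<pi> (2 * i - 1)) < 2 * k - 1" "2 * k - 1 < max (2 * i - 1) (\<pi> (2 * i - 1))"
    unfolding target(2)[OF i(1)] using k i False target(1)[OF i(1)] by auto
  then have "2 * target i - 2 < \<pi> (2 * k - 1)" "\<pi> (2 * k - 1) < 2 * i - 1"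
    using between[of "2 * i - 1" "2 * k - 1"] i target(2)[OF i(1)] by auto
  then show ?thesis using target[OF kn] i by auto
qed

text \<open>Forward orbits suffice for an equivalence relation, because an injective self-map of a
  finite set returns to each point.\<close>

definition orbit_rel :: "(nat \<times> nat) set" where
  "orbit_rel = {(i, j). i \<in> {1..n} \<and> (\<exists>k. j = (target ^^ k) i)}"

definition orbits :: "nat set set" where
  "orbits = {1..n} // orbit_rel"

lemma funpow_target: 
  assumes "A \<subseteq> {1..n}" "\<And>k. k \<in> A \<Longrightarrow> target k \<in> A" "i \<in> A"
  shows "(target ^^ k) i \<in> A"
  using assms by (induction k) auto

lemma funpow_target_range: "i \<in> {1..n} \<Longrightarrow> (target ^^ k) i \<in> {1..n}"
  using funpow_target[of "{1..n}"] target(1) by blast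

lemma funpow_target_return:
  assumes i: "i \<in> {1..n}"
  obtains m where "m > 0" "(target ^^ m) i = i"
proof -
  have "\<not> inj (\<lambda>k. (target ^^ k) i)"
    using funpow_target_range[OF i] finite_subset[of "range (\<lambda>k. (target ^^ k) i)" "{1..n}"]
    by (metis finite_atLeastAtMost finite_imageD image_subsetI infinite_UNIV_nat)
  then obtain a b where ab: "a < b" "(target ^^ a) i = (target ^^ b) i"
    unfolding inj_def by (metis linorder_neqE_nat)
  have inj: "inj_on (target ^^ a) {1..n}" for a
  proof (induction a)
    case (Suc a)
    have "(target ^^ a) ` {1..n} \<subseteq> {1..n}" using funpow_target_range by blast
    then have "inj_on (target \<circ> target ^^ a) {1..n}"
      by (intro comp_inj_on Suc inj_on_subset[OF target_inj])
    then show ?case by (simp only: funpow.simps(2))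
  qed simp
  have "(target ^^ a) ((target ^^ (b - a)) i) = (target ^^ a) i"
    using ab by (simp flip: funpow_add comp_apply[of "target ^^ a" "target ^^ (b - a)"])
  then have "(target ^^ (b - a)) i = i"
    using inj[of a] funpow_target_range[OF i] i by (meson inj_on_eq_iff)
  then show ?thesis using that[of "b - a"] ab by simp
qed

lemma equiv_orbit_rel: "equiv {1..n} orbit_rel"
proof (rule equivI)
  show "orbit_rel \<subseteq> {1..n} \<times> {1..n}" using funpow_target_range by (auto simp: orbit_rel_def)
  show "refl_on {1..n} orbit_rel"
    unfolding refl_on_def orbit_rel_def using funpow_0 by (metis (mono_tags, lifting) case_prodI mem_Collect_eq)
  show "sym orbit_rel"
  proof (rule symI)
    fix i j assume "(i, j) \<in> orbit_rel"
    then obtain k where i: "i \<in> {1..n}" and j: "j = (target ^^ k) i" by (auto simp: orbit_rel_def)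
    obtain m where m: "m > 0" "(target ^^ m) i = i" using funpow_target_return[OF i] .
    have "(target ^^ (m * q)) i = i" for q
      by (induction q) (simp_all add: funpow_add m)
    \<comment> \<open>Since \<open>m\<close> is at least 1, \<open>m * k - k\<close> further steps
      complete the \<open>k\<close> steps from \<open>i\<close> to \<open>j\<close> to
      \<open>k\<close> full periods.\<close>
    then have "(target ^^ (m * k - k)) j = i"
      unfolding j using m by (metis (no_types) Suc_leI add_diff_inverse_nat comp_apply diff_add_inverse2 funpow_add
        le_add_diff_inverse2 mult.commute mult_le_mono2 nat_mult_1_right One_nat_def)
    then have "\<exists>q. i = (target ^^ q) j" by metis
    then show "(j, i) \<in> orbit_rel" using funpow_target_range[OF i] unfolding orbit_rel_def j by blast
  qed
  show "trans orbit_rel"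
  proof (rule transI)
    fix i j k assume "(i, j) \<in> orbit_rel" "(j, k) \<in> orbit_rel"
    then obtain a b where "i \<in> {1..n}" "j = (target ^^ a) i" "k = (target ^^ b) j"
      by (auto simp: orbit_rel_def)
    then have "k = (target ^^ (b + a)) i" by (simp add: funpow_add)
    then show "(i, k) \<in> orbit_rel" using \<open>i \<in> {1..n}\<close> unfolding orbit_rel_def by blast
  qed
qed

lemma orbit_invariant:
  assumes A: "A \<subseteq> {1..n}" "\<And>k. k \<in> A \<Longrightarrow> target k \<in> A" and B: "B \<in> orbits" "i \<in> B" "i \<in> A"
  shows "B \<subseteq> A"
proof
  fix j assume "j \<in> B"
  then have "(i, j) \<in> orbit_rel"
    using B equiv_orbit_rel unfolding orbits_def by (meson quotient_eq_iff)
  then show "j \<in> A" using funpow_target[OF A B(3)] by (auto simp: orbit_rel_def)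
qed

lemma orbit_range: "B \<in> orbits \<Longrightarrow> B \<subseteq> {1..n}"
  using equiv_orbit_rel Union_quotient unfolding orbits_def by blast

lemma orbit_target: "B \<in> orbits \<Longrightarrow> i \<in> B \<Longrightarrow> target i \<in> B"
proof -
  assume B: "B \<in> orbits" "i \<in> B"
  then have "i \<in> {1..n}" using orbit_range by blast
  then have "(i, target i) \<in> orbit_rel"
    unfolding orbit_rel_def by (auto intro: exI[of _ 1])
  then show "target i \<in> B"
    using B equiv_orbit_rel unfolding orbits_def by (meson in_quotient_imp_closed)
qed

lemma orbits_disjoint: "B \<in> orbits \<Longrightarrow> B' \<in> orbits \<Longrightarrow> i \<in> B \<Longrightarrow> i \<in> B' \<Longrightarrow> B = B'"
  using quotient_disj[OF equiv_orbit_rel] unfolding orbits_def by blast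

lemma orbit_up:
  assumes "B \<in> orbits" "i \<in> B" "i < target i"
  shows "B \<inter> {i<..<target i} = {}"
proof (rule ccontr)
  have i: "i \<in> {1..n}" using assms orbit_range by blast
  assume "B \<inter> {i<..<target i} \<noteq> {}"
  then obtain j where "j \<in> B" "j \<in> {i<..<target i}" by blast
  then have "B \<subseteq> {i<..<target i}"
    using orbit_invariant[of "{i<..<target i}"] target_up[OF i assms(3)] assms(1) target(1)[OF i] by fastforce
  then show False using assms(2) by auto
qed

lemma orbit_down:
  assumes "B \<in> orbits" "i \<in> B" "target i \<le> i"
  shows "B \<subseteq> {target i..i}"
proof -
  have i: "i \<in> {1..n}" using assms orbit_range by blast
  show ?thesis
    using orbit_invariant[of "{target i..i}" B i] target_down[OF i assms(3)] assms target(1)[OF i] i by auto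
qed

text \<open>This makes \<open>orbits\<close> the right partition: its chords join exactly the points
  that the matching joins. An upward step skips no element of the orbit (\<open>orbit_up\<close>),
  and any other step spans the whole orbit (\<open>orbit_down\<close>), so it leads from the maximum
  to the minimum.\<close>

lemma block_succ_orbits:
  assumes i: "i \<in> {1..n}"
  shows "block_succ orbits i = target i"
proof -
  obtain B where B: "B \<in> orbits" "i \<in> B"
    using i equiv_orbit_rel unfolding orbits_def by (metis UnionE Union_quotient)
  have the: "(THE B. B \<in> orbits \<and> i \<in> B) = B"
    by (rule the_equality) (use B orbits_disjoint in blast)+
  have fin: "finite B" using orbit_range[OF B(1)] finite_subset by blast
  show ?thesis
  proof (cases "i < target i")
    case True
    have "Min {j \<in> B. i < j} = target i"
      using orbit_up[OF B True] True orbit_target[OF B] fin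
      by (intro Min_eqI) (auto simp: disjoint_iff not_less[symmetric])
    then show ?thesis unfolding block_succ_def the Let_def using True orbit_target[OF B] by auto
  next
    case False
    then have sub: "B \<subseteq> {target i..i}" using orbit_down[OF B] by simp
    then have "Min B = target i" using orbit_target[OF B] fin by (intro Min_eqI) auto
    moreover have "\<not> (\<exists>j\<in>B. i < j)" using sub by auto
    ultimately show ?thesis unfolding block_succ_def the Let_def by auto
  qed
qed

text \<open>Let \<open>i\<close> be the last element of \<open>B\<close> before \<open>j\<close>.
  The chord leaving \<open>i\<close> has to jump over \<open>j\<close>, and the indices under it
  form an invariant set, which therefore contains the whole orbit \<open>B'\<close>.\<close>

lemma orbit_in_gap:
  assumes B: "B \<in> orbits" "B' \<in> orbits" "B \<noteq> B'" and j: "j \<in> B'" "i0 \<in> B" "i0 < j" "i1 \<in> B" "j < i1"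
  obtains i where "i \<in> B" "i < target i" "B' \<subseteq> {i<..<target i}"
proof -
  have fin: "finite B" using orbit_range[OF B(1)] finite_subset by blast
  define i where "i = Max {k \<in> B. k < j}"
  have "i \<in> {k \<in> B. k < j}" unfolding i_def using fin j by (intro Max_in) auto
  then have i: "i \<in> B" "i < j" by auto
  have max: "k \<le> i" if "k \<in> B" "k < j" for k unfolding i_def using fin that by (intro Max_ge) auto
  have up: "i < target i"
  proof (rule ccontr)
    assume "\<not> i < target i"
    then have "B \<subseteq> {target i..i}" using orbit_down[OF B(1) i(1)] by simp
    then show False using j i by auto
  qed
  have "target i \<noteq> j" using orbits_disjoint[OF B(1,2)] B(3) orbit_target[OF B(1) i(1)] j(1) by blast
  then have "j < target i" using max[OF orbit_target[OF B(1) i(1)]] up by linarith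
  then have "B' \<subseteq> {i<..<target i}"
    using orbit_invariant[of "{i<..<target i}" B' j] target_up[of i] up i B j orbit_range[OF B(1)] target(1)[of i] by fastforce
  then show ?thesis using that i up by blast
qed

text \<open>Either some point of \<open>B'\<close> lies between points of \<open>B\<close>, and then
  all of \<open>B'\<close> sits in one gap of \<open>B\<close>, or \<open>B'\<close> avoids the
  interval spanned by \<open>B\<close>. In both cases an interval of indices separates the two
  blocks, hence a line separates their hulls.\<close>

theorem orbits_in_NC: "orbits \<in> NC n"
proof -
  have part: "partition_on {1..n} orbits"
    unfolding orbits_def using equiv_orbit_rel by (rule partition_on_quotient)
  let ?e = "\<lambda>m. cis (2 * pi * real m / real n)"
  have gap: "convex hull (?e ` B) \<inter> convex hull (?e ` B') = {}"
    if B: "B \<in> orbits" "B' \<in> orbits" "B \<noteq> B'" and j: "j \<in> B'" "i0 \<in> B" "i0 < j" "i1 \<in> B" "j < i1" for B B' j i0 i1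
  proof -
    obtain i where i: "i \<in> B" "i < target i" "B' \<subseteq> {i<..<target i}" using orbit_in_gap[OF B j] .
    have "B' \<subseteq> {Suc i..target i - 1}" using i(3) by fastforce
    moreover have "B \<subseteq> {1..n} - {Suc i..target i - 1}"
      using orbit_up[OF B(1) i(1,2)] orbit_range[OF B(1)] by fastforce
    moreover have "target i - 1 \<le> n" using orbit_target[OF B(1) i(1)] orbit_range[OF B(1)] by fastforce
    ultimately show ?thesis using convex_hull_roots_disjoint[of B' "Suc i" "target i - 1" B n] by auto
  qed
  have "convex hull (?e ` B) \<inter> convex hull (?e ` B') = {}" if B: "B \<in> orbits" "B' \<in> orbits" "B \<noteq> B'" for B B'
  proof -
    have ne: "B \<noteq> {}" using B part by (auto simp: partition_on_def)
    have fin: "finite B" using orbit_range[OF B(1)] finite_subset by blast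
    have disj: "B \<inter> B' = {}" using orbits_disjoint[OF B(1,2)] B(3) by blast
    let ?u = "Min B" and ?v = "Max B"
    have uv: "?u \<in> B" "?v \<in> B" "B \<subseteq> {?u..?v}" using fin ne by auto
    show ?thesis
    proof (cases "\<exists>j\<in>B'. ?u < j \<and> j < ?v")
      case True
      then show ?thesis using gap[OF B] uv by blast
    next
      case False
      have "B' \<subseteq> {1..n} - {?u..?v}"
      proof
        fix k assume k: "k \<in> B'"
        then have "k \<noteq> ?u" "k \<noteq> ?v" using disj uv(1,2) by blast+
        then have "k \<notin> {?u..?v}" using False k by force
        then show "k \<in> {1..n} - {?u..?v}" using orbit_range[OF B(2)] k by blast
      qed
      moreover have "1 \<le> ?u" "?v \<le> n" using uv orbit_range[OF B(1)] by auto
      ultimately show ?thesis using convex_hull_roots_disjoint[OF uv(3)] by blast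
    qed
  qed
  then show ?thesis unfolding NC_def using part by blast
qed

end

section \<open>Strands of a smoothed diagram\<close>

text \<open>
  A smoothed diagram is a finite set of edges together with a partial matching of their ends, where
  \<open>(e, False)\<close> is the initial and \<open>(e, True)\<close> the final end of \<open>e\<close>.
\<close>

locale end_matching =
  fixes E :: "'e set" and M :: "(('e \<times> bool) \<times> ('e \<times> bool)) set"
  assumes finite_E: "finite E" and M_ends: "M \<subseteq> (E \<times> UNIV) \<times> (E \<times> UNIV)"
    and sym_M: "sym M" and single_valued_M: "single_valued M" and irrefl_M: "(d, d) \<notin> M"
begin

definition adj :: "('e \<times> 'e) set" where
  "adj = {(e, f). \<exists>b c. ((e, b), (f, c)) \<in> M}"

definition strand :: "'e \<Rightarrow> 'e set" where
  "strand e = adj\<^sup>* `` {e}"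

lemma adj_E: "adj \<subseteq> E \<times> E"
  using M_ends by (auto simp: adj_def)

lemma sym_adj: "sym adj"
  using sym_M unfolding sym_def adj_def by blast

lemma strand_refl: "e \<in> strand e"
  by (simp add: strand_def)

lemma strand_subset: "e \<in> E \<Longrightarrow> strand e \<subseteq> E"
proof
  fix f assume "e \<in> E" "f \<in> strand e"
  then have "(e, f) \<in> adj\<^sup>*" by (simp add: strand_def)
  then show "f \<in> E" using \<open>e \<in> E\<close> adj_E by induction auto
qed

lemma strand_adj: "f \<in> strand e \<Longrightarrow> (f, g) \<in> adj \<Longrightarrow> g \<in> strand e"
  by (auto simp: strand_def)

lemma strand_sym: "f \<in> strand e \<Longrightarrow> e \<in> strand f"
  using sym_rtrancl[OF sym_adj] by (auto simp: strand_def sym_def)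

lemma strand_eq: "f \<in> strand e \<Longrightarrow> strand f = strand e"
  using strand_sym by (auto simp: strand_def intro: rtrancl_trans)

lemma strand_disjoint: "f \<notin> strand e \<Longrightarrow> strand f \<inter> strand e = {}"
  using strand_eq strand_refl by blast

lemma strand_induct [consumes 1, case_names refl step]:
  assumes "f \<in> strand e" "P e" "\<And>f g. f \<in> strand e \<Longrightarrow> P f \<Longrightarrow> (f, g) \<in> adj \<Longrightarrow> P g"
  shows "P f"
proof -
  have "(e, f) \<in> adj\<^sup>*" using assms(1) by (simp add: strand_def)
  then show ?thesis by induction (use assms(2,3) in \<open>auto simp: strand_def\<close>)
qed

definition free_ends :: "'e set \<Rightarrow> ('e \<times> bool) set" where
  "free_ends K = {d \<in> K \<times> UNIV. d \<notin> Domain M}"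

text \<open>Every edge has two ends, and the matched ends of a component are paired within the
  component.\<close>

lemma even_card_free_ends:
  assumes "e \<in> E"
  shows "even (card (free_ends (strand e)))"
proof -
  let ?K = "strand e"
  let ?A = "{d \<in> ?K \<times> UNIV. d \<in> Domain M}"
  have fin: "finite ?K" using finite_subset[OF strand_subset[OF assms] finite_E] .
  define m where "m = (\<lambda>d. SOME d'. (d, d') \<in> M)"
  have m: "(d, m d) \<in> M" if "d \<in> Domain M" for d
    unfolding m_def using that by (auto intro: someI_ex)
  have m_eq: "m d = d'" if "(d, d') \<in> M" for d d'
    using m[of d] that single_valued_M unfolding single_valued_def by blast
  have mM: "(m d, d) \<in> M" if "d \<in> Domain M" for d
    using m[OF that] sym_M by (auto dest: symD)
  have "even (card ?A)"
  proof (rule even_card_involution[where f=m])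
    show "finite ?A" using fin by simp
    fix d assume d: "d \<in> ?A"
    have "(fst d, fst (m d)) \<in> adj"
      unfolding adj_def using m[of d] d by (metis (mono_tags, lifting) CollectD CollectI case_prodI prod.collapse)
    then have "fst (m d) \<in> ?K" using d strand_adj by auto
    then show "m d \<in> ?A" using d mM[of d] by (auto simp: mem_Times_iff)
    show "m (m d) = d" using mM[of d] m_eq d by blast
    show "m d \<noteq> d" using m[of d] irrefl_M d by force
  qed
  moreover have "card (?K \<times> (UNIV :: bool set)) = card ?A + card (free_ends ?K)"
  proof -
    have "?K \<times> UNIV = ?A \<union> free_ends ?K" unfolding free_ends_def by blast
    moreover have "card (?A \<union> free_ends ?K) = card ?A + card (free_ends ?K)"
      using fin by (intro card_Un_disjoint) (auto simp: free_ends_def)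
    ultimately show ?thesis by simp
  qed
  moreover have "card (?K \<times> (UNIV :: bool set)) = 2 * card ?K" by (simp add: card_cartesian_product)
  ultimately show ?thesis by presburger
qed

text \<open>Adding to a connected set of edges a neighbour does not increase the number of its outer ends.\<close>

lemma card_free_ends_le:
  assumes "e \<in> E"
  shows "card (free_ends (strand e)) \<le> 2"
proof -
  let ?K = "strand e"
  have fin: "finite ?K" using finite_subset[OF strand_subset[OF assms] finite_E] .
  \<comment> \<open>\<open>U J\<close> collects the ends of \<open>J\<close> that are not matched
    inside \<open>J\<close>. A largest \<open>J\<close> around \<open>e\<close> with at most two of
    them must be the whole strand, as otherwise a neighbouring edge could be added.\<close>
  define U where "U = (\<lambda>J. {d \<in> J \<times> UNIV. \<not> (\<exists>d'\<in>J \<times> UNIV. (d, d') \<in> M)})"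
  define \<J> where "\<J> = {J. e \<in> J \<and> J \<subseteq> ?K \<and> card (U J) \<le> 2}"
  have finJ: "finite \<J>" using fin by (auto simp: \<J>_def intro: finite_subset[of _ "Pow ?K"])
  have "card (U {e}) \<le> card ({e} \<times> (UNIV :: bool set))" by (intro card_mono) (auto simp: U_def)
  then have "{e} \<in> \<J>" by (simp add: \<J>_def strand_refl card_cartesian_product)
  then obtain J where J: "J \<in> \<J>" and max: "\<And>J'. J' \<in> \<J> \<Longrightarrow> card J' \<le> card J"
  proof -
    have "Max (card ` \<J>) \<in> card ` \<J>" using finJ \<open>{e} \<in> \<J>\<close> by (intro Max_in) auto
    then obtain J where "J \<in> \<J>" "card J = Max (card ` \<J>)" by auto
    moreover have "card J' \<le> Max (card ` \<J>)" if "J' \<in> \<J>" for J' using finJ that by simp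
    ultimately show ?thesis using that by metis
  qed
  have JK: "e \<in> J" "J \<subseteq> ?K" "card (U J) \<le> 2" using J by (auto simp: \<J>_def)
  have finJ: "finite J" using JK(2) fin finite_subset by blast
  have "?K \<subseteq> J"
  proof
    fix f assume "f \<in> ?K"
    then show "f \<in> J"
    proof (induction rule: strand_induct)
      case refl show ?case by (rule JK)
    next
      case (step g f)
      show ?case
      proof (rule ccontr)
        assume f: "f \<notin> J"
        obtain b c where bc: "((g, b), (f, c)) \<in> M" using step by (auto simp: adj_def)
        then have cb: "((f, c), (g, b)) \<in> M" using sym_M by (auto dest: symD)
        have gb: "(g, b) \<in> U J"
        proof -
          have "\<not> (\<exists>d'\<in>J \<times> UNIV. ((g, b), d') \<in> M)"
            using bc single_valued_M f unfolding single_valued_def by blast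
          then show ?thesis using step by (auto simp: U_def)
        qed
        \<comment> \<open>The new edge uses up the outer end \<open>(g, b)\<close> together with its
          own end \<open>(f, c)\<close>, and contributes at most its other end.\<close>
        have "U (insert f J) \<subseteq> insert (f, \<not> c) (U J - {(g, b)})"
        proof
          fix d assume d: "d \<in> U (insert f J)"
          then have no: "\<not> (\<exists>d'\<in>insert f J \<times> UNIV. (d, d') \<in> M)" by (auto simp: U_def)
          have "d \<noteq> (f, c)" "d \<noteq> (g, b)" using no cb bc step.IH by auto
          moreover have "d \<in> insert f J \<times> UNIV" using d by (auto simp: U_def)
          ultimately show "d \<in> insert (f, \<not> c) (U J - {(g, b)})"
            using no by (cases d) (auto simp: U_def)
        qed
        moreover have "finite (U J)" using finJ by (auto simp: U_def intro: finite_subset[of _ "J \<times> UNIV"])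
        ultimately have "card (U (insert f J)) \<le> card (insert (f, \<not> c) (U J - {(g, b)}))"
          by (intro card_mono) auto
        also have "\<dots> \<le> Suc (card (U J - {(g, b)}))" by (rule card_insert_le_m1) auto
        also have "\<dots> = card (U J)" using \<open>finite (U J)\<close> gb by (rule card_Suc_Diff1)
        finally have "insert f J \<in> \<J>"
          unfolding \<J>_def using JK strand_adj[OF step.hyps] by force
        then have "card (insert f J) \<le> card J" by (rule max)
        then show False using card_insert_disjoint[OF finJ f] by linarith
      qed
    qed
  qed
  then have KJ: "?K = J" using JK by blast
  have "free_ends ?K \<subseteq> U ?K" by (auto simp: free_ends_def U_def)
  moreover have "finite (U ?K)" using fin by (auto simp: U_def intro: finite_subset[of _ "?K \<times> UNIV"])
  ultimately have "card (free_ends ?K) \<le> card (U ?K)" by (intro card_mono)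
  then show ?thesis using JK(3) KJ by simp
qed

text \<open>An even number that is at most 2 and not 0. A strand with a free end thus leads to
  exactly one other free end; this is applied both at the cut and at a deleted crossing.\<close>

lemma free_ends_pair:
  assumes "e \<in> E" "(e, b) \<notin> Domain M"
  obtains d where "d \<noteq> (e, b)" "free_ends (strand e) = {(e, b), d}"
proof -
  have "(e, b) \<in> free_ends (strand e)" using assms by (simp add: free_ends_def strand_refl)
  moreover have fin: "finite (free_ends (strand e))"
    using finite_subset[OF strand_subset[OF assms(1)] finite_E]
    by (auto simp: free_ends_def intro: finite_subset[of _ "strand e \<times> UNIV"])
  ultimately have "card (free_ends (strand e)) \<noteq> 0" by auto
  then have "card (free_ends (strand e)) = 2"
    using even_card_free_ends[OF assms(1)] card_free_ends_le[OF assms(1)] by presburger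
  then obtain d1 d2 where d: "free_ends (strand e) = {d1, d2}" "d1 \<noteq> d2" by (metis card_2_iff)
  then have "(e, b) = d1 \<or> (e, b) = d2" using \<open>(e, b) \<in> free_ends (strand e)\<close> by blast
  then show ?thesis using that d by (metis insert_commute)
qed

end

section \<open>The matching of edge ends given by a smoothing\<close>

definition end_pt :: "(real \<Rightarrow> complex) \<times> bool \<Rightarrow> complex" where
  "end_pt d = (if snd d then pathfinish (fst d) else pathstart (fst d))"

text \<open>The edge, parametrized so as to start at its end \<open>d\<close>. The four edges at a
  crossing are thereby treated alike, whether they come in or go out.\<close>

definition ray :: "(real \<Rightarrow> complex) \<times> bool \<Rightarrow> real \<Rightarrow> complex" where
  "ray d = (if snd d then reversepath (fst d) else fst d)"

abbreviation open_arc :: "(real \<Rightarrow> complex) \<Rightarrow> complex set" where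
  "open_arc e \<equiv> e ` {0<..<1}"

definition consistent :: "diagram \<Rightarrow> complex set \<Rightarrow> complex \<Rightarrow> bool" where
  "consistent D \<alpha> x \<longleftrightarrow> (positive_crossing D x \<longleftrightarrow> x \<notin> \<alpha>)"

text \<open>Refines \<open>joined\<close> from edges to their ends and localizes it at one vertex.
  Two edges may be joined at both of their ends, which a relation on edges does not record, while
  counting free ends depends on it.\<close>

definition mates_at :: "diagram \<Rightarrow> complex set \<Rightarrow> complex \<Rightarrow>
    (((real \<Rightarrow> complex) \<times> bool) \<times> ((real \<Rightarrow> complex) \<times> bool)) set" where
  "mates_at D \<alpha> v =
     (let P = if v \<in> set (crossings D) then
                if consistent D \<alpha> v
                then {((over_in D v, True), (under_out D v, False)), ((under_in D v, True), (over_out D v, False))}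
                else {((over_in D v, True), (under_in D v, True)), ((over_out D v, False), (under_out D v, False))}
              else {((e, True), (f, False)) | e f. e \<in> edges D \<and> f \<in> edges D \<and> pathfinish e = v \<and> pathstart f = v}
      in P \<union> P\<inverse>)"

text \<open>Edges are connected only at vertices in \<open>V\<close>. Deleting a crossing or one
  side of the cut means shrinking \<open>V\<close>, and the ends located there become free.\<close>

definition mates :: "diagram \<Rightarrow> complex set \<Rightarrow> complex set \<Rightarrow>
    (((real \<Rightarrow> complex) \<times> bool) \<times> ((real \<Rightarrow> complex) \<times> bool)) set" where
  "mates D \<alpha> V = (\<Union>v\<in>V. mates_at D \<alpha> v)"

lemma sym_mates_at: "(d, d') \<in> mates_at D \<alpha> v \<Longrightarrow> (d', d) \<in> mates_at D \<alpha> v"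
  unfolding mates_at_def Let_def by blast

lemma joined_mates_at:
  assumes "(e, f) \<in> joined D \<alpha>"
  obtains v b c where "((e, b), (f, c)) \<in> mates_at D \<alpha> v"
proof -
  consider "e \<in> edges D" "f \<in> edges D" "pathfinish e = pathstart f" "pathfinish e \<notin> set (crossings D)"
    | x where "x \<in> set (crossings D)" "(e, f) \<in> (if positive_crossing D x \<longleftrightarrow> x \<notin> \<alpha>
          then {(over_in D x, under_out D x), (under_in D x, over_out D x)}
          else {(over_in D x, under_in D x), (over_out D x, under_out D x)})"
    using assms unfolding joined_def by blast
  then show ?thesis
  proof cases
    case 1
    then have "((e, True), (f, False)) \<in> mates_at D \<alpha> (pathfinish e)"
      by (simp add: mates_at_def Let_def)
    then show ?thesis using that by blast
  next
    case (2 x)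
    show ?thesis
    proof (cases "consistent D \<alpha> x")
      case True
      then have "(e, f) = (over_in D x, under_out D x) \<or> (e, f) = (under_in D x, over_out D x)"
        using 2(2) by (simp add: consistent_def)
      then have "((e, True), (f, False)) \<in> mates_at D \<alpha> x" using True 2(1) by (auto simp: mates_at_def Let_def)
      then show ?thesis using that by blast
    next
      case False
      then have "(e, f) = (over_in D x, under_in D x) \<or> (e, f) = (over_out D x, under_out D x)"
        using 2(2) unfolding consistent_def by (simp only: if_False) simp
      then have "((e, True), (f, True)) \<in> mates_at D \<alpha> x \<or> ((e, False), (f, False)) \<in> mates_at D \<alpha> x"
        using False 2(1) by (auto simp: mates_at_def Let_def)
      then show ?thesis using that by blast
    qed
  qed
qed

lemma mates_at_joined:
  assumes "((e, b), (f, c)) \<in> mates_at D \<alpha> v"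
  shows "(e, f) \<in> joined D \<alpha> \<or> (f, e) \<in> joined D \<alpha>"
proof (cases "v \<in> set (crossings D)")
  case True
  let ?P = "if positive_crossing D v \<longleftrightarrow> v \<notin> \<alpha>
          then {(over_in D v, under_out D v), (under_in D v, over_out D v)}
          else {(over_in D v, under_in D v), (over_out D v, under_out D v)}"
  have "(e, f) \<in> ?P \<or> (f, e) \<in> ?P"
  proof (cases "consistent D \<alpha> v")
    case c: True
    then show ?thesis using assms True by (auto simp: mates_at_def Let_def consistent_def)
  next
    case c: False
    then have "?P = {(over_in D v, under_in D v), (over_out D v, under_out D v)}"
      unfolding consistent_def by (simp only: if_False)
    then show ?thesis using assms True c by (auto simp: mates_at_def Let_def)
  qed
  then show ?thesis unfolding joined_def using True by blast
next
  case False
  then show ?thesis using assms by (auto simp: mates_at_def Let_def joined_def)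
qed

text \<open>Circles are defined by the components of \<open>joined\<close>; this transfers them to
  the matching of ends.\<close>

lemma joined_eq:
  "joined D \<alpha> \<union> (joined D \<alpha>)\<inverse> = {(e, f). \<exists>b c. ((e, b), (f, c)) \<in> mates D \<alpha> UNIV}"
proof (intro equalityI subsetI)
  fix p assume "p \<in> joined D \<alpha> \<union> (joined D \<alpha>)\<inverse>"
  then obtain e f where p: "p = (e, f)" "(e, f) \<in> joined D \<alpha> \<or> (f, e) \<in> joined D \<alpha>" by (cases p) auto
  then obtain b c v where "((e, b), (f, c)) \<in> mates_at D \<alpha> v"
    using joined_mates_at sym_mates_at by metis
  then show "p \<in> {(e, f). \<exists>b c. ((e, b), (f, c)) \<in> mates D \<alpha> UNIV}" unfolding p(1) mates_def by blast
next
  fix p assume "p \<in> {(e, f). \<exists>b c. ((e, b), (f, c)) \<in> mates D \<alpha> UNIV}"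
  then obtain e f b c v where "p = (e, f)" "((e, b), (f, c)) \<in> mates_at D \<alpha> v" unfolding mates_def by blast
  then show "p \<in> joined D \<alpha> \<union> (joined D \<alpha>)\<inverse>" using mates_at_joined by blast
qed

locale link =
  fixes D :: diagram
  assumes link: "link_diagram D"
begin

lemma finite_edges: "finite (edges D)"
  using link by (simp add: link_diagram_def)

lemma arc_edge: "e \<in> edges D \<Longrightarrow> arc e"
  using link by (simp add: link_diagram_def regular_arc_def)

lemma edges_meet:
  "e \<in> edges D \<Longrightarrow> f \<in> edges D \<Longrightarrow> e \<noteq> f \<Longrightarrow>
   path_image e \<inter> path_image f \<subseteq> {pathstart e, pathfinish e} \<inter> {pathstart f, pathfinish f}"
  using link by (simp add: link_diagram_def)

lemma proper: "x \<in> set (crossings D) \<Longrightarrow> proper_crossing D x"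
  using link by (simp add: link_diagram_def)

lemma crossing_edges:
  assumes "x \<in> set (crossings D)"
  shows "over_in D x \<in> edges D" "under_in D x \<in> edges D" "over_out D x \<in> edges D" "under_out D x \<in> edges D"
    "pathfinish (over_in D x) = x" "pathfinish (under_in D x) = x"
    "pathstart (over_out D x) = x" "pathstart (under_out D x) = x"
    "over_in D x \<noteq> under_in D x" "over_out D x \<noteq> under_out D x"
    "e \<in> edges D \<Longrightarrow> pathfinish e = x \<Longrightarrow> e = over_in D x \<or> e = under_in D x"
    "e \<in> edges D \<Longrightarrow> pathstart e = x \<Longrightarrow> e = over_out D x \<or> e = under_out D x"
  using proper[OF assms] unfolding proper_crossing_def by blast+

lemma arc_ends_distinct: "e \<in> edges D \<Longrightarrow> pathstart e \<noteq> pathfinish e"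
  using arc_distinct_ends[OF arc_edge, of e] by auto

text \<open>Edges are arcs, so a loop based at a crossing is subdivided by a further vertex.
  Consequently the four ends at a crossing belong to four different edges.\<close>

lemma in_noteq_out:
  assumes "x \<in> set (crossings D)"
  shows "over_in D x \<noteq> over_out D x" "over_in D x \<noteq> under_out D x"
    "under_in D x \<noteq> over_out D x" "under_in D x \<noteq> under_out D x"
  using arc_ends_distinct[of "over_in D x"] arc_ends_distinct[of "under_in D x"] crossing_edges(1-8)[OF assms] by auto

lemma bivalent_unique:
  assumes "p \<in> vertices D" "p \<notin> set (crossings D)"
  shows "\<exists>!e. e \<in> edges D \<and> pathfinish e = p" "\<exists>!e. e \<in> edges D \<and> pathstart e = p"
  using link assms by (auto simp: link_diagram_def)

lemma mates_atD:
  assumes "(d, d') \<in> mates_at D \<alpha> v"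
  shows "fst d \<in> edges D" "fst d' \<in> edges D" "end_pt d = v" "end_pt d' = v" "fst d \<noteq> fst d'"
proof -
  have "fst d \<in> edges D \<and> fst d' \<in> edges D \<and> end_pt d = v \<and> end_pt d' = v \<and> fst d \<noteq> fst d'"
  proof (cases "v \<in> set (crossings D)")
    case True
    then show ?thesis
      using assms crossing_edges[OF True] in_noteq_out[OF True]
      by (auto simp: mates_at_def Let_def end_pt_def split: if_splits)
  next
    case False
    then show ?thesis
      using assms arc_ends_distinct by (auto simp: mates_at_def Let_def end_pt_def)
  qed
  then show "fst d \<in> edges D" "fst d' \<in> edges D" "end_pt d = v" "end_pt d' = v" "fst d \<noteq> fst d'" by auto
qed

lemma vertex_end_pt: "fst d \<in> edges D \<Longrightarrow> end_pt d \<in> vertices D"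
  by (auto simp: end_pt_def vertices_def)

lemma mates_at_functional:
  assumes "(d, d1) \<in> mates_at D \<alpha> v" "(d, d2) \<in> mates_at D \<alpha> v"
  shows "d1 = d2"
proof (cases "v \<in> set (crossings D)")
  case True
  note ne = in_noteq_out[OF True] crossing_edges(9,10)[OF True]
  show ?thesis
  proof (cases "consistent D \<alpha> v")
    case True
    then show ?thesis using assms \<open>v \<in> _\<close> ne by (auto simp: mates_at_def Let_def)
  next
    case False
    then show ?thesis using assms \<open>v \<in> _\<close> ne by (auto simp: mates_at_def Let_def)
  qed
next
  case False
  have "v \<in> vertices D" using mates_atD[OF assms(1)] vertex_end_pt by blast
  from bivalent_unique[OF this False] show ?thesis using assms False by (auto simp: mates_at_def Let_def)
qed

lemma mates_at_total:
  assumes "e \<in> edges D" "end_pt (e, b) = v"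
  shows "(e, b) \<in> Domain (mates_at D \<alpha> v)"
proof (cases "v \<in> set (crossings D)")
  case True
  show ?thesis
  proof (cases b)
    case b: True
    then have "e = over_in D v \<or> e = under_in D v" using crossing_edges(11)[OF True] assms by (auto simp: end_pt_def)
    then show ?thesis using True b by (auto simp: mates_at_def Let_def)
  next
    case b: False
    then have "e = over_out D v \<or> e = under_out D v" using crossing_edges(12)[OF True] assms by (auto simp: end_pt_def)
    then show ?thesis using True b by (auto simp: mates_at_def Let_def)
  qed
next
  case False
  have "v \<in> vertices D" using assms vertex_end_pt[of "(e, b)"] by auto
  from bivalent_unique[OF this False] obtain f g where "f \<in> edges D" "pathfinish f = v" "g \<in> edges D" "pathstart g = v"
    by blast
  moreover have "((e, True), (g, False)) \<in> mates_at D \<alpha> v" if b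
    using that False assms \<open>g \<in> edges D\<close> \<open>pathstart g = v\<close> by (auto simp: mates_at_def Let_def end_pt_def)
  moreover have "((e, False), (f, True)) \<in> mates_at D \<alpha> v" if "\<not> b"
    using that False assms \<open>f \<in> edges D\<close> \<open>pathfinish f = v\<close> by (auto simp: mates_at_def Let_def end_pt_def)
  ultimately show ?thesis by (metis (full_types) Domain.DomainI)
qed

lemma mates_end_pt: "(d, d') \<in> mates D \<alpha> V \<Longrightarrow> end_pt d = end_pt d' \<and> end_pt d \<in> V \<and> (d, d') \<in> mates_at D \<alpha> (end_pt d)"
  unfolding mates_def using mates_atD by blast

lemma mates_Domain: "e \<in> edges D \<Longrightarrow> (e, b) \<in> Domain (mates D \<alpha> V) \<longleftrightarrow> end_pt (e, b) \<in> V"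
  using mates_end_pt mates_at_total unfolding mates_def by (metis Domain.simps UN_I)

lemma end_matching_mates:
  assumes "E \<subseteq> edges D" "\<And>e b. e \<in> edges D \<Longrightarrow> end_pt (e, b) \<in> V \<Longrightarrow> e \<in> E"
  shows "end_matching E (mates D \<alpha> V)"
proof
  show "finite E" using assms(1) finite_edges finite_subset by blast
  show "mates D \<alpha> V \<subseteq> (E \<times> UNIV) \<times> (E \<times> UNIV)"
  proof
    fix p assume p: "p \<in> mates D \<alpha> V"
    obtain d d' where [simp]: "p = (d, d')" by (cases p)
    have m: "end_pt d = end_pt d' \<and> end_pt d \<in> V \<and> (d, d') \<in> mates_at D \<alpha> (end_pt d)"
      using p by (intro mates_end_pt) simp
    then have "fst d \<in> edges D" "fst d' \<in> edges D" using mates_atD(1,2) by blast+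
    then have "fst d \<in> E" "fst d' \<in> E"
      using assms(2)[of "fst d" "snd d"] assms(2)[of "fst d'" "snd d'"] m by auto
    then show "p \<in> (E \<times> UNIV) \<times> (E \<times> UNIV)" by (cases d; cases d') auto
  qed
  show "sym (mates D \<alpha> V)" unfolding mates_def sym_def using sym_mates_at by blast
  show "single_valued (mates D \<alpha> V)"
    unfolding single_valued_def using mates_end_pt mates_at_functional by blast
  show "(d, d) \<notin> mates D \<alpha> V" for d
    unfolding mates_def using mates_atD(5) by blast
qed

lemma regular_derivative:
  assumes "e \<in> edges D" "t \<in> {0..1}"
  shows "(e has_vector_derivative vector_derivative e (at t)) (at t)"
proof -
  have "e C1_differentiable_on {0..1}" using assms(1) link by (auto simp: link_diagram_def regular_arc_def)
  then show ?thesis using assms(2) by (simp add: C1_differentiable_on_eq vector_derivative_works)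
qed

lemma ray_simps:
  assumes "fst d \<in> edges D"
  shows "path_image (ray d) = path_image (fst d)" "pathstart (ray d) = end_pt d" "arc (ray d)"
    "ray d 0 = end_pt d" "ray d ` {0<..<1} = open_arc (fst d)"
proof -
  show "path_image (ray d) = path_image (fst d)" "pathstart (ray d) = end_pt d" "arc (ray d)"
    using arc_edge[OF assms] by (auto simp: ray_def end_pt_def arc_reversepath)
  then show "ray d 0 = end_pt d" by (simp add: pathstart_def)
  have "(\<lambda>t::real. 1 - t) ` {0<..<1} = {0<..<1}"
  proof (intro equalityI subsetI)
    fix x :: real assume "x \<in> {0<..<1}"
    then have "x = 1 - (1 - x)" "1 - x \<in> {0<..<1}" by auto
    then show "x \<in> (\<lambda>t. 1 - t) ` {0<..<1}" by (rule image_eqI)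
  qed auto
  then have "(\<lambda>t. fst d (1 - t)) ` {0<..<1} = open_arc (fst d)"
    by (metis image_image)
  then show "ray d ` {0<..<1} = open_arc (fst d)"
    by (auto simp: ray_def reversepath_def)
qed

lemma ray_derivative:
  assumes "fst d \<in> edges D"
  shows "(ray d has_vector_derivative
    (if snd d then - vector_derivative (fst d) (at 1) else vector_derivative (fst d) (at 0))) (at 0)"
proof (cases "snd d")
  case True
  have "(fst d has_vector_derivative vector_derivative (fst d) (at 1)) (at ((\<lambda>t. 1 - t) (0 :: real)))"
    using regular_derivative[OF assms, of 1] by simp
  moreover have "((\<lambda>t::real. 1 - t) has_vector_derivative - 1) (at 0)"
    by (auto intro!: derivative_eq_intros)
  ultimately have "(fst d \<circ> (\<lambda>t. 1 - t) has_vector_derivative (- 1) *\<^sub>R vector_derivative (fst d) (at 1)) (at 0)"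
    using vector_diff_chain_at by blast
  then show ?thesis using True by (simp add: ray_def reversepath_def o_def)
next
  case False
  then show ?thesis using regular_derivative[OF assms, of 0] by (simp add: ray_def)
qed

end

section \<open>Strands of a smoothing do not interleave on a Jordan curve\<close>

lemma endpoint_in_closure_open_arc:
  assumes "path p"
  shows "pathstart p \<in> closure (open_arc p)" "pathfinish p \<in> closure (open_arc p)"
proof -
  have "p ` closure {0<..<1} \<subseteq> closure (open_arc p)"
    using assms by (intro image_closure_subset) (auto simp: path_def closure_subset)
  then show "pathstart p \<in> closure (open_arc p)" "pathfinish p \<in> closure (open_arc p)"
    by (auto simp: pathstart_def pathfinish_def)
qed

lemma connected_open_arc: "path p \<Longrightarrow> connected (open_arc p)"
  by (intro connected_continuous_image) (auto simp: path_def intro: continuous_on_subset)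

text \<open>Reduces to \<open>chords_do_not_interleave\<close>. The closed edges of the first strand
  form a path connected set, which supplies the chord. The second strand may touch the first at
  smoothed crossings, so only its open edges are used, linked by the sets \<open>Q\<close> of the
  hypothesis, which pass near a shared vertex without meeting any other edge. The arcs
  \<open>A e\<close> are distinguished from the labels \<open>e\<close> because at a crossing the
  edges will be shortened.\<close>

lemma strands_do_not_interleave:
  fixes A :: "'e \<Rightarrow> real \<Rightarrow> complex" and C :: "real \<Rightarrow> complex"
  assumes M: "end_matching E M"
    and A: "\<And>e. e \<in> E \<Longrightarrow> path (A e)" "\<And>e. e \<in> E \<Longrightarrow> open_arc (A e) \<subseteq> S"
      "\<And>e. e \<in> E \<Longrightarrow> path_image (A e) \<subseteq> S \<union> path_image C"
      "\<And>e f. e \<in> E \<Longrightarrow> f \<in> E \<Longrightarrow> e \<noteq> f \<Longrightarrow> open_arc (A e) \<inter> path_image (A f) = {}"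
    and connector: "\<And>e b f c. ((e, b), (f, c)) \<in> M \<Longrightarrow> end_pt (A e, b) = end_pt (A f, c) \<and>
      (\<exists>Q. connected Q \<and> Q \<subseteq> S \<and> Q \<inter> open_arc (A e) \<noteq> {} \<and> Q \<inter> open_arc (A f) \<noteq> {} \<and>
         (\<forall>g\<in>E - {e, f}. Q \<inter> path_image (A g) = {}))"
    and C: "simple_path C" "pathfinish C = pathstart C"
    and S: "S = inside (path_image C) \<or> S = outside (path_image C)"
    and e: "e1 \<in> E" "e2 \<in> E" "e2 \<notin> end_matching.strand M e1"
    and d1: "f1 \<in> end_matching.strand M e1" "end_pt (A f1, b1) = C s1" "f1' \<in> end_matching.strand M e1" "end_pt (A f1', b1') = C s2"
    and d2: "f2 \<in> end_matching.strand M e2" "end_pt (A f2, b2) = C t1" "f2' \<in> end_matching.strand M e2" "end_pt (A f2', b2') = C t2"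
    and off: "\<And>g. g \<in> end_matching.strand M e1 \<Longrightarrow> C t1 \<notin> path_image (A g) \<and> C t2 \<notin> path_image (A g)"
    and s: "0 \<le> s1" "s1 < s2" "s2 \<le> 1" and t: "s1 < t1" "t1 < s2" "t2 < s1 \<or> s2 < t2" "t2 \<in> {0..1}"
  shows False
proof -
  interpret end_matching E M by fact
  define K1 where "K1 = (\<Union>g\<in>strand e1. path_image (A g))"
  have end_in: "end_pt (A f, b) \<in> path_image (A f)" for f b by (auto simp: end_pt_def)
  have K1: "path_component K1 (pathstart (A e1)) z" if "f \<in> strand e1" "z \<in> path_image (A f)" for f z
    using that
  proof (induction arbitrary: z rule: strand_induct)
    case refl
    have "path_component (path_image (A e1)) (pathstart (A e1)) z"
      using path_connected_path_image[OF A(1)[OF e(1)]] refl pathstart_in_path_image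
      unfolding path_connected_component by metis
    then show ?case
      by (rule path_component_of_subset[rotated]) (use strand_refl[of e1] in \<open>auto simp: K1_def\<close>)
  next
    case (step f g)
    obtain b c where bc: "((f, b), (g, c)) \<in> M" using step.hyps by (auto simp: adj_def)
    let ?p = "end_pt (A f, b)"
    have p: "?p \<in> path_image (A f)" "?p \<in> path_image (A g)"
      using connector[OF bc] end_in[of f b] end_in[of g c] by simp_all
    have g: "g \<in> strand e1" using strand_adj step.hyps by blast
    then have "g \<in> E" using strand_subset e by blast
    then have "path_component (path_image (A g)) ?p z"
      using path_connected_path_image[OF A(1)] p step.prems unfolding path_connected_component by metis
    then have "path_component K1 ?p z"
      by (rule path_component_of_subset[rotated]) (use g in \<open>auto simp: K1_def\<close>)
    then show ?case using step.IH[OF p(1)] path_component_trans by metis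
  qed
  have "path_component K1 (C s1) (C s2)"
    using K1[OF d1(1) end_in[of f1 b1]] K1[OF d1(3) end_in[of f1' b1']] d1(2,4)
    by (metis path_component_sym path_component_trans)
  then obtain \<gamma> where \<gamma>: "path \<gamma>" "path_image \<gamma> \<subseteq> K1" "pathstart \<gamma> = C s1" "pathfinish \<gamma> = C s2"
    by (auto simp: path_component_def)
  define Q where "Q = (\<lambda>(e, f). SOME Q. connected Q \<and> Q \<subseteq> S \<and> Q \<inter> open_arc (A e) \<noteq> {} \<and> Q \<inter> open_arc (A f) \<noteq> {} \<and>
         (\<forall>g\<in>E - {e, f}. Q \<inter> path_image (A g) = {}))"
  have Q: "connected (Q (e, f)) \<and> Q (e, f) \<subseteq> S \<and> Q (e, f) \<inter> open_arc (A e) \<noteq> {} \<and> Q (e, f) \<inter> open_arc (A f) \<noteq> {} \<and>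
         (\<forall>g\<in>E - {e, f}. Q (e, f) \<inter> path_image (A g) = {})" if "(e, f) \<in> adj" for e f
  proof -
    have "\<exists>Q. connected Q \<and> Q \<subseteq> S \<and> Q \<inter> open_arc (A e) \<noteq> {} \<and> Q \<inter> open_arc (A f) \<noteq> {} \<and>
         (\<forall>g\<in>E - {e, f}. Q \<inter> path_image (A g) = {})" using that connector by (auto simp: adj_def)
    then show ?thesis unfolding Q_def prod.case by (rule someI_ex)
  qed
  let ?adj2 = "{p \<in> adj. fst p \<in> strand e2}"
  define K2 where "K2 = (\<Union>g\<in>strand e2. open_arc (A g)) \<union> (\<Union>p\<in>?adj2. Q p)"
  let ?z = "A e2 (1/2)"
  have E2: "f \<in> E" if "f \<in> strand e2" for f using that strand_subset e by blast
  have K2: "connected_component K2 ?z z" if "f \<in> strand e2" "z \<in> open_arc (A f)" for f z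
    using that
  proof (induction arbitrary: z rule: strand_induct)
    case refl
    have "?z \<in> open_arc (A e2)" by auto
    moreover have "open_arc (A e2) \<subseteq> K2" unfolding K2_def using strand_refl[of e2] by blast
    ultimately show ?case
      using connected_open_arc[OF A(1)[OF e(2)]] refl
      unfolding connected_component_def by blast
  next
    case (step f g)
    have g: "g \<in> strand e2" using strand_adj step.hyps by blast
    note q = Q[OF step.hyps(2)]
    then obtain x y where x: "x \<in> Q (f, g)" "x \<in> open_arc (A f)" and y: "y \<in> Q (f, g)" "y \<in> open_arc (A g)" by blast
    have "Q (f, g) \<subseteq> K2" using step.hyps by (auto simp: K2_def)
    then have "connected_component K2 x y" using q x y unfolding connected_component_def by blast
    moreover have "connected_component K2 y z"
      using connected_open_arc[OF A(1)[OF E2[OF g]]] y step.prems g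
      unfolding connected_component_def by (intro exI[of _ "open_arc (A g)"]) (auto simp: K2_def)
    ultimately show ?case using step.IH[OF x(2)] connected_component_trans by metis
  qed
  have K2': "connected_component K2 ?z z" if z: "z \<in> K2" for z
  proof -
    from z consider f where "f \<in> strand e2" "z \<in> open_arc (A f)"
      | f g where "(f, g) \<in> adj" "f \<in> strand e2" "z \<in> Q (f, g)"
      unfolding K2_def by force
    then show ?thesis
    proof cases
      case 1 then show ?thesis using K2 by blast
    next
      case 2
      then obtain x where x: "x \<in> Q (f, g)" "x \<in> open_arc (A f)" using Q by blast
      have "Q (f, g) \<subseteq> K2" using 2 by (auto simp: K2_def)
      then have "connected_component K2 x z" using Q[OF 2(1)] x 2 unfolding connected_component_def by blast
      then show ?thesis using K2[OF 2(2) x(2)] connected_component_trans by metis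
    qed
  qed
  have connK2: "connected K2"
    unfolding connected_iff_connected_component using K2' connected_component_sym connected_component_trans by metis
  have K2S: "K2 \<subseteq> S"
    unfolding K2_def using A(2) E2 Q by (auto, blast)
  have ne: "f \<noteq> g" if "f \<in> strand e2" "g \<in> strand e1" for f g
    using strand_disjoint[OF e(3)] that by blast
  have "K2 \<inter> K1 = {}"
  proof -
    have "z \<notin> path_image (A g)" if z: "z \<in> K2" and g: "g \<in> strand e1" for z g
    proof -
      have gE: "g \<in> E" using g strand_subset e by blast
      from z consider f where "f \<in> strand e2" "z \<in> open_arc (A f)"
        | f h where "(f, h) \<in> adj" "f \<in> strand e2" "z \<in> Q (f, h)"
        unfolding K2_def by force
      then show ?thesis
      proof cases
        case 1 then show ?thesis using A(4)[OF E2 gE ne] g by blast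
      next
        case 2
        then have "h \<in> strand e2" using strand_adj by blast
        then have "g \<in> E - {f, h}" using ne 2 g gE by blast
        then show ?thesis using Q[OF 2(1)] 2(3) by blast
      qed
    qed
    then show ?thesis unfolding K1_def by blast
  qed
  then have K2\<gamma>: "K2 \<inter> path_image \<gamma> = {}" using \<gamma> by blast
  \<comment> \<open>The ends of the second strand on \<open>C\<close> do not belong to
    \<open>K2\<close>, which lies in the open side \<open>S\<close>; they are only limits of its
    points.\<close>
  have cl: "end_pt (A f, b) \<in> closure K2" if "f \<in> strand e2" for f b
  proof -
    have "open_arc (A f) \<subseteq> K2" using that by (auto simp: K2_def)
    then have "closure (open_arc (A f)) \<subseteq> closure K2" by (rule closure_mono)
    then show ?thesis using endpoint_in_closure_open_arc[OF A(1)[OF E2[OF that]]] by (auto simp: end_pt_def)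
  qed
  have K1S: "K1 \<subseteq> S \<union> path_image C" unfolding K1_def using A(3) strand_subset e by blast
  have "C t1 \<notin> path_image \<gamma>" "C t2 \<notin> path_image \<gamma>" using \<gamma>(2) off unfolding K1_def by blast+
  then show False
    using chords_do_not_interleave[OF C S \<gamma>(1) _ \<gamma>(3,4) s connK2 K2S K2\<gamma> t(1,2) _ _ t(3,4)]
      cl[OF d2(1), of b2] cl[OF d2(3), of b2'] d2(2,4) \<gamma>(2) K1S by (metis order_trans)
qed

text \<open>For small times this is the sign of the derivative of \<open>n \<bullet> \<rho>\<close>
  at 0; for the remaining times injectivity and compactness keep the arc away from
  \<open>x\<close>.\<close>

lemma ray_half_plane:
  fixes \<rho> :: "real \<Rightarrow> complex"
  assumes "arc \<rho>" "\<rho> 0 = x" "(\<rho> has_vector_derivative v) (at 0)" "n \<bullet> v > 0"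
  obtains \<epsilon> where "\<epsilon> > 0" "\<And>z. z \<in> path_image \<rho> \<Longrightarrow> z \<in> ball x \<epsilon> \<Longrightarrow> z = x \<or> n \<bullet> (z - x) > 0"
proof -
  have "((\<lambda>t. n \<bullet> \<rho> t) has_real_derivative n \<bullet> v) (at 0)"
    unfolding has_real_derivative_iff_has_vector_derivative
    by (rule bounded_linear.has_vector_derivative[OF bounded_linear_inner_right assms(3)])
  then obtain d where d: "d > 0" "\<And>h. h > 0 \<Longrightarrow> h < d \<Longrightarrow> n \<bullet> \<rho> 0 < n \<bullet> \<rho> h"
    using DERIV_pos_inc_right[of "\<lambda>t. n \<bullet> \<rho> t" "n \<bullet> v" 0] assms(4) by auto
  let ?F = "\<rho> ` {min d 1..1}"
  have "compact ?F"
  proof (rule compact_continuous_image[OF continuous_on_subset[of "{0..1}"]])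
    show "continuous_on {0..1} \<rho>" using assms(1) by (simp add: arc_def path_def)
  qed (use d in auto)
  moreover have "x \<notin> ?F"
  proof
    assume "x \<in> ?F"
    then obtain t where "t \<in> {min d 1..1}" "\<rho> t = \<rho> 0" using assms(2) by auto
    then show False using assms(1) d unfolding arc_def inj_on_def by force
  qed
  ultimately obtain \<epsilon> where \<epsilon>: "\<epsilon> > 0" "ball x \<epsilon> \<subseteq> - ?F"
    by (metis ComplI compact_imp_closed open_Compl open_contains_ball)
  show ?thesis
  proof (rule that[OF \<epsilon>(1)])
    fix z assume z: "z \<in> path_image \<rho>" "z \<in> ball x \<epsilon>"
    then obtain t where t: "t \<in> {0..1}" "z = \<rho> t" by (auto simp: path_image_def)
    have "t \<notin> {min d 1..1}" using z \<epsilon> t by blast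
    then have "t < d" using t by auto
    show "z = x \<or> n \<bullet> (z - x) > 0"
    proof (cases "t = 0")
      case True then show ?thesis using t assms by simp
    next
      case False
      then show ?thesis using d(2)[of t] t \<open>t < d\<close> assms(2) by (simp add: inner_diff_right)
    qed
  qed
qed

lemma open_arc_near_start:
  fixes \<rho> :: "real \<Rightarrow> complex"
  assumes "path \<rho>" "open U" "\<rho> 0 \<in> U"
  obtains \<delta> where "0 < \<delta>" "\<delta> < 1" "\<rho> ` {0..\<delta>} \<subseteq> U"
proof -
  obtain T where T: "open T" "0 \<in> T" "\<And>t. t \<in> {0..1} \<Longrightarrow> t \<in> T \<Longrightarrow> \<rho> t \<in> U"
    using assms unfolding path_def continuous_on_topological by (metis atLeastAtMost_iff order_refl zero_le_one)
  then obtain e where "e > 0" "ball 0 e \<subseteq> T" using open_contains_ball by blast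
  then show ?thesis using that[of "min (e/2) (1/2)"] T(3) by (force simp: dist_real_def)
qed

text \<open>Two linearly independent directions lie in a common open half plane, which then contains
  neither of the opposite directions. A small half disc meets rays 1 and 2 and misses the rest; it
  passes the crossing as a smoothing would if its branches were pulled apart.\<close>

lemma half_disc_connector:
  fixes \<rho>1 \<rho>2 \<rho>3 \<rho>4 :: "real \<Rightarrow> complex"
  assumes arcs: "arc \<rho>1" "arc \<rho>2" "arc \<rho>3" "arc \<rho>4"
    and starts: "\<rho>1 0 = x" "\<rho>2 0 = x" "\<rho>3 0 = x" "\<rho>4 0 = x"
    and derivs: "(\<rho>1 has_vector_derivative v1) (at 0)" "(\<rho>2 has_vector_derivative v2) (at 0)"
      "(\<rho>3 has_vector_derivative - (c1 *\<^sub>R v1)) (at 0)" "(\<rho>4 has_vector_derivative - (c2 *\<^sub>R v2)) (at 0)"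
    and c: "c1 > 0" "c2 > 0" and indep: "Im (cnj v1 * v2) \<noteq> 0"
    and U: "open U" "x \<in> U" and F: "closed F" "x \<notin> F"
  obtains Q where "connected Q" "Q \<subseteq> U" "Q \<inter> open_arc \<rho>1 \<noteq> {}" "Q \<inter> open_arc \<rho>2 \<noteq> {}"
    "Q \<inter> path_image \<rho>3 = {}" "Q \<inter> path_image \<rho>4 = {}" "Q \<inter> F = {}"
proof -
  \<comment> \<open>Orthogonal to \<open>v1 - v2\<close>, so that
    \<open>n \<bullet> v1 = n \<bullet> v2\<close>; the common value is the absolute value of the
    determinant of \<open>(v1, v2)\<close>.\<close>
  define n where "n = sgn (Im (cnj v1 * v2)) *\<^sub>R (\<i> * (v1 - v2))"
  have "n \<bullet> v1 = sgn (Im (cnj v1 * v2)) * Im (cnj v1 * v2)" "n \<bullet> v2 = sgn (Im (cnj v1 * v2)) * Im (cnj v1 * v2)"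
    by (simp_all add: n_def inner_complex_def algebra_simps)
  then have n: "n \<bullet> v1 > 0" "n \<bullet> v2 > 0" using indep by (simp_all add: sgn_mult_abs[symmetric] sgn_if)
  then have n': "(- n) \<bullet> (- (c1 *\<^sub>R v1)) > 0" "(- n) \<bullet> (- (c2 *\<^sub>R v2)) > 0" using c by simp_all
  obtain e1 where e1: "e1 > 0" "\<And>z. z \<in> path_image \<rho>1 \<Longrightarrow> z \<in> ball x e1 \<Longrightarrow> z = x \<or> n \<bullet> (z - x) > 0"
    using ray_half_plane[OF arcs(1) starts(1) derivs(1) n(1)] by metis
  obtain e2 where e2: "e2 > 0" "\<And>z. z \<in> path_image \<rho>2 \<Longrightarrow> z \<in> ball x e2 \<Longrightarrow> z = x \<or> n \<bullet> (z - x) > 0"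
    using ray_half_plane[OF arcs(2) starts(2) derivs(2) n(2)] by metis
  obtain e3 where e3: "e3 > 0" "\<And>z. z \<in> path_image \<rho>3 \<Longrightarrow> z \<in> ball x e3 \<Longrightarrow> z = x \<or> (- n) \<bullet> (z - x) > 0"
    using ray_half_plane[OF arcs(3) starts(3) derivs(3) n'(1)] by metis
  obtain e4 where e4: "e4 > 0" "\<And>z. z \<in> path_image \<rho>4 \<Longrightarrow> z \<in> ball x e4 \<Longrightarrow> z = x \<or> (- n) \<bullet> (z - x) > 0"
    using ray_half_plane[OF arcs(4) starts(4) derivs(4) n'(2)] by metis
  have "open (U \<inter> - F)" "x \<in> U \<inter> - F" using U F by auto
  then obtain e5 where e5: "e5 > 0" "ball x e5 \<subseteq> U \<inter> - F" by (metis open_contains_ball)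
  define e where "e = Min {e1, e2, e3, e4, e5}"
  have e: "e > 0" "e \<le> e1" "e \<le> e2" "e \<le> e3" "e \<le> e4" "e \<le> e5"
    using e1 e2 e3 e4 e5 by (auto simp: e_def)
  define Q where "Q = ball x e \<inter> {z. n \<bullet> z > n \<bullet> x}"
  have Q: "z \<in> Q \<longleftrightarrow> z \<in> ball x e \<and> n \<bullet> (z - x) > 0" for z by (auto simp: Q_def inner_diff_right)
  have meets: "Q \<inter> open_arc \<rho> \<noteq> {}"
    if \<rho>: "arc \<rho>" "\<rho> 0 = x" "\<And>z. z \<in> path_image \<rho> \<Longrightarrow> z \<in> ball x e \<Longrightarrow> z = x \<or> n \<bullet> (z - x) > 0" for \<rho>
  proof -
    have "path \<rho>" using \<rho>(1) by (simp add: arc_def)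
    then obtain \<delta> where \<delta>: "0 < \<delta>" "\<delta> < 1" "\<rho> ` {0..\<delta>} \<subseteq> ball x e"
      using open_arc_near_start[of \<rho> "ball x e"] \<rho>(2) e(1) by auto
    have "\<rho> \<delta> \<noteq> x" using \<rho>(1,2) \<delta> unfolding arc_def inj_on_def by force
    moreover have "\<rho> \<delta> \<in> \<rho> ` {0..\<delta>}" "\<rho> \<delta> \<in> path_image \<rho>" using \<delta> by (auto simp: path_image_def)
    then have "\<rho> \<delta> \<in> ball x e" "\<rho> \<delta> \<in> path_image \<rho>" using \<delta>(3) by blast+
    ultimately have "\<rho> \<delta> \<in> Q" using \<rho>(3) Q by blast
    then show ?thesis using \<delta> by auto
  qed
  show ?thesis
  proof (rule that)
    show "connected Q" unfolding Q_def
      by (intro convex_connected convex_Int convex_ball) (simp add: convex_halfspace_gt)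
    have "Q \<subseteq> ball x e5" using e by (auto simp: Q_def)
    then show "Q \<subseteq> U" "Q \<inter> F = {}" using e5 by blast+
    have "ball x e \<subseteq> ball x e1" "ball x e \<subseteq> ball x e2" using e by auto
    then have "\<And>z. z \<in> path_image \<rho>1 \<Longrightarrow> z \<in> ball x e \<Longrightarrow> z = x \<or> n \<bullet> (z - x) > 0"
      "\<And>z. z \<in> path_image \<rho>2 \<Longrightarrow> z \<in> ball x e \<Longrightarrow> z = x \<or> n \<bullet> (z - x) > 0"
      using e1(2) e2(2) by blast+
    then show "Q \<inter> open_arc \<rho>1 \<noteq> {}" "Q \<inter> open_arc \<rho>2 \<noteq> {}"
      using meets[OF arcs(1) starts(1)] meets[OF arcs(2) starts(2)] by blast+
    have "ball x e \<subseteq> ball x e3" "ball x e \<subseteq> ball x e4" using e by auto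
    then show "Q \<inter> path_image \<rho>3 = {}" "Q \<inter> path_image \<rho>4 = {}"
      using e3(2) e4(2) Q by fastforce+
  qed
qed

section \<open>The four rays at a crossing\<close>

text \<open>Along \<open>p + k * d\<close> the squared distance from the centre is quadratic in
  \<open>k\<close> and takes the value \<open>r\<^sup>2\<close> at \<open>k = 0\<close> and
  \<open>k = 1\<close>, hence nowhere else.\<close>

lemma line_meets_sphere:
  fixes p p' z x :: complex
  assumes "p \<in> sphere x r" "p' \<in> sphere x r" "z \<in> sphere x r" "p \<noteq> p'" "Im (cnj (p' - p) * (z - p)) = 0"
  shows "z = p \<or> z = p'"
proof -
  define d where "d = p' - p"
  have d: "d \<noteq> 0" using assms(4) by (simp add: d_def)
  define k where "k = Re (cnj d * (z - p)) / (cmod d)\<^sup>2"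
  have "cnj d * (z - p) = of_real (Re (cnj d * (z - p)))"
    using assms(5) by (simp add: complex_eq_iff d_def)
  then have "d * (cnj d * (z - p)) = d * of_real (k * (cmod d)\<^sup>2)" using d by (simp add: k_def)
  then have "of_real ((cmod d)\<^sup>2) * (z - p) = of_real ((cmod d)\<^sup>2) * (of_real k * d)"
    unfolding complex_norm_square of_real_mult by (simp add: mult_ac)
  then have zk: "z - p = of_real k * d" using d by simp
  have n: "norm (w - x) ^ 2 = (w - x) \<bullet> (w - x)" for w by (simp add: power2_norm_eq_inner)
  have eq: "norm (p + of_real t * d - x) ^ 2 = norm (p - x) ^ 2 + 2 * t * (d \<bullet> (p - x)) + t\<^sup>2 * (d \<bullet> d)" for t :: real
  proof -
    have "p + of_real t * d - x = (p - x) + t *\<^sub>R d" by (simp add: scaleR_conv_of_real)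
    then show ?thesis unfolding power2_norm_eq_inner
      by (simp add: inner_add_left inner_add_right inner_commute power2_eq_square algebra_simps)
  qed
  have r: "norm (p - x) = r" "norm (p' - x) = r" "norm (z - x) = r"
    using assms(1-3) by (auto simp: dist_norm norm_minus_commute)
  have "p' = p + of_real 1 * d" "z = p + of_real k * d" using zk by (simp_all add: d_def algebra_simps)
  then have "2 * (d \<bullet> (p - x)) + d \<bullet> d = 0" "2 * k * (d \<bullet> (p - x)) + k\<^sup>2 * (d \<bullet> d) = 0"
    using eq[of 1] eq[of k] r by (auto simp del: of_real_1)
  then have "k * (k - 1) * (d \<bullet> d) = 0" by algebra
  then have "k = 0 \<or> k = 1" using d by simp
  then show ?thesis using zk by (auto simp: d_def)
qed

lemma circlepath_eq_iff:
  assumes "r \<noteq> 0"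
  shows "circlepath x r a = circlepath x r b \<longleftrightarrow> (\<exists>n::int. a = b + of_int n)"
proof -
  have "circlepath x r a = circlepath x r b \<longleftrightarrow>
      exp (2 * of_real pi * \<i> * of_real a) = exp (2 * of_real pi * \<i> * of_real b)"
    using assms by (simp add: circlepath)
  also have "\<dots> \<longleftrightarrow> (\<exists>n::int. 2 * of_real pi * \<i> * of_real a = 2 * of_real pi * \<i> * of_real b + (of_int (2 * n) * pi) * \<i>)"
    unfolding exp_eq ..
  also have "\<dots> \<longleftrightarrow> (\<exists>n::int. a = b + of_int n)"
  proof -
    have "2 * of_real pi * \<i> * of_real a = 2 * of_real pi * \<i> * of_real b + (of_int (2 * n) * pi) * \<i> \<longleftrightarrow> a = b + of_int n"
      for n :: int
    proof -
      have "2 * of_real pi * \<i> * of_real b + (of_int (2 * n) * pi) * \<i> = 2 * of_real pi * \<i> * complex_of_real (b + of_int n)"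
        by (simp add: algebra_simps)
      moreover have "2 * of_real pi * \<i> * of_real a = 2 * of_real pi * \<i> * complex_of_real (b + of_int n) \<longleftrightarrow>
          complex_of_real a = complex_of_real (b + of_int n)" by simp
      ultimately show ?thesis by (metis of_real_eq_iff)
    qed
    then show ?thesis by simp
  qed
  finally show ?thesis .
qed

text \<open>The determinant relative to the secant through \<open>p\<close> and \<open>p'\<close>
  vanishes on the circle only at these two points, so it has constant sign on each arc between them.
  Points with opposite signs lie on different arcs, that is, their times interleave.\<close>

lemma circle_separation:
  fixes p p' q q' x :: complex
  assumes r: "r > 0" and on: "p \<in> sphere x r" "p' \<in> sphere x r" "q \<in> sphere x r" "q' \<in> sphere x r"
    and sep: "Im (cnj (p' - p) * (q - p)) * Im (cnj (p' - p) * (q' - p)) < 0"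
  obtains s1 s2 t1 t2 where "0 \<le> s1" "s1 < s2" "s2 \<le> 1" "s1 < t1" "t1 < s2" "t2 < s1 \<or> s2 < t2" "t2 \<in> {0..1}"
    "{circlepath x r s1, circlepath x r s2} = {p, p'}" "{circlepath x r t1, circlepath x r t2} = {q, q'}"
proof -
  let ?C = "circlepath x r"
  have time: "\<exists>t. 0 \<le> t \<and> t < 1 \<and> ?C t = z" if z: "z \<in> sphere x r" for z
  proof -
    have "z \<in> path_image ?C" using z r by simp
    then obtain t where t: "t \<in> {0..1}" "?C t = z" by (auto simp: path_image_def)
    moreover have "?C 0 = ?C 1" using r circlepath_eq_iff[of r x 0 1] by (auto intro: exI[of _ "- 1"])
    ultimately show ?thesis by (cases "t = 1") (auto intro: exI[of _ 0])
  qed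
  have pp: "p \<noteq> p'" using sep by auto
  obtain a b where ab: "0 \<le> a" "a < 1" "?C a = p" "0 \<le> b" "b < 1" "?C b = p'" using time on by metis
  obtain c d where cd: "0 \<le> c" "c < 1" "?C c = q" "0 \<le> d" "d < 1" "?C d = q'" using time on by metis
  define s1 where "s1 = min a b"
  define s2 where "s2 = max a b"
  have s: "0 \<le> s1" "s1 < s2" "s2 < 1" "{?C s1, ?C s2} = {p, p'}"
  proof -
    have "a \<noteq> b" using ab pp by auto
    then show "0 \<le> s1" "s1 < s2" "s2 < 1" "{?C s1, ?C s2} = {p, p'}"
      using ab by (auto simp: s1_def s2_def min_def max_def)
  qed
  define g where "g = (\<lambda>z. Im (cnj (p' - p) * (z - p)))"
  have cont: "continuous_on A (\<lambda>t. g (?C t))" for A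
    unfolding g_def circlepath by (intro continuous_intros)
  have zero: "?C t \<in> {p, p'}" if "g (?C t) = 0" for t
  proof -
    have "?C t \<in> sphere x r" using r by (simp add: circlepath dist_norm norm_mult)
    then show ?thesis using line_meets_sphere[OF on(1,2) _ pp] that by (auto simp: g_def)
  qed
  have no_zero: "?C t \<notin> {p, p'}" if "s1 < t" "t < s2 \<or> s2 < t \<and> t < s1 + 1" for t
  proof -
    have "?C t \<noteq> ?C s1" "?C t \<noteq> ?C s2"
      using that s r by (auto simp: circlepath_eq_iff)
    then show ?thesis using s(4) by auto
  qed
  have same: "g (?C t) * g (?C t') \<ge> 0" if I: "I = {s1<..<s2} \<or> I = {s2<..<s1 + 1}" and t: "t \<in> I" "t' \<in> I" for I t t'
  proof (rule ccontr)
    assume "\<not> g (?C t) * g (?C t') \<ge> 0"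
    then have neg: "g (?C t) * g (?C t') < 0" by simp
    have "connected ((\<lambda>t. g (?C t)) ` I)" using cont I by (intro connected_continuous_image) auto
    then have "is_interval ((\<lambda>t. g (?C t)) ` I)" by (simp add: is_interval_connected_1)
    moreover have "g (?C t) < 0 \<and> 0 < g (?C t') \<or> g (?C t') < 0 \<and> 0 < g (?C t)"
      using neg by (auto simp: mult_less_0_iff)
    ultimately have "0 \<in> (\<lambda>t. g (?C t)) ` I" using t unfolding is_interval_1 by (metis imageI less_imp_le)
    then obtain u where "u \<in> I" "g (?C u) = 0" by force
    then show False using zero[of u] no_zero[of u] I s by auto
  qed
  have neg: "g (?C c) * g (?C d) < 0" using sep cd by (simp add: g_def)
  have nz: "c \<noteq> s1" "c \<noteq> s2" "d \<noteq> s1" "d \<noteq> s2"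
  proof -
    have "g p = 0" "g p' = 0" by (simp_all add: g_def algebra_simps)
    moreover have "g q * g q' < 0" using sep by (simp only: g_def)
    ultimately have "q \<notin> {p, p'}" "q' \<notin> {p, p'}" by auto
    then show "c \<noteq> s1" "c \<noteq> s2" "d \<noteq> s1" "d \<noteq> s2" using cd s(4) by auto
  qed
  \<comment> \<open>One of the two arcs contains the base point of the circle; it is parametrized
    without a break by the interval from \<open>s2\<close> to \<open>s1 + 1\<close>.\<close>
  have shift: "\<exists>t\<in>{s2<..<s1 + 1}. ?C t = ?C u" if "0 \<le> u" "u < 1" "u \<noteq> s1" "u \<noteq> s2" "\<not> (s1 < u \<and> u < s2)" for u
  proof (cases "u < s1")
    case True
    then show ?thesis using that s r by (intro bexI[of _ "u + 1"]) (auto simp: circlepath_eq_iff intro: exI[of _ 1])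
  next
    case False
    then show ?thesis using that s by (intro bexI[of _ u]) auto
  qed
  have "(s1 < c \<and> c < s2) \<noteq> (s1 < d \<and> d < s2)"
  proof
    assume eq: "(s1 < c \<and> c < s2) = (s1 < d \<and> d < s2)"
    show False
    proof (cases "s1 < c \<and> c < s2")
      case True
      then show False using same[of "{s1<..<s2}" c d] eq neg by auto
    next
      case False
      obtain c' d' where "c' \<in> {s2<..<s1 + 1}" "?C c' = ?C c" "d' \<in> {s2<..<s1 + 1}" "?C d' = ?C d"
        using shift[of c] shift[of d] False eq cd nz by metis
      then show False using same[of "{s2<..<s1 + 1}" c' d'] neg by auto
    qed
  qed
  then consider "s1 < c \<and> c < s2 \<and> (d < s1 \<or> s2 < d)" | "s1 < d \<and> d < s2 \<and> (c < s1 \<or> s2 < c)"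
    using nz by linarith
  then show ?thesis
  proof cases
    case 1 then show ?thesis using that[of s1 s2 c d] s cd by auto
  next
    case 2 then show ?thesis using that[of s1 s2 d c] s cd by auto
  qed
qed

text \<open>Shortly after the start the arc lies from \<open>x\<close> roughly in the direction of
  \<open>v\<close>, so this holds for its last point on a small circle. The bound \<open>r0\<close>
  serves all smaller radii, so that one radius can be chosen for the four edges at a
  crossing.\<close>

lemma last_exit:
  fixes \<rho> :: "real \<Rightarrow> complex"
  assumes arc: "arc \<rho>" and start: "\<rho> 0 = x" and deriv: "(\<rho> has_vector_derivative v) (at 0)" "v \<noteq> 0" and \<epsilon>: "\<epsilon> > 0"
  obtains r0 where "r0 > 0" "\<And>r. 0 < r \<Longrightarrow> r < r0 \<Longrightarrow>
    \<exists>T. 0 < T \<and> T < 1 \<and> cmod (\<rho> T - x) = r \<and> (\<forall>t. T < t \<and> t \<le> 1 \<longrightarrow> r < cmod (\<rho> t - x)) \<and>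
      cmod ((\<rho> T - x) / of_real r - sgn v) < \<epsilon>"
proof -
  have "((\<lambda>t. (\<rho> t - \<rho> 0) /\<^sub>R t) \<longlongrightarrow> v) (at 0)"
  proof -
    have "((\<lambda>y. (1 / norm (y - 0)) *\<^sub>R (\<rho> y - (\<rho> 0 + (y - 0) *\<^sub>R v))) \<longlongrightarrow> 0) (at 0)"
      using deriv(1) unfolding has_vector_derivative_def has_derivative_within by simp
    then have "((\<lambda>y. norm ((1 / norm (y - 0)) *\<^sub>R (\<rho> y - (\<rho> 0 + (y - 0) *\<^sub>R v)))) \<longlongrightarrow> 0) (at 0)"
      by (rule tendsto_norm_zero)
    moreover have "eventually (\<lambda>y. norm ((1 / norm (y - 0)) *\<^sub>R (\<rho> y - (\<rho> 0 + (y - 0) *\<^sub>R v))) =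
        norm ((\<rho> y - \<rho> 0) /\<^sub>R y - v)) (at 0)"
    proof (rule eventually_at_filter[THEN iffD2], rule always_eventually, intro allI impI)
      fix y :: real assume "y \<noteq> 0"
      then have "(\<rho> y - \<rho> 0) /\<^sub>R y - v = (1 / y) *\<^sub>R (\<rho> y - (\<rho> 0 + (y - 0) *\<^sub>R v))"
        by (simp add: algebra_simps inverse_eq_divide)
      then show "norm ((1 / norm (y - 0)) *\<^sub>R (\<rho> y - (\<rho> 0 + (y - 0) *\<^sub>R v))) = norm ((\<rho> y - \<rho> 0) /\<^sub>R y - v)"
        by simp
    qed
    ultimately have "((\<lambda>y. norm ((\<rho> y - \<rho> 0) /\<^sub>R y - v)) \<longlongrightarrow> 0) (at 0)"
      using tendsto_cong by fast
    then have "((\<lambda>y. (\<rho> y - \<rho> 0) /\<^sub>R y - v) \<longlongrightarrow> 0) (at 0)" by (rule tendsto_norm_zero_cancel)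
    then show ?thesis by (simp add: LIM_zero_iff)
  qed
  then have "((\<lambda>t. sgn ((\<rho> t - \<rho> 0) /\<^sub>R t)) \<longlongrightarrow> sgn v) (at 0)" using deriv(2) by (rule tendsto_sgn)
  then obtain \<delta> where \<delta>: "\<delta> > 0" "\<And>t. t \<noteq> 0 \<Longrightarrow> \<bar>t\<bar> < \<delta> \<Longrightarrow> cmod (sgn ((\<rho> t - \<rho> 0) /\<^sub>R t) - sgn v) < \<epsilon>"
    using \<epsilon> unfolding LIM_def by (auto simp: dist_norm)
  have dir: "cmod (sgn (\<rho> t - x) - sgn v) < \<epsilon>" if "0 < t" "t < \<delta>" for t
    using \<delta>(2)[of t] that start by (simp add: sgn_scaleR)
  let ?F = "\<rho> ` {min \<delta> 1..1}"
  have cont: "continuous_on {0..1} \<rho>" using arc by (simp add: arc_def path_def)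
  have "compact ?F"
    by (rule compact_continuous_image[OF continuous_on_subset[OF cont]]) (use \<delta> in auto)
  moreover have "x \<notin> ?F"
  proof
    assume "x \<in> ?F"
    then obtain t where "t \<in> {min \<delta> 1..1}" "\<rho> t = \<rho> 0" using start by auto
    then show False using arc \<delta> unfolding arc_def inj_on_def by force
  qed
  ultimately obtain r0 where r0: "r0 > 0" "ball x r0 \<subseteq> - ?F"
    by (metis ComplI compact_imp_closed open_Compl open_contains_ball)
  show ?thesis
  proof (rule that[OF r0(1)])
    fix r :: real assume r: "0 < r" "r < r0"
    let ?A = "{0..1} \<inter> (\<lambda>t. cmod (\<rho> t - x)) -` {..r}"
    have cn: "continuous_on {0..1} (\<lambda>t. cmod (\<rho> t - x))" using cont by (intro continuous_intros)
    then have "closed ?A" by (intro continuous_closed_preimage) auto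
    then have "compact ?A" using compact_Icc[of "0::real" 1] by (metis compact_Int_closed inf.idem inf_assoc)
    moreover have "0 \<in> ?A" using start r by simp
    ultimately obtain T where T: "T \<in> ?A" "\<And>t. t \<in> ?A \<Longrightarrow> t \<le> T" using compact_attains_sup by (metis empty_iff)
    have out: "r < cmod (\<rho> t - x)" if "T < t" "t \<le> 1" for t
      by (rule ccontr) (use T(2)[of t] T(1) that in auto)
    \<comment> \<open>From time \<open>\<delta>\<close> on the arc keeps distance at least
      \<open>r0\<close> from \<open>x\<close>, so the last exit happens while the direction is still
      under control.\<close>
    have "T \<notin> {min \<delta> 1..1}"
    proof
      assume "T \<in> {min \<delta> 1..1}"
      then have "\<rho> T \<notin> ball x r0" using r0 by blast
      then show False using T(1) r by (auto simp: dist_norm norm_minus_commute)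
    qed
    then have T1: "T < \<delta>" "T < 1" using T(1) by auto
    have Tr: "cmod (\<rho> T - x) = r"
    proof (rule ccontr)
      assume "cmod (\<rho> T - x) \<noteq> r"
      then have less: "cmod (\<rho> T - x) < r" using T(1) by auto
      have cn': "continuous_on {T..1} (\<lambda>t. cmod (\<rho> t - x))" using cn T(1) by (rule_tac continuous_on_subset) auto
      have "r \<le> cmod (\<rho> 1 - x)" using out[of 1] T1 by simp
      then obtain t where "T \<le> t" "t \<le> 1" "cmod (\<rho> t - x) = r"
        using IVT'[of "\<lambda>t. cmod (\<rho> t - x)" T r 1] less T1 cn' by auto
      then show False using out[of t] less by (cases "t = T") auto
    qed
    have T0: "0 < T" using T(1) Tr start r by (cases "T = 0") auto
    have "(\<rho> T - x) / of_real r = sgn (\<rho> T - x)" using Tr by (simp add: sgn_eq)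
    then have "cmod ((\<rho> T - x) / of_real r - sgn v) < \<epsilon>" using dir[OF T0 T1(1)] by simp
    then show "\<exists>T. 0 < T \<and> T < 1 \<and> cmod (\<rho> T - x) = r \<and> (\<forall>t. T < t \<and> t \<le> 1 \<longrightarrow> r < cmod (\<rho> t - x)) \<and>
      cmod ((\<rho> T - x) / of_real r - sgn v) < \<epsilon>"
      using T0 T1 Tr out by blast
  qed
qed

text \<open>The inequality puts \<open>u2\<close> and \<open>u4\<close> on different sides of the
  line through \<open>u1\<close> and \<open>u3\<close>. It is an open condition, and for
  \<open>(w1, w2, - w1, - w2)\<close> the product is
  \<open>- 4 * (Im (cnj w1 * w2))\<^sup>2\<close>.\<close>

lemma nearby_directions_alternate:
  fixes w1 w2 :: complex
  assumes "Im (cnj w1 * w2) \<noteq> 0"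
  obtains \<epsilon> where "\<epsilon> > 0" "\<And>u1 u2 u3 u4. cmod (u1 - w1) < \<epsilon> \<Longrightarrow> cmod (u2 - w2) < \<epsilon> \<Longrightarrow>
    cmod (u3 + w1) < \<epsilon> \<Longrightarrow> cmod (u4 + w2) < \<epsilon> \<Longrightarrow>
    Im (cnj (u3 - u1) * (u2 - u1)) * Im (cnj (u3 - u1) * (u4 - u1)) < 0"
proof -
  let ?G = "\<lambda>(u1 :: complex, u2 :: complex, u3 :: complex, u4 :: complex).
      Im (cnj (u3 - u1) * (u2 - u1)) * Im (cnj (u3 - u1) * (u4 - u1))"
  define O' where "O' = {u. ?G u < 0}"
  have oO: "open O'"
    unfolding O'_def
    unfolding case_prod_unfold by (intro open_Collect_less continuous_intros)
  have "?G (w1, w2, - w1, - w2) < 0"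
  proof -
    have "Im (cnj (- w1 - w1) * (w2 - w1)) = - 2 * Im (cnj w1 * w2)"
      "Im (cnj (- w1 - w1) * (- w2 - w1)) = 2 * Im (cnj w1 * w2)"
      by (simp_all add: algebra_simps)
    moreover have "(- 2 * k) * (2 * k) < 0" if "k \<noteq> 0" for k :: real
    proof -
      have "0 < k\<^sup>2" using that by simp
      then show ?thesis by (simp add: power2_eq_square)
    qed
    ultimately show ?thesis using assms by (simp only: prod.case)
  qed
  then have inO: "(w1, w2, - w1, - w2) \<in> O'" by (simp only: O'_def mem_Collect_eq)
  obtain A1 B1 where 1: "open A1" "open B1" "w1 \<in> A1" "(w2, - w1, - w2) \<in> B1" "A1 \<times> B1 \<subseteq> O'"
    using open_prod_elim[OF oO inO] by (metis mem_Sigma_iff)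
  obtain A2 B2 where 2: "open A2" "open B2" "w2 \<in> A2" "(- w1, - w2) \<in> B2" "A2 \<times> B2 \<subseteq> B1"
    using open_prod_elim[OF 1(2,4)] by (metis mem_Sigma_iff)
  obtain A3 A4 where 3: "open A3" "open A4" "- w1 \<in> A3" "- w2 \<in> A4" "A3 \<times> A4 \<subseteq> B2"
    using open_prod_elim[OF 2(2,4)] by (metis mem_Sigma_iff)
  obtain e1 where e1: "e1 > 0" "ball w1 e1 \<subseteq> A1" using 1 open_contains_ball by metis
  obtain e2 where e2: "e2 > 0" "ball w2 e2 \<subseteq> A2" using 2 open_contains_ball by metis
  obtain e3 where e3: "e3 > 0" "ball (- w1) e3 \<subseteq> A3" using 3 open_contains_ball by metis
  obtain e4 where e4: "e4 > 0" "ball (- w2) e4 \<subseteq> A4" using 3 open_contains_ball by metis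
  show ?thesis
  proof (rule that[of "Min {e1, e2, e3, e4}"])
    show "Min {e1, e2, e3, e4} > 0" using e1 e2 e3 e4 by simp
    fix u1 u2 u3 u4
    assume u: "cmod (u1 - w1) < Min {e1, e2, e3, e4}" "cmod (u2 - w2) < Min {e1, e2, e3, e4}"
      "cmod (u3 + w1) < Min {e1, e2, e3, e4}" "cmod (u4 + w2) < Min {e1, e2, e3, e4}"
    have "u1 \<in> ball w1 e1" "u2 \<in> ball w2 e2" using u by (simp_all add: dist_norm norm_minus_commute)
    moreover have "u3 \<in> ball (- w1) e3" "u4 \<in> ball (- w2) e4"
      using u by (simp_all add: dist_norm norm_minus_commute[of "- _"])
    ultimately have "(u1, u2, u3, u4) \<in> A1 \<times> B1" using e1 e2 e3 e4 2(5) 3(5) by blast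
    then have "(u1, u2, u3, u4) \<in> O'" by (rule subsetD[OF 1(5)])
    then show "Im (cnj (u3 - u1) * (u2 - u1)) * Im (cnj (u3 - u1) * (u4 - u1)) < 0"
      by (simp only: O'_def mem_Collect_eq prod.case)
  qed
qed

section \<open>Connected sets that link two edges near a vertex\<close>

context link
begin

lemma endpoint_not_in_open_arc:
  assumes "e \<in> edges D"
  shows "end_pt (e, b) \<notin> open_arc e"
proof
  assume "end_pt (e, b) \<in> open_arc e"
  then obtain t where t: "0 < t" "t < 1" "e t = e (if b then 1 else 0)"
    by (auto simp: end_pt_def pathfinish_def pathstart_def split: if_splits)
  then show False using arc_edge[OF assms] unfolding arc_def inj_on_def by (cases b) force+
qed

lemma end_pt_in_image: "end_pt d \<in> path_image (fst d)"
  by (auto simp: end_pt_def)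

lemma open_arc_disjoint:
  assumes "e \<in> edges D" "f \<in> edges D" "e \<noteq> f"
  shows "open_arc e \<inter> path_image f = {}"
proof -
  have "z \<notin> path_image f" if "z \<in> open_arc e" for z
  proof
    assume "z \<in> path_image f"
    moreover have "z \<in> path_image e" using that by (auto simp: path_image_def)
    ultimately have "z \<in> {pathstart e, pathfinish e}" using edges_meet[OF assms] by blast
    then have "z = end_pt (e, False) \<or> z = end_pt (e, True)" by (auto simp: end_pt_def)
    then show False using endpoint_not_in_open_arc[OF assms(1)] that by blast
  qed
  then show ?thesis by blast
qed

lemma vertex_on_edge:
  assumes "fst d \<in> edges D" "g \<in> edges D" "end_pt d \<in> path_image g"
  shows "\<exists>b. end_pt (g, b) = end_pt d"
proof (cases "g = fst d")
  case True then show ?thesis by (metis prod.collapse)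
next
  case False
  have "end_pt d \<in> path_image (fst d)" by (rule end_pt_in_image)
  then have "end_pt d \<in> {pathstart g, pathfinish g}" using edges_meet[OF assms(1,2)] False assms(3) by blast
  then show ?thesis by (metis end_pt_def empty_iff fst_conv insert_iff snd_conv)
qed

lemma crossing_ends:
  assumes "x \<in> set (crossings D)" "e \<in> edges D" "end_pt (e, b) = x"
  shows "(e, b) \<in> {(over_in D x, True), (under_in D x, True), (over_out D x, False), (under_out D x, False)}"
  using crossing_edges(11,12)[OF assms(1,2)] assms(3) by (cases b) (auto simp: end_pt_def)

lemma end_pt_crossing:
  assumes "x \<in> set (crossings D)"
  shows "end_pt (over_in D x, True) = x" "end_pt (under_in D x, True) = x"
    "end_pt (over_out D x, False) = x" "end_pt (under_out D x, False) = x"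
  using crossing_edges(5-8)[OF assms] by (simp_all add: end_pt_def)

definition over_ray :: "complex \<Rightarrow> bool \<Rightarrow> (real \<Rightarrow> complex) \<times> bool" where
  "over_ray x b = (if b then (over_in D x, True) else (over_out D x, False))"

definition under_ray :: "complex \<Rightarrow> bool \<Rightarrow> (real \<Rightarrow> complex) \<times> bool" where
  "under_ray x b = (if b then (under_in D x, True) else (under_out D x, False))"

lemma rays_at_crossing:
  assumes "x \<in> set (crossings D)"
  shows "fst (over_ray x b) \<in> edges D" "fst (under_ray x b) \<in> edges D"
    "end_pt (over_ray x b) = x" "end_pt (under_ray x b) = x"
  using crossing_edges(1-4)[OF assms] end_pt_crossing[OF assms] by (simp_all add: over_ray_def under_ray_def)

text \<open>The ray of an incoming edge runs backwards, hence the negative multiples. Only their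
  signs are recorded, because the two edges of a strand have parallel tangents at the crossing but
  possibly different speeds.\<close>

lemma crossing_directions:
  assumes x: "x \<in> set (crossings D)"
  shows "\<exists>v w. Im (cnj v * w) \<noteq> 0 \<and>
    (\<forall>b. \<exists>c. (if b then c < 0 else c > 0) \<and> (ray (over_ray x b) has_vector_derivative c *\<^sub>R v) (at 0)) \<and>
    (\<forall>b. \<exists>c. (if b then c < 0 else c > 0) \<and> (ray (under_ray x b) has_vector_derivative c *\<^sub>R w) (at 0))"
proof -
  obtain r r' where r: "r > 0" "vector_derivative (over_out D x) (at 0) = r *\<^sub>R over_dir D x"
    "r' > 0" "vector_derivative (under_out D x) (at 0) = r' *\<^sub>R under_dir D x"
    and nz: "Im (cnj (over_dir D x) * under_dir D x) \<noteq> 0"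
    using proper[OF x] unfolding proper_crossing_def by blast
  note ce = crossing_edges(1-4)[OF x]
  show ?thesis
  proof (rule exI[of _ "over_dir D x"], rule exI[of _ "under_dir D x"], intro conjI nz allI)
    fix b
    show "\<exists>c. (if b then c < 0 else c > 0) \<and> (ray (over_ray x b) has_vector_derivative c *\<^sub>R over_dir D x) (at 0)"
      using ray_derivative[of "over_ray x b"] r ce
      by (cases b) (auto simp: over_ray_def over_dir_def intro: exI[of _ "- 1"] exI[of _ r])
    show "\<exists>c. (if b then c < 0 else c > 0) \<and> (ray (under_ray x b) has_vector_derivative c *\<^sub>R under_dir D x) (at 0)"
      using ray_derivative[of "under_ray x b"] r ce
      by (cases b) (auto simp: under_ray_def under_dir_def intro: exI[of _ "- 1"] exI[of _ r'])
  qed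
qed

text \<open>The flags \<open>a\<close> and \<open>b\<close> cover all pairs of an over end and an
  under end, hence both smoothings. The other two ends leave in the opposite directions, as
  \<open>half_disc_connector\<close> demands.\<close>

lemma crossing_connector:
  assumes x: "x \<in> set (crossings D)" and U: "open U" "x \<in> U"
  obtains Q where "connected Q" "Q \<subseteq> U" "Q \<inter> open_arc (fst (over_ray x a)) \<noteq> {}" "Q \<inter> open_arc (fst (under_ray x b)) \<noteq> {}"
    "\<And>g. g \<in> edges D \<Longrightarrow> g \<noteq> fst (over_ray x a) \<Longrightarrow> g \<noteq> fst (under_ray x b) \<Longrightarrow> Q \<inter> path_image g = {}"
proof -
  obtain v w where vw: "Im (cnj v * w) \<noteq> 0"
    "\<And>b. \<exists>c. (if b then c < 0 else c > 0) \<and> (ray (over_ray x b) has_vector_derivative c *\<^sub>R v) (at 0)"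
    "\<And>b. \<exists>c. (if b then c < 0 else c > 0) \<and> (ray (under_ray x b) has_vector_derivative c *\<^sub>R w) (at 0)"
    using crossing_directions[OF x] by blast
  obtain c1 c3 where c13: "c1 * c3 < 0" "(ray (over_ray x a) has_vector_derivative c1 *\<^sub>R v) (at 0)"
    "(ray (over_ray x (\<not> a)) has_vector_derivative c3 *\<^sub>R v) (at 0)"
    using vw(2)[of a] vw(2)[of "\<not> a"] by (cases a) (auto intro: mult_neg_pos mult_pos_neg)
  obtain c2 c4 where c24: "c2 * c4 < 0" "(ray (under_ray x b) has_vector_derivative c2 *\<^sub>R w) (at 0)"
    "(ray (under_ray x (\<not> b)) has_vector_derivative c4 *\<^sub>R w) (at 0)"
    using vw(3)[of b] vw(3)[of "\<not> b"] by (cases b) (auto intro: mult_neg_pos mult_pos_neg)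
  define k1 where "k1 = - c3 / c1"
  define k2 where "k2 = - c4 / c2"
  have nz: "c1 \<noteq> 0" "c2 \<noteq> 0" using c13 c24 by auto
  have k: "k1 > 0" "k2 > 0" using c13(1) c24(1) nz
    by (auto simp: k1_def k2_def mult_less_0_iff divide_less_0_iff)
  have d3: "(ray (over_ray x (\<not> a)) has_vector_derivative - (k1 *\<^sub>R (c1 *\<^sub>R v))) (at 0)"
    using c13(3) nz by (simp add: k1_def)
  have d4: "(ray (under_ray x (\<not> b)) has_vector_derivative - (k2 *\<^sub>R (c2 *\<^sub>R w))) (at 0)"
    using c24(3) nz by (simp add: k2_def)
  have indep: "Im (cnj (c1 *\<^sub>R v) * (c2 *\<^sub>R w)) \<noteq> 0"
  proof -
    have "cnj (c1 *\<^sub>R v) * (c2 *\<^sub>R w) = of_real (c1 * c2) * (cnj v * w)"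
      by (simp add: scaleR_conv_of_real mult_ac)
    then have "Im (cnj (c1 *\<^sub>R v) * (c2 *\<^sub>R w)) = c1 * c2 * Im (cnj v * w)"
      by (metis Im_complex_of_real Re_complex_of_real add.right_neutral mult.commute mult_zero_left times_complex.simps(2))
    then show ?thesis using nz vw(1) by simp
  qed
  let ?G = "edges D - {fst (over_ray x a), fst (over_ray x (\<not> a)), fst (under_ray x b), fst (under_ray x (\<not> b))}"
  let ?F = "\<Union> (path_image ` ?G)"
  have closedF: "closed ?F"
    using finite_edges arc_edge by (intro closed_Union) (auto intro: closed_arc_image)
  have "x \<notin> ?F"
  proof
    assume "x \<in> ?F"
    then obtain g where g: "g \<in> ?G" "x \<in> path_image g" by blast
    then obtain c where "end_pt (g, c) = x"
      using vertex_on_edge[of "over_ray x a" g] rays_at_crossing[OF x] by auto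
    then have "(g, c) \<in> {(over_in D x, True), (under_in D x, True), (over_out D x, False), (under_out D x, False)}"
      using crossing_ends[OF x] g(1) by blast
    then show False using g(1) by (cases a; cases b) (auto simp: over_ray_def under_ray_def)
  qed
  note rs = ray_simps[OF rays_at_crossing(1)[OF x]] ray_simps[OF rays_at_crossing(2)[OF x]]
  obtain Q where Q: "connected Q" "Q \<subseteq> U" "Q \<inter> open_arc (ray (over_ray x a)) \<noteq> {}" "Q \<inter> open_arc (ray (under_ray x b)) \<noteq> {}"
    "Q \<inter> path_image (ray (over_ray x (\<not> a))) = {}" "Q \<inter> path_image (ray (under_ray x (\<not> b))) = {}" "Q \<inter> ?F = {}"
    by (rule half_disc_connector[OF _ _ _ _ _ _ _ _ c13(2) c24(2) d3 d4 k indep U closedF \<open>x \<notin> ?F\<close>])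
      (auto simp: rs rays_at_crossing[OF x])
  show ?thesis
  proof (rule that[OF Q(1,2)])
    show "Q \<inter> open_arc (fst (over_ray x a)) \<noteq> {}" "Q \<inter> open_arc (fst (under_ray x b)) \<noteq> {}"
      using Q(3,4) unfolding rs by auto
    fix g assume g: "g \<in> edges D" "g \<noteq> fst (over_ray x a)" "g \<noteq> fst (under_ray x b)"
    then consider "g \<in> ?G" | "g = fst (over_ray x (\<not> a))" | "g = fst (under_ray x (\<not> b))" by blast
    then show "Q \<inter> path_image g = {}"
    proof cases
      case 1 then show ?thesis using Q(7) by blast
    next
      case 2 then show ?thesis using Q(5) by (simp only: rs)
    next
      case 3 then show ?thesis using Q(6) by (simp only: rs)
    qed
  qed
qed

text \<open>No third edge is present here, so short initial pieces of the two edges, including the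
  vertex itself, will do.\<close>

lemma bivalent_connector:
  assumes v: "v \<notin> set (crossings D)" and m: "(d, d') \<in> mates_at D \<alpha> v" and U: "open U" "v \<in> U"
  obtains Q where "connected Q" "Q \<subseteq> U" "Q \<inter> open_arc (fst d) \<noteq> {}" "Q \<inter> open_arc (fst d') \<noteq> {}"
    "\<And>g. g \<in> edges D \<Longrightarrow> g \<noteq> fst d \<Longrightarrow> g \<noteq> fst d' \<Longrightarrow> Q \<inter> path_image g = {}"
proof -
  note md = mates_atD[OF m]
  note rs = ray_simps[OF md(1)] and rs' = ray_simps[OF md(2)]
  have "path (ray d)" "path (ray d')" using rs(3) rs'(3) by (auto simp: arc_def)
  then obtain \<delta> \<delta>' where \<delta>: "0 < \<delta>" "\<delta> < 1" "ray d ` {0..\<delta>} \<subseteq> U" "0 < \<delta>'" "\<delta>' < 1" "ray d' ` {0..\<delta>'} \<subseteq> U"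
    using open_arc_near_start[of "ray d" U] open_arc_near_start[of "ray d'" U] U md rs(4) rs'(4) by metis
  let ?Q = "ray d ` {0..\<delta>} \<union> ray d' ` {0..\<delta>'}"
  have c: "connected (ray d ` {0..\<delta>})" "connected (ray d' ` {0..\<delta>'})"
    using \<open>path (ray d)\<close> \<open>path (ray d')\<close> \<delta>
    by (auto intro!: connected_continuous_image simp: path_def elim: continuous_on_subset)
  have "v \<in> ray d ` {0..\<delta>}" "v \<in> ray d' ` {0..\<delta>'}" using rs(4) rs'(4) md \<delta> by force+
  then have conn: "connected ?Q" using c by (intro connected_Un) auto
  have sub: "?Q \<subseteq> insert v (open_arc (fst d) \<union> open_arc (fst d'))"
  proof -
    have "ray d t \<in> insert v (ray d ` {0<..<1})" if "t \<in> {0..\<delta>}" for t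
      using that \<delta> rs(4) md by (cases "t = 0") auto
    moreover have "ray d' t \<in> insert v (ray d' ` {0<..<1})" if "t \<in> {0..\<delta>'}" for t
      using that \<delta> rs'(4) md by (cases "t = 0") auto
    ultimately show ?thesis unfolding rs(5)[symmetric] rs'(5)[symmetric] by blast
  qed
  show ?thesis
  proof (rule that[OF conn])
    show "?Q \<subseteq> U" using \<delta> by blast
    have "ray d \<delta> \<in> ?Q" "ray d \<delta> \<in> open_arc (fst d)" unfolding rs(5)[symmetric] using \<delta> by auto
    then show "?Q \<inter> open_arc (fst d) \<noteq> {}" by blast
    have "ray d' \<delta>' \<in> ?Q" "ray d' \<delta>' \<in> open_arc (fst d')" unfolding rs'(5)[symmetric] using \<delta> by auto
    then show "?Q \<inter> open_arc (fst d') \<noteq> {}" by blast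
    fix g assume g: "g \<in> edges D" "g \<noteq> fst d" "g \<noteq> fst d'"
    have "v \<notin> path_image g"
    proof
      assume "v \<in> path_image g"
      then obtain b where b: "end_pt (g, b) = v" using vertex_on_edge[OF md(1) g(1)] md by auto
      then obtain d'' where d'': "((g, b), d'') \<in> mates_at D \<alpha> v" using mates_at_total[OF g(1)] by blast
      obtain e f where ef: "{d, d'} = {(e, True), (f, False)}" "e \<in> edges D" "f \<in> edges D" "pathfinish e = v" "pathstart f = v"
        using m v by (auto simp: mates_at_def Let_def)
      have "v \<in> vertices D" using vertex_end_pt[OF md(1)] md by simp
      then have "if b then g = e else g = f"
        using bivalent_unique[OF _ v] b g(1) ef by (cases b) (auto simp: end_pt_def)
      then show False using g ef(1) by (cases b) (auto simp: doubleton_eq_iff)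
    qed
    then show "?Q \<inter> path_image g = {}"
      using sub open_arc_disjoint[OF md(1) g(1)] open_arc_disjoint[OF md(2) g(1)] g by blast
  qed
qed

lemma mates_connector:
  assumes m: "(d, d') \<in> mates_at D \<alpha> v" and U: "open U" "v \<in> U"
  obtains Q where "connected Q" "Q \<subseteq> U" "Q \<inter> open_arc (fst d) \<noteq> {}" "Q \<inter> open_arc (fst d') \<noteq> {}"
    "\<And>g. g \<in> edges D \<Longrightarrow> g \<noteq> fst d \<Longrightarrow> g \<noteq> fst d' \<Longrightarrow> Q \<inter> path_image g = {}"
proof (cases "v \<in> set (crossings D)")
  case True
  have "\<exists>a b. (d, d') = (over_ray v a, under_ray v b) \<or> (d', d) = (over_ray v a, under_ray v b)"
  proof (cases "consistent D \<alpha> v")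
    case c: True
    then have "(d, d') = (over_ray v True, under_ray v False) \<or> (d, d') = (over_ray v False, under_ray v True) \<or>
       (d', d) = (over_ray v True, under_ray v False) \<or> (d', d) = (over_ray v False, under_ray v True)"
      using m True by (auto simp: mates_at_def Let_def over_ray_def under_ray_def)
    then show ?thesis by blast
  next
    case c: False
    then have "(d, d') = (over_ray v True, under_ray v True) \<or> (d, d') = (over_ray v False, under_ray v False) \<or>
       (d', d) = (over_ray v True, under_ray v True) \<or> (d', d) = (over_ray v False, under_ray v False)"
      using m True by (auto simp: mates_at_def Let_def over_ray_def under_ray_def)
    then show ?thesis by blast
  qed
  then obtain a b where ab: "(d, d') = (over_ray v a, under_ray v b) \<or> (d', d) = (over_ray v a, under_ray v b)" by blast
  obtain Q where "connected Q" "Q \<subseteq> U" "Q \<inter> open_arc (fst (over_ray v a)) \<noteq> {}" "Q \<inter> open_arc (fst (under_ray v b)) \<noteq> {}"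
    "\<And>g. g \<in> edges D \<Longrightarrow> g \<noteq> fst (over_ray v a) \<Longrightarrow> g \<noteq> fst (under_ray v b) \<Longrightarrow> Q \<inter> path_image g = {}"
    using crossing_connector[OF True U, of a b] by metis
  then show ?thesis using that[of Q] ab by (elim disjE) simp_all
next
  case False
  show ?thesis using bivalent_connector[OF False m U] that by metis
qed

end

section \<open>Surgeries on systems of circles\<close>

definition num_minus :: "('c \<Rightarrow> vgen) \<Rightarrow> 'c set \<Rightarrow> nat" where
  "num_minus s I = card {Z \<in> I. s Z = vminus}"

definition num_plus :: "('c \<Rightarrow> vgen) \<Rightarrow> 'c set \<Rightarrow> nat" where
  "num_plus s I = card {Z \<in> I. s Z = vplus}"

text \<open>Symmetric in \<open>A\<close> and \<open>B\<close>, so that merging and splitting are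
  treated together: as both differences are nonempty, three changed circles means two to one or one
  to two. The equality of unions serves to see that two steps without a common intermediate circle
  do not interact at all.\<close>

definition surgery_step :: "complex \<Rightarrow> complex set set \<Rightarrow> complex set set \<Rightarrow> bool" where
  "surgery_step x A B \<longleftrightarrow>
     finite A \<and> finite B \<and> A - B = {Z \<in> A. x \<in> Z} \<and> B - A = {Z \<in> B. x \<in> Z} \<and>
     \<Union> (A - B) = \<Union> (B - A) \<and> card (A - B) + card (B - A) = 3 \<and> A - B \<noteq> {} \<and> B - A \<noteq> {}"

lemma vgen_cases: "v \<noteq> vminus \<longleftrightarrow> v = vplus" "v \<noteq> vplus \<longleftrightarrow> v = vminus"
  by (cases v; simp)+

lemma UNIV_vgen: "UNIV = {vminus, vplus}"
  by (auto intro: vgen.exhaust)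

lemma num_insert:
  assumes "finite I" "Z \<notin> I"
  shows "num_minus s (insert Z I) = num_minus s I + (if s Z = vminus then 1 else 0)"
    and "num_plus s (insert Z I) = num_plus s I + (if s Z = vplus then 1 else 0)"
proof -
  have "{Y \<in> insert Z I. s Y = v} = (if s Z = v then insert Z {Y \<in> I. s Y = v} else {Y \<in> I. s Y = v})" for v
    by auto
  then show "num_minus s (insert Z I) = num_minus s I + (if s Z = vminus then 1 else 0)"
    and "num_plus s (insert Z I) = num_plus s I + (if s Z = vplus then 1 else 0)"
    using assms by (auto simp: num_minus_def num_plus_def)
qed

lemma num_empty [simp]: "num_minus s {} = 0" "num_plus s {} = 0"
  by (simp_all add: num_minus_def num_plus_def)

lemma num_Un:
  assumes "finite I" "finite I'" "I \<inter> I' = {}"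
  shows "num_minus s (I \<union> I') = num_minus s I + num_minus s I'"
    and "num_plus s (I \<union> I') = num_plus s I + num_plus s I'"
proof -
  have "{Z \<in> I \<union> I'. s Z = v} = {Z \<in> I. s Z = v} \<union> {Z \<in> I'. s Z = v}" for v by auto
  then show "num_minus s (I \<union> I') = num_minus s I + num_minus s I'"
    and "num_plus s (I \<union> I') = num_plus s I + num_plus s I'"
    using assms unfolding num_minus_def num_plus_def by (auto intro!: card_Un_disjoint)
qed

lemma num_cong:
  assumes "\<And>Z. Z \<in> I \<Longrightarrow> s Z = t Z"
  shows "num_minus s I = num_minus t I" "num_plus s I = num_plus t I"
  using assms unfolding num_minus_def num_plus_def by (auto intro!: arg_cong[where f=card])

lemma sum_vdegree:
  assumes "finite I"
  shows "(\<Sum>Z\<in>I. vdegree (s Z)) = int (card I) - 2 * int (num_minus s I)"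
    and "(\<Sum>Z\<in>I. vdegree (s Z)) = 2 * int (num_plus s I) - int (card I)"
  using assms by (induction I) (auto simp: num_insert vgen_cases)

text \<open>
  The linear map of a connected genus 0 cobordism has entry 1 or 0 according to whether the number of
  incoming \<open>v\<^sub>-\<close> plus the number of outgoing \<open>v\<^sub>+\<close> is 1 or not; \<open>m\<close> and \<open>\<Delta>\<close> are instances of this rule.
\<close>

lemma arrow_coeff_step:
  assumes "surgery_step x A B"
  shows "arrow_coeff A B s t =
    (if (\<forall>Z\<in>A \<inter> B. s Z = t Z) \<and> num_minus s (A - B) + num_plus t (B - A) = 1 then 1 else (0 :: 'k::field))"
proof -
  have fin: "finite (A - B)" "finite (B - A)" and "card (A - B) + card (B - A) = 3"
    and "card (A - B) \<noteq> 0" "card (B - A) \<noteq> 0"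
    using assms by (auto simp: surgery_step_def)
  then consider "card (A - B) = 2" "card (B - A) = 1" | "card (A - B) = 1" "card (B - A) = 2"
    by linarith
  then have "((\<exists>X Y Z. X \<noteq> Y \<and> A - B = {X, Y} \<and> B - A = {Z} \<and> mult_term (s X) (s Y) (t Z)) \<or>
      (\<exists>X Y Z. X \<noteq> Y \<and> A - B = {Z} \<and> B - A = {X, Y} \<and> comult_term (s Z) (t X) (t Y))) \<longleftrightarrow>
      num_minus s (A - B) + num_plus t (B - A) = 1"
  proof cases
    case 1
    obtain X Y Z where XYZ: "A - B = {X, Y}" "X \<noteq> Y" "B - A = {Z}"
      using 1 by (metis card_1_singletonE card_2_iff)
    have "mult_term (s X) (s Y) (t Z) \<longleftrightarrow> num_minus s (A - B) + num_plus t (B - A) = 1"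
      using XYZ by (cases "s X"; cases "s Y"; cases "t Z") (simp_all add: num_insert mult_term_def)
    moreover have "mult_term (s X) (s Y) (t Z) \<longleftrightarrow> mult_term (s Y) (s X) (t Z)"
      by (auto simp: mult_term_def)
    moreover have "A - B \<noteq> {Z}" for Z using 1 by auto
    ultimately show ?thesis using XYZ(2) unfolding XYZ(1,3) doubleton_eq_iff singleton_inject by auto
  next
    case 2
    obtain X Y Z where XYZ: "B - A = {X, Y}" "X \<noteq> Y" "A - B = {Z}"
      using 2 by (metis card_1_singletonE card_2_iff)
    have "comult_term (s Z) (t X) (t Y) \<longleftrightarrow> num_minus s (A - B) + num_plus t (B - A) = 1"
      using XYZ by (cases "s Z"; cases "t X"; cases "t Y") (simp_all add: num_insert comult_term_def)
    moreover have "comult_term (s Z) (t X) (t Y) \<longleftrightarrow> comult_term (s Z) (t Y) (t X)"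
      by (auto simp: comult_term_def)
    moreover have "B - A \<noteq> {Z}" for Z using 2 by auto
    ultimately show ?thesis using XYZ(2) unfolding XYZ(1,3) doubleton_eq_iff singleton_inject by auto
  qed
  then show ?thesis unfolding arrow_coeff_def by simp
qed

lemma sum_vgen_insert:
  fixes F :: "('c \<Rightarrow> vgen) \<Rightarrow> 'k::comm_monoid_add"
  assumes "finite J" "Z \<notin> J"
  shows "(\<Sum>j\<in>insert Z J \<rightarrow>\<^sub>E UNIV. F j) = (\<Sum>j\<in>J \<rightarrow>\<^sub>E UNIV. F (j(Z := vminus)) + F (j(Z := vplus)))"
proof -
  have inj: "inj_on (\<lambda>(y, g). g(Z := y)) (UNIV \<times> (J \<rightarrow>\<^sub>E (UNIV :: vgen set)))"
    using inj_combinator[of Z J "\<lambda>_. UNIV"] assms by simp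
  have "(\<Sum>j\<in>insert Z J \<rightarrow>\<^sub>E UNIV. F j) = (\<Sum>(y, g)\<in>UNIV \<times> (J \<rightarrow>\<^sub>E UNIV). F (g(Z := y)))"
    unfolding PiE_insert_eq using inj by (simp add: sum.reindex case_prod_unfold)
  also have "\<dots> = (\<Sum>y\<in>UNIV. \<Sum>g\<in>J \<rightarrow>\<^sub>E UNIV. F (g(Z := y)))"
    by (simp add: sum.cartesian_product)
  finally show ?thesis by (simp add: UNIV_vgen sum.distrib)
qed

text \<open>Only the labels on \<open>J\<close> remain free. This will be applied to the circles
  that exist only between two arrows, all other labels being prescribed by the source or the
  target.\<close>

lemma sum_vgen_restricted:
  fixes F :: "('c \<Rightarrow> vgen) \<Rightarrow> 'k::comm_monoid_add"
  assumes B: "finite B" "J \<subseteq> B" and F: "\<And>t Z. F t \<noteq> 0 \<Longrightarrow> Z \<in> B - J \<Longrightarrow> t Z = t0 Z"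
  shows "(\<Sum>t\<in>B \<rightarrow>\<^sub>E UNIV. F t) = (\<Sum>j\<in>J \<rightarrow>\<^sub>E UNIV. F (\<lambda>Z\<in>B. if Z \<in> J then j Z else t0 Z))"
proof -
  let ?e = "\<lambda>j. \<lambda>Z\<in>B. if Z \<in> J then j Z else t0 Z"
  have inj: "inj_on ?e (J \<rightarrow>\<^sub>E UNIV)"
  proof (rule inj_onI)
    fix j j' assume j: "j \<in> J \<rightarrow>\<^sub>E UNIV" "j' \<in> J \<rightarrow>\<^sub>E UNIV" "?e j = ?e j'"
    have "j Z = j' Z" if "Z \<in> J" for Z using fun_cong[OF j(3), of Z] that B(2) by auto
    then show "j = j'" using j(1,2) by (metis PiE_ext)
  qed
  have "(\<Sum>t\<in>B \<rightarrow>\<^sub>E UNIV. F t) = (\<Sum>t\<in>?e ` (J \<rightarrow>\<^sub>E UNIV). F t)"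
  proof (rule sum.mono_neutral_right)
    show "finite (B \<rightarrow>\<^sub>E (UNIV :: vgen set))" using B by (intro finite_PiE) (auto simp: UNIV_vgen)
    show "\<forall>t\<in>(B \<rightarrow>\<^sub>E UNIV) - ?e ` (J \<rightarrow>\<^sub>E UNIV). F t = 0"
    proof (rule ballI, rule ccontr)
      fix t assume t: "t \<in> (B \<rightarrow>\<^sub>E UNIV) - ?e ` (J \<rightarrow>\<^sub>E UNIV)" "F t \<noteq> 0"
      have "t = ?e (restrict t J)"
      proof (rule PiE_ext)
        show "t \<in> B \<rightarrow>\<^sub>E UNIV" using t by simp
        show "?e (restrict t J) \<in> B \<rightarrow>\<^sub>E UNIV" by simp
        show "t Z = ?e (restrict t J) Z" if "Z \<in> B" for Z using F[OF t(2), of Z] that by auto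
      qed
      moreover have "restrict t J \<in> J \<rightarrow>\<^sub>E UNIV" by simp
      ultimately show False using t(1) by blast
    qed
  qed auto
  then show ?thesis using inj by (simp add: sum.reindex)
qed

text \<open>The two saddles form a cobordism whose shape is given by the number of intermediate
  circles touched by both, the set \<open>J\<close>. With none there are two separate genus 0
  pieces. With one there is a connected genus 0 piece with four boundary circles, which again obeys
  the rule \<open>N + P = 1\<close>. With two there is a piece of genus 1, where \<open>m\<close>
  after \<open>\<Delta>\<close> sends \<open>v\<^sub>+\<close> to \<open>2 v\<^sub>-\<close> and
  \<open>v\<^sub>-\<close> to 0. The second claim shows that \<open>card J\<close> is determined by
  the circles before and after.\<close>

lemma surgery_step_composite:
  fixes s u :: "complex set \<Rightarrow> vgen"
  assumes AB: "surgery_step x A B" and BC: "surgery_step y B C"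
  defines "J \<equiv> {Z \<in> B. x \<in> Z \<and> y \<in> Z}"
    and "N \<equiv> num_minus s {Z \<in> A. x \<in> Z \<or> y \<in> Z}" and "P \<equiv> num_plus u {Z \<in> C. x \<in> Z \<or> y \<in> Z}"
  shows "(\<Sum>t\<in>B \<rightarrow>\<^sub>E UNIV. arrow_coeff A B s t * arrow_coeff B C t u) =
    (if \<forall>Z\<in>A. x \<notin> Z \<longrightarrow> y \<notin> Z \<longrightarrow> s Z = u Z then
       if card J = 0 then
         if num_minus s {Z \<in> A. x \<in> Z} + num_plus u {Z \<in> C. x \<in> Z} = 1 \<and>
            num_minus s {Z \<in> A. y \<in> Z} + num_plus u {Z \<in> C. y \<in> Z} = 1 then 1 else 0
       else if card J = 1 then if N + P = 1 then 1 else 0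
       else if N + P = 0 then 2 else 0
     else (0 :: 'k::field))"
    and "card {Z \<in> A. x \<in> Z \<or> y \<in> Z} + card {Z \<in> C. x \<in> Z \<or> y \<in> Z} + 2 * card J = 6"
proof -
  have fin: "finite A" "finite B" "finite C" using AB BC by (auto simp: surgery_step_def)
  have D: "A - B = {Z \<in> A. x \<in> Z}" "B - A = {Z \<in> B. x \<in> Z}" "B - C = {Z \<in> B. y \<in> Z}" "C - B = {Z \<in> C. y \<in> Z}"
    using AB BC by (auto simp: surgery_step_def)
  have AB': "Z \<in> A \<longleftrightarrow> Z \<in> B" if "x \<notin> Z" for Z using D(1,2) that by blast
  have BC': "Z \<in> B \<longleftrightarrow> Z \<in> C" if "y \<notin> Z" for Z using D(3,4) that by blast
  have nB: "Z \<notin> B" if "Z \<in> A" "x \<in> Z" for Z using D(1) that by blast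
  have nA: "Z \<notin> A" if "Z \<in> B" "x \<in> Z" for Z using D(2) that by blast
  have nC: "Z \<notin> C" if "Z \<in> B" "y \<in> Z" for Z using D(3) that by blast
  have finJ: "finite J" using fin by (simp add: J_def)
  have Bx: "{Z \<in> B. x \<in> Z} = J \<union> {Z \<in> C. x \<in> Z \<and> y \<notin> Z}" using BC' by (auto simp: J_def)
  have By: "{Z \<in> B. y \<in> Z} = J \<union> {Z \<in> A. y \<in> Z \<and> x \<notin> Z}" using AB' by (auto simp: J_def)
  have disj: "J \<inter> {Z \<in> C. x \<in> Z \<and> y \<notin> Z} = {}" "J \<inter> {Z \<in> A. y \<in> Z \<and> x \<notin> Z} = {}"
    by (auto simp: J_def)
  have At: "{Z \<in> A. x \<in> Z \<or> y \<in> Z} = {Z \<in> A. x \<in> Z} \<union> {Z \<in> A. y \<in> Z \<and> x \<notin> Z}"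
    and Ct: "{Z \<in> C. x \<in> Z \<or> y \<in> Z} = {Z \<in> C. y \<in> Z} \<union> {Z \<in> C. x \<in> Z \<and> y \<notin> Z}" by auto
  have cAt: "card {Z \<in> A. x \<in> Z \<or> y \<in> Z} = card {Z \<in> A. x \<in> Z} + card {Z \<in> A. y \<in> Z \<and> x \<notin> Z}"
    unfolding At using fin by (intro card_Un_disjoint) auto
  have cCt: "card {Z \<in> C. x \<in> Z \<or> y \<in> Z} = card {Z \<in> C. y \<in> Z} + card {Z \<in> C. x \<in> Z \<and> y \<notin> Z}"
    unfolding Ct using fin by (intro card_Un_disjoint) auto
  have c1: "card {Z \<in> A. x \<in> Z} + card {Z \<in> B. x \<in> Z} = 3" "card {Z \<in> B. y \<in> Z} + card {Z \<in> C. y \<in> Z} = 3"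
      "card {Z \<in> A. x \<in> Z} \<noteq> 0" "card {Z \<in> C. y \<in> Z} \<noteq> 0"
    using AB BC unfolding surgery_step_def by (metis card_eq_0_iff fin finite_Diff)+
  have cBx: "card {Z \<in> B. x \<in> Z} = card J + card {Z \<in> C. x \<in> Z \<and> y \<notin> Z}"
    unfolding Bx using fin finJ disj by (intro card_Un_disjoint) auto
  have cBy: "card {Z \<in> B. y \<in> Z} = card J + card {Z \<in> A. y \<in> Z \<and> x \<notin> Z}"
    unfolding By using fin finJ disj by (intro card_Un_disjoint) auto
  show "card {Z \<in> A. x \<in> Z \<or> y \<in> Z} + card {Z \<in> C. x \<in> Z \<or> y \<in> Z} + 2 * card J = 6"
    using cAt cCt c1 cBx cBy by linarith
  have cJ: "card J \<le> 2" using c1 cBx by linarith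
  \<comment> \<open>The contributions of the circles outside \<open>J\<close> to the counts at the
    first and at the second arrow; \<open>num_plus j J\<close> and \<open>num_minus j J\<close>
    complete them.\<close>
  define a where "a = num_minus s {Z \<in> A. x \<in> Z} + num_plus u {Z \<in> C. x \<in> Z \<and> y \<notin> Z}"
  define b where "b = num_minus s {Z \<in> A. y \<in> Z \<and> x \<notin> Z} + num_plus u {Z \<in> C. y \<in> Z}"
  have NP: "N + P = a + b"
    unfolding N_def P_def a_def b_def At Ct using fin by (subst num_Un; (subst num_Un)?; auto)
  define t0 where "t0 = (\<lambda>Z. if Z \<in> A then s Z else u Z)"
  define F :: "(complex set \<Rightarrow> vgen) \<Rightarrow> 'k" where "F = (\<lambda>t. arrow_coeff A B s t * arrow_coeff B C t u)"
  define E where "E \<longleftrightarrow> (\<forall>Z\<in>A. x \<notin> Z \<longrightarrow> y \<notin> Z \<longrightarrow> s Z = u Z)"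
  have F_eq: "F t = (if (\<forall>Z\<in>A \<inter> B. s Z = t Z) \<and> (\<forall>Z\<in>B \<inter> C. t Z = u Z) \<and>
      num_minus s (A - B) + num_plus t (B - A) = 1 \<and> num_minus t (B - C) + num_plus u (C - B) = 1 then 1 else 0)" for t
    unfolding F_def arrow_coeff_step[OF AB] arrow_coeff_step[OF BC] by simp
  have F0: "t Z = t0 Z" if "F t \<noteq> 0" "Z \<in> B - J" for t Z
  proof (cases "x \<in> Z")
    case True
    then have "Z \<in> B \<inter> C" "Z \<notin> A" using that nA BC' by (auto simp: J_def)
    then show ?thesis using that by (auto simp: F_eq t0_def split: if_splits)
  next
    case False
    then have "Z \<in> A \<inter> B" using that AB' by auto
    then show ?thesis using that by (auto simp: F_eq t0_def split: if_splits)
  qed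
  have Fj: "F (\<lambda>Z\<in>B. if Z \<in> J then j Z else t0 Z) =
     (if E \<and> a + num_plus j J = 1 \<and> b + num_minus j J = 1 then 1 else 0)" for j
  proof -
    let ?t = "\<lambda>Z\<in>B. if Z \<in> J then j Z else t0 Z"
    have "num_plus ?t (B - A) = num_plus ?t J + num_plus ?t {Z \<in> C. x \<in> Z \<and> y \<notin> Z}"
      unfolding D Bx using fin finJ disj by (intro num_Un) auto
    also have "num_plus ?t J = num_plus j J" by (rule num_cong) (auto simp: J_def)
    also have "num_plus ?t {Z \<in> C. x \<in> Z \<and> y \<notin> Z} = num_plus u {Z \<in> C. x \<in> Z \<and> y \<notin> Z}"
      using BC' nA by (intro num_cong) (auto simp: J_def t0_def)
    finally have 1: "num_minus s (A - B) + num_plus ?t (B - A) = a + num_plus j J"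
      unfolding a_def D by (simp only: ac_simps)
    have "num_minus ?t (B - C) = num_minus ?t J + num_minus ?t {Z \<in> A. y \<in> Z \<and> x \<notin> Z}"
      unfolding D By using fin finJ disj by (intro num_Un) auto
    also have "num_minus ?t J = num_minus j J" by (rule num_cong) (auto simp: J_def)
    also have "num_minus ?t {Z \<in> A. y \<in> Z \<and> x \<notin> Z} = num_minus s {Z \<in> A. y \<in> Z \<and> x \<notin> Z}"
      using AB' by (intro num_cong) (auto simp: J_def t0_def)
    finally have 2: "num_minus ?t (B - C) + num_plus u (C - B) = b + num_minus j J"
      unfolding b_def D by (simp only: ac_simps)
    have 3: "(\<forall>Z\<in>A \<inter> B. s Z = ?t Z) \<and> (\<forall>Z\<in>B \<inter> C. ?t Z = u Z) \<longleftrightarrow> E"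
    proof
      assume "(\<forall>Z\<in>A \<inter> B. s Z = ?t Z) \<and> (\<forall>Z\<in>B \<inter> C. ?t Z = u Z)"
      then show E unfolding E_def using AB' BC' by (metis IntI)
    next
      assume E
      have "s Z = ?t Z" if "Z \<in> A \<inter> B" for Z using that nA by (auto simp: t0_def J_def)
      moreover have "?t Z = u Z" if "Z \<in> B \<inter> C" for Z
        using that nC nA \<open>E\<close> by (auto simp: t0_def J_def E_def)
      ultimately show "(\<forall>Z\<in>A \<inter> B. s Z = ?t Z) \<and> (\<forall>Z\<in>B \<inter> C. ?t Z = u Z)" by blast
    qed
    show ?thesis unfolding F_eq 1 2 using 3 by auto
  qed
  have sum: "(\<Sum>t\<in>B \<rightarrow>\<^sub>E UNIV. F t) =
      (\<Sum>j\<in>J \<rightarrow>\<^sub>E UNIV. if E \<and> a + num_plus j J = 1 \<and> b + num_minus j J = 1 then 1 else 0)"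
    unfolding Fj[symmetric] by (rule sum_vgen_restricted) (use fin F0 in \<open>auto simp: J_def\<close>)
  consider "card J = 0" | "card J = 1" | "card J = 2" using cJ by linarith
  then have sumE: "(\<Sum>t\<in>B \<rightarrow>\<^sub>E UNIV. F t) = (if E then
       if card J = 0 then if a = 1 \<and> b = 1 then 1 else 0
       else if card J = 1 then if N + P = 1 then 1 else 0
       else if N + P = 0 then 2 else 0
     else 0)"
  proof cases
    case 1
    then have "J = {}" using finJ by simp
    then show ?thesis unfolding sum by simp
  next
    case 2
    then obtain Z where "J = {Z}" by (metis card_1_singletonE)
    then show ?thesis unfolding sum NP by (auto simp: sum_vgen_insert num_insert)
  next
    case 3
    then obtain Z Z' where "J = {Z, Z'}" "Z \<noteq> Z'" by (metis card_2_iff)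
    then show ?thesis unfolding sum NP by (auto simp: sum_vgen_insert num_insert)
  qed
  \<comment> \<open>If no intermediate circle is touched by both steps, then neither is a first or a
    last one: the changed circles cover the same points before and after each step.\<close>
  have ab: "a = num_minus s {Z \<in> A. x \<in> Z} + num_plus u {Z \<in> C. x \<in> Z}"
      "b = num_minus s {Z \<in> A. y \<in> Z} + num_plus u {Z \<in> C. y \<in> Z}" if "card J = 0"
  proof -
    have J: "J = {}" using that finJ by simp
    have U: "\<Union> (A - B) = \<Union> (B - A)" "\<Union> (B - C) = \<Union> (C - B)"
      using AB BC unfolding surgery_step_def by blast+
    have "y \<notin> Z" if "Z \<in> C" "x \<in> Z" for Z
    proof
      assume "y \<in> Z"
      then have "x \<in> \<Union> (B - C)" using U(2) that unfolding D by blast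
      then show False using J unfolding J_def D by blast
    qed
    then have "{Z \<in> C. x \<in> Z} = {Z \<in> C. x \<in> Z \<and> y \<notin> Z}" by auto
    moreover have "x \<notin> Z" if "Z \<in> A" "y \<in> Z" for Z
    proof
      assume "x \<in> Z"
      then have "y \<in> \<Union> (B - A)" using U(1) that unfolding D by blast
      then show False using J unfolding J_def D by blast
    qed
    then have "{Z \<in> A. y \<in> Z} = {Z \<in> A. y \<in> Z \<and> x \<notin> Z}" by auto
    ultimately show "a = num_minus s {Z \<in> A. x \<in> Z} + num_plus u {Z \<in> C. x \<in> Z}"
      "b = num_minus s {Z \<in> A. y \<in> Z} + num_plus u {Z \<in> C. y \<in> Z}" by (simp_all add: a_def b_def)
  qed
  show "(\<Sum>t\<in>B \<rightarrow>\<^sub>E UNIV. arrow_coeff A B s t * arrow_coeff B C t u) =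
    (if \<forall>Z\<in>A. x \<notin> Z \<longrightarrow> y \<notin> Z \<longrightarrow> s Z = u Z then
       if card J = 0 then
         if num_minus s {Z \<in> A. x \<in> Z} + num_plus u {Z \<in> C. x \<in> Z} = 1 \<and>
            num_minus s {Z \<in> A. y \<in> Z} + num_plus u {Z \<in> C. y \<in> Z} = 1 then 1 else 0
       else if card J = 1 then if N + P = 1 then 1 else 0
       else if N + P = 0 then 2 else 0
     else (0 :: 'k::field))"
  proof (cases "card J = 0")
    case True
    then show ?thesis using sumE unfolding ab[OF True] by (simp only: F_def E_def if_True)
  next
    case False
    then show ?thesis using sumE by (simp only: F_def E_def if_False)
  qed
qed

text \<open>The composite formula is symmetric in \<open>x\<close> and \<open>y\<close> and sees the
  intermediate circles only through \<open>card J\<close>, which the count of touched circles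
  expresses in terms of \<open>A\<close> and \<open>C\<close>.\<close>

lemma surgery_steps_commute:
  assumes "surgery_step x A B" "surgery_step y B C" "surgery_step y A B'" "surgery_step x B' C"
  shows "(\<Sum>t\<in>B \<rightarrow>\<^sub>E UNIV. arrow_coeff A B s t * arrow_coeff B C t u) =
    (\<Sum>t\<in>B' \<rightarrow>\<^sub>E UNIV. arrow_coeff A B' s t * arrow_coeff B' C t u :: 'k::field)"
proof -
  have swap: "{Z \<in> D. y \<in> Z \<or> x \<in> Z} = {Z \<in> D. x \<in> Z \<or> y \<in> Z}" for D :: "complex set set" by auto
  have "card {Z \<in> B. x \<in> Z \<and> y \<in> Z} = card {Z \<in> B'. y \<in> Z \<and> x \<in> Z}"
    using surgery_step_composite(2)[OF assms(1,2)] surgery_step_composite(2)[OF assms(3,4)]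
    unfolding swap by linarith
  then show ?thesis
    unfolding surgery_step_composite(1)[OF assms(1,2)] surgery_step_composite(1)[OF assms(3,4)] swap
    by (auto simp del: One_nat_def)
qed

text \<open>Three changed circles minus twice the count 1 of the rule. The loss is made up by the
  shift \<open>{r}\<close>, which grows by 1 along an arrow.\<close>

lemma arrow_coeff_degree:
  assumes "surgery_step x A B" "arrow_coeff A B s t \<noteq> (0 :: 'k::field)"
  shows "(\<Sum>Z\<in>B. vdegree (t Z)) + 1 = (\<Sum>Z\<in>A. vdegree (s Z))"
proof -
  have fin: "finite A" "finite B" and c: "card (A - B) + card (B - A) = 3"
    using assms(1) by (auto simp: surgery_step_def)
  have *: "\<forall>Z\<in>A \<inter> B. s Z = t Z" "num_minus s (A - B) + num_plus t (B - A) = 1"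
    using assms(2) unfolding arrow_coeff_step[OF assms(1)] by (auto split: if_splits)
  have "(\<Sum>Z\<in>A \<inter> B. vdegree (s Z)) = (\<Sum>Z\<in>B \<inter> A. vdegree (t Z))"
    using *(1) by (intro sum.cong) auto
  moreover have "(\<Sum>Z\<in>A. vdegree (s Z)) = (\<Sum>Z\<in>A \<inter> B. vdegree (s Z)) + (\<Sum>Z\<in>A - B. vdegree (s Z))"
    "(\<Sum>Z\<in>B. vdegree (t Z)) = (\<Sum>Z\<in>B \<inter> A. vdegree (t Z)) + (\<Sum>Z\<in>B - A. vdegree (t Z))"
    using fin sum.Int_Diff by blast+
  moreover have "(\<Sum>Z\<in>A - B. vdegree (s Z)) = int (card (A - B)) - 2 * int (num_minus s (A - B))"
    "(\<Sum>Z\<in>B - A. vdegree (t Z)) = 2 * int (num_plus t (B - A)) - int (card (B - A))"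
    using sum_vdegree(1)[of "A - B" s] sum_vdegree(2)[of "B - A" t] fin by simp_all
  ultimately show ?thesis using *(2) c by linarith
qed

section \<open>The smoothings at a crossing merge or split circles\<close>

text \<open>Cuts off the part of the edge near its end \<open>d\<close> but keeps the orientation,
  so that the flags of the ends retain their meaning.\<close>

definition trunc :: "real \<Rightarrow> (real \<Rightarrow> complex) \<times> bool \<Rightarrow> real \<Rightarrow> complex" where
  "trunc T d = (if snd d then reversepath (subpath T 1 (ray d)) else subpath T 1 (ray d))"

lemma trunc:
  assumes "path (ray d)" "0 < T" "T < 1"
  shows "path (trunc T d)" "path_image (trunc T d) = ray d ` {T..1}"
    "open_arc (trunc T d) = ray d ` {T<..<1}"
    "end_pt (trunc T d, snd d) = ray d T" "end_pt (trunc T d, \<not> snd d) = ray d 1"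
proof -
  show "path (trunc T d)" "path_image (trunc T d) = ray d ` {T..1}"
    using assms by (auto simp: trunc_def path_image_subpath)
  show "end_pt (trunc T d, snd d) = ray d T" "end_pt (trunc T d, \<not> snd d) = ray d 1"
    by (auto simp: trunc_def end_pt_def)
  have "(\<lambda>t. (1 - T) * t + T) ` {0<..<1} = {T<..<1}"
  proof (intro equalityI subsetI)
    fix u assume "u \<in> {T<..<1}"
    then have "u = (1 - T) * ((u - T) / (1 - T)) + T" "(u - T) / (1 - T) \<in> {0<..<1}"
      using assms by (auto simp: field_simps)
    then show "u \<in> (\<lambda>t. (1 - T) * t + T) ` {0<..<1}" by (rule image_eqI)
  next
    fix u assume "u \<in> (\<lambda>t. (1 - T) * t + T) ` {0<..<1}"
    then obtain t where t: "0 < t" "t < 1" "u = (1 - T) * t + T" by auto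
    have "0 < (1 - T) * t" "0 < (1 - T) * (1 - t)" using t assms by simp_all
    then show "u \<in> {T<..<1}" using t(3) by (simp add: algebra_simps)
  qed
  then have 1: "open_arc (subpath T 1 (ray d)) = ray d ` {T<..<1}"
    unfolding subpath_def by (metis image_image)
  have "(\<lambda>t::real. 1 - t) ` {0<..<1} = {0<..<1}"
  proof (intro equalityI subsetI)
    fix x :: real assume "x \<in> {0<..<1}"
    then have "x = 1 - (1 - x)" "1 - x \<in> {0<..<1}" by auto
    then show "x \<in> (\<lambda>t. 1 - t) ` {0<..<1}" by (rule image_eqI)
  qed auto
  then have "open_arc (reversepath p) = open_arc p" for p :: "real \<Rightarrow> complex"
    unfolding reversepath_def by (metis image_image)
  then show "open_arc (trunc T d) = ray d ` {T<..<1}" using 1 by (simp add: trunc_def)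
qed

context link
begin

text \<open>By counting free ends, the two under ends would be joined to each other as well. A small
  circle around the crossing meets the four edges, cut off at their last exit, in four alternating
  points, and both strands run outside of it. This contradicts
  \<open>strands_do_not_interleave\<close>, applied to the outside of the circle.\<close>

lemma opposite_ends_not_joined:
  assumes x: "x \<in> set (crossings D)"
  shows "over_out D x \<notin> end_matching.strand (mates D \<alpha> (UNIV - {x})) (over_in D x)"
proof
  define M where "M = mates D \<alpha> (UNIV - {x})"
  interpret m: end_matching "edges D" M
    unfolding M_def by (rule end_matching_mates) auto
  let ?oi = "over_in D x" and ?oo = "over_out D x" and ?ui = "under_in D x" and ?uo = "under_out D x"
  note E4 = crossing_edges(1-4)[OF x] and P4 = end_pt_crossing[OF x]
  note ne = in_noteq_out[OF x] crossing_edges(9,10)[OF x]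
  assume "over_out D x \<in> end_matching.strand (mates D \<alpha> (UNIV - {x})) (over_in D x)"
  then have bad: "?oo \<in> m.strand ?oi" by (simp add: M_def)
  have free: "(e, b) \<notin> Domain M \<longleftrightarrow> end_pt (e, b) = x" if "e \<in> edges D" for e b
    unfolding M_def mates_Domain[OF that] by simp
  have in_free: "d \<in> m.free_ends (m.strand e) \<longleftrightarrow> fst d \<in> m.strand e \<and> end_pt d = x" if "e \<in> edges D" for e d
    using free[of "fst d" "snd d"] m.strand_subset[OF that] by (cases d) (auto simp: m.free_ends_def)
  obtain d where d: "d \<noteq> (?oi, True)" "m.free_ends (m.strand ?oi) = {(?oi, True), d}"
    using m.free_ends_pair[OF E4(1), of True] free[OF E4(1)] P4 by metis
  have "(?oo, False) \<in> m.free_ends (m.strand ?oi)" using in_free[OF E4(1)] bad P4 by simp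
  then have d': "m.free_ends (m.strand ?oi) = {(?oi, True), (?oo, False)}" using d by auto
  have "(?ui, True) \<notin> m.free_ends (m.strand ?oi)" "(?uo, False) \<notin> m.free_ends (m.strand ?oi)"
    unfolding d' using ne by auto
  then have no: "?ui \<notin> m.strand ?oi" "?uo \<notin> m.strand ?oi" using in_free[OF E4(1)] P4 by auto
  \<comment> \<open>The strand of \<open>?ui\<close> needs a second free end, and the two over ends
    are already taken by each other.\<close>
  have ui: "?uo \<in> m.strand ?ui"
  proof -
    obtain d where d: "d \<noteq> (?ui, True)" "m.free_ends (m.strand ?ui) = {(?ui, True), d}"
      using m.free_ends_pair[OF E4(2), of True] free[OF E4(2)] P4 by metis
    then have dd: "fst d \<in> m.strand ?ui" "end_pt d = x" using in_free[OF E4(2)] by blast+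
    then have "d \<in> {(?oi, True), (?ui, True), (?oo, False), (?uo, False)}"
      using crossing_ends[OF x, of "fst d" "snd d"] m.strand_subset[OF E4(2)] by auto
    moreover have "d \<noteq> (?oi, True)" using dd(1) m.strand_sym no(1) by (metis fst_conv)
    moreover have "d \<noteq> (?oo, False)"
    proof
      assume "d = (?oo, False)"
      then have "?ui \<in> m.strand ?oo" using dd(1) m.strand_sym by (metis fst_conv)
      then show False using no(1) m.strand_eq[OF bad] by simp
    qed
    ultimately show ?thesis using d dd by auto
  qed
  obtain v w where vw: "Im (cnj v * w) \<noteq> 0"
    "\<And>b. \<exists>c. (if b then c < 0 else c > 0) \<and> (ray (over_ray x b) has_vector_derivative c *\<^sub>R v) (at 0)"
    "\<And>b. \<exists>c. (if b then c < 0 else c > 0) \<and> (ray (under_ray x b) has_vector_derivative c *\<^sub>R w) (at 0)"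
    using crossing_directions[OF x] by blast
  have nz: "v \<noteq> 0" "w \<noteq> 0" using vw(1) by auto
  define dir where "dir = (\<lambda>d. if d = (?oi, True) then - sgn v else if d = (?oo, False) then sgn v
      else if d = (?ui, True) then - sgn w else sgn w)"
  have "Im (cnj (- sgn v) * (- sgn w)) \<noteq> 0"
  proof -
    have "cnj (- sgn v) * (- sgn w) = of_real (inverse (cmod v) * inverse (cmod w)) * (cnj v * w)"
      by (simp add: sgn_div_norm scaleR_conv_of_real)
    then have "Im (cnj (- sgn v) * (- sgn w)) = inverse (cmod v) * inverse (cmod w) * Im (cnj v * w)"
      by (metis Im_complex_of_real Re_complex_of_real add.right_neutral mult.commute mult_zero_left times_complex.simps(2))
    then show ?thesis using nz vw(1) by simp
  qed
  then obtain \<epsilon> where \<epsilon>: "\<epsilon> > 0" "\<And>u1 u2 u3 u4. cmod (u1 - (- sgn v)) < \<epsilon> \<Longrightarrow> cmod (u2 - (- sgn w)) < \<epsilon> \<Longrightarrow>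
    cmod (u3 + (- sgn v)) < \<epsilon> \<Longrightarrow> cmod (u4 + (- sgn w)) < \<epsilon> \<Longrightarrow>
    Im (cnj (u3 - u1) * (u2 - u1)) * Im (cnj (u3 - u1) * (u4 - u1)) < 0"
    using nearby_directions_alternate by metis
  define Ends where "Ends = {(?oi, True), (?ui, True), (?oo, False), (?uo, False)}"
  have Ends_iff: "d \<in> Ends \<longleftrightarrow> fst d \<in> edges D \<and> end_pt d = x" for d
    using crossing_ends[OF x, of "fst d" "snd d"] E4 P4 by (cases d) (auto simp: Ends_def)
  have exit: "\<exists>r0>0. \<forall>r. 0 < r \<longrightarrow> r < r0 \<longrightarrow>
    (\<exists>T. 0 < T \<and> T < 1 \<and> cmod (ray d T - x) = r \<and> (\<forall>t. T < t \<and> t \<le> 1 \<longrightarrow> r < cmod (ray d t - x)) \<and>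
      cmod ((ray d T - x) / of_real r - dir d) < \<epsilon>)" if "d \<in> Ends" for d
  proof -
    have "\<exists>u. u \<noteq> 0 \<and> sgn u = dir d \<and> (ray d has_vector_derivative u) (at 0)"
    proof -
      obtain c1 c2 c3 c4 where c: "c1 < 0" "(ray (?oi, True) has_vector_derivative c1 *\<^sub>R v) (at 0)"
        "c2 < 0" "(ray (?ui, True) has_vector_derivative c2 *\<^sub>R w) (at 0)"
        "c3 > 0" "(ray (?oo, False) has_vector_derivative c3 *\<^sub>R v) (at 0)"
        "c4 > 0" "(ray (?uo, False) has_vector_derivative c4 *\<^sub>R w) (at 0)"
        using vw(2)[of True] vw(2)[of False] vw(3)[of True] vw(3)[of False] by (auto simp: over_ray_def under_ray_def)
      have "sgn (c1 *\<^sub>R v) = dir (?oi, True)" "sgn (c2 *\<^sub>R w) = dir (?ui, True)"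
        "sgn (c3 *\<^sub>R v) = dir (?oo, False)" "sgn (c4 *\<^sub>R w) = dir (?uo, False)"
        using c ne by (auto simp: dir_def sgn_scaleR)
      then show ?thesis using that c nz unfolding Ends_def
        by (auto intro: exI[of _ "c1 *\<^sub>R v"] exI[of _ "c2 *\<^sub>R w"] exI[of _ "c3 *\<^sub>R v"] exI[of _ "c4 *\<^sub>R w"])
    qed
    then obtain u where u: "u \<noteq> 0" "sgn u = dir d" "(ray d has_vector_derivative u) (at 0)" by blast
    have "arc (ray d)" "ray d 0 = x" using ray_simps[of d] that Ends_iff by auto
    then show ?thesis using last_exit[OF _ _ u(3,1) \<epsilon>(1), of x] u(2) by metis
  qed
  let ?G = "edges D - fst ` Ends"
  let ?F = "\<Union> (path_image ` ?G)"
  have "closed ?F" using finite_edges arc_edge by (intro closed_Union) (auto intro: closed_arc_image)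
  moreover have "x \<notin> ?F"
  proof
    assume "x \<in> ?F"
    then obtain g where g: "g \<in> ?G" "x \<in> path_image g" by blast
    then obtain c where "end_pt (g, c) = x" using vertex_on_edge[of "(?oi, True)" g] E4 P4 by auto
    then have "(g, c) \<in> Ends" using g Ends_iff by auto
    then show False using g by force
  qed
  ultimately obtain rF where rF: "rF > 0" "ball x rF \<subseteq> - ?F"
    by (metis ComplI open_Compl open_contains_ball)
  obtain R where R: "\<And>d. d \<in> Ends \<Longrightarrow> R d > 0" "\<And>d r. d \<in> Ends \<Longrightarrow> 0 < r \<Longrightarrow> r < R d \<Longrightarrow>
    \<exists>T. 0 < T \<and> T < 1 \<and> cmod (ray d T - x) = r \<and> (\<forall>t. T < t \<and> t \<le> 1 \<longrightarrow> r < cmod (ray d t - x)) \<and>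
      cmod ((ray d T - x) / of_real r - dir d) < \<epsilon>"
    using exit by metis
  \<comment> \<open>One radius for the last exits of all four edges that also keeps the remaining
    edges outside the disc; halving the minimum makes the inequalities strict.\<close>
  define r where "r = Min (insert rF (R ` Ends)) / 2"
  have finE: "finite Ends" by (simp add: Ends_def)
  have "Min (insert rF (R ` Ends)) > 0" using finE rF R(1) by auto
  then have r: "r > 0" "r < rF" "\<And>d. d \<in> Ends \<Longrightarrow> r < R d"
  proof -
    assume m: "Min (insert rF (R ` Ends)) > 0"
    have "Min (insert rF (R ` Ends)) \<le> rF" "\<And>d. d \<in> Ends \<Longrightarrow> Min (insert rF (R ` Ends)) \<le> R d"
      using finE by (auto intro: Min_le)
    then show "r > 0" "r < rF" "\<And>d. d \<in> Ends \<Longrightarrow> r < R d" using m unfolding r_def by force+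
  qed
  have "\<forall>d\<in>Ends. \<exists>T. 0 < T \<and> T < 1 \<and> cmod (ray d T - x) = r \<and> (\<forall>t. T < t \<and> t \<le> 1 \<longrightarrow> r < cmod (ray d t - x)) \<and>
      cmod ((ray d T - x) / of_real r - dir d) < \<epsilon>"
    using R(2) r by blast
  from bchoice[OF this] obtain T where TT: "\<forall>d\<in>Ends. 0 < T d \<and> T d < 1 \<and> cmod (ray d (T d) - x) = r \<and>
      (\<forall>t. T d < t \<and> t \<le> 1 \<longrightarrow> r < cmod (ray d t - x)) \<and> cmod ((ray d (T d) - x) / of_real r - dir d) < \<epsilon>"
    by blast
  then have T: "0 < T d" "T d < 1" "cmod (ray d (T d) - x) = r"
    "\<And>t. T d < t \<Longrightarrow> t \<le> 1 \<Longrightarrow> r < cmod (ray d t - x)"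
    "cmod ((ray d (T d) - x) / of_real r - dir d) < \<epsilon>" if "d \<in> Ends" for d
    using that by blast+
  \<comment> \<open>An edge has at most one end at \<open>x\<close> (see \<open>other_end\<close>),
    so it is shortened at most once.\<close>
  define A where "A = (\<lambda>e. if (e, True) \<in> Ends then trunc (T (e, True)) (e, True)
    else if (e, False) \<in> Ends then trunc (T (e, False)) (e, False) else e)"
  have other_end: "(fst d, \<not> snd d) \<notin> Ends" if "d \<in> Ends" for d
    using that ne unfolding Ends_def by auto
  have A_Ends: "A (fst d) = trunc (T d) d" if "d \<in> Ends" for d
    using other_end[OF that] that by (cases d; cases "snd d") (auto simp: A_def)
  have A_other: "A e = e" if "e \<notin> fst ` Ends" for e
    using that by (force simp: A_def)
  have ray_Ends: "path (ray d)" "fst d \<in> edges D" if "d \<in> Ends" for d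
    using ray_simps(3)[of d] that Ends_iff by (auto simp: arc_def)
  note tr = trunc[OF ray_Ends(1) T(1,2)]
  let ?C = "circlepath x r"
  have imC: "path_image ?C = sphere x r" using r by simp
  have outC: "outside (path_image ?C) = - cball x r"
  proof -
    have "outside (frontier (cball x r)) = - closure (cball x r)"
      by (rule outside_frontier_eq_complement_closure) (auto simp: convex_cball)
    then show ?thesis using r imC by (simp add: frontier_cball)
  qed
  have far: "path_image e \<inter> cball x r = {}" if "e \<in> edges D" "e \<notin> fst ` Ends" for e
  proof -
    have "path_image e \<subseteq> ?F" using that by blast
    moreover have "cball x r \<subseteq> ball x rF" using r by auto
    ultimately show ?thesis using rF by blast
  qed
  have A_sub: "open_arc (A e) \<subseteq> open_arc e" "path_image (A e) \<subseteq> path_image e" "path (A e)"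
    "open_arc (A e) \<subseteq> - cball x r" "path_image (A e) \<subseteq> - cball x r \<union> sphere x r" if e: "e \<in> edges D" for e
  proof -
    have "open_arc (A e) \<subseteq> open_arc e \<and> path_image (A e) \<subseteq> path_image e \<and> path (A e) \<and>
      open_arc (A e) \<subseteq> - cball x r \<and> path_image (A e) \<subseteq> - cball x r \<union> sphere x r"
    proof (cases "e \<in> fst ` Ends")
      case True
      then obtain d where d: "d \<in> Ends" "e = fst d" by auto
      note rs = ray_simps[OF ray_Ends(2)[OF d(1)]]
      have "ray d ` {T d<..<1} \<subseteq> ray d ` {0<..<1}" "ray d ` {T d..1} \<subseteq> ray d ` {0..1}"
        using T(1)[OF d(1)] by (auto intro!: imageI)
      moreover have "ray d t \<in> - cball x r" if "T d < t" "t \<le> 1" for t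
        using T(4)[OF d(1) that] by (simp add: dist_norm norm_minus_commute)
      moreover have "ray d (T d) \<in> sphere x r"
        using T(3)[OF d(1)] by (simp add: dist_norm norm_minus_commute)
      ultimately have "ray d ` {T d<..<1} \<subseteq> - cball x r" "ray d ` {T d..1} \<subseteq> - cball x r \<union> sphere x r"
        by (auto, metis ComplD Un_iff order_le_less mem_cball mem_sphere)
      then show ?thesis
        unfolding d(2) A_Ends[OF d(1)] tr(2,3)[OF d(1) d(1) d(1)]
        using \<open>ray d ` {T d<..<1} \<subseteq> ray d ` {0<..<1}\<close> \<open>ray d ` {T d..1} \<subseteq> ray d ` {0..1}\<close> rs(1,5) tr(1)[OF d(1) d(1) d(1)]
        by (simp add: path_image_def)
    next
      case False
      then have Ae: "A e = e" by (rule A_other)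
      have "path e" using arc_edge[OF e] by (simp add: arc_def)
      moreover have "open_arc e \<subseteq> path_image e" by (auto simp: path_image_def)
      ultimately show ?thesis unfolding Ae using far[OF e False] by blast
    qed
    then show "open_arc (A e) \<subseteq> open_arc e" "path_image (A e) \<subseteq> path_image e" "path (A e)"
      "open_arc (A e) \<subseteq> - cball x r" "path_image (A e) \<subseteq> - cball x r \<union> sphere x r" by blast+
  qed
  have A_end: "end_pt (A e, b) = end_pt (e, b)" "end_pt (e, b) \<notin> cball x r"
    if e: "e \<in> edges D" "end_pt (e, b) \<noteq> x" for e b
  proof -
    have "end_pt (A e, b) = end_pt (e, b) \<and> end_pt (e, b) \<notin> cball x r"
    proof (cases "e \<in> fst ` Ends")
      case True
      then obtain d where d: "d \<in> Ends" "e = fst d" by auto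
      have "(e, b) \<noteq> d" using e(2) Ends_iff[of d] d(1) by metis
      then have b: "b = (\<not> snd d)" using d(2) by (cases d) auto
      have "end_pt (A e, b) = ray d 1" unfolding d(2) A_Ends[OF d(1)] b by (rule tr(5)[OF d(1) d(1) d(1)])
      moreover have "end_pt (e, b) = ray d 1"
        by (auto simp: d(2) b end_pt_def ray_def reversepath_def pathstart_def pathfinish_def)
      moreover have "ray d 1 \<notin> cball x r"
        using T(4)[OF d(1), of 1] T(2)[OF d(1)] by (simp add: dist_norm norm_minus_commute)
      ultimately show ?thesis by simp
    next
      case False
      have "end_pt (e, b) \<in> path_image e" using end_pt_in_image[of "(e, b)"] by simp
      then show ?thesis using A_other[OF False] far[OF e(1) False] by auto
    qed
    then show "end_pt (A e, b) = end_pt (e, b)" "end_pt (e, b) \<notin> cball x r" by blast+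
  qed
  \<comment> \<open>The connectors have to avoid the disc as well as the pieces that were cut off:
    an intersection with an edge must be one with its remaining part.\<close>
  let ?N = "cball x r \<union> (\<Union>d\<in>Ends. ray d ` {0..T d})"
  have closedN: "closed ?N"
  proof -
    have "compact (ray d ` {0..T d})" if "d \<in> Ends" for d
      using ray_Ends(1)[OF that] T(2)[OF that]
      by (intro compact_continuous_image) (auto simp: path_def elim: continuous_on_subset)
    then show ?thesis using finE by (intro closed_Un closed_UN) (auto intro: compact_imp_closed)
  qed
  have conn: "end_pt (A e, b) = end_pt (A f, c) \<and>
      (\<exists>Q. connected Q \<and> Q \<subseteq> - cball x r \<and> Q \<inter> open_arc (A e) \<noteq> {} \<and> Q \<inter> open_arc (A f) \<noteq> {} \<and>
         (\<forall>g\<in>edges D - {e, f}. Q \<inter> path_image (A g) = {}))" if ef: "((e, b), (f, c)) \<in> M" for e b f c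
  proof -
    let ?v = "end_pt (e, b)"
    have m: "end_pt (e, b) = end_pt (f, c)" "?v \<noteq> x" "((e, b), (f, c)) \<in> mates_at D \<alpha> ?v"
      using mates_end_pt[OF ef[unfolded M_def]] by auto
    note md = mates_atD[OF m(3)]
    have eE: "e \<in> edges D" "f \<in> edges D" using md by auto
    have "?v \<notin> ray d ` {0..T d}" if d: "d \<in> Ends" for d
    proof
      assume "?v \<in> ray d ` {0..T d}"
      then obtain t where t: "0 \<le> t" "t \<le> T d" "?v = ray d t" by auto
      note rs = ray_simps[OF ray_Ends(2)[OF d]]
      have "t \<noteq> 0" using t m(2) rs(4) Ends_iff d by auto
      then have "?v \<in> open_arc (fst d)" unfolding rs(5)[symmetric] using t T(2)[OF d] by auto
      then show False
        using endpoint_not_in_open_arc[OF eE(1), of b] open_arc_disjoint[OF ray_Ends(2)[OF d] eE(1)] end_pt_in_image[of "(e, b)"]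
        by (cases "fst d = e") auto
    qed
    then have "?v \<in> - ?N" using A_end(2)[OF eE(1) m(2)] by blast
    moreover have "open (- ?N)" using closedN by (rule open_Compl)
    ultimately have oN: "open (- ?N)" "?v \<in> - ?N" by blast+
    obtain Q where Q: "connected Q" "Q \<subseteq> - ?N" "Q \<inter> open_arc e \<noteq> {}" "Q \<inter> open_arc f \<noteq> {}"
      "\<And>g. g \<in> edges D \<Longrightarrow> g \<noteq> e \<Longrightarrow> g \<noteq> f \<Longrightarrow> Q \<inter> path_image g = {}"
      using mates_connector[OF m(3) oN, unfolded fst_conv] by blast
    have meet: "Q \<inter> open_arc (A g) \<noteq> {}" if g: "Q \<inter> open_arc g \<noteq> {}" "g \<in> edges D" for g
    proof (cases "g \<in> fst ` Ends")
      case True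
      then obtain d where d: "d \<in> Ends" "g = fst d" by auto
      note rs = ray_simps[OF ray_Ends(2)[OF d(1)]]
      obtain t where t: "0 < t" "t < 1" "ray d t \<in> Q" using g(1) unfolding d(2) rs(5)[symmetric] by auto
      have "\<not> t \<le> T d"
      proof
        assume "t \<le> T d"
        then have "ray d t \<in> ray d ` {0..T d}" using t by (intro imageI) auto
        then show False using t(3) d(1) Q(2) by blast
      qed
      then have "ray d t \<in> open_arc (A g)" unfolding d(2) A_Ends[OF d(1)] tr(3)[OF d(1) d(1) d(1)] using t by auto
      then show ?thesis using t by blast
    next
      case False
      then show ?thesis using A_other g by simp
    qed
    have avoid: "Q \<inter> path_image (A g) = {}" if "g \<in> edges D - {e, f}" for g
      using Q(5)[of g] A_sub(2)[of g] that by blast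
    have "end_pt (A e, b) = end_pt (A f, c)"
      using A_end(1)[OF eE(1) m(2)] A_end(1)[OF eE(2), of c] m(1,2) by simp
    moreover have "Q \<subseteq> - cball x r" using Q(2) by blast
    ultimately show ?thesis
      by (intro conjI exI[of _ Q] ballI Q(1) meet[OF Q(3) eE(1)] meet[OF Q(4) eE(2)] avoid)
  qed
  define P where "P = (\<lambda>d. ray d (T d))"
  have P_end: "end_pt (A (fst d), snd d) = P d" if "d \<in> Ends" for d
    unfolding P_def A_Ends[OF that] by (rule tr(4)[OF that that that])
  have P_open: "P d \<in> open_arc (fst d)" if "d \<in> Ends" for d
    unfolding P_def ray_simps(5)[OF ray_Ends(2)[OF that], symmetric] using T(1,2)[OF that] by auto
  have P_sphere: "P d \<in> sphere x r" if "d \<in> Ends" for d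
    using T(3)[OF that] by (simp add: P_def dist_norm norm_minus_commute)
  let ?d1 = "(?oi, True)" and ?d2 = "(?ui, True)" and ?d3 = "(?oo, False)" and ?d4 = "(?uo, False)"
  have inE: "?d1 \<in> Ends" "?d2 \<in> Ends" "?d3 \<in> Ends" "?d4 \<in> Ends" by (auto simp: Ends_def)
  \<comment> \<open>Differences of points on the circle are \<open>r\<close> times differences of
    directions, so the product only changes by the positive factor \<open>r^4\<close>.\<close>
  have sep: "Im (cnj (P ?d3 - P ?d1) * (P ?d2 - P ?d1)) * Im (cnj (P ?d3 - P ?d1) * (P ?d4 - P ?d1)) < 0"
  proof -
    define u where "u = (\<lambda>d. (P d - x) / of_real r)"
    have Pu: "P d - P d' = r *\<^sub>R (u d - u d')" for d d'
      using r(1) by (simp add: u_def scaleR_conv_of_real field_simps)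
    have "Im (cnj (r *\<^sub>R a) * (r *\<^sub>R b)) = r\<^sup>2 * Im (cnj a * b)" for a b
      by (simp add: power2_eq_square algebra_simps)
    then have eq: "Im (cnj (P d - P d') * (P c - P c')) = r\<^sup>2 * Im (cnj (u d - u d') * (u c - u c'))" for d d' c c'
      unfolding Pu .
    have dirs: "dir ?d1 = - sgn v" "dir ?d3 = sgn v" "dir ?d2 = - sgn w" "dir ?d4 = sgn w"
      using ne by (auto simp: dir_def)
    have "cmod (u ?d1 - (- sgn v)) < \<epsilon>" "cmod (u ?d2 - (- sgn w)) < \<epsilon>"
      "cmod (u ?d3 + (- sgn v)) < \<epsilon>" "cmod (u ?d4 + (- sgn w)) < \<epsilon>"
      using T(5)[OF inE(1)] T(5)[OF inE(2)] T(5)[OF inE(3)] T(5)[OF inE(4)] unfolding dirs u_def P_def by simp_all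
    from \<epsilon>(2)[OF this] have neg: "Im (cnj (u ?d3 - u ?d1) * (u ?d2 - u ?d1)) * Im (cnj (u ?d3 - u ?d1) * (u ?d4 - u ?d1)) < 0" .
    have "r\<^sup>2 * a * (r\<^sup>2 * b) < 0" if "a * b < 0" for a b :: real
    proof -
      have "r\<^sup>2 * a * (r\<^sup>2 * b) = (r\<^sup>2 * r\<^sup>2) * (a * b)" by (simp only: mult_ac)
      moreover have "r\<^sup>2 * r\<^sup>2 > 0" using r by simp
      ultimately show ?thesis using that by (simp only: mult_pos_neg)
    qed
    from this[OF neg] show ?thesis unfolding eq .
  qed
  obtain s1 s2 t1 t2 where st: "0 \<le> s1" "s1 < s2" "s2 \<le> 1" "s1 < t1" "t1 < s2" "t2 < s1 \<or> s2 < t2" "t2 \<in> {0..1}"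
    "{?C s1, ?C s2} = {P ?d1, P ?d3}" "{?C t1, ?C t2} = {P ?d2, P ?d4}"
    using circle_separation[OF r(1) P_sphere[OF inE(1)] P_sphere[OF inE(3)] P_sphere[OF inE(2)] P_sphere[OF inE(4)] sep]
    by metis
  have s: "\<exists>f1 b1 f1' b1'. f1 \<in> m.strand ?oi \<and> end_pt (A f1, b1) = ?C s1 \<and> f1' \<in> m.strand ?oi \<and> end_pt (A f1', b1') = ?C s2"
    using st(8) P_end[OF inE(1)] P_end[OF inE(3)] m.strand_refl[of ?oi] bad unfolding doubleton_eq_iff by (metis fst_conv snd_conv)
  have t: "\<exists>f2 b2 f2' b2'. f2 \<in> m.strand ?ui \<and> end_pt (A f2, b2) = ?C t1 \<and> f2' \<in> m.strand ?ui \<and> end_pt (A f2', b2') = ?C t2"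
    using st(9) P_end[OF inE(2)] P_end[OF inE(4)] m.strand_refl[of ?ui] ui unfolding doubleton_eq_iff by (metis fst_conv snd_conv)
  obtain f1 b1 f1' b1' where f1: "f1 \<in> m.strand ?oi" "end_pt (A f1, b1) = ?C s1" "f1' \<in> m.strand ?oi" "end_pt (A f1', b1') = ?C s2"
    using s by blast
  obtain f2 b2 f2' b2' where f2: "f2 \<in> m.strand ?ui" "end_pt (A f2, b2) = ?C t1" "f2' \<in> m.strand ?ui" "end_pt (A f2', b2') = ?C t2"
    using t by blast
  have off: "?C t1 \<notin> path_image (A g) \<and> ?C t2 \<notin> path_image (A g)" if g: "g \<in> m.strand ?oi" for g
  proof -
    have gE: "g \<in> edges D" using g m.strand_subset[OF E4(1)] by blast
    have "P ?d2 \<notin> path_image g"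
      using P_open[OF inE(2)] open_arc_disjoint[OF E4(2) gE] g no by auto
    moreover have "P ?d4 \<notin> path_image g"
      using P_open[OF inE(4)] open_arc_disjoint[OF E4(4) gE] g no by auto
    ultimately have n: "\<forall>z\<in>{P ?d2, P ?d4}. z \<notin> path_image (A g)" using A_sub(2)[OF gE] by auto
    have "?C t1 \<in> {P ?d2, P ?d4}" "?C t2 \<in> {P ?d2, P ?d4}" unfolding st(9)[symmetric] by simp_all
    from bspec[OF n this(1)] bspec[OF n this(2)] show ?thesis by (rule conjI)
  qed
  show False
  proof (rule strands_do_not_interleave[OF m.end_matching_axioms, where A = A and S = "- cball x r" and C = ?C and ?e1.0 = ?oi and ?e2.0 = ?ui])
    show "simple_path ?C" using r by (simp add: simple_path_circlepath)
    show "pathfinish ?C = pathstart ?C" by simp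
    show "- cball x r = inside (path_image ?C) \<or> - cball x r = outside (path_image ?C)" using outC by simp
    show "path_image (A e) \<subseteq> - cball x r \<union> path_image ?C" if "e \<in> edges D" for e
      using A_sub(5)[OF that] unfolding imC .
    show "open_arc (A e) \<inter> path_image (A f) = {}" if "e \<in> edges D" "f \<in> edges D" "e \<noteq> f" for e f
      using A_sub(1)[OF that(1)] A_sub(2)[OF that(2)] open_arc_disjoint[OF that] by blast
  qed (use A_sub conn E4 no(1) f1 f2 off st in auto)
qed

end

section \<open>Signed bijections of bases\<close>

text \<open>An isomorphism given by a bijection of bases with signs. In the form
  \<open>\<eta> b * \<eta> b = 1\<close> the signs make the matrix inverse to its transpose. The
  last clause ties the differential of \<open>Y\<close> to its basis, so that \<open>Y\<close>
  inherits the property of being a complex from \<open>X\<close>.\<close>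

definition signed_bijection :: "('b, 'k::field) cpx \<Rightarrow> ('c, 'k) cpx \<Rightarrow> ('b \<Rightarrow> 'c) \<Rightarrow> ('b \<Rightarrow> 'k) \<Rightarrow> bool" where
  "signed_bijection X Y \<phi> \<eta> \<longleftrightarrow>
     bij_betw \<phi> (gens X) (gens Y) \<and>
     (\<forall>b\<in>gens X. \<eta> b * \<eta> b = 1 \<and> hdeg Y (\<phi> b) = hdeg X b \<and> qdeg Y (\<phi> b) = qdeg X b) \<and>
     (\<forall>b\<in>gens X. \<forall>c\<in>gens X. \<eta> b * bd Y (\<phi> b) (\<phi> c) = bd X b c * \<eta> c) \<and>
     (\<forall>b c. bd Y b c \<noteq> 0 \<longrightarrow> b \<in> gens Y \<and> c \<in> gens Y)"

lemma signed_bijection_trans: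
  assumes "signed_bijection X Y \<phi> \<eta>" "signed_bijection Y Z \<psi> \<theta>"
  shows "signed_bijection X Z (\<psi> \<circ> \<phi>) (\<lambda>b. \<eta> b * \<theta> (\<phi> b))"
proof -
  have \<phi>: "\<phi> b \<in> gens Y" if "b \<in> gens X" for b
    using assms(1) that by (auto simp: signed_bijection_def bij_betw_def)
  have "\<eta> b * \<theta> (\<phi> b) * bd Z (\<psi> (\<phi> b)) (\<psi> (\<phi> c)) = bd X b c * (\<eta> c * \<theta> (\<phi> c))"
    if "b \<in> gens X" "c \<in> gens X" for b c
  proof -
    have "\<theta> (\<phi> b) * bd Z (\<psi> (\<phi> b)) (\<psi> (\<phi> c)) = bd Y (\<phi> b) (\<phi> c) * \<theta> (\<phi> c)"
      using assms(2) \<phi> that by (auto simp: signed_bijection_def)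
    moreover have "\<eta> b * bd Y (\<phi> b) (\<phi> c) = bd X b c * \<eta> c"
      using assms(1) that by (auto simp: signed_bijection_def)
    ultimately show ?thesis by (metis mult.assoc)
  qed
  moreover have "\<eta> b * \<theta> (\<phi> b) * (\<eta> b * \<theta> (\<phi> b)) = 1" if "b \<in> gens X" for b
  proof -
    have "\<eta> b * \<eta> b = 1" "\<theta> (\<phi> b) * \<theta> (\<phi> b) = 1"
      using assms \<phi>[OF that] that by (auto simp: signed_bijection_def)
    then show ?thesis by (metis mult.assoc mult.commute mult.right_neutral)
  qed
  ultimately show ?thesis
    using assms \<phi> unfolding signed_bijection_def by (auto intro: bij_betw_trans)
qed

context
  fixes X :: "('b, 'k::field) cpx" and Y :: "('c, 'k) cpx" and \<phi> \<eta> \<psi> f g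
  assumes X: "chain_complex X" and sb: "signed_bijection X Y \<phi> \<eta>"
  defines "\<psi> \<equiv> inv_into (gens X) \<phi>"
  defines "f \<equiv> (\<lambda>b c. if b \<in> gens X \<and> c = \<phi> b then \<eta> b else 0)"
  defines "g \<equiv> (\<lambda>c b. if b \<in> gens X \<and> c = \<phi> b then \<eta> b else 0)"
begin

private lemma bij: "bij_betw \<phi> (gens X) (gens Y)"
  using sb by (simp add: signed_bijection_def)

private lemma fin: "finite (gens X)" "finite (gens Y)"
  using X bij by (auto simp: chain_complex_def bij_betw_finite[symmetric])

private lemma \<phi>_in: "b \<in> gens X \<Longrightarrow> \<phi> b \<in> gens Y"
  using bij by (auto simp: bij_betw_def)

private lemma \<phi>_eq: "b \<in> gens X \<Longrightarrow> c \<in> gens X \<Longrightarrow> \<phi> b = \<phi> c \<longleftrightarrow> b = c"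
  using bij by (auto simp: bij_betw_def inj_on_def)

private lemma \<psi>: "c \<in> gens Y \<Longrightarrow> \<psi> c \<in> gens X \<and> \<phi> (\<psi> c) = c"
  using bij by (auto simp: bij_betw_def \<psi>_def inv_into_into f_inv_into_f)

private lemma \<eta>\<eta>: "b \<in> gens X \<Longrightarrow> \<eta> b * \<eta> b = 1"
  using sb by (simp add: signed_bijection_def)

private lemma sum_f_left: "(\<Sum>c\<in>gens Y. f b c * h c) = (if b \<in> gens X then \<eta> b * h (\<phi> b) else 0)"
  using fin \<phi>_in by (auto simp: f_def if_distrib[of "\<lambda>x. x * _"] sum.delta cong: if_cong)

private lemma sum_f_right:
  "c \<in> gens Y \<Longrightarrow> (\<Sum>b\<in>gens X. h b * f b c) = h (\<psi> c) * \<eta> (\<psi> c)"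
  "c \<notin> gens Y \<Longrightarrow> (\<Sum>b\<in>gens X. h b * f b c) = 0"
proof -
  assume c: "c \<in> gens Y"
  have "h b * f b c = (if b = \<psi> c then h b * \<eta> b else 0)" if "b \<in> gens X" for b
    using that \<psi>[OF c] \<phi>_eq[of b "\<psi> c"] by (auto simp: f_def)
  then have "(\<Sum>b\<in>gens X. h b * f b c) = (\<Sum>b\<in>gens X. if b = \<psi> c then h b * \<eta> b else 0)"
    by (intro sum.cong) auto
  also have "\<dots> = h (\<psi> c) * \<eta> (\<psi> c)" using fin \<psi>[OF c] by simp
  finally show "(\<Sum>b\<in>gens X. h b * f b c) = h (\<psi> c) * \<eta> (\<psi> c)" .
next
  assume "c \<notin> gens Y"
  then show "(\<Sum>b\<in>gens X. h b * f b c) = 0" using \<phi>_in by (auto simp: f_def intro!: sum.neutral)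
qed

private lemma g_eq: "g c b = f b c"
  by (auto simp: f_def g_def)

private lemma bdY: "bd Y b c = (if b \<in> gens Y \<and> c \<in> gens Y then \<eta> (\<psi> b) * bd X (\<psi> b) (\<psi> c) * \<eta> (\<psi> c) else 0)"
proof (cases "b \<in> gens Y \<and> c \<in> gens Y")
  case True
  then have "\<eta> (\<psi> b) * bd Y b c = bd X (\<psi> b) (\<psi> c) * \<eta> (\<psi> c)"
    using sb \<psi>[of b] \<psi>[of c] unfolding signed_bijection_def by metis
  then have "\<eta> (\<psi> b) * \<eta> (\<psi> b) * bd Y b c = \<eta> (\<psi> b) * bd X (\<psi> b) (\<psi> c) * \<eta> (\<psi> c)"
    by (simp add: mult.assoc)
  then show ?thesis using True \<eta>\<eta> \<psi>[of b] by simp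
qed (use sb in \<open>auto simp: signed_bijection_def\<close>)

private lemma bdX0: "bd X b c \<noteq> 0 \<Longrightarrow> b \<in> gens X \<and> c \<in> gens X"
  using X by (auto simp: chain_complex_def graded_map_def)

private lemma fmap: "graded_map 0 X Y f" "graded_map 0 Y X g"
  using sb \<phi>_in by (auto simp: graded_map_def f_def g_def signed_bijection_def split: if_splits)

private lemma \<psi>\<phi>: "b \<in> gens X \<Longrightarrow> \<psi> (\<phi> b) = b"
  by (metis \<phi>_eq \<phi>_in \<psi>)

private lemma f_comm: "mcomp (gens X) (bd X) f = mcomp (gens Y) f (bd Y)"
proof (intro ext)
  fix b c
  have "mcomp (gens Y) f (bd Y) b c = (if b \<in> gens X then \<eta> b * bd Y (\<phi> b) c else 0)"
    by (simp add: mcomp_def sum_f_left)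
  also have "\<dots> = (if b \<in> gens X \<and> c \<in> gens Y then (\<eta> b * \<eta> b) * bd X b (\<psi> c) * \<eta> (\<psi> c) else 0)"
    using \<phi>_in by (auto simp: bdY \<psi>\<phi> mult.assoc)
  also have "\<dots> = (if c \<in> gens Y then bd X b (\<psi> c) * \<eta> (\<psi> c) else 0)"
    using bdX0[of b "\<psi> c"] by (auto simp: \<eta>\<eta>)
  finally show "mcomp (gens X) (bd X) f b c = mcomp (gens Y) f (bd Y) b c"
    by (simp add: mcomp_def sum_f_right)
qed

private lemma g_comm: "mcomp (gens Y) (bd Y) g = mcomp (gens X) g (bd X)"
proof (intro ext)
  fix c b
  have "mcomp (gens X) g (bd X) c b = (\<Sum>b'\<in>gens X. bd X b' b * f b' c)"
    by (simp add: mcomp_def g_eq mult.commute)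
  also have "\<dots> = (if c \<in> gens Y then bd X (\<psi> c) b * \<eta> (\<psi> c) else 0)"
    by (simp add: sum_f_right)
  finally have 1: "mcomp (gens X) g (bd X) c b = (if c \<in> gens Y then bd X (\<psi> c) b * \<eta> (\<psi> c) else 0)" .
  have "mcomp (gens Y) (bd Y) g c b = (\<Sum>b'\<in>gens Y. f b b' * bd Y c b')"
    by (simp add: mcomp_def g_eq mult.commute)
  also have "\<dots> = (if b \<in> gens X then \<eta> b * bd Y c (\<phi> b) else 0)"
    by (simp add: sum_f_left)
  also have "\<dots> = (if b \<in> gens X \<and> c \<in> gens Y then \<eta> (\<psi> c) * bd X (\<psi> c) b * (\<eta> b * \<eta> b) else 0)"
    using \<phi>_in by (auto simp: bdY \<psi>\<phi> mult_ac)
  finally show "mcomp (gens Y) (bd Y) g c b = mcomp (gens X) g (bd X) c b"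
    unfolding 1 using bdX0[of "\<psi> c" b] by (auto simp: \<eta>\<eta>)
qed

private lemma fg: "mcomp (gens Y) f g = idmat (gens X)"
  using \<eta>\<eta> by (intro ext) (auto simp: mcomp_def sum_f_left g_def idmat_def \<phi>_eq)

private lemma gf: "mcomp (gens X) g f = idmat (gens Y)"
proof (intro ext)
  fix c d
  have "mcomp (gens X) g f c d = (if d \<in> gens Y then f (\<psi> d) c * \<eta> (\<psi> d) else 0)"
    by (simp add: mcomp_def g_eq sum_f_right)
  then show "mcomp (gens X) g f c d = idmat (gens Y) c d"
    using \<psi> \<eta>\<eta> by (auto simp: f_def idmat_def)
qed

private lemma Y: "chain_complex Y"
  unfolding chain_complex_def
proof (intro conjI ext)
  show "finite (gens Y)" by (rule fin)
  show "graded_map 1 Y Y (bd Y)"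
    unfolding graded_map_def
  proof (intro allI impI)
    fix b c assume nz: "bd Y b c \<noteq> 0"
    then have bc: "b \<in> gens Y" "c \<in> gens Y" by (auto simp: bdY split: if_splits)
    have "bd X (\<psi> b) (\<psi> c) \<noteq> 0" using nz by (auto simp: bdY split: if_splits)
    then have "hdeg X (\<psi> c) = hdeg X (\<psi> b) + 1 \<and> qdeg X (\<psi> c) = qdeg X (\<psi> b)"
      using X by (auto simp: chain_complex_def graded_map_def)
    moreover have "hdeg Y b = hdeg X (\<psi> b)" "hdeg Y c = hdeg X (\<psi> c)"
        "qdeg Y b = qdeg X (\<psi> b)" "qdeg Y c = qdeg X (\<psi> c)"
      using sb \<psi> bc unfolding signed_bijection_def by metis+
    ultimately show "b \<in> gens Y \<and> c \<in> gens Y \<and> hdeg Y c = hdeg Y b + 1 \<and> qdeg Y c = qdeg Y b"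
      using bc by simp
  qed
next
  fix b c
  show "mcomp (gens Y) (bd Y) (bd Y) b c = 0"
  proof (cases "b \<in> gens Y \<and> c \<in> gens Y")
    case True
    have "mcomp (gens Y) (bd Y) (bd Y) b c = (\<Sum>a\<in>gens X. bd Y b (\<phi> a) * bd Y (\<phi> a) c)"
      unfolding mcomp_def by (rule sum.reindex_bij_betw[OF bij, symmetric])
    also have "\<dots> = (\<Sum>a\<in>gens X. \<eta> (\<psi> b) * (bd X (\<psi> b) a * bd X a (\<psi> c)) * \<eta> (\<psi> c))"
    proof (rule sum.cong[OF refl])
      fix a assume a: "a \<in> gens X"
      have "bd Y b (\<phi> a) * bd Y (\<phi> a) c = \<eta> (\<psi> b) * bd X (\<psi> b) a * (\<eta> a * \<eta> a) * bd X a (\<psi> c) * \<eta> (\<psi> c)"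
        using a True \<phi>_in by (simp add: bdY \<psi>\<phi> mult_ac)
      then show "bd Y b (\<phi> a) * bd Y (\<phi> a) c = \<eta> (\<psi> b) * (bd X (\<psi> b) a * bd X a (\<psi> c)) * \<eta> (\<psi> c)"
        using \<eta>\<eta>[OF a] by (simp add: mult_ac)
    qed
    also have "\<dots> = \<eta> (\<psi> b) * mcomp (gens X) (bd X) (bd X) (\<psi> b) (\<psi> c) * \<eta> (\<psi> c)"
      by (simp add: mcomp_def sum_distrib_left sum_distrib_right)
    also have "\<dots> = 0" using X by (simp add: chain_complex_def)
    finally show ?thesis .
  qed (auto simp: mcomp_def bdY)
qed

text \<open>That \<open>Y\<close> is a complex is part of the conclusion; this is how the sums of
  complexes of surgeries are recognized as complexes.\<close>

lemma signed_bijection_imp_cpx_iso: "cpx_iso X Y"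
  unfolding cpx_iso_def chain_map_def
  using X Y fmap f_comm g_comm fg gf by blast

lemma signed_bijection_imp_homotopy_equivalent: "homotopy_equivalent_cpx X Y"
proof -
  have "null_homotopic X (\<lambda>b c. 0)" "null_homotopic Y (\<lambda>b c. 0)"
    unfolding null_homotopic_def by (rule exI[of _ "\<lambda>b c. 0"], simp add: graded_map_def mcomp_def)+
  then show ?thesis
    unfolding homotopy_equivalent_cpx_def chain_map_def
    using X Y fmap f_comm g_comm fg gf by (intro conjI exI[of _ f] exI[of _ g]) simp_all
qed

end

text \<open>The coefficient spaces arise with states and labellings as bases; here they are
  renumbered by natural numbers, as \<open>linear_combination\<close> prescribes.\<close>

lemma linear_combination_if_signed_bijection:
  fixes W :: "'i \<Rightarrow> 'w graded" and X :: "'i \<Rightarrow> ('b, 'k::field) cpx" and Y :: "('c, 'k) cpx"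
  assumes Y: "chain_complex Y" and fin: "\<And>i. i \<in> I \<Longrightarrow> finite (gbasis (W i))"
    and sb: "signed_bijection Y (direct_sum_cpx I (\<lambda>i. tensor_cpx (W i) (X i))) \<phi> \<eta>"
  shows "linear_combination I X Y"
proof -
  define e where "e = (\<lambda>i. to_nat_on (gbasis (W i)))"
  define W' where "W' = (\<lambda>i. \<lparr> gbasis = e i ` gbasis (W i), gdeg = (\<lambda>n. gdeg (W i) (inv_into (gbasis (W i)) (e i) n)) \<rparr>)"
  have inj: "inj_on (e i) (gbasis (W i))" if "i \<in> I" for i
    using inj_on_to_nat_on[OF countable_finite[OF fin[OF that]]] by (simp add: e_def)
  let ?D = "direct_sum_cpx I (\<lambda>i. tensor_cpx (W i) (X i))"
  let ?D' = "direct_sum_cpx I (\<lambda>i. tensor_cpx (W' i) (X i))"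
  have bd: "b \<in> gens ?D \<and> c \<in> gens ?D" if "bd ?D b c \<noteq> 0" for b c
    using sb that unfolding signed_bijection_def by blast
  \<comment> \<open>Read off from the support of the differential of the whole sum; a basis vector
    \<open>w\<close> is required to embed the summand there.\<close>
  have X0: "b \<in> gens (X i) \<and> c \<in> gens (X i)" if "i \<in> I" "w \<in> gbasis (W i)" "bd (X i) b c \<noteq> 0" for i w b c
    using bd[of "(i, w, b)" "(i, w, c)"] that by (auto simp: direct_sum_cpx_def tensor_cpx_def)
  have bij: "bij_betw (\<lambda>(i, w, b). (i, e i w, b)) (gens ?D) (gens ?D')"
    unfolding bij_betw_def
  proof
    show "inj_on (\<lambda>(i, w, b). (i, e i w, b)) (gens ?D)"
      using inj by (auto simp: direct_sum_cpx_def tensor_cpx_def inj_on_def)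
    show "(\<lambda>(i, w, b). (i, e i w, b)) ` gens ?D = gens ?D'"
      by (force simp: direct_sum_cpx_def tensor_cpx_def W'_def image_iff)
  qed
  have "signed_bijection ?D ?D' (\<lambda>(i, w, b). (i, e i w, b)) (\<lambda>_. 1)"
    unfolding signed_bijection_def
  proof (intro conjI ballI allI impI bij)
    fix b assume "b \<in> gens ?D"
    then show "hdeg ?D' ((\<lambda>(i, w, b). (i, e i w, b)) b) = hdeg ?D b"
      and "qdeg ?D' ((\<lambda>(i, w, b). (i, e i w, b)) b) = qdeg ?D b"
      using inj by (auto simp: direct_sum_cpx_def tensor_cpx_def W'_def)
  next
    fix b c assume "b \<in> gens ?D" "c \<in> gens ?D"
    then show "1 * bd ?D' ((\<lambda>(i, w, b). (i, e i w, b)) b) ((\<lambda>(i, w, b). (i, e i w, b)) c) = bd ?D b c * 1"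
      using inj_on_eq_iff[OF inj] by (auto simp: direct_sum_cpx_def tensor_cpx_def W'_def)
  next
    fix b c assume nz: "bd ?D' b c \<noteq> 0"
    obtain i w b' j v c' where bc: "b = (i, w, b')" "c = (j, v, c')" by (metis prod.exhaust)
    from nz have *: "i \<in> I" "i = j" "w \<in> gbasis (W' i)" "w = v" "bd (X i) b' c' \<noteq> 0"
      by (auto simp: bc direct_sum_cpx_def tensor_cpx_def split: if_splits)
    then obtain w0 where "w0 \<in> gbasis (W i)" by (auto simp: W'_def)
    with * X0[of i w0 b' c'] show "b \<in> gens ?D'" "c \<in> gens ?D'"
      by (auto simp: bc direct_sum_cpx_def tensor_cpx_def)
  qed auto
  from signed_bijection_trans[OF sb this] have "cpx_iso Y ?D'"
    using signed_bijection_imp_cpx_iso[OF Y] by blast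
  moreover have "\<forall>i\<in>I. finite (gbasis (W' i))" using fin by (auto simp: W'_def)
  ultimately show ?thesis unfolding linear_combination_def by blast
qed

section \<open>Total complex, rows and relabelling of a double complex\<close>

lemma chain_complex_total:
  assumes A: "double_complex A"
  shows "chain_complex (total_complex A)"
proof -
  have h: "b \<in> dgens A \<and> c \<in> dgens A \<and> pdeg A c = pdeg A b + 1 \<and> vdeg A c = vdeg A b \<and> dqdeg A c = dqdeg A b"
    if "dhor A b c \<noteq> 0" for b c using A that unfolding double_complex_def by blast
  have v: "b \<in> dgens A \<and> c \<in> dgens A \<and> pdeg A c = pdeg A b \<and> vdeg A c = vdeg A b + 1 \<and> dqdeg A c = dqdeg A b"
    if "dvert A b c \<noteq> 0" for b c using A that unfolding double_complex_def by blast
  have hh: "(\<Sum>a\<in>dgens A. dhor A b a * dhor A a c) = 0" and vv: "(\<Sum>a\<in>dgens A. dvert A b a * dvert A a c) = 0"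
    and hv: "(\<Sum>a\<in>dgens A. dhor A b a * dvert A a c) = (\<Sum>a\<in>dgens A. dvert A b a * dhor A a c)" for b c
    using A unfolding double_complex_def mcomp_def by (auto dest: fun_cong[where x=b] fun_cong[where x=c] simp: fun_eq_iff)
  show ?thesis
    unfolding chain_complex_def
  proof (intro conjI ext)
    show "finite (gens (total_complex A))" using A by (simp add: double_complex_def total_complex_def)
    show "graded_map 1 (total_complex A) (total_complex A) (bd (total_complex A))"
      unfolding graded_map_def
    proof (intro allI impI)
      fix b c assume "bd (total_complex A) b c \<noteq> 0"
      then have "dhor A b c \<noteq> 0 \<or> dvert A b c \<noteq> 0" by (auto simp: total_complex_def)
      then show "b \<in> gens (total_complex A) \<and> c \<in> gens (total_complex A) \<and>
        hdeg (total_complex A) c = hdeg (total_complex A) b + 1 \<and> qdeg (total_complex A) c = qdeg (total_complex A) b"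
        using h[of b c] v[of b c] by (auto simp: total_complex_def)
    qed
    fix b c
    let ?e = "\<lambda>b. (- 1 :: 'b) powi pdeg A b"
    have ee: "?e b * ?e b = 1" for b by (simp add: power_int_mult_distrib[symmetric])
    have "(dhor A b a + ?e b * dvert A b a) * (dhor A a c + ?e a * dvert A a c) =
        dhor A b a * dhor A a c - ?e b * (dhor A b a * dvert A a c) + ?e b * (dvert A b a * dhor A a c) +
        dvert A b a * dvert A a c" for a
    proof -
      \<comment> \<open>A horizontal step changes the parity of \<open>pdeg\<close> and a vertical
        one does not; so the two mixed terms get opposite signs.\<close>
      have "dhor A b a * (?e a * dvert A a c) = - ?e b * (dhor A b a * dvert A a c)"
        using h[of b a] by (cases "dhor A b a = 0") (auto simp: power_int_add)
      moreover have "?e b * dvert A b a * (?e a * dvert A a c) = ?e b * ?e b * (dvert A b a * dvert A a c)"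
        using v[of b a] by (cases "dvert A b a = 0") auto
      ultimately show ?thesis unfolding ee by (simp add: algebra_simps)
    qed
    then show "mcomp (gens (total_complex A)) (bd (total_complex A)) (bd (total_complex A)) b c = 0"
      by (simp add: mcomp_def total_complex_def sum.distrib sum_subtractf sum_distrib_left[symmetric] hh vv hv)
  qed
qed

lemma chain_complex_row:
  assumes A: "double_complex A"
  shows "chain_complex (row_cpx A q)"
proof -
  have h: "b \<in> dgens A \<and> c \<in> dgens A \<and> pdeg A c = pdeg A b + 1 \<and> vdeg A c = vdeg A b \<and> dqdeg A c = dqdeg A b"
    if "dhor A b c \<noteq> 0" for b c using A that unfolding double_complex_def by blast
  have hh: "(\<Sum>a\<in>dgens A. dhor A b a * dhor A a c) = 0" for b c
    using A unfolding double_complex_def mcomp_def by (auto simp: fun_eq_iff)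
  have rr: "(\<Sum>a\<in>{a \<in> dgens A. vdeg A a = q}. dhor A b a * dhor A a c) = 0" if "vdeg A b = q" for b c
    unfolding hh[of b c, symmetric]
    using A h that by (intro sum.mono_neutral_left) (auto simp: double_complex_def)
  let ?B = "{a \<in> dgens A. vdeg A a = q}"
  have "(\<Sum>a\<in>?B. restrict_mat ?B (dhor A) b a * restrict_mat ?B (dhor A) a c) = 0" for b c
  proof (cases "b \<in> ?B \<and> c \<in> ?B")
    case True
    then have "(\<Sum>a\<in>?B. restrict_mat ?B (dhor A) b a * restrict_mat ?B (dhor A) a c) =
        (\<Sum>a\<in>?B. dhor A b a * dhor A a c)"
      by (intro sum.cong) (auto simp: restrict_mat_def)
    with rr True show ?thesis by simp
  qed (auto simp: restrict_mat_def intro!: sum.neutral)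
  then show ?thesis
    using A h unfolding chain_complex_def graded_map_def
    by (auto simp: row_cpx_def mcomp_def fun_eq_iff double_complex_def)
       (auto simp: restrict_mat_def split: if_splits)
qed

text \<open>Reduces columns to rows. The exchange again gives a double complex because the two
  differentials commute.\<close>

definition flip_dcpx :: "('b, 'k) dcpx \<Rightarrow> ('b, 'k) dcpx" where
  "flip_dcpx A = \<lparr> dgens = dgens A, pdeg = vdeg A, vdeg = pdeg A, dqdeg = dqdeg A, dhor = dvert A, dvert = dhor A \<rparr>"

lemma double_complex_flip: "double_complex A \<Longrightarrow> double_complex (flip_dcpx A)"
  by (simp add: double_complex_def flip_dcpx_def)

lemma column_eq_row_flip: "column_cpx A p = row_cpx (flip_dcpx A) p"
  by (simp add: column_cpx_def row_cpx_def flip_dcpx_def)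

text \<open>The double complex to be exhibited has natural numbers as basis. A single enumeration of
  the basis serves all rows, all columns and the total complex at once.\<close>

lemma double_complex_encode_nat:
  fixes A :: "('b, 'k::field) dcpx"
  assumes A: "double_complex A"
  obtains A' :: "(nat, 'k) dcpx" and \<phi> where "double_complex A'"
    "\<And>q. signed_bijection (row_cpx A' q) (row_cpx A q) \<phi> (\<lambda>_. 1)"
    "\<And>p. signed_bijection (column_cpx A' p) (column_cpx A p) \<phi> (\<lambda>_. 1)"
    "signed_bijection (total_complex A') (total_complex A) \<phi> (\<lambda>_. 1)"
proof -
  define G where "G = dgens A"
  have fin: "finite G" using A by (simp add: G_def double_complex_def)
  define e where "e = to_nat_on G"
  define \<phi> where "\<phi> = inv_into G e"
  have inj: "inj_on e G" using inj_on_to_nat_on[OF countable_finite[OF fin]] by (simp add: e_def)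
  have \<phi>e: "\<phi> (e b) = b" if "b \<in> G" for b using inj that by (simp add: \<phi>_def)
  have e\<phi>: "e (\<phi> n) = n" "\<phi> n \<in> G" if "n \<in> e ` G" for n
    using that by (auto simp: \<phi>e)
  have bij: "bij_betw \<phi> (e ` G) G" by (rule bij_betw_byWitness[where f'=e]) (auto simp: \<phi>e)
  define tr :: "('b \<Rightarrow> 'b \<Rightarrow> 'k) \<Rightarrow> nat \<Rightarrow> nat \<Rightarrow> 'k" where
    "tr = (\<lambda>f m n. if m \<in> e ` G \<and> n \<in> e ` G then f (\<phi> m) (\<phi> n) else 0)"
  define A' where "A' = \<lparr> dgens = e ` G, pdeg = pdeg A \<circ> \<phi>, vdeg = vdeg A \<circ> \<phi>, dqdeg = dqdeg A \<circ> \<phi>,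
    dhor = tr (dhor A), dvert = tr (dvert A) \<rparr>"
  have mc: "mcomp (e ` G) (tr f) (tr g) = tr (mcomp G f g)" for f g
  proof (intro ext)
    fix m n
    have "mcomp (e ` G) (tr f) (tr g) m n = (\<Sum>b\<in>G. tr f m (e b) * tr g (e b) n)"
      unfolding mcomp_def using inj by (simp add: sum.reindex)
    then show "mcomp (e ` G) (tr f) (tr g) m n = tr (mcomp G f g) m n"
      by (auto simp: tr_def mcomp_def \<phi>e)
  qed
  have dc: "double_complex A'"
    using A e\<phi> inj unfolding double_complex_def
    by (simp add: A'_def mc G_def[symmetric] fin) (auto simp: tr_def fun_eq_iff)
  have rows: "bij_betw \<phi> {b \<in> e ` G. Q (\<phi> b)} {b \<in> G. Q b}" for Q
    by (rule bij_betw_byWitness[where f'=e]) (auto simp: \<phi>e)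
  have "signed_bijection (row_cpx A' q) (row_cpx A q) \<phi> (\<lambda>_. 1)" for q
    using rows[of "\<lambda>b. vdeg A b = q"] e\<phi>
    by (auto simp: signed_bijection_def row_cpx_def A'_def restrict_mat_def tr_def G_def[symmetric] split: if_splits)
  moreover have "signed_bijection (column_cpx A' p) (column_cpx A p) \<phi> (\<lambda>_. 1)" for p
    using rows[of "\<lambda>b. pdeg A b = p"] e\<phi>
    by (auto simp: signed_bijection_def column_cpx_def A'_def restrict_mat_def tr_def G_def[symmetric] split: if_splits)
  moreover have "signed_bijection (total_complex A') (total_complex A) \<phi> (\<lambda>_. 1)"
    unfolding signed_bijection_def
  proof (intro conjI allI impI ballI)
    fix b c assume "bd (total_complex A) b c \<noteq> 0"
    then have "dhor A b c \<noteq> 0 \<or> dvert A b c \<noteq> 0" by (auto simp: total_complex_def)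
    then show "b \<in> gens (total_complex A)" "c \<in> gens (total_complex A)"
      using A unfolding double_complex_def by (auto simp: total_complex_def)
  qed (use bij e\<phi> in \<open>auto simp: total_complex_def A'_def tr_def G_def[symmetric]\<close>)
  ultimately show ?thesis using that dc by blast
qed

section \<open>The double complex of a partition of the crossings\<close>

text \<open>The sign of an arrow of the cube for an arbitrary way \<open>r\<close> of comparing
  crossings; see \<open>sg_order_sign\<close>.\<close>

definition order_sign :: "('a \<Rightarrow> 'a \<Rightarrow> bool) \<Rightarrow> 'a set \<Rightarrow> 'a \<Rightarrow> 'k::field" where
  "order_sign r \<alpha> x = (- 1) ^ card {y \<in> \<alpha>. r y x}"

text \<open>The sign of the permutation that sorts \<open>\<alpha>\<close> from one order into the
  other. Rescaling the state \<open>\<alpha>\<close> by it turns arrow signs for \<open>r\<close>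
  into those for \<open>r'\<close>, as \<open>inversion_sign_insert\<close> shows.\<close>

definition inversion_sign :: "('a \<Rightarrow> 'a \<Rightarrow> bool) \<Rightarrow> ('a \<Rightarrow> 'a \<Rightarrow> bool) \<Rightarrow> 'a set \<Rightarrow> 'k::field" where
  "inversion_sign r r' \<alpha> = (- 1) ^ card {(y, z). y \<in> \<alpha> \<and> z \<in> \<alpha> \<and> r y z \<and> r' z y}"

text \<open>The sign rules compare two crossings at a time; this is the part of a strict total order
  that governs such comparisons.\<close>

definition tournament :: "('a \<Rightarrow> 'a \<Rightarrow> bool) \<Rightarrow> 'a set \<Rightarrow> bool" where
  "tournament r X \<longleftrightarrow> (\<forall>x\<in>X. \<not> r x x) \<and> (\<forall>x\<in>X. \<forall>y\<in>X. x \<noteq> y \<longrightarrow> (r x y \<or> r y x) \<and> \<not> (r x y \<and> r y x))"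

lemma tournament_subset: "tournament r X \<Longrightarrow> Y \<subseteq> X \<Longrightarrow> tournament r Y"
  unfolding tournament_def by (metis subsetD)

lemma order_sign_square [simp]: "order_sign r \<alpha> x * order_sign r \<alpha> x = 1"
  by (simp add: order_sign_def)

lemma inversion_sign_square [simp]: "inversion_sign r r' \<alpha> * inversion_sign r r' \<alpha> = 1"
  by (simp add: inversion_sign_def)

lemma order_sign_insert:
  assumes "finite \<alpha>" "x \<notin> \<alpha>"
  shows "order_sign r (insert x \<alpha>) y = (if r x y then - 1 else 1) * order_sign r \<alpha> y"
proof -
  have "{z \<in> insert x \<alpha>. r z y} = (if r x y then insert x {z \<in> \<alpha>. r z y} else {z \<in> \<alpha>. r z y})" by auto
  then show ?thesis using assms by (simp add: order_sign_def)
qed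

text \<open>Exactly one of \<open>x\<close> and \<open>y\<close> precedes the other, so just one of
  the four signs around the face is affected by the other insertion.\<close>

lemma order_sign_anticommute:
  assumes "finite \<alpha>" "x \<notin> \<alpha>" "y \<notin> \<alpha>" "x \<noteq> y" "tournament r Y" "x \<in> Y" "y \<in> Y"
  shows "order_sign r \<alpha> x * order_sign r (insert x \<alpha>) y =
    - (order_sign r \<alpha> y * order_sign r (insert y \<alpha>) x :: 'k::field)"
proof -
  have "r x y \<longleftrightarrow> \<not> r y x" using assms(4-7) unfolding tournament_def by metis
  then show ?thesis using assms by (cases "r x y") (simp_all add: order_sign_insert)
qed

text \<open>The new inversions are the pairs of \<open>x\<close> with an element that
  \<open>r\<close> and \<open>r'\<close> place on different sides of \<open>x\<close>. Their number
  has the parity of the sum of the two numbers of predecessors of \<open>x\<close>.\<close>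

lemma inversion_sign_insert:
  assumes \<alpha>: "finite \<alpha>" "x \<notin> \<alpha>" and r: "tournament r (insert x \<alpha>)" "tournament r' (insert x \<alpha>)"
  shows "inversion_sign r r' (insert x \<alpha>) =
    (inversion_sign r r' \<alpha> * order_sign r \<alpha> x * order_sign r' \<alpha> x :: 'k::field)"
proof -
  let ?I = "\<lambda>\<alpha>. {(y, z). y \<in> \<alpha> \<and> z \<in> \<alpha> \<and> r y z \<and> r' z y}"
  let ?L = "{y \<in> \<alpha>. r y x \<and> \<not> r' y x}" and ?U = "{y \<in> \<alpha>. \<not> r y x \<and> r' y x}" and ?B = "{y \<in> \<alpha>. r y x \<and> r' y x}"
  have rx: "\<not> r x x" "\<And>y. y \<in> \<alpha> \<Longrightarrow> r x y \<longleftrightarrow> \<not> r y x" "\<And>y. y \<in> \<alpha> \<Longrightarrow> r' x y \<longleftrightarrow> \<not> r' y x"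
    using r \<alpha>(2) unfolding tournament_def by (metis insertI1 insertI2)+
  have "?I (insert x \<alpha>) = ?I \<alpha> \<union> ((\<lambda>y. (y, x)) ` ?L \<union> (\<lambda>z. (x, z)) ` ?U)"
    using rx by auto
  moreover have fI: "finite (?I \<alpha>)" by (rule finite_subset[of _ "\<alpha> \<times> \<alpha>"]) (use \<alpha> in auto)
  ultimately have "card (?I (insert x \<alpha>)) = card (?I \<alpha>) + card ((\<lambda>y. (y, x)) ` ?L \<union> (\<lambda>z. (x, z)) ` ?U)"
    using \<alpha> by (simp only:, intro card_Un_disjoint) auto
  also have "card ((\<lambda>y. (y, x)) ` ?L \<union> (\<lambda>z. (x, z)) ` ?U) =
      card ((\<lambda>y. (y, x)) ` ?L) + card ((\<lambda>z. (x, z)) ` ?U)"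
    using \<alpha> by (intro card_Un_disjoint) auto
  finally have "card (?I (insert x \<alpha>)) = card (?I \<alpha>) + (card ((\<lambda>y. (y, x)) ` ?L) + card ((\<lambda>z. (x, z)) ` ?U))" .
  moreover have "card ((\<lambda>y. (y, x)) ` ?L) = card ?L" "card ((\<lambda>z. (x, z)) ` ?U) = card ?U"
    by (auto intro!: card_image inj_onI)
  ultimately have 1: "card (?I (insert x \<alpha>)) = card (?I \<alpha>) + (card ?L + card ?U)" by simp
  have "{y \<in> \<alpha>. r y x} = ?B \<union> ?L" "{y \<in> \<alpha>. r' y x} = ?B \<union> ?U" by auto
  moreover have "card (?B \<union> ?L) = card ?B + card ?L" "card (?B \<union> ?U) = card ?B + card ?U"
    using \<alpha> by (auto intro!: card_Un_disjoint)
  ultimately have 2: "card {y \<in> \<alpha>. r y x} = card ?B + card ?L" "card {y \<in> \<alpha>. r' y x} = card ?B + card ?U" by auto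
  have "((- 1) ^ card ?B * (- 1) ^ card ?B :: 'k) = 1" by simp
  then show ?thesis unfolding inversion_sign_def order_sign_def 1 2
    by (simp add: power_add mult_ac)
qed

definition before :: "'a list \<Rightarrow> 'a \<Rightarrow> 'a \<Rightarrow> bool" where
  "before xs y x \<longleftrightarrow> y \<in> set (takeWhile (\<lambda>y. y \<noteq> x) xs)"

lemma before_Cons: "before (z # zs) y x \<longleftrightarrow> z \<noteq> x \<and> (y = z \<or> before zs y x)"
  by (cases "z = x") (simp_all add: before_def)

lemma before_irrefl: "\<not> before xs x x"
  by (auto simp: before_def dest: set_takeWhileD)

lemma before_asym: "x \<in> set xs \<Longrightarrow> y \<in> set xs \<Longrightarrow> x \<noteq> y \<Longrightarrow> before xs x y \<longleftrightarrow> \<not> before xs y x"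
  by (induction xs) (auto simp: before_Cons)

lemma tournament_before: "tournament (before xs) (set xs)"
  unfolding tournament_def using before_irrefl before_asym by metis

lemma sg_order_sign:
  assumes "distinct (crossings D)"
  shows "(- 1) ^ sg D \<alpha> x = order_sign (before (crossings D)) \<alpha> x"
proof -
  have "sg D \<alpha> x = card (set (filter (\<lambda>y. y \<in> \<alpha>) (takeWhile (\<lambda>y. y \<noteq> x) (crossings D))))"
    unfolding sg_def using assms by (intro distinct_card[symmetric]) simp
  also have "set (filter (\<lambda>y. y \<in> \<alpha>) (takeWhile (\<lambda>y. y \<noteq> x) (crossings D))) =
      {y \<in> \<alpha>. before (crossings D) y x}" by (auto simp: before_def)
  finally show ?thesis by (simp add: order_sign_def)
qed

section \<open>Partial differentials of the cube of smoothings\<close>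

definition partial_bd :: "diagram \<Rightarrow> complex set \<Rightarrow> (complex set \<Rightarrow> complex \<Rightarrow> 'k::field) \<Rightarrow>
    complex set \<times> (complex set \<Rightarrow> vgen) \<Rightarrow> complex set \<times> (complex set \<Rightarrow> vgen) \<Rightarrow> 'k" where
  "partial_bd D Y \<epsilon> = restrict_mat (khovanov_gens D)
     (\<lambda>(\<alpha>, s) (\<beta>, t). \<Sum>x\<in>{x \<in> Y - \<alpha>. \<beta> = insert x \<alpha>}.
        \<epsilon> \<alpha> x * arrow_coeff (circles D \<alpha>) (circles D \<beta>) s t)"

lemma partial_bd_insert:
  assumes "(\<alpha>, s) \<in> khovanov_gens D" "(insert x \<alpha>, t) \<in> khovanov_gens D" "x \<in> Y - \<alpha>"
  shows "partial_bd D Y \<epsilon> (\<alpha>, s) (insert x \<alpha>, t) =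
    \<epsilon> \<alpha> x * arrow_coeff (circles D \<alpha>) (circles D (insert x \<alpha>)) s t"
proof -
  have "{x' \<in> Y - \<alpha>. insert x \<alpha> = insert x' \<alpha>} = {x}" using assms(3) by auto
  then show ?thesis using assms by (simp add: partial_bd_def restrict_mat_def)
qed

lemma partial_bd_nonzero:
  assumes "partial_bd D Y \<epsilon> (\<alpha>, s) (\<beta>, t) \<noteq> 0"
  obtains x where "x \<in> Y - \<alpha>" "\<beta> = insert x \<alpha>" "(\<alpha>, s) \<in> khovanov_gens D" "(\<beta>, t) \<in> khovanov_gens D"
    "arrow_coeff (circles D \<alpha>) (circles D \<beta>) s t \<noteq> (0 :: 'k::field)" "\<epsilon> \<alpha> x \<noteq> (0 :: 'k)"
proof -
  have "(\<alpha>, s) \<in> khovanov_gens D" "(\<beta>, t) \<in> khovanov_gens D"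
    and "(\<Sum>x\<in>{x \<in> Y - \<alpha>. \<beta> = insert x \<alpha>}. \<epsilon> \<alpha> x * arrow_coeff (circles D \<alpha>) (circles D \<beta>) s t) \<noteq> 0"
    using assms by (auto simp: partial_bd_def restrict_mat_def split: if_splits)
  moreover from this obtain x where "x \<in> {x \<in> Y - \<alpha>. \<beta> = insert x \<alpha>}"
    "\<epsilon> \<alpha> x * arrow_coeff (circles D \<alpha>) (circles D \<beta>) s t \<noteq> 0"
    by (meson sum.not_neutral_contains_not_neutral)
  ultimately show ?thesis using that by auto
qed

text \<open>The interface between plane geometry and algebra: this is the information on a diagram
  from which the double complex is built. Link diagrams provide it by
  \<open>surgery_cube_link\<close>.\<close>

definition surgery_cube :: "diagram \<Rightarrow> bool" where
  "surgery_cube D \<longleftrightarrow> distinct (crossings D) \<and> (\<forall>\<alpha>\<subseteq>set (crossings D). finite (circles D \<alpha>)) \<and>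
     (\<forall>\<alpha>\<subseteq>set (crossings D). \<forall>x\<in>set (crossings D) - \<alpha>.
        surgery_step x (circles D \<alpha>) (circles D (insert x \<alpha>)))"

lemma finite_khovanov_gens:
  assumes "\<forall>\<alpha>\<subseteq>set (crossings D). finite (circles D \<alpha>)"
  shows "finite (khovanov_gens D)"
  unfolding khovanov_gens_def using assms by (intro finite_SigmaI finite_PiE) (auto simp: UNIV_vgen)

definition composite_coeff :: "diagram \<Rightarrow> complex set \<Rightarrow> complex set \<Rightarrow> complex set \<Rightarrow>
    (complex set \<Rightarrow> vgen) \<Rightarrow> (complex set \<Rightarrow> vgen) \<Rightarrow> 'k::field" where
  "composite_coeff D \<alpha> \<beta> \<gamma> s u = (\<Sum>t\<in>circles D \<beta> \<rightarrow>\<^sub>E UNIV.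
     arrow_coeff (circles D \<alpha>) (circles D \<beta>) s t * arrow_coeff (circles D \<beta>) (circles D \<gamma>) t u)"

text \<open>A composite is described by the crossings \<open>x\<close> and \<open>y\<close> changed
  in turn. The intermediate state is \<open>insert x \<alpha>\<close>, and the sum over its
  labellings is separated as \<open>composite_coeff\<close>, so that only signs remain to be
  compared.\<close>

lemma mcomp_partial_bd:
  assumes D: "surgery_cube D" and Y: "Y \<subseteq> set (crossings D)" "Y' \<subseteq> set (crossings D)"
    and g: "(\<alpha>, s) \<in> khovanov_gens D" "(\<gamma>, u) \<in> khovanov_gens D"
  shows "mcomp (khovanov_gens D) (partial_bd D Y \<epsilon>) (partial_bd D Y' \<epsilon>') (\<alpha>, s) (\<gamma>, u) =
    (\<Sum>(x, y)\<in>{(x, y). x \<in> Y - \<alpha> \<and> y \<in> Y' - insert x \<alpha> \<and> \<gamma> = insert y (insert x \<alpha>)}.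
       \<epsilon> \<alpha> x * \<epsilon>' (insert x \<alpha>) y * composite_coeff D \<alpha> (insert x \<alpha>) \<gamma> s u :: 'k::field)"
proof -
  let ?X = "set (crossings D)"
  let ?c = "\<lambda>\<alpha> \<beta> s t. arrow_coeff (circles D \<alpha>) (circles D \<beta>) s t :: 'k"
  let ?x = "\<lambda>\<beta>. {x \<in> Y - \<alpha>. \<beta> = insert x \<alpha>}" and ?y = "\<lambda>\<beta>. {y \<in> Y' - \<beta>. \<gamma> = insert y \<beta>}"
  let ?F = "\<lambda>\<beta> x y. \<epsilon> \<alpha> x * \<epsilon>' \<beta> y * composite_coeff D \<alpha> \<beta> \<gamma> s u"
  have finY: "finite Y" "finite Y'" using Y finite_subset by auto
  have "mcomp (khovanov_gens D) (partial_bd D Y \<epsilon>) (partial_bd D Y' \<epsilon>') (\<alpha>, s) (\<gamma>, u) =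
      (\<Sum>(\<beta>, t)\<in>khovanov_gens D. (\<Sum>x\<in>?x \<beta>. \<epsilon> \<alpha> x * ?c \<alpha> \<beta> s t) * (\<Sum>y\<in>?y \<beta>. \<epsilon>' \<beta> y * ?c \<beta> \<gamma> t u))"
    unfolding mcomp_def using g by (intro sum.cong) (auto simp: partial_bd_def restrict_mat_def)
  also have "\<dots> = (\<Sum>\<beta>\<in>Pow ?X. \<Sum>t\<in>circles D \<beta> \<rightarrow>\<^sub>E UNIV.
      (\<Sum>x\<in>?x \<beta>. \<epsilon> \<alpha> x * ?c \<alpha> \<beta> s t) * (\<Sum>y\<in>?y \<beta>. \<epsilon>' \<beta> y * ?c \<beta> \<gamma> t u))"
    unfolding khovanov_gens_def using D
    by (subst sum.Sigma) (auto intro!: finite_PiE simp: surgery_cube_def UNIV_vgen)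
  also have "\<dots> = (\<Sum>\<beta>\<in>Pow ?X. \<Sum>x\<in>?x \<beta>. \<Sum>y\<in>?y \<beta>. ?F \<beta> x y)"
  proof (rule sum.cong[OF refl])
    fix \<beta>
    have "(\<Sum>t\<in>circles D \<beta> \<rightarrow>\<^sub>E UNIV. (\<Sum>x\<in>?x \<beta>. \<epsilon> \<alpha> x * ?c \<alpha> \<beta> s t) * (\<Sum>y\<in>?y \<beta>. \<epsilon>' \<beta> y * ?c \<beta> \<gamma> t u)) =
        (\<Sum>t\<in>circles D \<beta> \<rightarrow>\<^sub>E UNIV. ((\<Sum>x\<in>?x \<beta>. \<epsilon> \<alpha> x) * (\<Sum>y\<in>?y \<beta>. \<epsilon>' \<beta> y)) * (?c \<alpha> \<beta> s t * ?c \<beta> \<gamma> t u))"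
      by (simp only: sum_distrib_right[symmetric] mult_ac)
    also have "\<dots> = ((\<Sum>x\<in>?x \<beta>. \<epsilon> \<alpha> x) * (\<Sum>y\<in>?y \<beta>. \<epsilon>' \<beta> y)) * composite_coeff D \<alpha> \<beta> \<gamma> s u"
      by (simp add: composite_coeff_def sum_distrib_left)
    also have "\<dots> = (\<Sum>x\<in>?x \<beta>. \<Sum>y\<in>?y \<beta>. \<epsilon> \<alpha> x * \<epsilon>' \<beta> y) * composite_coeff D \<alpha> \<beta> \<gamma> s u"
      by (simp only: sum_product)
    also have "\<dots> = (\<Sum>x\<in>?x \<beta>. \<Sum>y\<in>?y \<beta>. ?F \<beta> x y)"
      by (simp only: sum_distrib_right)
    finally show "(\<Sum>t\<in>circles D \<beta> \<rightarrow>\<^sub>E UNIV. (\<Sum>x\<in>?x \<beta>. \<epsilon> \<alpha> x * ?c \<alpha> \<beta> s t) * (\<Sum>y\<in>?y \<beta>. \<epsilon>' \<beta> y * ?c \<beta> \<gamma> t u)) =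
       (\<Sum>x\<in>?x \<beta>. \<Sum>y\<in>?y \<beta>. ?F \<beta> x y)" .
  qed
  also have "\<dots> = (\<Sum>\<beta>\<in>Pow ?X. \<Sum>(x, y)\<in>?x \<beta> \<times> ?y \<beta>. ?F \<beta> x y)"
    by (simp only: sum.cartesian_product)
  also have "\<dots> = (\<Sum>(\<beta>, x, y)\<in>(SIGMA \<beta>:Pow ?X. ?x \<beta> \<times> ?y \<beta>). ?F \<beta> x y)"
    using finY by (intro sum.Sigma) auto
  also have "\<dots> = (\<Sum>(x, y)\<in>{(x, y). x \<in> Y - \<alpha> \<and> y \<in> Y' - insert x \<alpha> \<and> \<gamma> = insert y (insert x \<alpha>)}. ?F (insert x \<alpha>) x y)"
    using g Y by (intro sum.reindex_bij_witness[where i="\<lambda>(x, y). (insert x \<alpha>, x, y)" and j="\<lambda>(\<beta>, x, y). (x, y)"])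
      (auto simp: khovanov_gens_def)
  finally show ?thesis .
qed

lemma composite_coeff_commute:
  assumes D: "surgery_cube D" and "\<alpha> \<subseteq> set (crossings D)" "x \<in> set (crossings D) - \<alpha>" "y \<in> set (crossings D) - \<alpha>" "x \<noteq> y"
  shows "composite_coeff D \<alpha> (insert x \<alpha>) (insert y (insert x \<alpha>)) s u =
    (composite_coeff D \<alpha> (insert y \<alpha>) (insert y (insert x \<alpha>)) s u :: 'k::field)"
proof -
  have *: "surgery_step x (circles D \<alpha>) (circles D (insert x \<alpha>))"
    if "\<alpha> \<subseteq> set (crossings D)" "x \<in> set (crossings D) - \<alpha>" for \<alpha> x
    using D that unfolding surgery_cube_def by blast
  have "surgery_step x (circles D (insert y \<alpha>)) (circles D (insert y (insert x \<alpha>)))"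
    using *[of "insert y \<alpha>" x] assms by (simp add: insert_commute)
  moreover have "surgery_step y (circles D (insert x \<alpha>)) (circles D (insert y (insert x \<alpha>)))"
    using *[of "insert x \<alpha>" y] assms by simp
  ultimately show ?thesis
    unfolding composite_coeff_def using assms * by (intro surgery_steps_commute) auto
qed

text \<open>Each differential is signed by the order within its own set of crossings, so the two
  commute; the sign \<open>(-1)^p\<close> of the total complex supplies the rest. The shift by the
  number of negative crossings is divided between the two degrees according to where these crossings
  lie.\<close>

definition cube_dcpx :: "diagram \<Rightarrow> (complex \<Rightarrow> complex \<Rightarrow> bool) \<Rightarrow> complex set \<Rightarrow> complex set \<Rightarrow>
    (complex set \<times> (complex set \<Rightarrow> vgen), 'k::field) dcpx" where
  "cube_dcpx D r X1 X2 =
     \<lparr> dgens = khovanov_gens D,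
       pdeg = (\<lambda>(\<alpha>, s). int (card (\<alpha> \<inter> X1)) - int (card {x \<in> X1. \<not> positive_crossing D x})),
       vdeg = (\<lambda>(\<alpha>, s). int (card (\<alpha> \<inter> X2)) - int (card {x \<in> X2. \<not> positive_crossing D x})),
       dqdeg = qdeg (khovanov D :: (_, 'k) cpx),
       dhor = partial_bd D X1 (\<lambda>\<alpha>. order_sign r (\<alpha> \<inter> X1)),
       dvert = partial_bd D X2 (\<lambda>\<alpha>. order_sign r (\<alpha> \<inter> X2)) \<rparr>"

lemma flip_cube_dcpx: "flip_dcpx (cube_dcpx D r X1 X2) = cube_dcpx D r X2 X1"
  by (simp add: flip_dcpx_def cube_dcpx_def)

lemma partial_bd_degree:
  assumes D: "surgery_cube D" and nz: "partial_bd D Y \<epsilon> b c \<noteq> (0 :: 'k::field)"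
    and Y: "Y \<union> Y' \<subseteq> set (crossings D)" "Y \<inter> Y' = {}"
  shows "b \<in> khovanov_gens D" "c \<in> khovanov_gens D" "card (fst c \<inter> Y) = card (fst b \<inter> Y) + 1"
    "card (fst c \<inter> Y') = card (fst b \<inter> Y')" "qdeg (khovanov D :: (_, 'k) cpx) c = qdeg (khovanov D :: (_, 'k) cpx) b"
proof -
  obtain \<alpha> s \<beta> t where bc: "b = (\<alpha>, s)" "c = (\<beta>, t)" by fastforce
  obtain x where x: "x \<in> Y - \<alpha>" "\<beta> = insert x \<alpha>" "b \<in> khovanov_gens D" "c \<in> khovanov_gens D"
    "arrow_coeff (circles D \<alpha>) (circles D \<beta>) s t \<noteq> (0 :: 'k::field)"
    using partial_bd_nonzero[OF nz[unfolded bc]] bc by metis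
  show "b \<in> khovanov_gens D" "c \<in> khovanov_gens D" by fact+
  have \<alpha>: "\<alpha> \<subseteq> set (crossings D)" using x bc by (auto simp: khovanov_gens_def)
  then have fin: "finite \<alpha>" using finite_subset by blast
  have "\<beta> \<inter> Y = insert x (\<alpha> \<inter> Y)" "\<beta> \<inter> Y' = \<alpha> \<inter> Y'" using x Y by auto
  then show "card (fst c \<inter> Y) = card (fst b \<inter> Y) + 1" "card (fst c \<inter> Y') = card (fst b \<inter> Y')"
    using x fin by (simp_all add: bc)
  have "surgery_step x (circles D \<alpha>) (circles D \<beta>)" using D x \<alpha> Y unfolding surgery_cube_def by auto
  from arrow_coeff_degree[OF this x(5)] have "(\<Sum>Z\<in>circles D \<beta>. vdegree (t Z)) + 1 = (\<Sum>Z\<in>circles D \<alpha>. vdegree (s Z))" .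
  then show "qdeg (khovanov D :: (_, 'k) cpx) c = qdeg (khovanov D :: (_, 'k) cpx) b"
    using x fin by (simp add: khovanov_def bc)
qed

lemma mcomp_outside:
  assumes "(b, c) \<notin> G \<times> G" "\<And>b c. f b c \<noteq> 0 \<Longrightarrow> b \<in> G" "\<And>b c. g b c \<noteq> 0 \<Longrightarrow> c \<in> G"
  shows "mcomp G f g b c = 0"
  unfolding mcomp_def using assms by (intro sum.neutral) (metis SigmaI mult_eq_0_iff)

text \<open>A face contributes its two orders of crossings with the same composite coefficient and,
  by \<open>order_sign_anticommute\<close>, opposite signs.\<close>

lemma partial_bd_square:
  assumes D: "surgery_cube D" and r: "tournament r (set (crossings D))" and Y: "Y \<subseteq> set (crossings D)"
  shows "mcomp (khovanov_gens D) (partial_bd D Y (\<lambda>\<alpha>. order_sign r (\<alpha> \<inter> Y)))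
    (partial_bd D Y (\<lambda>\<alpha>. order_sign r (\<alpha> \<inter> Y))) = (\<lambda>b c. 0 :: 'k::field)"
proof (intro ext)
  fix b c :: "complex set \<times> (complex set \<Rightarrow> vgen)"
  let ?\<epsilon> = "\<lambda>\<alpha>. order_sign r (\<alpha> \<inter> Y) :: complex \<Rightarrow> 'k"
  let ?d = "partial_bd D Y ?\<epsilon>"
  obtain \<alpha> s \<gamma> u where bc: "b = (\<alpha>, s)" "c = (\<gamma>, u)" by fastforce
  show "mcomp (khovanov_gens D) ?d ?d b c = 0"
  proof (cases "b \<in> khovanov_gens D \<and> c \<in> khovanov_gens D")
    case True
    let ?P = "{(x, y). x \<in> Y - \<alpha> \<and> y \<in> Y - insert x \<alpha> \<and> \<gamma> = insert y (insert x \<alpha>)}"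
    let ?f = "\<lambda>(x, y). ?\<epsilon> \<alpha> x * ?\<epsilon> (insert x \<alpha>) y * composite_coeff D \<alpha> (insert x \<alpha>) \<gamma> s u"
    have \<alpha>: "\<alpha> \<subseteq> set (crossings D)" using True bc by (auto simp: khovanov_gens_def)
    have "sum ?f ?P = 0"
    proof (cases "?P = {}")
      case False
      then obtain x y where xy: "x \<in> Y - \<alpha>" "y \<in> Y - insert x \<alpha>" "\<gamma> = insert y (insert x \<alpha>)" by blast
      then have P: "?P = {(x, y), (y, x)}" by auto
      have ins: "insert x \<alpha> \<inter> Y = insert x (\<alpha> \<inter> Y)" "insert y \<alpha> \<inter> Y = insert y (\<alpha> \<inter> Y)" using xy by auto
      have "?\<epsilon> \<alpha> x * ?\<epsilon> (insert x \<alpha>) y = - (?\<epsilon> \<alpha> y * ?\<epsilon> (insert y \<alpha>) x)"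
        unfolding ins using xy \<alpha> finite_subset[OF \<alpha>] r Y
        by (intro order_sign_anticommute[of _ _ _ _ "set (crossings D)"]) auto
      moreover have "composite_coeff D \<alpha> (insert x \<alpha>) \<gamma> s u = (composite_coeff D \<alpha> (insert y \<alpha>) \<gamma> s u :: 'k)"
        unfolding xy(3) using xy Y \<alpha> by (intro composite_coeff_commute[OF D]) auto
      ultimately show ?thesis unfolding P using xy by simp
    next
      case True
      then show ?thesis by (simp only: sum.empty)
    qed
    moreover have "mcomp (khovanov_gens D) ?d ?d (\<alpha>, s) (\<gamma>, u) = sum ?f ?P"
      using True unfolding bc by (intro mcomp_partial_bd[OF D Y Y]) auto
    ultimately show ?thesis by (simp only: bc)
  next
    case False
    then show ?thesis
      by (intro mcomp_outside) (auto simp: partial_bd_def restrict_mat_def split: if_splits)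
  qed
qed

text \<open>An arrow at a crossing of one set does not change the part of the state in the other
  set, hence not the sign of the other arrow.\<close>

lemma partial_bd_commute:
  assumes D: "surgery_cube D" and Y: "Y \<union> Y' \<subseteq> set (crossings D)" "Y \<inter> Y' = {}"
  shows "mcomp (khovanov_gens D) (partial_bd D Y (\<lambda>\<alpha>. order_sign r (\<alpha> \<inter> Y)))
      (partial_bd D Y' (\<lambda>\<alpha>. order_sign r (\<alpha> \<inter> Y'))) =
    mcomp (khovanov_gens D) (partial_bd D Y' (\<lambda>\<alpha>. order_sign r (\<alpha> \<inter> Y')))
      (partial_bd D Y (\<lambda>\<alpha>. order_sign r (\<alpha> \<inter> Y)) :: _ \<Rightarrow> _ \<Rightarrow> 'k::field)"
proof (intro ext)
  fix b c :: "complex set \<times> (complex set \<Rightarrow> vgen)"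
  let ?\<epsilon> = "\<lambda>Y \<alpha>. order_sign r (\<alpha> \<inter> Y) :: complex \<Rightarrow> 'k"
  let ?d = "\<lambda>Y. partial_bd D Y (?\<epsilon> Y)"
  obtain \<alpha> s \<gamma> u where bc: "b = (\<alpha>, s)" "c = (\<gamma>, u)" by fastforce
  show "mcomp (khovanov_gens D) (?d Y) (?d Y') b c = mcomp (khovanov_gens D) (?d Y') (?d Y) b c"
  proof (cases "b \<in> khovanov_gens D \<and> c \<in> khovanov_gens D")
    case True
    let ?P = "\<lambda>Y Y'. {(x, y). x \<in> Y - \<alpha> \<and> y \<in> Y' - insert x \<alpha> \<and> \<gamma> = insert y (insert x \<alpha>)}"
    let ?f = "\<lambda>Y Y'. \<lambda>(x, y). ?\<epsilon> Y \<alpha> x * ?\<epsilon> Y' (insert x \<alpha>) y * composite_coeff D \<alpha> (insert x \<alpha>) \<gamma> s u"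
    have \<alpha>: "\<alpha> \<subseteq> set (crossings D)" using True bc by (auto simp: khovanov_gens_def)
    have eq: "?f Y Y' (x, y) = ?f Y' Y (y, x)" if "(x, y) \<in> ?P Y Y'" for x y
    proof -
      have "insert x \<alpha> \<inter> Y' = \<alpha> \<inter> Y'" "insert y \<alpha> \<inter> Y = \<alpha> \<inter> Y" using that Y by auto
      moreover have "composite_coeff D \<alpha> (insert x \<alpha>) (insert y (insert x \<alpha>)) s u =
          (composite_coeff D \<alpha> (insert y \<alpha>) (insert y (insert x \<alpha>)) s u :: 'k)"
        using that Y \<alpha> by (intro composite_coeff_commute[OF D]) auto
      ultimately show ?thesis using that by simp
    qed
    have "sum (?f Y Y') (?P Y Y') = sum (?f Y' Y) (?P Y' Y)"
      by (rule sum.reindex_bij_witness[where i=prod.swap and j=prod.swap]) (use eq Y in \<open>auto simp: insert_commute\<close>)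
    moreover have "mcomp (khovanov_gens D) (?d Y) (?d Y') (\<alpha>, s) (\<gamma>, u) = sum (?f Y Y') (?P Y Y')"
      "mcomp (khovanov_gens D) (?d Y') (?d Y) (\<alpha>, s) (\<gamma>, u) = sum (?f Y' Y) (?P Y' Y)"
      using True Y unfolding bc by (intro mcomp_partial_bd[OF D]; auto)+
    ultimately show ?thesis by (simp only: bc)
  next
    case False
    then have "mcomp (khovanov_gens D) (partial_bd D Y \<epsilon>) (partial_bd D Y' \<epsilon>') b c = (0 :: 'k)" for Y Y' \<epsilon> \<epsilon>'
      by (intro mcomp_outside) (auto simp: partial_bd_def restrict_mat_def split: if_splits)
    then show ?thesis by simp
  qed
qed

lemma double_complex_cube:
  assumes D: "surgery_cube D" and r: "tournament r (set (crossings D))"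
    and X: "X1 \<union> X2 = set (crossings D)" "X1 \<inter> X2 = {}"
  shows "double_complex (cube_dcpx D r X1 X2 :: (_, 'k::field) dcpx)"
proof -
  have fin: "finite (khovanov_gens D)" using D by (intro finite_khovanov_gens) (auto simp: surgery_cube_def)
  have X': "X2 \<union> X1 \<subseteq> set (crossings D)" "X2 \<inter> X1 = {}" "X1 \<union> X2 \<subseteq> set (crossings D)" using X by auto
  note h = partial_bd_degree[OF D _ X'(3) X(2)] and v = partial_bd_degree[OF D _ X'(1,2)]
  let ?A = "cube_dcpx D r X1 X2 :: (_, 'k) dcpx"
  have "b \<in> dgens ?A \<and> c \<in> dgens ?A \<and> pdeg ?A c = pdeg ?A b + 1 \<and> vdeg ?A c = vdeg ?A b \<and> dqdeg ?A c = dqdeg ?A b"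
    if "dhor ?A b c \<noteq> 0" for b c
  proof -
    have "partial_bd D X1 (\<lambda>\<alpha>. order_sign r (\<alpha> \<inter> X1)) b c \<noteq> (0 :: 'k)" using that by (simp add: cube_dcpx_def)
    from h[OF this] show ?thesis by (simp add: cube_dcpx_def split_beta)
  qed
  moreover have "b \<in> dgens ?A \<and> c \<in> dgens ?A \<and> pdeg ?A c = pdeg ?A b \<and> vdeg ?A c = vdeg ?A b + 1 \<and> dqdeg ?A c = dqdeg ?A b"
    if "dvert ?A b c \<noteq> 0" for b c
  proof -
    have "partial_bd D X2 (\<lambda>\<alpha>. order_sign r (\<alpha> \<inter> X2)) b c \<noteq> (0 :: 'k)" using that by (simp add: cube_dcpx_def)
    from v[OF this] show ?thesis by (simp add: cube_dcpx_def split_beta)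
  qed
  moreover have "mcomp (dgens ?A) (dhor ?A) (dhor ?A) = (\<lambda>b c. 0)" "mcomp (dgens ?A) (dvert ?A) (dvert ?A) = (\<lambda>b c. 0)"
    using X' by (simp_all add: cube_dcpx_def partial_bd_square[OF D r])
  moreover have "mcomp (dgens ?A) (dhor ?A) (dvert ?A) = mcomp (dgens ?A) (dvert ?A) (dhor ?A)"
    by (simp add: cube_dcpx_def partial_bd_commute[OF D X'(3) X(2)])
  moreover have "finite (dgens ?A)" using fin by (simp add: cube_dcpx_def)
  ultimately show ?thesis unfolding double_complex_def by blast
qed

section \<open>How the components of edges change at a crossing\<close>

lemma rtrancl_merge:
  fixes R :: "'e rel"
  assumes R: "sym R" and p': "(p, p') \<in> R\<^sup>*" and q': "(q, q') \<in> R\<^sup>*"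
    and R': "R' = R \<union> {(p, q), (q, p), (p', q'), (q', p')}"
  shows "R'\<^sup>* `` {e} = (if e \<in> R\<^sup>* `` {p} \<union> R\<^sup>* `` {q} then R\<^sup>* `` {p} \<union> R\<^sup>* `` {q} else R\<^sup>* `` {e})"
    (is "_ = ?J")
proof
  have sym: "(a, b) \<in> R\<^sup>* \<Longrightarrow> (b, a) \<in> R\<^sup>*" for a b using sym_rtrancl[OF R] by (auto dest: symD)
  show "R'\<^sup>* `` {e} \<subseteq> ?J"
  proof
    fix f assume "f \<in> R'\<^sup>* `` {e}"
    then have "(e, f) \<in> R'\<^sup>*" by simp
    then show "f \<in> ?J"
    proof induction
      case base show ?case by simp
    next
      case (step f g)
      show ?case
      proof (cases "(f, g) \<in> R")
        case True
        then show ?thesis using step.IH by (auto split: if_splits intro: rtrancl.rtrancl_into_rtrancl)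
      next
        case False
        then have fg: "(f, g) \<in> {(p, q), (q, p), (p', q'), (q', p')}" using step.hyps R' by blast
        have in4: "u \<in> R\<^sup>* `` {p} \<union> R\<^sup>* `` {q}" if "u \<in> {p, q, p', q'}" for u using that p' q' by auto
        have fK: "f \<in> R\<^sup>* `` {p} \<union> R\<^sup>* `` {q}" and "g \<in> R\<^sup>* `` {p} \<union> R\<^sup>* `` {q}" using fg in4 by blast+
        moreover have "e \<in> R\<^sup>* `` {p} \<union> R\<^sup>* `` {q}"
        proof (rule ccontr)
          assume ne: "e \<notin> R\<^sup>* `` {p} \<union> R\<^sup>* `` {q}"
          then have "(e, f) \<in> R\<^sup>*" using step.IH by auto
          then show False using ne fK sym by (auto intro: rtrancl_trans)
        qed
        ultimately show ?thesis using fK by simp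
      qed
    qed
  qed
  have sub: "R\<^sup>* \<subseteq> R'\<^sup>*" unfolding R' by (rule rtrancl_mono) auto
  have pq: "(p, q) \<in> R'\<^sup>*" "(q, p) \<in> R'\<^sup>*" unfolding R' by auto
  show "?J \<subseteq> R'\<^sup>* `` {e}"
  proof (cases "e \<in> R\<^sup>* `` {p} \<union> R\<^sup>* `` {q}")
    case True
    then have "(e, p) \<in> R'\<^sup>* \<and> (e, q) \<in> R'\<^sup>*"
      using sub sym pq by (auto intro: rtrancl_trans)
    then show ?thesis using True sub by (auto intro: rtrancl_trans)
  next
    case False
    then show ?thesis using sub by auto
  qed
qed

text \<open>Together with \<open>rtrancl_merge\<close> this covers the two smoothings of a crossing
  whose four ends lie on two strands: one smoothing closes up each strand, the other joins
  them.\<close>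

lemma rtrancl_same:
  fixes R :: "'e rel"
  assumes "sym R" "(p, q) \<in> R\<^sup>*" "(p', q') \<in> R\<^sup>*" "R' = R \<union> {(p, q), (q, p), (p', q'), (q', p')}"
  shows "R'\<^sup>* = R\<^sup>*"
proof -
  have "(q, p) \<in> R\<^sup>*" "(q', p') \<in> R\<^sup>*" using sym_rtrancl[OF assms(1)] assms(2,3) by (auto dest: symD)
  then have "R' \<subseteq> R\<^sup>*" unfolding assms(4) using assms(2,3) by (simp add: subset_iff r_into_rtrancl)
  moreover have "R \<subseteq> R'" unfolding assms(4) by (rule Un_upper1)
  ultimately show ?thesis using rtrancl_subset by metis
qed

lemma surgery_step_sym: "surgery_step x A B \<Longrightarrow> surgery_step x B A"
  unfolding surgery_step_def by (metis add.commute)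

definition pts :: "(real \<Rightarrow> complex) set \<Rightarrow> complex set" where
  "pts K = (\<Union>e\<in>K. path_image e)"

lemma end_pairs_insert:
  "{(e, f). \<exists>b c. ((e, b), (f, c)) \<in> insert ((p, i), (q, j)) S} = insert (p, q) {(e, f). \<exists>b c. ((e, b), (f, c)) \<in> S}"
  "{(e, f). \<exists>b c. ((e, b), (f, c)) \<in> {}} = {}"
  by auto

lemma circles_eq:
  "circles D \<alpha> = (\<lambda>e. pts ((joined D \<alpha> \<union> (joined D \<alpha>)\<inverse>)\<^sup>* `` {e})) ` edges D"
  unfolding circles_def quotient_def pts_def by auto

context link
begin

text \<open>The midpoint of an edge lies on no other edge, so a set of edges can be recovered from
  the points it covers.\<close>

lemma inj_pts: "inj_on pts (Pow (edges D))"
proof -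
  have "e \<in> K'" if KE: "K \<subseteq> edges D" "K' \<subseteq> edges D" "pts K = pts K'" "e \<in> K" for K K' e
  proof -
    have m: "e (1/2) \<in> open_arc e" by auto
    then have "e (1/2) \<in> path_image e" by (auto simp: path_image_def)
    then have "e (1/2) \<in> pts K" using KE(4) by (auto simp: pts_def)
    then obtain g where "g \<in> K'" "e (1/2) \<in> path_image g" using KE(3) by (auto simp: pts_def)
    then have "g = e" using open_arc_disjoint[of e g] m KE by blast
    then show ?thesis using \<open>g \<in> K'\<close> by simp
  qed
  then show ?thesis unfolding inj_on_def by blast
qed

lemma finite_circles_link: "finite (circles D \<alpha>)"
  unfolding circles_eq using finite_edges by simp

text \<open>\<open>K\<close> assigns to an edge its component, and \<open>inj_pts\<close> allows
  passing to point sets. No third circle contains \<open>x\<close>, because all four edges at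
  \<open>x\<close> belong to the two components that are merged.\<close>

lemma merge_step:
  assumes x: "x \<in> set (crossings D)"
    and K: "\<And>e. e \<in> edges D \<Longrightarrow> K e \<subseteq> edges D" "\<And>e. e \<in> K e" "\<And>e f. f \<in> K e \<Longrightarrow> K f = K e"
    and p: "p \<in> edges D" "q \<in> edges D" "q \<notin> K p"
    and ends: "over_in D x \<in> K p \<union> K q" "under_in D x \<in> K p \<union> K q" "over_out D x \<in> K p \<union> K q" "under_out D x \<in> K p \<union> K q"
    and at_x: "x \<in> path_image p" "x \<in> path_image q"
    and K': "\<And>e. K' e = (if e \<in> K p \<union> K q then K p \<union> K q else K e)"
  shows "surgery_step x ((\<lambda>e. pts (K e)) ` edges D) ((\<lambda>e. pts (K' e)) ` edges D)"
proof -
  let ?\<A> = "K ` edges D"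
  let ?\<B> = "K' ` edges D"
  let ?M = "K p \<union> K q"
  have disj: "K p \<inter> K q = {}" using K(2,3) p(3) by blast
  have ne: "K p \<noteq> K q" "K p \<noteq> ?M" "K q \<noteq> ?M" using K(2)[of p] K(2)[of q] disj by blast+
  have sub: "?\<A> \<subseteq> Pow (edges D)" "?\<B> \<subseteq> Pow (edges D)" using K(1) p by (auto simp: K' split: if_splits)
  have KM: "K e = K p \<or> K e = K q" if "e \<in> ?M" for e using that K(3) by blast
  have no_M: "?M \<notin> ?\<A>"
  proof
    assume "?M \<in> ?\<A>"
    then obtain e where "K e = ?M" by auto
    then have "e \<in> ?M" using K(2)[of e] by simp
    then show False using KM \<open>K e = ?M\<close> ne by metis
  qed
  have "K p \<notin> ?\<B>" "K q \<notin> ?\<B>"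
  proof -
    have "K' e \<noteq> K p \<and> K' e \<noteq> K q" for e
    proof (cases "e \<in> ?M")
      case True then show ?thesis using ne by (simp add: K')
    next
      case False
      then have "K e \<noteq> K p" "K e \<noteq> K q" using K(2)[of e] by blast+
      then show ?thesis using False by (simp add: K')
    qed
    then show "K p \<notin> ?\<B>" "K q \<notin> ?\<B>" by blast+
  qed
  moreover have "K e \<in> ?\<B>" if "e \<in> edges D" "e \<notin> ?M" for e
    using that by (intro image_eqI[of _ _ e]) (auto simp: K')
  then have "Z = K p \<or> Z = K q" if "Z \<in> ?\<A> - ?\<B>" for Z using that KM by blast
  ultimately have AB: "?\<A> - ?\<B> = {K p, K q}" using p by blast
  have BA: "?\<B> - ?\<A> = {?M}"
  proof -
    have "?M \<in> ?\<B>" using p K(2)[of p] by (intro image_eqI[of _ _ p]) (auto simp: K')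
    moreover have "K' e = ?M \<or> K' e \<in> ?\<A>" if "e \<in> edges D" for e using that by (auto simp: K')
    ultimately show ?thesis using no_M by auto
  qed
  have img: "pts ` I - pts ` J = pts ` (I - J)" if "I \<subseteq> Pow (edges D)" "J \<subseteq> Pow (edges D)" for I J
    using inj_on_image_set_diff[OF inj_pts] that by (metis Diff_subset subset_trans)
  have im: "(\<lambda>e. pts (K e)) ` edges D = pts ` ?\<A>" "(\<lambda>e. pts (K' e)) ` edges D = pts ` ?\<B>" by auto
  have d1: "(\<lambda>e. pts (K e)) ` edges D - (\<lambda>e. pts (K' e)) ` edges D = {pts (K p), pts (K q)}"
    unfolding im img[OF sub] AB by simp
  have d2: "(\<lambda>e. pts (K' e)) ` edges D - (\<lambda>e. pts (K e)) ` edges D = {pts ?M}"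
    unfolding im img[OF sub(2,1)] BA by simp
  have xK: "x \<in> pts (K p)" "x \<in> pts (K q)" "x \<in> pts ?M"
    using at_x K(2)[of p] K(2)[of q] by (auto simp: pts_def)
  have x_only: "e \<in> ?M" if e: "e \<in> edges D" "x \<in> pts (K e)" for e
  proof -
    obtain g where g: "g \<in> K e" "x \<in> path_image g" using e by (auto simp: pts_def)
    then have "g \<in> edges D" using K(1) e by blast
    then obtain b where b: "end_pt (g, b) = x"
      using vertex_on_edge[of "(over_in D x, True)" g] g crossing_edges(1)[OF x] end_pt_crossing[OF x] by auto
    then have "g \<in> ?M" using crossing_ends[OF x \<open>g \<in> edges D\<close> b] ends by auto
    then show ?thesis using K(2)[of e] K(3)[OF g(1)] K(3)[of g p] K(3)[of g q] by blast
  qed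
  have "{Z \<in> (\<lambda>e. pts (K e)) ` edges D. x \<in> Z} = {pts (K p), pts (K q)}"
  proof -
    have "pts (K e) = pts (K p) \<or> pts (K e) = pts (K q)" if "e \<in> edges D" "x \<in> pts (K e)" for e
      using KM[OF x_only[OF that]] by metis
    then show ?thesis using xK(1,2) p(1,2) by blast
  qed
  moreover have "{Z \<in> (\<lambda>e. pts (K' e)) ` edges D. x \<in> Z} = {pts ?M}"
  proof -
    have "pts (K' e) = pts ?M" if "e \<in> edges D" "x \<in> pts (K' e)" for e
      using that x_only[of e] by (cases "e \<in> ?M") (auto simp: K')
    moreover have "pts ?M \<in> (\<lambda>e. pts (K' e)) ` edges D"
      using p K(2)[of p] by (intro image_eqI[of _ _ p]) (auto simp: K')
    ultimately show ?thesis using xK(3) by blast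
  qed
  moreover have "pts (K p) \<noteq> pts (K q)" using inj_pts K(1) p ne by (auto simp: inj_on_def)
  moreover have "\<Union> {pts (K p), pts (K q)} = \<Union> {pts ?M}" by (auto simp: pts_def)
  ultimately show ?thesis unfolding surgery_step_def d1 d2 using finite_edges by simp
qed

text \<open>With the crossing deleted, \<open>opposite_ends_not_joined\<close> forces each over end
  to be joined to an under end, so there are two strands. One smoothing closes them up separately
  and the other joins them to one circle. Which of these belongs to the state with value 0 only
  decides between splitting and merging, and \<open>surgery_step\<close> is symmetric.\<close>

lemma circles_surgery_step:
  assumes x: "x \<in> set (crossings D)" "x \<notin> \<alpha>"
  shows "surgery_step x (circles D \<alpha>) (circles D (insert x \<alpha>))"
proof -
  define M where "M = mates D \<alpha> (UNIV - {x})"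
  interpret m: end_matching "edges D" M
    unfolding M_def by (rule end_matching_mates) auto
  let ?oi = "over_in D x" and ?oo = "over_out D x" and ?ui = "under_in D x" and ?uo = "under_out D x"
  note E4 = crossing_edges(1-4)[OF x(1)] and P4 = end_pt_crossing[OF x(1)]
  note ne = in_noteq_out[OF x(1)] crossing_edges(9,10)[OF x(1)]
  have noopp: "?oo \<notin> m.strand ?oi" using opposite_ends_not_joined[OF x(1)] by (simp add: M_def)
  have free: "(e, b) \<notin> Domain M \<longleftrightarrow> end_pt (e, b) = x" if "e \<in> edges D" for e b
    unfolding M_def mates_Domain[OF that] by simp
  have in_free: "d \<in> m.free_ends (m.strand e) \<longleftrightarrow> fst d \<in> m.strand e \<and> end_pt d = x" if "e \<in> edges D" for e d
    using free[of "fst d" "snd d"] m.strand_subset[OF that] by (cases d) (auto simp: m.free_ends_def)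
  have partner: "\<exists>d. d \<noteq> (e, b) \<and> m.free_ends (m.strand e) = {(e, b), d} \<and>
      d \<in> {(?oi, True), (?ui, True), (?oo, False), (?uo, False)} \<and> fst d \<in> m.strand e"
    if e: "e \<in> edges D" and eb: "end_pt (e, b) = x" for e b
  proof -
    obtain d where d: "d \<noteq> (e, b)" "m.free_ends (m.strand e) = {(e, b), d}"
      using m.free_ends_pair[OF e, of b] free[OF e] eb by metis
    then have dd: "fst d \<in> m.strand e" "end_pt d = x" using in_free[OF e] by blast+
    then have "d \<in> {(?oi, True), (?ui, True), (?oo, False), (?uo, False)}"
      using crossing_ends[OF x(1), of "fst d" "snd d"] m.strand_subset[OF e] by auto
    then show ?thesis using d dd(1) by blast
  qed
  obtain d1 where d1: "d1 \<noteq> (?oi, True)" "m.free_ends (m.strand ?oi) = {(?oi, True), d1}"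
      "d1 \<in> {(?oi, True), (?ui, True), (?oo, False), (?uo, False)}" "fst d1 \<in> m.strand ?oi"
    using partner[OF E4(1) P4(1)] by blast
  obtain d2 where d2: "d2 \<noteq> (?oo, False)" "m.free_ends (m.strand ?oo) = {(?oo, False), d2}"
      "d2 \<in> {(?oi, True), (?ui, True), (?oo, False), (?uo, False)}" "fst d2 \<in> m.strand ?oo"
    using partner[OF E4(3) P4(3)] by blast
  have "d1 \<noteq> (?oo, False)" using d1(4) noopp by auto
  then have d1': "d1 = (?ui, True) \<or> d1 = (?uo, False)" using d1 by auto
  have oi_no: "?oi \<notin> m.strand ?oo" using noopp m.strand_sym by blast
  then have "d2 \<noteq> (?oi, True)" using d2(4) by auto
  then have d2': "d2 = (?ui, True) \<or> d2 = (?uo, False)" using d2 by auto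
  \<comment> \<open>Otherwise both over ends would lie on a common strand.\<close>
  have "d1 \<noteq> d2"
  proof
    assume "d1 = d2"
    then have "fst d1 \<in> m.strand ?oo" using d2(4) by simp
    then show False using d1(4) m.strand_eq noopp m.strand_refl by metis
  qed
  then have cases: "?ui \<in> m.strand ?oi \<and> ?uo \<in> m.strand ?oo \<or> ?uo \<in> m.strand ?oi \<and> ?ui \<in> m.strand ?oo"
    using d1' d2' d1(4) d2(4) by auto
  let ?K = m.strand
  have M_eq: "mates D \<gamma> (UNIV - {x}) = M" if "\<gamma> = \<alpha> \<or> \<gamma> = insert x \<alpha>" for \<gamma>
  proof -
    have "mates_at D \<gamma> v = mates_at D \<alpha> v" if "v \<noteq> x" for v
    proof -
      have "consistent D \<gamma> v = consistent D \<alpha> v" using that \<open>\<gamma> = \<alpha> \<or> _\<close> by (auto simp: consistent_def)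
      then show ?thesis by (simp add: mates_at_def)
    qed
    then show ?thesis by (auto simp: M_def mates_def)
  qed
  have R: "joined D \<gamma> \<union> (joined D \<gamma>)\<inverse> = m.adj \<union>
      (if consistent D \<gamma> x then {(?oi, ?uo), (?uo, ?oi), (?ui, ?oo), (?oo, ?ui)}
       else {(?oi, ?ui), (?ui, ?oi), (?uo, ?oo), (?oo, ?uo)})" if "\<gamma> = \<alpha> \<or> \<gamma> = insert x \<alpha>" for \<gamma>
  proof -
    have "mates D \<gamma> UNIV = M \<union> mates_at D \<gamma> x" using M_eq[OF that] by (auto simp: mates_def)
    then have "joined D \<gamma> \<union> (joined D \<gamma>)\<inverse> = m.adj \<union> {(e, f). \<exists>b c. ((e, b), (f, c)) \<in> mates_at D \<gamma> x}"
      unfolding joined_eq m.adj_def by auto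
    moreover have "{(e, f). \<exists>b c. ((e, b), (f, c)) \<in> mates_at D \<gamma> x} =
        (if consistent D \<gamma> x then {(?oi, ?uo), (?uo, ?oi), (?ui, ?oo), (?oo, ?ui)}
         else {(?oi, ?ui), (?ui, ?oi), (?uo, ?oo), (?oo, ?uo)})"
    proof (cases "consistent D \<gamma> x")
      case True
      then have "mates_at D \<gamma> x = {((?oi, True), (?uo, False)), ((?uo, False), (?oi, True)),
          ((?ui, True), (?oo, False)), ((?oo, False), (?ui, True))}"
        using x(1) unfolding mates_at_def Let_def by (simp only: if_True) blast
      then show ?thesis using True by (simp only: end_pairs_insert if_True)
    next
      case False
      then have "mates_at D \<gamma> x = {((?oi, True), (?ui, True)), ((?ui, True), (?oi, True)),
          ((?uo, False), (?oo, False)), ((?oo, False), (?uo, False))}"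
        using x(1) unfolding mates_at_def Let_def by (simp only: if_True if_False) blast
      then show ?thesis using False by (simp only: end_pairs_insert if_False)
    qed
    ultimately show ?thesis by (simp only:)
  qed
  have K_rt: "m.adj\<^sup>* `` {e} = ?K e" for e by (simp add: m.strand_def)
  have rt: "(e, f) \<in> m.adj\<^sup>* \<longleftrightarrow> f \<in> ?K e" for e f by (simp add: m.strand_def)
  have at_x: "x \<in> path_image ?oi" "x \<in> path_image ?oo"
    using end_pt_in_image[of "(?oi, True)"] end_pt_in_image[of "(?oo, False)"] P4 by auto
  have step: "surgery_step x ((\<lambda>e. pts (?K e)) ` edges D)
      ((\<lambda>e. pts (if e \<in> ?K ?oi \<union> ?K ?oo then ?K ?oi \<union> ?K ?oo else ?K e)) ` edges D)"
    by (rule merge_step[OF x(1) m.strand_subset m.strand_refl m.strand_eq E4(1,3) noopp _ _ _ _ at_x])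
      (use cases m.strand_refl in auto)
  \<comment> \<open>Here \<open>\<gamma>\<close> is the state whose smoothing closes up both
    strands, and \<open>\<delta>\<close> is the other one.\<close>
  have circ: "circles D \<gamma> = (\<lambda>e. pts (?K e)) ` edges D \<and> circles D \<delta> =
      (\<lambda>e. pts (if e \<in> ?K ?oi \<union> ?K ?oo then ?K ?oi \<union> ?K ?oo else ?K e)) ` edges D"
    if \<gamma>: "\<gamma> = \<alpha> \<or> \<gamma> = insert x \<alpha>" and \<delta>: "\<delta> = \<alpha> \<or> \<delta> = insert x \<alpha>"
      and c: "consistent D \<gamma> x \<longleftrightarrow> ?uo \<in> ?K ?oi" "consistent D \<delta> x \<longleftrightarrow> \<not> consistent D \<gamma> x" for \<gamma> \<delta>
  proof (cases "?uo \<in> ?K ?oi")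
    case True
    have ui: "?ui \<in> ?K ?oo"
    proof -
      have "?uo \<notin> ?K ?oo" using True m.strand_eq noopp m.strand_refl by metis
      then show ?thesis using cases by blast
    qed
    have eq: "?K ?ui = ?K ?oo" using m.strand_eq[OF ui] .
    have "(joined D \<gamma> \<union> (joined D \<gamma>)\<inverse>)\<^sup>* = m.adj\<^sup>*"
      by (rule rtrancl_same[OF m.sym_adj, of ?oi ?uo ?ui ?oo]) (use R[OF \<gamma>] c True ui rt m.strand_sym in auto)
    moreover have "(joined D \<delta> \<union> (joined D \<delta>)\<inverse>)\<^sup>* `` {e} =
        (if e \<in> ?K ?oi \<union> ?K ?ui then ?K ?oi \<union> ?K ?ui else ?K e)" for e
      unfolding K_rt[symmetric]
      by (rule rtrancl_merge[OF m.sym_adj, of ?oi ?uo ?ui ?oo]) (use R[OF \<delta>] c True ui rt m.strand_sym in auto)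
    ultimately show ?thesis unfolding circles_eq K_rt eq by (simp add: K_rt)
  next
    case False
    then have u: "?ui \<in> ?K ?oi" "?uo \<in> ?K ?oo" using cases by blast+
    have eq: "?K ?uo = ?K ?oo" using m.strand_eq[OF u(2)] .
    have "(joined D \<gamma> \<union> (joined D \<gamma>)\<inverse>)\<^sup>* = m.adj\<^sup>*"
      by (rule rtrancl_same[OF m.sym_adj, of ?oi ?ui ?uo ?oo]) (use R[OF \<gamma>] c False u rt m.strand_sym in auto)
    moreover have "(joined D \<delta> \<union> (joined D \<delta>)\<inverse>)\<^sup>* `` {e} =
        (if e \<in> ?K ?oi \<union> ?K ?uo then ?K ?oi \<union> ?K ?uo else ?K e)" for e
      unfolding K_rt[symmetric]
      by (rule rtrancl_merge[OF m.sym_adj, of ?oi ?ui ?uo ?oo]) (use R[OF \<delta>] c False u rt m.strand_sym in auto)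
    ultimately show ?thesis unfolding circles_eq K_rt eq by (simp add: K_rt)
  qed
  have flip: "consistent D (insert x \<alpha>) x \<longleftrightarrow> \<not> consistent D \<alpha> x" using x(2) by (auto simp: consistent_def)
  show ?thesis
  proof (cases "consistent D \<alpha> x \<longleftrightarrow> ?uo \<in> ?K ?oi")
    case True
    then show ?thesis using circ[of \<alpha> "insert x \<alpha>"] flip step by simp
  next
    case False
    then show ?thesis using circ[of "insert x \<alpha>" \<alpha>] flip surgery_step_sym[OF step] by simp
  qed
qed

theorem surgery_cube_link: "surgery_cube D"
  unfolding surgery_cube_def using link finite_circles_link circles_surgery_step by (auto simp: link_diagram_def)

end

section \<open>Rows as sums of Khovanov complexes\<close>

lemma image_doubleton_singleton:
  assumes inj: "inj_on \<Psi> (U \<union> V)"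
  shows "(\<exists>X Y Z. X \<noteq> Y \<and> \<Psi> ` U = {X, Y} \<and> \<Psi> ` V = {Z} \<and> Q X Y Z) \<longleftrightarrow>
    (\<exists>X Y Z. X \<noteq> Y \<and> U = {X, Y} \<and> V = {Z} \<and> Q (\<Psi> X) (\<Psi> Y) (\<Psi> Z))"
proof
  assume "\<exists>X Y Z. X \<noteq> Y \<and> \<Psi> ` U = {X, Y} \<and> \<Psi> ` V = {Z} \<and> Q X Y Z"
  then obtain X Y Z where *: "X \<noteq> Y" "\<Psi> ` U = {X, Y}" "\<Psi> ` V = {Z}" "Q X Y Z" by blast
  have "X \<in> \<Psi> ` U" "Y \<in> \<Psi> ` U" "Z \<in> \<Psi> ` V" unfolding * by simp_all
  then obtain X' Y' Z' where **: "X' \<in> U" "Y' \<in> U" "Z' \<in> V" "X = \<Psi> X'" "Y = \<Psi> Y'" "Z = \<Psi> Z'"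
    by blast
  have "U = {X', Y'}" using inj_on_image_eq_iff[OF inj, of U "{X', Y'}"] * ** by simp
  moreover have "V = {Z'}" using inj_on_image_eq_iff[OF inj, of V "{Z'}"] * ** by simp
  ultimately show "\<exists>X Y Z. X \<noteq> Y \<and> U = {X, Y} \<and> V = {Z} \<and> Q (\<Psi> X) (\<Psi> Y) (\<Psi> Z)"
    using * ** by (intro exI[of _ X'] exI[of _ Y'] exI[of _ Z']) auto
next
  assume "\<exists>X Y Z. X \<noteq> Y \<and> U = {X, Y} \<and> V = {Z} \<and> Q (\<Psi> X) (\<Psi> Y) (\<Psi> Z)"
  then obtain X Y Z where *: "X \<noteq> Y" "U = {X, Y}" "V = {Z}" "Q (\<Psi> X) (\<Psi> Y) (\<Psi> Z)" by blast
  moreover from this have "\<Psi> X \<noteq> \<Psi> Y" using inj by (auto simp: inj_on_def)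
  ultimately show "\<exists>X Y Z. X \<noteq> Y \<and> \<Psi> ` U = {X, Y} \<and> \<Psi> ` V = {Z} \<and> Q X Y Z"
    by (intro exI[of _ "\<Psi> X"] exI[of _ "\<Psi> Y"] exI[of _ "\<Psi> Z"]) simp
qed

text \<open>The coefficient depends only on which circles change and on the labels, so an injective
  renaming does not affect it. The circles in \<open>Cl\<close> occur on both sides and merely have
  to keep their labels.\<close>

lemma arrow_coeff_image:
  assumes inj: "inj_on \<Psi> (A \<union> B)" and Cl: "Cl \<inter> \<Psi> ` (A \<union> B) = {}"
    and s': "\<And>Z. Z \<in> A \<Longrightarrow> s' Z = s (\<Psi> Z)" and t': "\<And>Z. Z \<in> B \<Longrightarrow> t' Z = t (\<Psi> Z)"
  shows "arrow_coeff (\<Psi> ` A \<union> Cl) (\<Psi> ` B \<union> Cl) s t =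
    (if \<forall>Z\<in>Cl. s Z = t Z then arrow_coeff A B s' t' else (0 :: 'k::field))"
proof -
  have "\<Psi> ` A - \<Psi> ` B = \<Psi> ` (A - B)" "\<Psi> ` B - \<Psi> ` A = \<Psi> ` (B - A)" "\<Psi> ` A \<inter> \<Psi> ` B = \<Psi> ` (A \<inter> B)"
    using inj by (auto simp: inj_on_def)
  moreover have "(\<Psi> ` A \<union> Cl) - (\<Psi> ` B \<union> Cl) = \<Psi> ` A - \<Psi> ` B"
    "(\<Psi> ` B \<union> Cl) - (\<Psi> ` A \<union> Cl) = \<Psi> ` B - \<Psi> ` A" using Cl by blast+
  moreover have "(\<Psi> ` A \<union> Cl) \<inter> (\<Psi> ` B \<union> Cl) = (\<Psi> ` A \<inter> \<Psi> ` B) \<union> Cl" by blast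
  ultimately have D: "(\<Psi> ` A \<union> Cl) - (\<Psi> ` B \<union> Cl) = \<Psi> ` (A - B)" "(\<Psi> ` B \<union> Cl) - (\<Psi> ` A \<union> Cl) = \<Psi> ` (B - A)"
    "(\<Psi> ` A \<union> Cl) \<inter> (\<Psi> ` B \<union> Cl) = \<Psi> ` (A \<inter> B) \<union> Cl"
    by simp_all
  have 1: "(\<forall>Z\<in>\<Psi> ` (A \<inter> B) \<union> Cl. s Z = t Z) \<longleftrightarrow> (\<forall>Z\<in>Cl. s Z = t Z) \<and> (\<forall>Z\<in>A \<inter> B. s' Z = t' Z)"
    using s' t' by auto
  have inj': "inj_on \<Psi> ((A - B) \<union> (B - A))" "inj_on \<Psi> ((B - A) \<union> (A - B))"
    by (rule inj_on_subset[OF inj]; blast)+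
  have 2: "(\<exists>X Y Z. X \<noteq> Y \<and> \<Psi> ` (A - B) = {X, Y} \<and> \<Psi> ` (B - A) = {Z} \<and> Q (s X) (s Y) (t Z)) \<longleftrightarrow>
      (\<exists>X Y Z. X \<noteq> Y \<and> A - B = {X, Y} \<and> B - A = {Z} \<and> Q (s' X) (s' Y) (t' Z))" for Q
  proof -
    have "Q (s (\<Psi> X)) (s (\<Psi> Y)) (t (\<Psi> Z)) \<longleftrightarrow> Q (s' X) (s' Y) (t' Z)"
      if "A - B = {X, Y}" "B - A = {Z}" for X Y Z
    proof -
      have "X \<in> A" "Y \<in> A" "Z \<in> B" using that by auto
      then show ?thesis using s' t' by simp
    qed
    then show ?thesis unfolding image_doubleton_singleton[OF inj'(1)] by (intro ex_cong1 conj_cong refl) blast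
  qed
  have 3: "(\<exists>X Y Z. X \<noteq> Y \<and> \<Psi> ` (A - B) = {Z} \<and> \<Psi> ` (B - A) = {X, Y} \<and> Q (s Z) (t X) (t Y)) \<longleftrightarrow>
      (\<exists>X Y Z. X \<noteq> Y \<and> A - B = {Z} \<and> B - A = {X, Y} \<and> Q (s' Z) (t' X) (t' Y))" for Q
  proof -
    have "Q (s (\<Psi> Z)) (t (\<Psi> X)) (t (\<Psi> Y)) \<longleftrightarrow> Q (s' Z) (t' X) (t' Y)"
      if "B - A = {X, Y}" "A - B = {Z}" for X Y Z
    proof -
      have "X \<in> B" "Y \<in> B" "Z \<in> A" using that by auto
      then show ?thesis using s' t' by simp
    qed
    then have "(\<exists>X Y Z. X \<noteq> Y \<and> \<Psi> ` (B - A) = {X, Y} \<and> \<Psi> ` (A - B) = {Z} \<and> Q (s Z) (t X) (t Y)) \<longleftrightarrow>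
      (\<exists>X Y Z. X \<noteq> Y \<and> B - A = {X, Y} \<and> A - B = {Z} \<and> Q (s' Z) (t' X) (t' Y))"
      unfolding image_doubleton_singleton[OF inj'(2)] by (intro ex_cong1 conj_cong refl) blast
    moreover have "X \<noteq> Y \<and> P \<and> P' \<and> R \<longleftrightarrow> X \<noteq> Y \<and> P' \<and> P \<and> R" for X Y :: "complex set" and P P' R by blast
    ultimately show ?thesis by (simp only: conj_left_commute)
  qed
  show ?thesis unfolding arrow_coeff_def D 1 2 3 by auto
qed

text \<open>
  For a state \<open>\<beta>\<close> of the crossings \<open>X2\<close>, the circles of \<open>L\<close> are those of the surgered diagram \<open>D (pt \<beta>)\<close>,
  rerouted by \<open>\<Psi> \<beta>\<close>, together with the circles \<open>Cl \<beta>\<close> that stay on the side of \<open>X2\<close>.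
\<close>

locale glued_circles =
  fixes L :: diagram and X1 X2 :: "complex set" and I :: "'i set" and D :: "'i \<Rightarrow> diagram"
    and pt :: "complex set \<Rightarrow> 'i" and \<Psi> :: "complex set \<Rightarrow> complex set \<Rightarrow> complex set"
    and Cl :: "complex set \<Rightarrow> complex set set"
  assumes X: "X1 \<union> X2 = set (crossings L)" "X1 \<inter> X2 = {}"
    and distinct_L: "distinct (crossings L)"
    and finite_circles: "\<gamma> \<subseteq> set (crossings L) \<Longrightarrow> finite (circles L \<gamma>)"
    and pt: "\<beta> \<subseteq> X2 \<Longrightarrow> pt \<beta> \<in> I"
    and crossings_D: "i \<in> I \<Longrightarrow> set (crossings (D i)) = X1" "i \<in> I \<Longrightarrow> distinct (crossings (D i))"
      "i \<in> I \<Longrightarrow> x \<in> X1 \<Longrightarrow> positive_crossing (D i) x \<longleftrightarrow> positive_crossing L x"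
    and inj_\<Psi>: "\<beta> \<subseteq> X2 \<Longrightarrow> inj_on (\<Psi> \<beta>) (\<Union>\<alpha>\<in>Pow X1. circles (D (pt \<beta>)) \<alpha>)"
    and Cl_\<Psi>: "\<beta> \<subseteq> X2 \<Longrightarrow> Cl \<beta> \<inter> \<Psi> \<beta> ` (\<Union>\<alpha>\<in>Pow X1. circles (D (pt \<beta>)) \<alpha>) = {}"
    and circles_L: "\<beta> \<subseteq> X2 \<Longrightarrow> \<alpha> \<subseteq> X1 \<Longrightarrow> circles L (\<alpha> \<union> \<beta>) = \<Psi> \<beta> ` circles (D (pt \<beta>)) \<alpha> \<union> Cl \<beta>"
begin

text \<open>The multiplicity of the surgery \<open>i\<close> in row \<open>q\<close>: one basis
  vector for each state of \<open>X2\<close> leading to \<open>i\<close> and each labelling of its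
  inert circles. The degree carries the share of \<open>X2\<close> in the shifts of
  \<open>khovanov L\<close>.\<close>

definition coeff_space :: "int \<Rightarrow> 'i \<Rightarrow> (complex set \<times> (complex set \<Rightarrow> vgen)) graded" where
  "coeff_space q i =
     \<lparr> gbasis = {(\<beta>, u). \<beta> \<subseteq> X2 \<and> int (card \<beta>) - int (card {x \<in> X2. \<not> positive_crossing L x}) = q \<and>
         pt \<beta> = i \<and> u \<in> Cl \<beta> \<rightarrow>\<^sub>E UNIV},
       gdeg = (\<lambda>(\<beta>, u). (\<Sum>Z\<in>Cl \<beta>. vdegree (u Z)) + int (card \<beta>) +
         int (card {x \<in> X2. positive_crossing L x}) - 2 * int (card {x \<in> X2. \<not> positive_crossing L x})) \<rparr>"

definition split_gen where
  "split_gen = (\<lambda>(\<gamma>, s). let \<beta> = \<gamma> \<inter> X2; \<alpha> = \<gamma> \<inter> X1 in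
     (pt \<beta>, ((\<beta>, restrict s (Cl \<beta>)), (\<alpha>, \<lambda>Z\<in>circles (D (pt \<beta>)) \<alpha>. s (\<Psi> \<beta> Z)))))"

definition join_gen where
  "join_gen = (\<lambda>(i :: 'i, ((\<beta>, u), (\<alpha>, s'))). (\<alpha> \<union> \<beta>, \<lambda>Z\<in>circles L (\<alpha> \<union> \<beta>).
     if Z \<in> Cl \<beta> then u Z else (s' (inv_into (circles (D (pt \<beta>)) \<alpha>) (\<Psi> \<beta>) Z) :: vgen)))"

lemma finite_X: "finite X1" "finite X2"
  using X(1) by (metis finite_Un finite_set)+

lemma inj_\<Psi>': "\<beta> \<subseteq> X2 \<Longrightarrow> \<alpha> \<subseteq> X1 \<Longrightarrow> inj_on (\<Psi> \<beta>) (circles (D (pt \<beta>)) \<alpha>)"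
  by (rule inj_on_subset[OF inj_\<Psi>]) auto

lemma Cl_\<Psi>': "\<beta> \<subseteq> X2 \<Longrightarrow> \<alpha> \<subseteq> X1 \<Longrightarrow> Cl \<beta> \<inter> \<Psi> \<beta> ` circles (D (pt \<beta>)) \<alpha> = {}"
  using Cl_\<Psi> by blast

lemma finite_Cl: "\<beta> \<subseteq> X2 \<Longrightarrow> finite (Cl \<beta>)"
  using finite_circles[of \<beta>] circles_L[of \<beta> "{}"] X by auto

lemma finite_circles_D: "\<beta> \<subseteq> X2 \<Longrightarrow> \<alpha> \<subseteq> X1 \<Longrightarrow> finite (circles (D (pt \<beta>)) \<alpha>)"
  using finite_circles[of "\<alpha> \<union> \<beta>"] circles_L[of \<beta> \<alpha>] X(1) finite_imageD[OF _ inj_\<Psi>']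
  by (metis Un_commute Un_mono finite_Un)

lemma finite_coeff_space: "finite (gbasis (coeff_space q i))"
proof (rule finite_subset)
  show "gbasis (coeff_space q i) \<subseteq> (SIGMA \<beta>:Pow X2. Cl \<beta> \<rightarrow>\<^sub>E UNIV)" by (auto simp: coeff_space_def)
  show "finite (SIGMA \<beta>:Pow X2. Cl \<beta> \<rightarrow>\<^sub>E (UNIV :: vgen set))"
    using finite_X finite_Cl by (intro finite_SigmaI finite_PiE) (auto simp: UNIV_vgen)
qed

context
  fixes r :: "complex \<Rightarrow> complex \<Rightarrow> bool" and q :: int
  assumes r: "tournament r (set (crossings L))"
begin

abbreviation row :: "(complex set \<times> (complex set \<Rightarrow> vgen), 'k::field) cpx" where
  "row \<equiv> row_cpx (cube_dcpx L r X1 X2) q"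

abbreviation summands where
  "summands \<equiv> direct_sum_cpx I (\<lambda>i. tensor_cpx (coeff_space q i) (khovanov (D i) :: (_, 'k::field) cpx))"

lemma gens_row:
  "(\<gamma>, s) \<in> gens (row :: (_, 'k::field) cpx) \<longleftrightarrow> \<gamma> \<subseteq> X1 \<union> X2 \<and> s \<in> circles L \<gamma> \<rightarrow>\<^sub>E UNIV \<and>
     int (card (\<gamma> \<inter> X2)) - int (card {x \<in> X2. \<not> positive_crossing L x}) = q"
  by (auto simp: row_cpx_def cube_dcpx_def khovanov_gens_def X)

lemma gens_summands:
  "(i, ((\<beta>, u), (\<alpha>, s'))) \<in> gens (summands :: (_, 'k::field) cpx) \<longleftrightarrow> i \<in> I \<and> i = pt \<beta> \<and> \<beta> \<subseteq> X2 \<and>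
     int (card \<beta>) - int (card {x \<in> X2. \<not> positive_crossing L x}) = q \<and> u \<in> Cl \<beta> \<rightarrow>\<^sub>E UNIV \<and>
     \<alpha> \<subseteq> X1 \<and> s' \<in> circles (D i) \<alpha> \<rightarrow>\<^sub>E UNIV"
  by (auto simp: direct_sum_cpx_def tensor_cpx_def coeff_space_def khovanov_def khovanov_gens_def crossings_D)

lemma split_gen_bij: "bij_betw split_gen (gens (row :: (_, 'k::field) cpx)) (gens (summands :: (_, 'k) cpx))"
proof (rule bij_betw_byWitness[where f'=join_gen])
  show "\<forall>b\<in>gens (row :: (_, 'k) cpx). join_gen (split_gen b) = b"
  proof
    fix b assume b: "b \<in> gens (row :: (_, 'k) cpx)"
    obtain \<gamma> s where b_eq: "b = (\<gamma>, s)" by fastforce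
    let ?\<beta> = "\<gamma> \<inter> X2" and ?\<alpha> = "\<gamma> \<inter> X1"
    have g: "\<gamma> \<subseteq> X1 \<union> X2" "s \<in> circles L \<gamma> \<rightarrow>\<^sub>E UNIV" using b unfolding b_eq gens_row by auto
    have u: "?\<alpha> \<union> ?\<beta> = \<gamma>" using g(1) by auto
    have c: "circles L \<gamma> = \<Psi> ?\<beta> ` circles (D (pt ?\<beta>)) ?\<alpha> \<union> Cl ?\<beta>" using circles_L[of ?\<beta> ?\<alpha>] u by simp
    have inj: "inj_on (\<Psi> ?\<beta>) (circles (D (pt ?\<beta>)) ?\<alpha>)" by (rule inj_\<Psi>') auto
    have "(\<lambda>Z\<in>circles L \<gamma>. if Z \<in> Cl ?\<beta> then restrict s (Cl ?\<beta>) Z else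
        (\<lambda>Z\<in>circles (D (pt ?\<beta>)) ?\<alpha>. s (\<Psi> ?\<beta> Z)) (inv_into (circles (D (pt ?\<beta>)) ?\<alpha>) (\<Psi> ?\<beta>) Z)) = s"
      (is "?s = s")
    proof (rule PiE_ext[OF _ g(2)])
      show "?s \<in> circles L \<gamma> \<rightarrow>\<^sub>E UNIV" by simp
      fix Z assume "Z \<in> circles L \<gamma>"
      then show "?s Z = s Z" unfolding c using inj by auto
    qed
    then show "join_gen (split_gen b) = b" by (simp add: b_eq split_gen_def join_gen_def Let_def u)
  qed
  have split_join: "split_gen (join_gen c) = c" and join_in: "join_gen c \<in> gens (row :: (_, 'k) cpx)"
    if c: "c \<in> gens (summands :: (_, 'k) cpx)" for c
  proof -
    obtain i \<beta> u \<alpha> s' where c_eq: "c = (i, ((\<beta>, u), (\<alpha>, s')))" by (metis surj_pair)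
    have g: "i = pt \<beta>" "\<beta> \<subseteq> X2" "u \<in> Cl \<beta> \<rightarrow>\<^sub>E UNIV" "\<alpha> \<subseteq> X1" "s' \<in> circles (D i) \<alpha> \<rightarrow>\<^sub>E UNIV"
      "int (card \<beta>) - int (card {x \<in> X2. \<not> positive_crossing L x}) = q"
      using c unfolding c_eq gens_summands by auto
    have u: "(\<alpha> \<union> \<beta>) \<inter> X2 = \<beta>" "(\<alpha> \<union> \<beta>) \<inter> X1 = \<alpha>" using g X(2) by auto
    note cL = circles_L[OF g(2,4)] and inj = inj_\<Psi>'[OF g(2,4)] and disj = Cl_\<Psi>'[OF g(2,4)]
    let ?s = "\<lambda>Z\<in>circles L (\<alpha> \<union> \<beta>). if Z \<in> Cl \<beta> then u Z else s' (inv_into (circles (D (pt \<beta>)) \<alpha>) (\<Psi> \<beta>) Z)"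
    have "restrict ?s (Cl \<beta>) = u"
      by (rule PiE_ext[OF _ g(3)]) (auto simp: cL)
    moreover have "(\<lambda>Z\<in>circles (D (pt \<beta>)) \<alpha>. ?s (\<Psi> \<beta> Z)) = s'"
      by (rule PiE_ext[OF _ g(5)]) (use inj disj g(1) in \<open>auto simp: cL\<close>)
    ultimately show "split_gen (join_gen c) = c"
      by (simp add: c_eq split_gen_def join_gen_def Let_def u g(1))
    show "join_gen c \<in> gens (row :: (_, 'k) cpx)"
      unfolding c_eq join_gen_def using g(2,4,6) u by (simp add: gens_row) auto
  qed
  show "\<forall>c\<in>gens (summands :: (_, 'k) cpx). split_gen (join_gen c) = c"
    and "join_gen ` gens (summands :: (_, 'k) cpx) \<subseteq> gens (row :: (_, 'k) cpx)"
    using split_join join_in by auto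
  show "split_gen ` gens (row :: (_, 'k) cpx) \<subseteq> gens (summands :: (_, 'k) cpx)"
  proof
    fix c assume "c \<in> split_gen ` gens (row :: (_, 'k) cpx)"
    then obtain \<gamma> s where "c = split_gen (\<gamma>, s)" "(\<gamma>, s) \<in> gens (row :: (_, 'k) cpx)" by fastforce
    then show "c \<in> gens (summands :: (_, 'k) cpx)"
      using pt[of "\<gamma> \<inter> X2"] by (auto simp: gens_row gens_summands split_gen_def Let_def)
  qed
qed

lemma count_crossings:
  assumes "i \<in> I"
  shows "lneg L = lneg (D i) + card {x \<in> X2. \<not> positive_crossing L x}"
    and "lpos L = lpos (D i) + card {x \<in> X2. positive_crossing L x}"
    and "lneg (D i) = card {x \<in> X1. \<not> positive_crossing L x}"
proof -
  have "card {x \<in> X1 \<union> X2. Q x} = card {x \<in> X1. Q x} + card {x \<in> X2. Q x}" for Q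
  proof -
    have "{x \<in> X1 \<union> X2. Q x} = {x \<in> X1. Q x} \<union> {x \<in> X2. Q x}" by auto
    then show ?thesis using finite_X X(2) by (simp add: card_Un_disjoint disjoint_iff)
  qed
  moreover have "{x \<in> X1. positive_crossing (D i) x} = {x \<in> X1. positive_crossing L x}"
      "{x \<in> X1. \<not> positive_crossing (D i) x} = {x \<in> X1. \<not> positive_crossing L x}"
    using crossings_D(3)[OF assms] by auto
  ultimately show "lneg L = lneg (D i) + card {x \<in> X2. \<not> positive_crossing L x}"
    and "lpos L = lpos (D i) + card {x \<in> X2. positive_crossing L x}"
    and "lneg (D i) = card {x \<in> X1. \<not> positive_crossing L x}"
    unfolding lneg_def lpos_def crossings_D(1)[OF assms] X(1)[symmetric] by simp_all
qed

lemma split_gen_degree: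
  assumes b: "b \<in> gens (row :: (_, 'k::field) cpx)"
  shows "hdeg (summands :: (_, 'k) cpx) (split_gen b) = hdeg (row :: (_, 'k) cpx) b"
    and "qdeg (summands :: (_, 'k) cpx) (split_gen b) = qdeg (row :: (_, 'k) cpx) b"
proof -
  obtain \<gamma> s where b_eq: "b = (\<gamma>, s)" by fastforce
  let ?\<beta> = "\<gamma> \<inter> X2" and ?\<alpha> = "\<gamma> \<inter> X1"
  let ?i = "pt ?\<beta>"
  have i: "?i \<in> I" using pt by auto
  have \<gamma>: "?\<alpha> \<union> ?\<beta> = \<gamma>" using b unfolding b_eq gens_row by auto
  note cc = count_crossings[OF i]
  show "hdeg (summands :: (_, 'k) cpx) (split_gen b) = hdeg (row :: (_, 'k) cpx) b"
    by (simp add: b_eq split_gen_def Let_def direct_sum_cpx_def tensor_cpx_def khovanov_def row_cpx_def cube_dcpx_def cc)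
  have "card \<gamma> = card ?\<alpha> + card ?\<beta>"
    using finite_X X(2) by (subst \<gamma>[symmetric], subst card_Un_disjoint) auto
  moreover have "(\<Sum>Z\<in>circles L \<gamma>. vdegree (s Z)) =
      (\<Sum>Z\<in>Cl ?\<beta>. vdegree (restrict s (Cl ?\<beta>) Z)) +
      (\<Sum>Z\<in>circles (D ?i) ?\<alpha>. vdegree ((\<lambda>Z\<in>circles (D ?i) ?\<alpha>. s (\<Psi> ?\<beta> Z)) Z))"
  proof -
    have "circles L \<gamma> = \<Psi> ?\<beta> ` circles (D ?i) ?\<alpha> \<union> Cl ?\<beta>" using circles_L[of ?\<beta> ?\<alpha>] \<gamma> by simp
    moreover have "(\<Sum>Z\<in>\<Psi> ?\<beta> ` circles (D ?i) ?\<alpha> \<union> Cl ?\<beta>. vdegree (s Z)) =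
        (\<Sum>Z\<in>\<Psi> ?\<beta> ` circles (D ?i) ?\<alpha>. vdegree (s Z)) + (\<Sum>Z\<in>Cl ?\<beta>. vdegree (s Z))"
      using finite_Cl finite_circles_D Cl_\<Psi>'[of ?\<beta> ?\<alpha>] by (intro sum.union_disjoint) auto
    moreover have "(\<Sum>Z\<in>\<Psi> ?\<beta> ` circles (D ?i) ?\<alpha>. vdegree (s Z)) = (\<Sum>Z\<in>circles (D ?i) ?\<alpha>. vdegree (s (\<Psi> ?\<beta> Z)))"
      using inj_\<Psi>'[of ?\<beta> ?\<alpha>] by (simp add: sum.reindex)
    ultimately show ?thesis by simp
  qed
  ultimately show "qdeg (summands :: (_, 'k) cpx) (split_gen b) = qdeg (row :: (_, 'k) cpx) b"
    by (simp add: b_eq split_gen_def Let_def direct_sum_cpx_def tensor_cpx_def khovanov_def row_cpx_def cube_dcpx_def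
        coeff_space_def cc)
qed

text \<open>A surgery may list its crossings in another order than the one used in the row. The
  correction depends on the \<open>X2\<close> part of the state through the surgery, and this part
  is constant along horizontal arrows.\<close>

definition gen_sign :: "complex set \<times> (complex set \<Rightarrow> vgen) \<Rightarrow> 'k::field" where
  "gen_sign = (\<lambda>(\<gamma>, s). inversion_sign r (before (crossings (D (pt (\<gamma> \<inter> X2))))) (\<gamma> \<inter> X1))"

text \<open>Along a horizontal arrow only the \<open>X1\<close> part of the state changes. The
  coefficients then agree by \<open>arrow_coeff_image\<close> and the signs by
  \<open>inversion_sign_insert\<close>; for all other pairs of states both entries vanish.\<close>

lemma split_gen_bd:
  assumes b: "b \<in> gens (row :: (_, 'k::field) cpx)" and c: "c \<in> gens (row :: (_, 'k) cpx)"
  shows "gen_sign b * bd (summands :: (_, 'k) cpx) (split_gen b) (split_gen c) = bd (row :: (_, 'k) cpx) b c * gen_sign c"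
proof -
  obtain \<gamma> s \<delta> t where bc: "b = (\<gamma>, s)" "c = (\<delta>, t)" by fastforce
  let ?\<beta> = "\<gamma> \<inter> X2" and ?\<alpha> = "\<gamma> \<inter> X1"
  let ?i = "pt ?\<beta>"
  let ?r' = "before (crossings (D ?i))"
  have \<beta>: "?\<beta> \<subseteq> X2" "?\<alpha> \<subseteq> X1" by auto
  have i: "?i \<in> I" using pt[OF \<beta>(1)] .
  have \<gamma>: "?\<alpha> \<union> ?\<beta> = \<gamma>" "\<gamma> \<subseteq> X1 \<union> X2" and \<delta>: "\<delta> \<subseteq> X1 \<union> X2"
    using b c unfolding bc gens_row by auto
  have gens: "b \<in> khovanov_gens L" "c \<in> khovanov_gens L"
    using b c by (auto simp: row_cpx_def cube_dcpx_def)
  have bd_row: "bd (row :: (_, 'k) cpx) b c = partial_bd L X1 (\<lambda>\<alpha>. order_sign r (\<alpha> \<inter> X1)) b c"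
    using b c by (auto simp: row_cpx_def cube_dcpx_def restrict_mat_def)
  have bd_sum: "bd (summands :: (_, 'k) cpx) (split_gen b) (split_gen c) =
      (if ?i = pt (\<delta> \<inter> X2) \<and> ?\<beta> = \<delta> \<inter> X2 \<and> restrict s (Cl ?\<beta>) = restrict t (Cl (\<delta> \<inter> X2)) then
        bd (khovanov (D ?i) :: (_, 'k) cpx) (snd (snd (split_gen b))) (snd (snd (split_gen c))) else 0)"
  proof -
    have "fst (snd (split_gen b)) \<in> gbasis (coeff_space q ?i)"
      using b unfolding bc gens_row by (auto simp: split_gen_def Let_def coeff_space_def)
    then show ?thesis using i by (auto simp: direct_sum_cpx_def tensor_cpx_def bc split_gen_def Let_def)
  qed
  have bd_kh: "bd (khovanov (D ?i) :: (_, 'k) cpx) = partial_bd (D ?i) X1 (order_sign ?r')"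
    unfolding khovanov_def partial_bd_def
    by (simp add: crossings_D(1)[OF i] sg_order_sign[OF crossings_D(2)[OF i]])
  show ?thesis
  proof (cases "\<exists>x\<in>X1 - \<gamma>. \<delta> = insert x \<gamma>")
    case True
    then obtain x where x: "x \<in> X1" "x \<notin> \<gamma>" "\<delta> = insert x \<gamma>" by blast
    have \<delta>': "\<delta> \<inter> X2 = ?\<beta>" "\<delta> \<inter> X1 = insert x ?\<alpha>" using x X(2) by auto
    let ?s = "\<lambda>Z\<in>circles (D ?i) ?\<alpha>. s (\<Psi> ?\<beta> Z)" and ?t = "\<lambda>Z\<in>circles (D ?i) (insert x ?\<alpha>). t (\<Psi> ?\<beta> Z)"
    have sb: "snd (snd (split_gen b)) = (?\<alpha>, ?s)" "snd (snd (split_gen c)) = (insert x ?\<alpha>, ?t)"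
      by (simp_all add: bc split_gen_def Let_def \<delta>')
    have ins: "insert x ?\<alpha> \<subseteq> X1" using x by auto
    have fin: "finite ?\<alpha>" using finite_X by auto
    have cL: "circles L \<gamma> = \<Psi> ?\<beta> ` circles (D ?i) ?\<alpha> \<union> Cl ?\<beta>"
      "circles L \<delta> = \<Psi> ?\<beta> ` circles (D ?i) (insert x ?\<alpha>) \<union> Cl ?\<beta>"
    proof -
      have "insert x ?\<alpha> \<union> ?\<beta> = \<delta>" using \<gamma>(1) x(3) by blast
      then show "circles L \<gamma> = \<Psi> ?\<beta> ` circles (D ?i) ?\<alpha> \<union> Cl ?\<beta>"
        "circles L \<delta> = \<Psi> ?\<beta> ` circles (D ?i) (insert x ?\<alpha>) \<union> Cl ?\<beta>"
        using circles_L[OF \<beta>] circles_L[OF \<beta>(1) ins] \<gamma>(1) by (simp_all only:)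
    qed
    have ac: "arrow_coeff (circles L \<gamma>) (circles L \<delta>) s t =
        (if \<forall>Z\<in>Cl ?\<beta>. s Z = t Z then arrow_coeff (circles (D ?i) ?\<alpha>) (circles (D ?i) (insert x ?\<alpha>)) ?s ?t else (0 :: 'k))"
      unfolding cL
    proof (rule arrow_coeff_image)
      show "inj_on (\<Psi> ?\<beta>) (circles (D ?i) ?\<alpha> \<union> circles (D ?i) (insert x ?\<alpha>))"
        by (rule inj_on_subset[OF inj_\<Psi>[OF \<beta>(1)]]) (use ins in auto)
      have "circles (D ?i) ?\<alpha> \<union> circles (D ?i) (insert x ?\<alpha>) \<subseteq> (\<Union>\<alpha>\<in>Pow X1. circles (D ?i) \<alpha>)"
        using ins by blast
      then show "Cl ?\<beta> \<inter> \<Psi> ?\<beta> ` (circles (D ?i) ?\<alpha> \<union> circles (D ?i) (insert x ?\<alpha>)) = {}"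
        using Cl_\<Psi>[OF \<beta>(1)] by blast
    qed simp_all
    have re: "(restrict s (Cl ?\<beta>) = restrict t (Cl ?\<beta>)) \<longleftrightarrow> (\<forall>Z\<in>Cl ?\<beta>. s Z = t Z)"
      by (metis restrict_apply' restrict_ext)
    have kh: "bd (khovanov (D ?i) :: (_, 'k) cpx) (?\<alpha>, ?s) (insert x ?\<alpha>, ?t) =
        order_sign ?r' ?\<alpha> x * arrow_coeff (circles (D ?i) ?\<alpha>) (circles (D ?i) (insert x ?\<alpha>)) ?s ?t"
      unfolding bd_kh using x ins by (intro partial_bd_insert) (auto simp: khovanov_gens_def crossings_D(1)[OF i])
    have rw: "bd (row :: (_, 'k) cpx) b c = order_sign r ?\<alpha> x * arrow_coeff (circles L \<gamma>) (circles L \<delta>) s t"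
      unfolding bd_row unfolding bc x(3) using x gens by (intro partial_bd_insert) (auto simp: bc)
    have gc: "gen_sign c = (inversion_sign r ?r' ?\<alpha> * order_sign r ?\<alpha> x * order_sign ?r' ?\<alpha> x :: 'k)"
      unfolding bc gen_sign_def prod.case \<delta>' using fin x
      by (intro inversion_sign_insert)
        (auto intro: tournament_subset[OF r] tournament_subset[OF tournament_before] simp: crossings_D(1)[OF i] X(1)[symmetric])
    have gb: "gen_sign b = (inversion_sign r ?r' ?\<alpha> :: 'k)" by (simp add: bc gen_sign_def)
    have sg: "(inversion_sign r ?r' ?\<alpha> :: 'k) * order_sign ?r' ?\<alpha> x =
        order_sign r ?\<alpha> x * (inversion_sign r ?r' ?\<alpha> * order_sign r ?\<alpha> x * order_sign ?r' ?\<alpha> x)"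
    proof -
      have "order_sign r ?\<alpha> x * (inversion_sign r ?r' ?\<alpha> * order_sign r ?\<alpha> x * order_sign ?r' ?\<alpha> x) =
        (order_sign r ?\<alpha> x * order_sign r ?\<alpha> x) * (inversion_sign r ?r' ?\<alpha> * order_sign ?r' ?\<alpha> x :: 'k)"
        by (simp only: mult_ac)
      then show ?thesis by simp
    qed
    show ?thesis
    proof (cases "\<forall>Z\<in>Cl ?\<beta>. s Z = t Z")
      case True
      let ?A = "arrow_coeff (circles (D ?i) ?\<alpha>) (circles (D ?i) (insert x ?\<alpha>)) ?s ?t :: 'k"
      have "gen_sign b * bd (summands :: (_, 'k) cpx) (split_gen b) (split_gen c) =
          inversion_sign r ?r' ?\<alpha> * (order_sign ?r' ?\<alpha> x * ?A)"
        unfolding bd_sum sb \<delta>' gb kh using re True by simp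
      also have "\<dots> = (inversion_sign r ?r' ?\<alpha> * order_sign ?r' ?\<alpha> x) * ?A" by (simp only: mult.assoc)
      also have "\<dots> = (order_sign r ?\<alpha> x * ?A) * gen_sign c"
        unfolding gc by (subst sg) (simp only: mult_ac)
      also have "order_sign r ?\<alpha> x * ?A = bd (row :: (_, 'k) cpx) b c" unfolding rw ac using True by simp
      finally show ?thesis .
    next
      case False
      then have nr: "restrict s (Cl ?\<beta>) \<noteq> restrict t (Cl ?\<beta>)" using re by blast
      have "bd (row :: (_, 'k) cpx) b c = 0" unfolding rw ac if_not_P[OF False] by simp
      moreover have "bd (summands :: (_, 'k) cpx) (split_gen b) (split_gen c) = 0"
        unfolding bd_sum \<delta>' using nr by simp
      ultimately show ?thesis by simp
    qed
  next
    case False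
    then have 1: "bd (row :: (_, 'k) cpx) b c = 0"
      unfolding bd_row unfolding bc using partial_bd_nonzero by blast
    have "bd (summands :: (_, 'k) cpx) (split_gen b) (split_gen c) = 0"
    proof (rule ccontr)
      assume "bd (summands :: (_, 'k) cpx) (split_gen b) (split_gen c) \<noteq> 0"
      then have \<beta>: "?\<beta> = \<delta> \<inter> X2"
        and "partial_bd (D ?i) X1 (order_sign ?r' :: _ \<Rightarrow> _ \<Rightarrow> 'k) (snd (snd (split_gen b))) (snd (snd (split_gen c))) \<noteq> 0"
        unfolding bd_sum bd_kh by (auto split: if_splits)
      then obtain x where "x \<in> X1 - ?\<alpha>" "\<delta> \<inter> X1 = insert x ?\<alpha>"
        unfolding bc split_gen_def Let_def by simp (erule partial_bd_nonzero, blast)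
      then have "x \<in> X1 - \<gamma>" "\<delta> = insert x \<gamma>" using \<beta> \<gamma> \<delta> by blast+
      then show False using False by blast
    qed
    then show ?thesis using 1 by simp
  qed
qed

text \<open>\<open>Y\<close> may be any relabelling of the row, in view of the double complex with
  natural numbers as basis.\<close>

theorem row_linear_combination:
  assumes "chain_complex (row :: (_, 'k::field) cpx)"
    and "signed_bijection Y (row :: (_, 'k) cpx) \<phi> \<eta>" "chain_complex Y"
  shows "linear_combination I (\<lambda>i. khovanov (D i)) Y"
proof (rule linear_combination_if_signed_bijection[OF assms(3) finite_coeff_space])
  have "signed_bijection (row :: (_, 'k) cpx) (summands :: (_, 'k) cpx) split_gen gen_sign"
    unfolding signed_bijection_def
  proof (intro conjI ballI allI impI split_gen_bij)
    fix b c assume nz: "bd (summands :: (_, 'k) cpx) b c \<noteq> 0"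
    obtain i w b' j v c' where bc: "b = (i, w, b')" "c = (j, v, c')" by (metis prod.exhaust)
    from nz have "i \<in> I" "i = j" "w \<in> gbasis (coeff_space q i)" "w = v" "bd (khovanov (D i) :: (_, 'k) cpx) b' c' \<noteq> 0"
      by (auto simp: bc direct_sum_cpx_def tensor_cpx_def split: if_splits)
    then show "b \<in> gens (summands :: (_, 'k) cpx)" "c \<in> gens (summands :: (_, 'k) cpx)"
      by (auto simp: bc direct_sum_cpx_def tensor_cpx_def khovanov_def restrict_mat_def split: if_splits)
  qed (use split_gen_degree split_gen_bd in \<open>auto simp: gen_sign_def\<close>)
  from signed_bijection_trans[OF assms(2) this]
  show "signed_bijection Y (summands :: (_, 'k) cpx) (split_gen \<circ> \<phi>) (\<lambda>b. \<eta> b * gen_sign (\<phi> b))" .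
qed

end

end

text \<open>As \<open>(-1)^p\<close> counts the elements of the state in \<open>X1\<close>, the
  total complex has the arrow signs of the order \<open>r'\<close> that puts \<open>X1\<close>
  before \<open>X2\<close>, except that \<open>p\<close> is shifted by the number \<open>?n1\<close>
  of negative crossings in \<open>X1\<close>. The inversion sign in \<open>\<eta>\<close> changes
  the order, and the factor with exponent \<open>?n1 * card (\<alpha> \<inter> X2)\<close> absorbs
  the constant sign on vertical arrows.\<close>

lemma total_cube_signed_bijection:
  assumes D: "surgery_cube L" and X: "X1 \<union> X2 = set (crossings L)" "X1 \<inter> X2 = {}"
  shows "\<exists>\<eta>. signed_bijection (total_complex (cube_dcpx L (before (crossings L)) X1 X2)) (khovanov L :: (_, 'k::field) cpx) id \<eta>"
proof -
  let ?r = "before (crossings L)"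
  let ?T = "total_complex (cube_dcpx L ?r X1 X2) :: (_, 'k) cpx"
  let ?n1 = "card {x \<in> X1. \<not> positive_crossing L x}" and ?n2 = "card {x \<in> X2. \<not> positive_crossing L x}"
  define r' where "r' = (\<lambda>x y. if x \<in> X1 \<and> y \<in> X2 then True else if x \<in> X2 \<and> y \<in> X1 then False else ?r x y)"
  have r: "tournament ?r (set (crossings L))" by (rule tournament_before)
  have r': "tournament r' (set (crossings L))"
    unfolding tournament_def
  proof (intro conjI[of "\<forall>x\<in>_. \<not> _ x"] ballI impI)
    fix x assume "x \<in> set (crossings L)"
    then show "\<not> r' x x" using X(2) before_irrefl[of "crossings L" x] by (auto simp: r'_def)
  next
    fix x y assume xy: "x \<in> set (crossings L)" "y \<in> set (crossings L)" "x \<noteq> y"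
    then have "(?r x y \<or> ?r y x) \<and> \<not> (?r x y \<and> ?r y x)" using r unfolding tournament_def by metis
    moreover have "x \<in> X1 \<and> x \<notin> X2 \<or> x \<in> X2 \<and> x \<notin> X1" "y \<in> X1 \<and> y \<notin> X2 \<or> y \<in> X2 \<and> y \<notin> X1"
      using X xy by blast+
    ultimately show "(r' x y \<or> r' y x) \<and> \<not> (r' x y \<and> r' y x)" unfolding r'_def by argo
  qed
  have dist: "distinct (crossings L)" using D by (simp add: surgery_cube_def)
  define \<eta> :: "complex set \<times> (complex set \<Rightarrow> vgen) \<Rightarrow> 'k" where
    "\<eta> = (\<lambda>(\<alpha>, s). inversion_sign ?r r' \<alpha> * (- 1) ^ (?n1 * card (\<alpha> \<inter> X2)))"
  have bd_kh: "bd (khovanov L :: (_, 'k) cpx) = partial_bd L (set (crossings L)) (order_sign ?r)"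
    unfolding khovanov_def partial_bd_def by (simp add: sg_order_sign[OF dist])
  have cnt: "card {x \<in> set (crossings L). \<not> positive_crossing L x} = ?n1 + ?n2"
  proof -
    have "{x \<in> set (crossings L). \<not> positive_crossing L x} =
      {x \<in> X1. \<not> positive_crossing L x} \<union> {x \<in> X2. \<not> positive_crossing L x}" using X(1) by auto
    moreover have "finite X1" "finite X2" using X(1) by (metis finite_Un finite_set)+
    ultimately show ?thesis using X(2) by (simp add: card_Un_disjoint disjoint_iff)
  qed
  have "signed_bijection ?T (khovanov L) id \<eta>"
    unfolding signed_bijection_def
  proof (intro conjI ballI allI impI)
    show "bij_betw id (gens ?T) (gens (khovanov L :: (_, 'k) cpx))"
      by (simp add: total_complex_def cube_dcpx_def khovanov_def bij_betw_id)
    fix b assume b: "b \<in> gens ?T"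
    obtain \<alpha> s where b_eq: "b = (\<alpha>, s)" by fastforce
    have \<alpha>: "\<alpha> \<subseteq> X1 \<union> X2" "(\<alpha>, s) \<in> khovanov_gens L"
      using b X(1) by (auto simp: b_eq total_complex_def cube_dcpx_def khovanov_gens_def)
    have fin: "finite \<alpha>" using \<alpha>(1) X(1) by (metis finite_set finite_subset)
    have "card \<alpha> = card (\<alpha> \<inter> X1) + card (\<alpha> \<inter> X2)"
    proof -
      have "\<alpha> = (\<alpha> \<inter> X1) \<union> (\<alpha> \<inter> X2)" using \<alpha>(1) by auto
      moreover have "card ((\<alpha> \<inter> X1) \<union> (\<alpha> \<inter> X2)) = card (\<alpha> \<inter> X1) + card (\<alpha> \<inter> X2)"
        using fin X(2) by (intro card_Un_disjoint) auto
      ultimately show ?thesis by simp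
    qed
    then show "hdeg (khovanov L :: (_, 'k) cpx) (id b) = hdeg ?T b"
      by (simp add: b_eq total_complex_def cube_dcpx_def khovanov_def lneg_def cnt)
    show "qdeg (khovanov L :: (_, 'k) cpx) (id b) = qdeg ?T b"
      by (simp add: total_complex_def cube_dcpx_def)
    show "\<eta> b * \<eta> b = 1"
    proof -
      have "\<eta> b * \<eta> b = (inversion_sign ?r r' \<alpha> * inversion_sign ?r r' \<alpha>) *
          ((- 1) ^ (?n1 * card (\<alpha> \<inter> X2)) * (- 1) ^ (?n1 * card (\<alpha> \<inter> X2)))"
        by (simp only: b_eq \<eta>_def prod.case mult_ac)
      then show ?thesis by simp
    qed
    fix c assume c: "c \<in> gens ?T"
    obtain \<beta> t where c_eq: "c = (\<beta>, t)" by fastforce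
    have \<beta>: "(\<beta>, t) \<in> khovanov_gens L" using c by (simp add: c_eq total_complex_def cube_dcpx_def)
    let ?d1 = "partial_bd L X1 (\<lambda>\<alpha>. order_sign ?r (\<alpha> \<inter> X1)) b c :: 'k"
    let ?d2 = "partial_bd L X2 (\<lambda>\<alpha>. order_sign ?r (\<alpha> \<inter> X2)) b c :: 'k"
    have bdT: "bd ?T b c = ?d1 + (- 1) powi (int (card (\<alpha> \<inter> X1)) - int ?n1) * ?d2"
      by (simp add: total_complex_def cube_dcpx_def b_eq)
    show "\<eta> b * bd (khovanov L :: (_, 'k) cpx) (id b) (id c) = bd ?T b c * \<eta> c"
    proof (cases "\<exists>x\<in>set (crossings L) - \<alpha>. \<beta> = insert x \<alpha>")
      case True
      then obtain x where x: "x \<in> set (crossings L)" "x \<notin> \<alpha>" "\<beta> = insert x \<alpha>" by blast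
      let ?c = "arrow_coeff (circles L \<alpha>) (circles L \<beta>) s t :: 'k"
      have kh: "bd (khovanov L :: (_, 'k) cpx) b c = order_sign ?r \<alpha> x * ?c"
        unfolding bd_kh b_eq c_eq x(3) using \<alpha> \<beta> x by (intro partial_bd_insert) auto
      have inv: "inversion_sign ?r r' \<beta> = (inversion_sign ?r r' \<alpha> * order_sign ?r \<alpha> x * order_sign r' \<alpha> x :: 'k)"
        unfolding x(3) using fin x \<alpha>(1) X(1)
        by (intro inversion_sign_insert) (auto intro: tournament_subset[OF r] tournament_subset[OF r'])
      have T: "bd ?T b c = (if x \<in> X1 then 1 else (- 1) ^ ?n1) * order_sign r' \<alpha> x * ?c"
      proof (cases "x \<in> X1")
        case True
        have "?d1 = order_sign ?r (\<alpha> \<inter> X1) x * ?c"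
          unfolding b_eq c_eq x(3) using \<alpha> \<beta> x True by (intro partial_bd_insert) auto
        moreover have "x \<notin> X2" using True X(2) by auto
        then have "?d2 = 0" unfolding b_eq c_eq using x partial_bd_nonzero by (metis Diff_iff insert_iff)
        moreover have "{y \<in> \<alpha> \<inter> X1. ?r y x} = {y \<in> \<alpha>. r' y x}" 
          using True \<open>x \<notin> X2\<close> \<alpha>(1) X(2) by (auto simp: r'_def)
        ultimately show ?thesis using True by (simp add: bdT order_sign_def)
      next
        case False
        then have x2: "x \<in> X2" using x X(1) by auto
        have "?d2 = order_sign ?r (\<alpha> \<inter> X2) x * ?c"
          unfolding b_eq c_eq x(3) using \<alpha> \<beta> x x2 by (intro partial_bd_insert) auto
        moreover have "?d1 = 0" unfolding b_eq c_eq using x False partial_bd_nonzero by (metis Diff_iff insert_iff)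
        moreover have "{y \<in> \<alpha>. r' y x} = {y \<in> \<alpha> \<inter> X2. ?r y x} \<union> (\<alpha> \<inter> X1)"
          using False x2 \<alpha>(1) X(2) by (auto simp: r'_def)
        then have "card {y \<in> \<alpha>. r' y x} = card {y \<in> \<alpha> \<inter> X2. ?r y x} + card (\<alpha> \<inter> X1)"
          using fin X(2) by (simp, intro card_Un_disjoint) auto
        then have "order_sign r' \<alpha> x = (- 1) ^ card (\<alpha> \<inter> X1) * (order_sign ?r (\<alpha> \<inter> X2) x :: 'k)"
          by (simp add: order_sign_def power_add mult.commute)
        moreover have "((- 1) powi (int (card (\<alpha> \<inter> X1)) - int ?n1) :: 'k) = (- 1) ^ ?n1 * (- 1) ^ card (\<alpha> \<inter> X1)"
          by (simp add: power_int_diff minus_one_power_iff)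
        ultimately show ?thesis using False by (simp add: bdT mult_ac)
      qed
      have X2: "card (\<beta> \<inter> X2) = card (\<alpha> \<inter> X2) + (if x \<in> X1 then 0 else 1)"
      proof (cases "x \<in> X1")
        case True
        then have "\<beta> \<inter> X2 = \<alpha> \<inter> X2" using x X(2) by auto
        then show ?thesis using True by simp
      next
        case False
        then have "\<beta> \<inter> X2 = insert x (\<alpha> \<inter> X2)" using x X(1) by auto
        then show ?thesis using False x fin by simp
      qed
      define e where "e = (if x \<in> X1 then 1 else (- 1) ^ ?n1 :: 'k)"
      define m where "m = ((- 1) ^ (?n1 * card (\<alpha> \<inter> X2)) :: 'k)"
      have ee: "e * e = 1" by (simp add: e_def)
      have "(- 1) ^ (?n1 * card (\<beta> \<inter> X2)) = m * e"
        unfolding X2 m_def e_def by (simp add: power_add distrib_left)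
      then have "\<eta> c = inversion_sign ?r r' \<alpha> * order_sign ?r \<alpha> x * order_sign r' \<alpha> x * (m * e)"
        by (simp add: c_eq \<eta>_def inv)
      moreover have "\<eta> b = inversion_sign ?r r' \<alpha> * m" by (simp add: b_eq \<eta>_def m_def)
      ultimately have "bd ?T b c * \<eta> c = (e * e) * (order_sign r' \<alpha> x * order_sign r' \<alpha> x) * (\<eta> b * (order_sign ?r \<alpha> x * ?c))"
        unfolding T e_def[symmetric] by (simp only: mult_ac)
      then show ?thesis using ee by (simp add: kh)
    next
      case False
      have "bd (khovanov L :: (_, 'k) cpx) b c = 0" unfolding bd_kh b_eq c_eq using False partial_bd_nonzero by blast
      moreover have "?d1 = 0" "?d2 = 0" unfolding b_eq c_eq using False X(1) partial_bd_nonzero by (metis DiffE DiffI UnCI)+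
      ultimately show ?thesis by (simp add: bdT)
    qed
  next
    fix b c assume "bd (khovanov L :: (_, 'k) cpx) b c \<noteq> 0"
    then show "b \<in> gens (khovanov L :: (_, 'k) cpx)" "c \<in> gens (khovanov L :: (_, 'k) cpx)"
      by (auto simp: khovanov_def restrict_mat_def split: if_splits)
  qed
  then show ?thesis by (rule exI[of _ \<eta>])
qed

section \<open>Gluing tangles along the cut\<close>

text \<open>
  Two ways of extending a graph on \<open>E1\<close>: \<open>outer\<close> attaches the graph \<open>J2\<close> on \<open>E2\<close> at the points \<open>Pts\<close>, and in
  \<open>inner\<close> the component of \<open>e2 p\<close> in \<open>J2\<close> is contracted to the single chord \<open>e3 p\<close>.
\<close>

locale glued_relations =
  fixes E1 E2 :: "'e set" and Pts :: "'p set" and e1 e2 e3 :: "'p \<Rightarrow> 'e" and J2 :: "'e rel"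
  assumes disj: "E1 \<inter> E2 = {}" "e3 ` Pts \<inter> E1 = {}"
    and J2: "J2 \<subseteq> E2 \<times> E2" "sym J2"
    and e12: "\<And>p. p \<in> Pts \<Longrightarrow> e1 p \<in> E1" "\<And>p. p \<in> Pts \<Longrightarrow> e2 p \<in> E2"
    and match: "\<And>p q. p \<in> Pts \<Longrightarrow> q \<in> Pts \<Longrightarrow> e3 p = e3 q \<longleftrightarrow> (e2 p, e2 q) \<in> J2\<^sup>*"
begin

definition outer :: "'e rel \<Rightarrow> 'e rel" where
  "outer J1 = J1 \<union> J2 \<union> {(e, f). \<exists>p\<in>Pts. e = e1 p \<and> f = e2 p \<or> e = e2 p \<and> f = e1 p}"

definition inner :: "'e rel \<Rightarrow> 'e rel" where
  "inner J1 = J1 \<union> {(e, f). \<exists>p\<in>Pts. e = e1 p \<and> f = e3 p \<or> e = e3 p \<and> f = e1 p}"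

text \<open>Replaces every chord in \<open>K\<close> by the far component that it stands
  for.\<close>

definition \<Phi> :: "'e set \<Rightarrow> 'e set" where
  "\<Phi> K = (K \<inter> E1) \<union> {f \<in> E2. \<exists>p\<in>Pts. e3 p \<in> K \<and> (e2 p, f) \<in> J2\<^sup>*}"

definition closed_classes :: "'e set set" where
  "closed_classes = (\<lambda>e. J2\<^sup>* `` {e}) ` {e \<in> E2. \<not> (\<exists>p\<in>Pts. (e2 p, e) \<in> J2\<^sup>*)}"

lemma J2_sym: "(a, b) \<in> J2\<^sup>* \<Longrightarrow> (b, a) \<in> J2\<^sup>*"
  using sym_rtrancl[OF J2(2)] by (auto dest: symD)

lemma J2_in: "(a, b) \<in> J2\<^sup>* \<Longrightarrow> a \<in> E2 \<Longrightarrow> b \<in> E2"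
  by (induction rule: rtrancl_induct) (use J2 in auto)

context
  fixes J1 :: "'e rel"
  assumes J1: "J1 \<subseteq> E1 \<times> E1" "sym J1"
begin

lemma sym_outer: "sym (outer J1)"
  using J1(2) J2(2) unfolding sym_def outer_def by blast

lemma sym_inner: "sym (inner J1)"
  using J1(2) unfolding sym_def inner_def by blast

lemma outer_sym: "(a, b) \<in> (outer J1)\<^sup>* \<Longrightarrow> (b, a) \<in> (outer J1)\<^sup>*"
  using sym_rtrancl[OF sym_outer] by (auto dest: symD)

lemma inner_sym: "(a, b) \<in> (inner J1)\<^sup>* \<Longrightarrow> (b, a) \<in> (inner J1)\<^sup>*"
  using sym_rtrancl[OF sym_inner] by (auto dest: symD)

lemma outer_class_eq: "(a, b) \<in> (outer J1)\<^sup>* \<Longrightarrow> (outer J1)\<^sup>* `` {a} = (outer J1)\<^sup>* `` {b}"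
  using outer_sym by (auto intro: rtrancl_trans)

lemma inner_class_eq: "(a, b) \<in> (inner J1)\<^sup>* \<Longrightarrow> (inner J1)\<^sup>* `` {a} = (inner J1)\<^sup>* `` {b}"
  using inner_sym by (auto intro: rtrancl_trans)

lemma J2_outer: "(a, b) \<in> J2\<^sup>* \<Longrightarrow> (a, b) \<in> (outer J1)\<^sup>*"
  by (rule subsetD[OF rtrancl_mono]) (auto simp: outer_def)

lemma attach: "p \<in> Pts \<Longrightarrow> (e1 p, e2 p) \<in> outer J1" "p \<in> Pts \<Longrightarrow> (e2 p, e1 p) \<in> outer J1"
  "p \<in> Pts \<Longrightarrow> (e1 p, e3 p) \<in> inner J1" "p \<in> Pts \<Longrightarrow> (e3 p, e1 p) \<in> inner J1"
  by (auto simp: outer_def inner_def)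

lemma chord_in_class:
  assumes "p \<in> Pts"
  shows "e3 p \<in> (inner J1)\<^sup>* `` {e} \<longleftrightarrow> e1 p \<in> (inner J1)\<^sup>* `` {e}"
  using attach(3,4)[OF assms] by (auto intro: rtrancl.rtrancl_into_rtrancl)

text \<open>Paths are followed step by step. A passage through a far component enters and leaves it
  at points with the same chord, by \<open>match\<close>, and so corresponds to a passage through
  that chord, and conversely.\<close>

lemma outer_class:
  assumes e: "e \<in> E1"
  shows "(outer J1)\<^sup>* `` {e} = \<Phi> ((inner J1)\<^sup>* `` {e})"
proof
  let ?K = "(inner J1)\<^sup>* `` {e}"
  show "(outer J1)\<^sup>* `` {e} \<subseteq> \<Phi> ?K"
  proof
    fix f assume "f \<in> (outer J1)\<^sup>* `` {e}"
    then have "(e, f) \<in> (outer J1)\<^sup>*" by simp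
    then show "f \<in> \<Phi> ?K"
    proof induction
      case base then show ?case using e by (simp add: \<Phi>_def)
    next
      case (step f g)
      consider "(f, g) \<in> J1" | "(f, g) \<in> J2" | p where "p \<in> Pts" "f = e1 p" "g = e2 p"
        | p where "p \<in> Pts" "f = e2 p" "g = e1 p" using step.hyps(2) unfolding outer_def by blast
      then show ?case
      proof cases
        case 1
        then have "f \<in> E1" "g \<in> E1" "(f, g) \<in> inner J1" using J1 by (auto simp: inner_def)
        moreover from this have "f \<in> ?K" using step.IH disj(1) by (auto simp: \<Phi>_def)
        ultimately show ?thesis by (auto simp: \<Phi>_def intro: rtrancl.rtrancl_into_rtrancl)
      next
        case 2
        then have fg: "f \<in> E2" "g \<in> E2" using J2 by auto
        then obtain p where "p \<in> Pts" "e3 p \<in> ?K" "(e2 p, f) \<in> J2\<^sup>*"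
          using step.IH disj(1) unfolding \<Phi>_def by blast
        moreover from this have "(e2 p, g) \<in> J2\<^sup>*" using 2 by (auto intro: rtrancl.rtrancl_into_rtrancl)
        ultimately show ?thesis using fg unfolding \<Phi>_def by blast
      next
        case (3 p)
        then have "e1 p \<in> ?K" using step.IH e12[of p] disj(1) by (auto simp: \<Phi>_def)
        then have "e3 p \<in> ?K" using chord_in_class 3(1) by blast
        then show ?thesis using 3 e12 unfolding \<Phi>_def by blast
      next
        case (4 p)
        then obtain q where q: "q \<in> Pts" "e3 q \<in> ?K" "(e2 q, e2 p) \<in> J2\<^sup>*"
          using step.IH e12[of p] disj(1) unfolding \<Phi>_def by blast
        then have "e3 p \<in> ?K" using match[OF q(1) 4(1)] by simp
        then have "e1 p \<in> ?K" using chord_in_class 4(1) by blast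
        then show ?thesis using 4 e12 unfolding \<Phi>_def by blast
      qed
    qed
  qed
  \<comment> \<open>A chord may be left at another point than it was entered, so the claim at a
    chord is made for all points \<open>p\<close> that it serves.\<close>
  have *: "(f \<in> E1 \<longrightarrow> (e, f) \<in> (outer J1)\<^sup>*) \<and> (\<forall>p\<in>Pts. f = e3 p \<longrightarrow> (e, e2 p) \<in> (outer J1)\<^sup>*)" if "(e, f) \<in> (inner J1)\<^sup>*" for f
    using that
  proof induction
    case base
    have "e \<noteq> e3 p" if "p \<in> Pts" for p using that e disj(2) by blast
    then show ?case by blast
  next
    case (step f g)
    consider "(f, g) \<in> J1" | p where "p \<in> Pts" "f = e1 p" "g = e3 p"
        | p where "p \<in> Pts" "f = e3 p" "g = e1 p" using step.hyps(2) unfolding inner_def by blast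
    then show ?case
    proof cases
      case 1
      then have fg: "f \<in> E1" "g \<in> E1" "(f, g) \<in> outer J1" using J1 by (auto simp: outer_def)
      then have "(e, g) \<in> (outer J1)\<^sup>*" using step.IH by (auto intro: rtrancl.rtrancl_into_rtrancl)
      moreover have "g \<noteq> e3 p" if "p \<in> Pts" for p using that fg disj(2) by blast
      ultimately show ?thesis by blast
    next
      case (2 p)
      have "(e, e1 p) \<in> (outer J1)\<^sup>*" using step.IH 2 e12 by blast
      then have e2p: "(e, e2 p) \<in> (outer J1)\<^sup>*" using attach(1)[OF 2(1)] by (auto intro: rtrancl.rtrancl_into_rtrancl)
      have "(e, e2 q) \<in> (outer J1)\<^sup>*" if "q \<in> Pts" "g = e3 q" for q
      proof -
        have "(e2 p, e2 q) \<in> J2\<^sup>*" using match[OF 2(1) that(1)] 2 that by simp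
        then show ?thesis using e2p J2_outer by (blast intro: rtrancl_trans)
      qed
      moreover have "g \<notin> E1" using 2 disj(2) by blast
      ultimately show ?thesis by blast
    next
      case (3 p)
      have "(e, e2 p) \<in> (outer J1)\<^sup>*" using step.IH 3 by blast
      then have "(e, g) \<in> (outer J1)\<^sup>*" using attach(2)[OF 3(1)] 3(3) by (auto intro: rtrancl.rtrancl_into_rtrancl)
      moreover have "g \<in> E1" using 3 e12 by blast
      moreover have "g \<noteq> e3 q" if "q \<in> Pts" for q using that \<open>g \<in> E1\<close> disj(2) by blast
      ultimately show ?thesis by blast
    qed
  qed
  show "\<Phi> ?K \<subseteq> (outer J1)\<^sup>* `` {e}"
  proof
    fix f assume "f \<in> \<Phi> ?K"
    then consider "f \<in> ?K" "f \<in> E1" | p where "p \<in> Pts" "e3 p \<in> ?K" "(e2 p, f) \<in> J2\<^sup>*" unfolding \<Phi>_def by blast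
    then show "f \<in> (outer J1)\<^sup>* `` {e}"
    proof cases
      case 1 then show ?thesis using * by blast
    next
      case (2 p)
      then have "(e, e2 p) \<in> (outer J1)\<^sup>*" using * by blast
      then show ?thesis using J2_outer[OF 2(3)] by (auto intro: rtrancl_trans)
    qed
  qed
qed

lemma outer_class_closed:
  assumes e: "e \<in> E2" "\<not> (\<exists>p\<in>Pts. (e2 p, e) \<in> J2\<^sup>*)"
  shows "(outer J1)\<^sup>* `` {e} = J2\<^sup>* `` {e}"
proof
  show "(outer J1)\<^sup>* `` {e} \<subseteq> J2\<^sup>* `` {e}"
  proof
    fix f assume "f \<in> (outer J1)\<^sup>* `` {e}"
    then have "(e, f) \<in> (outer J1)\<^sup>*" by simp
    then show "f \<in> J2\<^sup>* `` {e}"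
    proof induction
      case base show ?case by simp
    next
      case (step f g)
      have f: "f \<in> E2" using step.IH J2_in e by auto
      have "f \<noteq> e2 p" if "p \<in> Pts" for p using step.IH J2_sym e(2) that by auto
      then have "(f, g) \<in> J2" using step.hyps(2) f J1 e12 disj(1) unfolding outer_def by blast
      then show ?case using step.IH by (auto intro: rtrancl.rtrancl_into_rtrancl)
    qed
  qed
  show "J2\<^sup>* `` {e} \<subseteq> (outer J1)\<^sup>* `` {e}" using J2_outer by auto
qed

text \<open>A far component that reaches a point of \<open>Pts\<close> belongs to the class of a
  near edge, so only the closed far components yield classes of their own.\<close>

lemma classes_glued:
  "(\<lambda>e. (outer J1)\<^sup>* `` {e}) ` (E1 \<union> E2) =
     \<Phi> ` (\<lambda>e. (inner J1)\<^sup>* `` {e}) ` (E1 \<union> e3 ` Pts) \<union> closed_classes"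
proof -
  \<comment> \<open>A chord is in the class of the near edge at its end, so the chords do not
    produce additional classes.\<close>
  have 3: "(inner J1)\<^sup>* `` {e3 p} = (inner J1)\<^sup>* `` {e1 p}" if "p \<in> Pts" for p
    using attach(4)[OF that] by (intro inner_class_eq) auto
  then have "(\<lambda>e. (inner J1)\<^sup>* `` {e}) ` (E1 \<union> e3 ` Pts) = (\<lambda>e. (inner J1)\<^sup>* `` {e}) ` E1"
    using e12(1) by (auto simp: image_iff)
  then have "\<Phi> ` (\<lambda>e. (inner J1)\<^sup>* `` {e}) ` (E1 \<union> e3 ` Pts) = (\<lambda>e. (outer J1)\<^sup>* `` {e}) ` E1"
    by (simp only: image_image) (rule image_cong, simp_all add: outer_class)
  moreover have "(\<lambda>e. (outer J1)\<^sup>* `` {e}) ` (E1 \<union> E2) = (\<lambda>e. (outer J1)\<^sup>* `` {e}) ` E1 \<union> closed_classes"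
  proof -
    have "(outer J1)\<^sup>* `` {e} \<in> (\<lambda>e. (outer J1)\<^sup>* `` {e}) ` E1 \<union> closed_classes" if e: "e \<in> E2" for e
    proof (cases "\<exists>p\<in>Pts. (e2 p, e) \<in> J2\<^sup>*")
      case True
      then obtain p where p: "p \<in> Pts" "(e2 p, e) \<in> J2\<^sup>*" by blast
      have "(e1 p, e) \<in> (outer J1)\<^sup>*"
        using attach(1)[OF p(1)] J2_outer[OF p(2)] by (rule converse_rtrancl_into_rtrancl)
      then have "(outer J1)\<^sup>* `` {e} = (outer J1)\<^sup>* `` {e1 p}" using outer_class_eq by metis
      then show ?thesis using e12(1)[OF p(1)] by blast
    next
      case False
      then show ?thesis using outer_class_closed[OF e] e unfolding closed_classes_def by blast
    qed
    moreover have "K \<in> (\<lambda>e. (outer J1)\<^sup>* `` {e}) ` E2" if K: "K \<in> closed_classes" for K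
    proof -
      obtain e where e: "K = J2\<^sup>* `` {e}" "e \<in> E2" "\<not> (\<exists>p\<in>Pts. (e2 p, e) \<in> J2\<^sup>*)"
        using K unfolding closed_classes_def by blast
      then show ?thesis using outer_class_closed[OF e(2,3)] by blast
    qed
    ultimately show ?thesis by blast
  qed
  ultimately show ?thesis by simp
qed

lemma inner_class_meets_E1:
  assumes "K \<in> (\<lambda>e. (inner J1)\<^sup>* `` {e}) ` (E1 \<union> e3 ` Pts)"
  shows "K \<inter> E1 \<noteq> {}" "\<And>p. p \<in> Pts \<Longrightarrow> e3 p \<in> K \<longleftrightarrow> e1 p \<in> K" "K \<subseteq> E1 \<union> e3 ` Pts"
proof -
  obtain e where e: "e \<in> E1 \<union> e3 ` Pts" "K = (inner J1)\<^sup>* `` {e}" using assms by blast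
  show 2: "e3 p \<in> K \<longleftrightarrow> e1 p \<in> K" if "p \<in> Pts" for p using chord_in_class[OF that] e by simp
  have "e \<in> K" using e by auto
  then show "K \<inter> E1 \<noteq> {}" using e(1) 2 e12(1) by blast
  show "K \<subseteq> E1 \<union> e3 ` Pts"
  proof
    fix f assume "f \<in> K"
    then have "(e, f) \<in> (inner J1)\<^sup>*" using e by simp
    then show "f \<in> E1 \<union> e3 ` Pts"
    proof induction
      case base show ?case by (rule e)
    next
      case (step f g) then show ?case using J1 e12(1) unfolding inner_def by blast
    qed
  qed
qed

end

text \<open>\<open>\<Phi>\<close> keeps the part in \<open>E1\<close>, and that part decides which
  chords belong to \<open>K\<close>, each chord being attached to an edge of
  \<open>E1\<close>.\<close>

lemma \<Phi>_inj:
  assumes "K \<subseteq> E1 \<union> e3 ` Pts" "\<And>p. p \<in> Pts \<Longrightarrow> e3 p \<in> K \<longleftrightarrow> e1 p \<in> K"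
    and "K' \<subseteq> E1 \<union> e3 ` Pts" "\<And>p. p \<in> Pts \<Longrightarrow> e3 p \<in> K' \<longleftrightarrow> e1 p \<in> K'"
    and "\<Phi> K = \<Phi> K'"
  shows "K = K'"
proof -
  have "\<Phi> K \<inter> E1 = K \<inter> E1" for K using disj(1) unfolding \<Phi>_def by blast
  then have "K \<inter> E1 = K' \<inter> E1" using assms(5) by metis
  then have iff: "z \<in> K \<longleftrightarrow> z \<in> K'" if "z \<in> E1" for z using that by blast
  have "z \<in> K \<longleftrightarrow> z \<in> K'" if z: "z \<in> E1 \<union> e3 ` Pts" for z
  proof (cases "z \<in> E1")
    case False
    then obtain p where p: "p \<in> Pts" "z = e3 p" using z by blast
    then show ?thesis using assms(2,4)[OF p(1)] iff[OF e12(1)[OF p(1)]] by simp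
  qed (rule iff)
  then show ?thesis using assms(1,3) by (meson subsetD subset_antisym subsetI)
qed

lemma \<Phi>_not_closed:
  assumes "K \<inter> E1 \<noteq> {}"
  shows "\<Phi> K \<notin> closed_classes"
proof
  assume "\<Phi> K \<in> closed_classes"
  then have "\<Phi> K \<subseteq> E2" using J2_in unfolding closed_classes_def by auto
  then show False using assms disj(1) unfolding \<Phi>_def by blast
qed

lemma \<Phi>_subset: "\<Phi> K \<subseteq> E1 \<union> E2"
  unfolding \<Phi>_def by blast

lemma closed_classes_subset: "K \<in> closed_classes \<Longrightarrow> K \<subseteq> E2"
  using J2_in unfolding closed_classes_def by auto

end

section \<open>A link diagram divided by a Jordan curve into a near and a far side\<close>

locale cut_link = link +
  fixes C :: "real \<Rightarrow> complex" and S S' :: "complex set"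
  assumes cut: "transversal_cut D C"
    and sides: "S = inside (path_image C) \<and> S' = outside (path_image C) \<or>
      S = outside (path_image C) \<and> S' = inside (path_image C)"
begin

abbreviation \<Gamma> :: "complex set" where
  "\<Gamma> \<equiv> path_image C"

definition side :: "complex set \<Rightarrow> (real \<Rightarrow> complex) set" where
  "side T = {e \<in> edges D. path_image e \<subseteq> \<Gamma> \<union> T}"

definition cut_pts :: "complex set" where
  "cut_pts = \<Gamma> \<inter> support D"

lemma C: "simple_path C" "pathfinish C = pathstart C"
  using cut by (auto simp: transversal_cut_def)

lemma side_sets: "S \<inter> S' = {}" "S \<inter> \<Gamma> = {}" "S' \<inter> \<Gamma> = {}" "S \<union> S' \<union> \<Gamma> = UNIV" "open S" "open S'"
  "closure S = S \<union> \<Gamma>" "closure S' = S' \<union> \<Gamma>"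
proof -
  note J = Jordan_inside_outside[OF C]
  have a: "inside \<Gamma> \<inter> outside \<Gamma> = {}" "inside \<Gamma> \<inter> \<Gamma> = {}" "outside \<Gamma> \<inter> \<Gamma> = {}" "inside \<Gamma> \<union> outside \<Gamma> \<union> \<Gamma> = UNIV"
    by (simp_all add: inside_Int_outside inside_no_overlap outside_no_overlap inside_Un_outside)
  show "S \<inter> S' = {}" "S \<inter> \<Gamma> = {}" "S' \<inter> \<Gamma> = {}" "S \<union> S' \<union> \<Gamma> = UNIV" using sides a by blast+
  show "open S" "open S'" using sides J by auto
  have "frontier (inside \<Gamma>) = \<Gamma>" "frontier (outside \<Gamma>) = \<Gamma>" using J by auto
  then have "closure (inside \<Gamma>) = inside \<Gamma> \<union> \<Gamma>" "closure (outside \<Gamma>) = outside \<Gamma> \<union> \<Gamma>"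
    by (metis closure_Un_frontier)+
  then show "closure S = S \<union> \<Gamma>" "closure S' = S' \<union> \<Gamma>" using sides by auto
qed

text \<open>Either side can be regarded as the near one; facts on \<open>S'\<close> are obtained
  from those on \<open>S\<close> in this way.\<close>

lemma swap: "cut_link D C S' S"
  by unfold_locales (use cut sides in auto)

lemma end_in_support: "e \<in> edges D \<Longrightarrow> end_pt (e, b) \<in> support D"
  using end_pt_in_image[of "(e, b)"] by (auto simp: support_def)

lemma cut_pts_vertices: "p \<in> cut_pts \<Longrightarrow> p \<in> vertices D" "p \<in> cut_pts \<Longrightarrow> p \<notin> set (crossings D)"
  using cut by (auto simp: transversal_cut_def cut_pts_def)

lemma vertices_end_pt: "p \<in> vertices D \<Longrightarrow> \<exists>f b. f \<in> edges D \<and> p = end_pt (f, b)"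
proof -
  assume "p \<in> vertices D"
  then obtain f where "f \<in> edges D" "p = pathstart f \<or> p = pathfinish f" by (auto simp: vertices_def)
  then have "f \<in> edges D \<and> (p = end_pt (f, False) \<or> p = end_pt (f, True))" by (simp add: end_pt_def)
  then show ?thesis by blast
qed

text \<open>The cut meets the diagram only in vertices, and the interior of an edge contains no
  vertex.\<close>

lemma open_arc_off_cut:
  assumes "e \<in> edges D"
  shows "open_arc e \<inter> \<Gamma> = {}"
proof -
  have "z \<notin> \<Gamma>" if z: "z \<in> open_arc e" for z
  proof
    assume "z \<in> \<Gamma>"
    moreover have ze: "z \<in> path_image e" using z by (auto simp: path_image_def)
    ultimately have "z \<in> cut_pts" using assms by (auto simp: cut_pts_def support_def)
    then obtain f b where f: "f \<in> edges D" "z = end_pt (f, b)"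
      using cut_pts_vertices(1) vertices_end_pt by blast
    then obtain c where "end_pt (e, c) = z" using vertex_on_edge[of "(f, b)" e] assms ze by auto
    then show False using endpoint_not_in_open_arc[OF assms, of c] z by simp
  qed
  then show ?thesis by blast
qed

lemma open_arc_side: "e \<in> edges D \<Longrightarrow> open_arc e \<subseteq> S \<or> open_arc e \<subseteq> S'"
proof -
  assume e: "e \<in> edges D"
  have "connected (open_arc e)" using arc_edge[OF e] by (intro connected_open_arc) (simp add: arc_def)
  moreover have "open_arc e \<subseteq> S \<union> S'" using open_arc_off_cut[OF e] side_sets(4) by blast
  ultimately have "S \<inter> open_arc e = {} \<or> S' \<inter> open_arc e = {}"
    using connectedD[of "open_arc e" S S'] side_sets(1,5,6) by blast
  then show ?thesis using \<open>open_arc e \<subseteq> S \<union> S'\<close> by blast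
qed

lemma path_image_split: "path_image e = open_arc e \<union> {pathstart e, pathfinish e}"
proof -
  have "{0..1} = {0<..<1} \<union> {0, 1::real}" by auto
  then show ?thesis unfolding path_image_def pathstart_def pathfinish_def by (metis image_Un image_empty image_insert)
qed

lemma side_iff: "e \<in> edges D \<Longrightarrow> e \<in> side S \<longleftrightarrow> open_arc e \<subseteq> S"
proof
  assume e: "e \<in> edges D"
  show "e \<in> side S \<Longrightarrow> open_arc e \<subseteq> S"
    using open_arc_off_cut[OF e] path_image_split[of e] by (auto simp: side_def)
  assume "open_arc e \<subseteq> S"
  then have "closure (open_arc e) \<subseteq> S \<union> \<Gamma>" using closure_mono side_sets(7) by metis
  moreover have "pathstart e \<in> closure (open_arc e)" "pathfinish e \<in> closure (open_arc e)"
    using arc_edge[OF e] by (auto simp: arc_def intro: endpoint_in_closure_open_arc)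
  ultimately show "e \<in> side S"
    using e path_image_split[of e] \<open>open_arc e \<subseteq> S\<close> by (auto simp: side_def)
qed

lemma side_iff': "e \<in> edges D \<Longrightarrow> e \<in> side S' \<longleftrightarrow> open_arc e \<subseteq> S'"
  using cut_link.side_iff[OF swap] cut_link.side_def[OF swap] side_def by simp

lemma sides_cover: "side S \<union> side S' = edges D" "side S \<inter> side S' = {}"
proof -
  have sub: "side T \<subseteq> edges D" for T by (auto simp: side_def)
  have "e \<in> side S \<or> e \<in> side S'" if "e \<in> edges D" for e
    using open_arc_side[OF that] side_iff[OF that] side_iff'[OF that] by blast
  then show "side S \<union> side S' = edges D" using sub by blast
  have "\<not> (open_arc e \<subseteq> S \<and> open_arc e \<subseteq> S')" for e :: "real \<Rightarrow> complex"
  proof -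
    have "e (1/2) \<in> open_arc e" by auto
    then show ?thesis using side_sets(1) by blast
  qed
  then have "\<not> (e \<in> side S \<and> e \<in> side S')" for e using sub side_iff side_iff' by blast
  then show "side S \<inter> side S' = {}" by blast
qed

lemma end_in_side: "e \<in> edges D \<Longrightarrow> end_pt (e, b) \<in> S \<Longrightarrow> e \<in> side S"
proof (rule ccontr)
  assume e: "e \<in> edges D" "end_pt (e, b) \<in> S" "e \<notin> side S"
  then have "e \<in> side S'" using sides_cover by blast
  then show False using e end_pt_in_image[of "(e, b)"] side_sets(1,2) by (auto simp: side_def)
qed

lemma side_end: "e \<in> side S \<Longrightarrow> end_pt (e, b) \<in> S \<or> end_pt (e, b) \<in> cut_pts"
  using end_pt_in_image[of "(e, b)"] end_in_support[of e b] by (auto simp: side_def cut_pts_def)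

lemma side_end': "e \<in> side S' \<Longrightarrow> end_pt (e, b) \<in> S' \<or> end_pt (e, b) \<in> cut_pts"
  using end_pt_in_image[of "(e, b)"] end_in_support[of e b] by (auto simp: side_def cut_pts_def)

text \<open>A cut point is bivalent and transversality puts its two edges on different sides. The
  flag of the near end records the direction of passage: it is a final end iff the diagram leaves
  the near side there.\<close>

lemma passes_iff:
  assumes "p \<in> cut_pts"
  shows "\<exists>d d'. fst d \<in> side S \<and> fst d' \<in> side S' \<and> end_pt d = p \<and> end_pt d' = p \<and> snd d' = (\<not> snd d) \<and>
    (\<forall>d''. fst d'' \<in> edges D \<longrightarrow> end_pt d'' = p \<longrightarrow> d'' = d \<or> d'' = d') \<and>
    (snd d \<longleftrightarrow> passes D p (\<Gamma> \<union> S) (\<Gamma> \<union> S')) \<and> (\<not> snd d \<longleftrightarrow> passes D p (\<Gamma> \<union> S') (\<Gamma> \<union> S))"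
proof -
  have discs: "{inner_disc C, outer_disc C} = {\<Gamma> \<union> S, \<Gamma> \<union> S'}"
    using sides by (auto simp: inner_disc_def outer_disc_def)
  obtain e f where ef: "e \<in> edges D" "pathfinish e = p" "f \<in> edges D" "pathstart f = p"
    and eu: "\<And>g. g \<in> edges D \<Longrightarrow> pathfinish g = p \<Longrightarrow> g = e" and fu: "\<And>g. g \<in> edges D \<Longrightarrow> pathstart g = p \<Longrightarrow> g = f"
    using bivalent_unique[OF cut_pts_vertices[OF assms]] by metis
  have ps: "passes D p (\<Gamma> \<union> T) (\<Gamma> \<union> T') \<longleftrightarrow> e \<in> side T \<and> f \<in> side T'" for T T'
    using ef eu fu unfolding passes_def side_def by blast
  have "passes D p (inner_disc C) (outer_disc C) \<or> passes D p (outer_disc C) (inner_disc C)"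
    using cut assms by (auto simp: transversal_cut_def cut_pts_def)
  then have or: "passes D p (\<Gamma> \<union> S) (\<Gamma> \<union> S') \<or> passes D p (\<Gamma> \<union> S') (\<Gamma> \<union> S)"
    using discs unfolding doubleton_eq_iff by auto
  have all: "\<forall>d''. fst d'' \<in> edges D \<longrightarrow> end_pt d'' = p \<longrightarrow> d'' = (e, True) \<or> d'' = (f, False)"
  proof (intro allI impI)
    fix d'' assume "fst d'' \<in> edges D" "end_pt d'' = p"
    then show "d'' = (e, True) \<or> d'' = (f, False)"
      using eu fu by (cases d''; cases "snd d''") (auto simp: end_pt_def)
  qed
  have ends: "end_pt (e, True) = p" "end_pt (f, False) = p" using ef by (simp_all add: end_pt_def)
  show ?thesis
  proof (cases "e \<in> side S \<and> f \<in> side S'")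
    case True
    then have no: "\<not> (e \<in> side S' \<and> f \<in> side S)" using sides_cover by blast
    show ?thesis
      by (rule exI[of _ "(e, True)"], rule exI[of _ "(f, False)"], unfold fst_conv snd_conv, intro conjI)
        (use no True ends all in \<open>simp_all add: ps\<close>)
  next
    case False
    then have no: "e \<in> side S' \<and> f \<in> side S" using or ps by blast
    show ?thesis
      by (rule exI[of _ "(f, False)"], rule exI[of _ "(e, True)"], unfold fst_conv snd_conv, intro conjI)
        (use no False ends all in \<open>simp_all add: ps disj_commute\<close>)
  qed
qed

definition cut_ends :: "complex \<Rightarrow> ((real \<Rightarrow> complex) \<times> bool) \<times> ((real \<Rightarrow> complex) \<times> bool)" where
  "cut_ends p = (SOME (d, d'). fst d \<in> side S \<and> fst d' \<in> side S' \<and> end_pt d = p \<and> end_pt d' = p \<and> snd d' = (\<not> snd d) \<and>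
    (\<forall>d''. fst d'' \<in> edges D \<longrightarrow> end_pt d'' = p \<longrightarrow> d'' = d \<or> d'' = d') \<and>
    (snd d \<longleftrightarrow> passes D p (\<Gamma> \<union> S) (\<Gamma> \<union> S')) \<and> (\<not> snd d \<longleftrightarrow> passes D p (\<Gamma> \<union> S') (\<Gamma> \<union> S)))"

definition near :: "complex \<Rightarrow> (real \<Rightarrow> complex) \<times> bool" where "near p = fst (cut_ends p)"
definition far :: "complex \<Rightarrow> (real \<Rightarrow> complex) \<times> bool" where "far p = snd (cut_ends p)"

lemma near_far:
  assumes "p \<in> cut_pts"
  shows "fst (near p) \<in> side S" "fst (far p) \<in> side S'" "end_pt (near p) = p" "end_pt (far p) = p"
    "snd (far p) = (\<not> snd (near p))"
    "\<And>d. fst d \<in> edges D \<Longrightarrow> end_pt d = p \<Longrightarrow> d = near p \<or> d = far p"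
    "snd (near p) \<longleftrightarrow> passes D p (\<Gamma> \<union> S) (\<Gamma> \<union> S')" "\<not> snd (near p) \<longleftrightarrow> passes D p (\<Gamma> \<union> S') (\<Gamma> \<union> S)"
proof -
  let ?P = "\<lambda>(d, d'). fst d \<in> side S \<and> fst d' \<in> side S' \<and> end_pt d = p \<and> end_pt d' = p \<and> snd d' = (\<not> snd d) \<and>
    (\<forall>d''. fst d'' \<in> edges D \<longrightarrow> end_pt d'' = p \<longrightarrow> d'' = d \<or> d'' = d') \<and>
    (snd d \<longleftrightarrow> passes D p (\<Gamma> \<union> S) (\<Gamma> \<union> S')) \<and> (\<not> snd d \<longleftrightarrow> passes D p (\<Gamma> \<union> S') (\<Gamma> \<union> S))"
  have "\<exists>x. ?P x" using passes_iff[OF assms] by (simp only: split_paired_Ex prod.case)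
  then have "?P (cut_ends p)" unfolding cut_ends_def by (rule someI_ex)
  then have "?P (near p, far p)" by (simp only: near_def far_def prod.collapse)
  then have P: "fst (near p) \<in> side S \<and> fst (far p) \<in> side S' \<and> end_pt (near p) = p \<and> end_pt (far p) = p \<and>
    snd (far p) = (\<not> snd (near p)) \<and>
    (\<forall>d. fst d \<in> edges D \<longrightarrow> end_pt d = p \<longrightarrow> d = near p \<or> d = far p) \<and>
    (snd (near p) \<longleftrightarrow> passes D p (\<Gamma> \<union> S) (\<Gamma> \<union> S')) \<and> (\<not> snd (near p) \<longleftrightarrow> passes D p (\<Gamma> \<union> S') (\<Gamma> \<union> S))"
    unfolding prod.case .
  from P show "fst (near p) \<in> side S" "fst (far p) \<in> side S'" "end_pt (near p) = p" "end_pt (far p) = p"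
    "snd (far p) = (\<not> snd (near p))"
    "snd (near p) \<longleftrightarrow> passes D p (\<Gamma> \<union> S) (\<Gamma> \<union> S')" "\<not> snd (near p) \<longleftrightarrow> passes D p (\<Gamma> \<union> S') (\<Gamma> \<union> S)"
    by - ((elim conjE, assumption)+)
  from P have "\<forall>d. fst d \<in> edges D \<longrightarrow> end_pt d = p \<longrightarrow> d = near p \<or> d = far p" by (elim conjE)
  then show "\<And>d. fst d \<in> edges D \<Longrightarrow> end_pt d = p \<Longrightarrow> d = near p \<or> d = far p" by blast
qed

lemma far_matching: "end_matching (side S') (mates D \<beta> S')"
  using cut_link.end_in_side[OF swap] cut_link.side_def[OF swap] side_def
  by (intro end_matching_mates) (auto simp: side_def)

definition strand' :: "complex set \<Rightarrow> complex \<Rightarrow> (real \<Rightarrow> complex) set" where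
  "strand' \<beta> p = end_matching.strand (mates D \<beta> S') (fst (far p))"

lemma far_free:
  assumes "e \<in> side S'"
  shows "(e, b) \<notin> Domain (mates D \<beta> S') \<longleftrightarrow> end_pt (e, b) \<in> cut_pts"
proof -
  have "e \<in> edges D" using assms by (simp add: side_def)
  then have "(e, b) \<notin> Domain (mates D \<beta> S') \<longleftrightarrow> end_pt (e, b) \<notin> S'" using mates_Domain by simp
  also have "\<dots> \<longleftrightarrow> end_pt (e, b) \<in> cut_pts"
    using side_end'[OF assms, of b] side_sets(3) by (auto simp: cut_pts_def)
  finally show ?thesis .
qed

text \<open>The free ends of the far matching are exactly the far ends at cut points, and a strand
  with a free end has exactly two of them.\<close>

lemma strand_cut_pts:
  assumes p: "p \<in> cut_pts"
  obtains p' where "p' \<in> cut_pts" "p' \<noteq> p" "\<And>q. q \<in> cut_pts \<Longrightarrow> fst (far q) \<in> strand' \<beta> p \<longleftrightarrow> q = p \<or> q = p'"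
proof -
  interpret m: end_matching "side S'" "mates D \<beta> S'" by (rule far_matching)
  let ?K = "m.strand (fst (far p))"
  have E: "fst (far p) \<in> side S'" using near_far[OF p] by blast
  have sub: "?K \<subseteq> side S'" using m.strand_subset[OF E] .
  have in_free: "d \<in> m.free_ends ?K \<longleftrightarrow> fst d \<in> ?K \<and> end_pt d \<in> cut_pts" for d
    using far_free[of "fst d" "snd d" \<beta>] sub by (cases d) (auto simp: m.free_ends_def)
  have "far p \<notin> Domain (mates D \<beta> S')"
    using far_free[of "fst (far p)" "snd (far p)"] E near_far(4)[OF p] p by simp
  then obtain d where d: "d \<noteq> far p" "m.free_ends ?K = {far p, d}"
    using m.free_ends_pair[OF E, of "snd (far p)"] by (metis prod.collapse)
  have far_of: "d' = far (end_pt d')" if "fst d' \<in> side S'" "end_pt d' \<in> cut_pts" for d'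
  proof -
    have "fst d' \<in> edges D" using that by (simp add: side_def)
    then have "d' = near (end_pt d') \<or> d' = far (end_pt d')" using near_far(6)[OF that(2)] by blast
    then show ?thesis using near_far(1)[OF that(2)] that(1) sides_cover(2) by auto
  qed
  have dd: "fst d \<in> ?K" "end_pt d \<in> cut_pts" using in_free d by blast+
  then have dfar: "d = far (end_pt d)" using far_of sub by blast
  show ?thesis
  proof (rule that[of "end_pt d"])
    show "end_pt d \<in> cut_pts" by fact
    show "end_pt d \<noteq> p" using d(1) dfar by auto
    fix q assume q: "q \<in> cut_pts"
    have "fst (far q) \<in> ?K \<longleftrightarrow> far q \<in> m.free_ends ?K" using in_free near_far(4)[OF q] q by simp
    also have "\<dots> \<longleftrightarrow> far q = far p \<or> far q = d" using d by simp
    also have "\<dots> \<longleftrightarrow> q = p \<or> q = end_pt d"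
      using near_far(4)[OF q] near_far(4)[OF p] dfar by metis
    finally show "fst (far q) \<in> strand' \<beta> p \<longleftrightarrow> q = p \<or> q = end_pt d" by (simp add: strand'_def)
  qed
qed

text \<open>This is \<open>strands_do_not_interleave\<close> for the unshortened far edges. The
  connectors can be found inside \<open>S'\<close>, because \<open>S'\<close> is open and the far
  edges are joined only at vertices in it.\<close>

lemma strands_noncrossing:
  assumes p: "C s1 \<in> cut_pts" "C s2 \<in> cut_pts" "C t1 \<in> cut_pts" "C t2 \<in> cut_pts"
    and j: "fst (far (C s2)) \<in> strand' \<beta> (C s1)" "fst (far (C t2)) \<in> strand' \<beta> (C t1)"
      "fst (far (C t1)) \<notin> strand' \<beta> (C s1)"
    and s: "0 \<le> s1" "s1 < s2" "s2 \<le> 1" and t: "s1 < t1" "t1 < s2" "t2 < s1 \<or> s2 < t2" "t2 \<in> {0..1}"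
  shows False
proof -
  interpret m: end_matching "side S'" "mates D \<beta> S'" by (rule far_matching)
  have sE: "e \<in> edges D" if "e \<in> side S'" for e using that by (simp add: side_def)
  let ?e = "\<lambda>t. fst (far (C t))"
  have E: "?e s1 \<in> side S'" "?e t1 \<in> side S'" using near_far(2) p by blast+
  have T: "?e t2 \<notin> m.strand (?e s1)"
  proof
    assume "?e t2 \<in> m.strand (?e s1)"
    then have "m.strand (?e t2) = m.strand (?e s1)" "m.strand (?e t2) = m.strand (?e t1)"
      using m.strand_eq j(2) unfolding strand'_def by blast+
    then show False using j(3) m.strand_refl unfolding strand'_def by metis
  qed
  \<comment> \<open>Only one far edge arrives at a cut point, so a far strand contains the point
    only if it contains that edge.\<close>
  have off: "q \<notin> path_image g" if q: "q \<in> cut_pts" "fst (far q) \<notin> m.strand (?e s1)" and g: "g \<in> m.strand (?e s1)" for q g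
  proof
    assume "q \<in> path_image g"
    have gS: "g \<in> side S'" using g m.strand_subset[OF E(1)] by blast
    obtain b where b: "end_pt (g, b) = q"
      using vertex_on_edge[of "far q" g] near_far(2,4)[OF q(1)] sE gS \<open>q \<in> path_image g\<close> by auto
    then have "(g, b) = near q \<or> (g, b) = far q" using near_far(6)[OF q(1), of "(g, b)"] sE[OF gS] by simp
    moreover have "(g, b) \<noteq> near q" using near_far(1)[OF q(1)] gS sides_cover(2) by (metis IntI empty_iff fst_conv)
    ultimately have "fst (far q) = g" by (metis fst_conv)
    then show False using q(2) g by simp
  qed
  show False
  proof (rule strands_do_not_interleave[OF far_matching, where A = "\<lambda>e. e" and S = S' and C = C and ?e1.0 = "?e s1" and ?e2.0 = "?e t1"])
    show "path e" if "e \<in> side S'" for e using arc_edge[OF sE[OF that]] by (simp add: arc_def)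
    show "open_arc e \<subseteq> S'" if "e \<in> side S'" for e using side_iff'[OF sE[OF that]] that by blast
    show "path_image e \<subseteq> S' \<union> \<Gamma>" if "e \<in> side S'" for e using that by (auto simp: side_def)
    show "open_arc e \<inter> path_image f = {}" if "e \<in> side S'" "f \<in> side S'" "e \<noteq> f" for e f
      using open_arc_disjoint[OF sE[OF that(1)] sE[OF that(2)] that(3)] .
    show "end_pt (e, b) = end_pt (f, c) \<and> (\<exists>Q. connected Q \<and> Q \<subseteq> S' \<and> Q \<inter> open_arc e \<noteq> {} \<and> Q \<inter> open_arc f \<noteq> {} \<and>
         (\<forall>g\<in>side S' - {e, f}. Q \<inter> path_image g = {}))" if ef: "((e, b), (f, c)) \<in> mates D \<beta> S'" for e b f c
    proof -
      have m: "end_pt (e, b) = end_pt (f, c)" "end_pt (e, b) \<in> S'" "((e, b), (f, c)) \<in> mates_at D \<beta> (end_pt (e, b))"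
        using mates_end_pt[OF ef] by auto
      obtain Q where Q: "connected Q" "Q \<subseteq> S'" "Q \<inter> open_arc e \<noteq> {}" "Q \<inter> open_arc f \<noteq> {}"
        "\<And>g. g \<in> edges D \<Longrightarrow> g \<noteq> e \<Longrightarrow> g \<noteq> f \<Longrightarrow> Q \<inter> path_image g = {}"
        using mates_connector[OF m(3) side_sets(6) m(2), unfolded fst_conv] by blast
      have "Q \<inter> path_image g = {}" if "g \<in> side S' - {e, f}" for g using Q(5)[of g] sE that by blast
      then show ?thesis using m(1) Q(1-4) by (intro conjI exI[of _ Q] ballI) assumption+
    qed
    show "simple_path C" "pathfinish C = pathstart C" by (rule C)+
    show "S' = inside \<Gamma> \<or> S' = outside \<Gamma>" using sides by blast
    show "?e s1 \<in> side S'" "?e t1 \<in> side S'" by (rule E)+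
    show "?e t1 \<notin> m.strand (?e s1)" using j(3) by (simp add: strand'_def)
    show "?e s1 \<in> m.strand (?e s1)" "?e t1 \<in> m.strand (?e t1)" by (rule m.strand_refl)+
    show "?e s2 \<in> m.strand (?e s1)" "?e t2 \<in> m.strand (?e t1)" using j by (simp_all add: strand'_def)
    show "end_pt (?e s1, snd (far (C s1))) = C s1" "end_pt (?e s2, snd (far (C s2))) = C s2"
      "end_pt (?e t1, snd (far (C t1))) = C t1" "end_pt (?e t2, snd (far (C t2))) = C t2"
      using near_far(4) p by simp_all
    show "C t1 \<notin> path_image g \<and> C t2 \<notin> path_image g" if "g \<in> m.strand (?e s1)" for g
      using off[OF p(3) _ that] off[OF p(4) T that] j(3) by (auto simp: strand'_def)
  qed (use s t in auto)
qed

end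

section \<open>The non crossing matching of the cut points by far strands\<close>

locale admissible_cut_link = cut_link +
  assumes admissible: "admissible_cut D C"
begin

abbreviation "ts \<equiv> cut_times D C"
abbreviation "n \<equiv> cut_size D C"

lemma C_inj: "s \<in> {0..<1} \<Longrightarrow> t \<in> {0..<1} \<Longrightarrow> C s = C t \<Longrightarrow> s = t"
  using C(1) unfolding simple_path_def loop_free_def by force

lemma finite_cut_pts: "finite cut_pts"
proof (rule finite_subset)
  show "cut_pts \<subseteq> vertices D" using cut_pts_vertices by blast
  show "finite (vertices D)" using finite_edges by (simp add: vertices_def)
qed

lemma bij_times: "bij_betw C {t \<in> {0..<1}. C t \<in> support D} cut_pts"
proof -
  have "p \<in> C ` {t \<in> {0..<1}. C t \<in> support D}" if "p \<in> cut_pts" for p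
  proof -
    obtain t where "t \<in> {0..1}" "p = C t" using \<open>p \<in> cut_pts\<close> unfolding cut_pts_def path_image_def by blast
    then have t: "t \<in> {0..1}" "p = C t" "C t \<in> support D" using \<open>p \<in> cut_pts\<close> by (simp_all add: cut_pts_def)
    have "C 1 = C 0" using C(2) by (simp add: pathfinish_def pathstart_def)
    then have "(if t = 1 then 0 else t) \<in> {t \<in> {0..<1}. C t \<in> support D}" "p = C (if t = 1 then 0 else t)"
      using t by auto
    then show ?thesis by (rule rev_image_eqI)
  qed
  moreover have "C t \<in> cut_pts" if "t \<in> {0..<1}" "C t \<in> support D" for t
    using that by (auto simp: cut_pts_def path_image_def)
  moreover have "inj_on C {t \<in> {0..<1}. C t \<in> support D}" by (rule inj_onI) (use C_inj in auto)
  ultimately show ?thesis unfolding bij_betw_def by blast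
qed

lemma times: "set ts = {t \<in> {0..<1}. C t \<in> support D}" "sorted_wrt (<) ts" "distinct ts"
proof -
  have "finite {t \<in> {0..<1}. C t \<in> support D}" using bij_betw_finite[OF bij_times] finite_cut_pts by simp
  then show "set ts = {t \<in> {0..<1}. C t \<in> support D}" by (simp add: cut_times_def)
  show "sorted_wrt (<) ts" "distinct ts" by (simp_all add: cut_times_def)
qed

definition cut_pt :: "nat \<Rightarrow> complex" where
  "cut_pt k = C (ts ! k)"

lemma bij_cut_pt: "bij_betw cut_pt {..<length ts} cut_pts"
proof -
  have "bij_betw (\<lambda>k. ts ! k) {..<length ts} (set ts)" using bij_betw_nth[OF times(3)] by blast
  then have "bij_betw (C \<circ> (\<lambda>k. ts ! k)) {..<length ts} cut_pts"
    using bij_betw_trans[OF _ bij_times] times(1) by auto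
  then show ?thesis by (simp add: cut_pt_def[abs_def] comp_def)
qed

lemma cut_pt_in: "k < length ts \<Longrightarrow> cut_pt k \<in> cut_pts"
  using bij_cut_pt by (auto simp: bij_betw_def)

lemma cut_pt_eq: "k < length ts \<Longrightarrow> l < length ts \<Longrightarrow> cut_pt k = cut_pt l \<longleftrightarrow> k = l"
  using bij_cut_pt by (auto simp: bij_betw_def inj_on_def)

lemma times_less: "k < l \<Longrightarrow> l < length ts \<Longrightarrow> ts ! k < ts ! l"
  using times(2) by (simp add: sorted_wrt_iff_nth_less)

lemma times_in: "k < length ts \<Longrightarrow> ts ! k \<in> {0..<1}"
  using times(1) nth_mem by blast

lemma inner_outer: "passes D p (inner_disc C) (outer_disc C) \<longleftrightarrow> \<not> passes D p (outer_disc C) (inner_disc C)"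
  if p: "p \<in> cut_pts"
proof -
  have "inner_disc C = \<Gamma> \<union> S \<and> outer_disc C = \<Gamma> \<union> S' \<or> inner_disc C = \<Gamma> \<union> S' \<and> outer_disc C = \<Gamma> \<union> S"
    using sides by (auto simp: inner_disc_def outer_disc_def)
  then show ?thesis
  proof
    assume "inner_disc C = \<Gamma> \<union> S \<and> outer_disc C = \<Gamma> \<union> S'"
    then have d: "inner_disc C = \<Gamma> \<union> S" "outer_disc C = \<Gamma> \<union> S'" by - ((elim conjE, assumption)+)
    show ?thesis unfolding d near_far(7)[OF p, symmetric] near_far(8)[OF p, symmetric] by simp
  next
    assume "inner_disc C = \<Gamma> \<union> S' \<and> outer_disc C = \<Gamma> \<union> S"
    then have d: "inner_disc C = \<Gamma> \<union> S'" "outer_disc C = \<Gamma> \<union> S" by - ((elim conjE, assumption)+)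
    show ?thesis unfolding d near_far(7)[OF p, symmetric] near_far(8)[OF p, symmetric] by (rule refl)
  qed
qed

text \<open>The alternation is cyclic: with an odd number of points, going once around would reverse
  the direction at the first point.\<close>

lemma length_times: "length ts = 2 * n"
proof -
  let ?Q = "\<lambda>k. passes D (cut_pt k) (inner_disc C) (outer_disc C)"
  have alt: "?Q k \<longleftrightarrow> \<not> ?Q (Suc k mod length ts)" if k: "k < length ts" for k
  proof -
    have m: "Suc k mod length ts < length ts" using k by (intro mod_less_divisor) auto
    have "?Q k \<longleftrightarrow> passes D (cut_pt (Suc k mod length ts)) (outer_disc C) (inner_disc C)"
      using admissible k unfolding admissible_cut_def Let_def cut_pt_def by blast
    then show ?thesis using inner_outer[OF cut_pt_in[OF m]] by simp
  qed
  have Q: "k < length ts \<Longrightarrow> ?Q k \<longleftrightarrow> (even k \<longleftrightarrow> ?Q 0)" for k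
  proof (induction k)
    case (Suc k)
    then have "?Q k \<longleftrightarrow> \<not> ?Q (Suc k)" using alt[of k] by simp
    then show ?case using Suc by auto
  qed simp
  have "even (length ts)"
  proof (rule ccontr)
    assume odd: "odd (length ts)"
    then have l: "length ts - 1 < length ts" "even (length ts - 1)" by (auto elim: oddE)
    have "Suc (length ts - 1) = length ts" using l(1) by simp
    then have "Suc (length ts - 1) mod length ts = 0" by simp
    then have "?Q (length ts - 1) \<longleftrightarrow> \<not> ?Q 0" using alt[OF l(1)] by metis
    then show False using Q[OF l(1)] l(2) by simp
  qed
  then show ?thesis by (simp add: cut_size_def)
qed

definition partner :: "complex set \<Rightarrow> complex \<Rightarrow> complex" where
  "partner \<beta> p = (SOME p'. p' \<in> cut_pts \<and> p' \<noteq> p \<and> (\<forall>q\<in>cut_pts. fst (far q) \<in> strand' \<beta> p \<longleftrightarrow> q = p \<or> q = p'))"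

lemma partner:
  assumes "p \<in> cut_pts"
  shows "partner \<beta> p \<in> cut_pts" "partner \<beta> p \<noteq> p"
    "\<And>q. q \<in> cut_pts \<Longrightarrow> fst (far q) \<in> strand' \<beta> p \<longleftrightarrow> q = p \<or> q = partner \<beta> p"
proof -
  let ?P = "\<lambda>p'. p' \<in> cut_pts \<and> p' \<noteq> p \<and> (\<forall>q\<in>cut_pts. fst (far q) \<in> strand' \<beta> p \<longleftrightarrow> q = p \<or> q = p')"
  obtain p' where "p' \<in> cut_pts" "p' \<noteq> p" "\<And>q. q \<in> cut_pts \<Longrightarrow> fst (far q) \<in> strand' \<beta> p \<longleftrightarrow> q = p \<or> q = p'"
    using strand_cut_pts[OF assms, of \<beta>] by metis
  then have "?P p'" by simp
  then have P: "?P (partner \<beta> p)" unfolding partner_def by (rule someI)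
  from P show "partner \<beta> p \<in> cut_pts" "partner \<beta> p \<noteq> p" by - ((elim conjE, assumption)+)
  from P have "\<forall>q\<in>cut_pts. fst (far q) \<in> strand' \<beta> p \<longleftrightarrow> q = p \<or> q = partner \<beta> p" by (elim conjE)
  then show "\<And>q. q \<in> cut_pts \<Longrightarrow> fst (far q) \<in> strand' \<beta> p \<longleftrightarrow> q = p \<or> q = partner \<beta> p" by (rule bspec)
qed

lemma partner_partner:
  assumes p: "p \<in> cut_pts"
  shows "partner \<beta> (partner \<beta> p) = p"
proof -
  interpret m: end_matching "side S'" "mates D \<beta> S'" by (rule far_matching)
  let ?q = "partner \<beta> p"
  have q: "?q \<in> cut_pts" "?q \<noteq> p" using partner[OF p] by blast+
  have "fst (far ?q) \<in> strand' \<beta> p" using partner(3)[OF p q(1)] by simp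
  then have "fst (far p) \<in> strand' \<beta> ?q" unfolding strand'_def by (rule m.strand_sym)
  then show ?thesis using partner(3)[OF q(1) p] q(2) by metis
qed

definition mate_index :: "complex set \<Rightarrow> nat \<Rightarrow> nat" where
  "mate_index \<beta> k = inv_into {..<length ts} cut_pt (partner \<beta> (cut_pt k))"

lemma mate_index:
  assumes "k < length ts"
  shows "mate_index \<beta> k < length ts" "cut_pt (mate_index \<beta> k) = partner \<beta> (cut_pt k)"
proof -
  have "partner \<beta> (cut_pt k) \<in> cut_pt ` {..<length ts}"
    using partner(1)[OF cut_pt_in[OF assms]] bij_cut_pt by (simp add: bij_betw_def)
  then show "mate_index \<beta> k < length ts" "cut_pt (mate_index \<beta> k) = partner \<beta> (cut_pt k)"
    unfolding mate_index_def using inv_into_into[of _ cut_pt "{..<length ts}"] f_inv_into_f[of _ cut_pt "{..<length ts}"] by auto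
qed

lemma strand'_cut_pt:
  assumes "k < length ts" "l < length ts"
  shows "fst (far (cut_pt l)) \<in> strand' \<beta> (cut_pt k) \<longleftrightarrow> l = k \<or> l = mate_index \<beta> k"
  using partner(3)[OF cut_pt_in[OF assms(1)] cut_pt_in[OF assms(2)]] mate_index[OF assms(1)] cut_pt_eq assms by metis

lemma mate_index_involution: "k < length ts \<Longrightarrow> mate_index \<beta> (mate_index \<beta> k) = k"
  using mate_index partner_partner[OF cut_pt_in] cut_pt_eq by metis

lemma mate_index_noncrossing:
  assumes k: "k < length ts" "k < l" "l < mate_index \<beta> k"
  shows "k < mate_index \<beta> l \<and> mate_index \<beta> l < mate_index \<beta> k"
proof (rule ccontr)
  assume no: "\<not> ?thesis"
  let ?\<pi> = "mate_index \<beta>"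
  have kl: "?\<pi> k < length ts" "l < length ts" using mate_index(1)[OF k(1)] k by (auto intro: less_trans)
  have ll: "?\<pi> l < length ts" by (rule mate_index(1)[OF kl(2)])
  have "?\<pi> l \<noteq> k" using mate_index_involution[OF kl(2)] k by (metis less_irrefl)
  moreover have "?\<pi> l \<noteq> ?\<pi> k" using mate_index_involution[OF kl(2)] mate_index_involution[OF k(1)] k by (metis less_irrefl)
  ultimately have out: "?\<pi> l < k \<or> ?\<pi> k < ?\<pi> l" using no by linarith
  show False
  proof (rule strands_noncrossing[of "ts ! k" "ts ! ?\<pi> k" "ts ! l" "ts ! ?\<pi> l" \<beta>, folded cut_pt_def])
    show "cut_pt k \<in> cut_pts" "cut_pt (?\<pi> k) \<in> cut_pts" "cut_pt l \<in> cut_pts" "cut_pt (?\<pi> l) \<in> cut_pts"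
      using cut_pt_in k(1) kl ll by blast+
    show "fst (far (cut_pt (?\<pi> k))) \<in> strand' \<beta> (cut_pt k)" using strand'_cut_pt[OF k(1) kl(1)] by simp
    show "fst (far (cut_pt (?\<pi> l))) \<in> strand' \<beta> (cut_pt l)" using strand'_cut_pt[OF kl(2) ll] by simp
    show "fst (far (cut_pt l)) \<notin> strand' \<beta> (cut_pt k)" using strand'_cut_pt[OF k(1) kl(2)] k by simp
    show "0 \<le> ts ! k" "ts ! ?\<pi> k \<le> 1" "ts ! ?\<pi> l \<in> {0..1}" using times_in[OF k(1)] times_in[OF kl(1)] times_in[OF ll] by auto
    show "ts ! k < ts ! ?\<pi> k" "ts ! k < ts ! l" "ts ! l < ts ! ?\<pi> k" using times_less k kl by auto
    show "ts ! ?\<pi> l < ts ! k \<or> ts ! ?\<pi> k < ts ! ?\<pi> l" using out times_less k(1) ll by blast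
  qed
qed

lemma noncrossing_mate_index: "noncrossing_matching n (mate_index \<beta>)"
proof
  show "mate_index \<beta> k < 2 * n" "mate_index \<beta> (mate_index \<beta> k) = k" if "k < 2 * n" for k
    using that mate_index(1) mate_index_involution unfolding length_times by blast+
  show "mate_index \<beta> k \<noteq> k" if "k < 2 * n" for k
    using mate_index(2)[of k \<beta>] partner(2)[OF cut_pt_in, of k \<beta>] that unfolding length_times by metis
  show "k < mate_index \<beta> l \<and> mate_index \<beta> l < mate_index \<beta> k" if "k < 2 * n" "k < l" "l < mate_index \<beta> k" for k l
    using mate_index_noncrossing that unfolding length_times by blast
qed

lemma cut_ab:
  "i \<in> {1..n} \<Longrightarrow> cut_b D C i = cut_pt (2 * i - 1) \<and> cut_a D C i = cut_pt (2 * i - 2)"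
  by (simp add: cut_b_def cut_a_def cut_pt_def)

text \<open>\<open>ch p\<close> is the chord at \<open>p\<close> of the chord system that imitates the strands of the far tangle.\<close>

lemma far_pattern:
  obtains P ch where "P \<in> NC n" "\<And>p. p \<in> cut_pts \<Longrightarrow> ch p \<in> {1..n}"
    "\<And>p. p \<in> cut_pts \<Longrightarrow> p = cut_b D C (ch p) \<or> p = cut_a D C (block_succ P (ch p))"
    "\<And>i. i \<in> {1..n} \<Longrightarrow> cut_b D C i \<in> cut_pts \<and> ch (cut_b D C i) = i"
    "\<And>i. i \<in> {1..n} \<Longrightarrow> cut_a D C (block_succ P i) \<in> cut_pts \<and> ch (cut_a D C (block_succ P i)) = i"
    "\<And>p q. p \<in> cut_pts \<Longrightarrow> q \<in> cut_pts \<Longrightarrow> ch p = ch q \<longleftrightarrow> fst (far q) \<in> strand' \<beta> p"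
proof -
  let ?\<pi> = "mate_index \<beta>"
  interpret N: noncrossing_matching n ?\<pi> by (rule noncrossing_mate_index)
  \<comment> \<open>The odd one of the two positions that the strand at \<open>k\<close> joins,
    unique by \<open>N.parity\<close>. It has the form \<open>2 * i - 1\<close> and belongs to the
    point \<open>b i\<close>; \<open>ch\<close> extracts this index \<open>i\<close>.\<close>
  define o' where "o' k = (if odd k then k else ?\<pi> k)" for k
  define idx where "idx = inv_into {..<length ts} cut_pt"
  define ch where "ch p = Suc (o' (idx p)) div 2" for p
  have idx: "idx p < length ts \<and> cut_pt (idx p) = p" if "p \<in> cut_pts" for p
    using bij_cut_pt that inv_into_into[of p cut_pt "{..<length ts}"] f_inv_into_f[of p cut_pt "{..<length ts}"]
    by (auto simp: idx_def bij_betw_def)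
  have idx_pt: "idx (cut_pt k) = k" if "k < length ts" for k
    using bij_cut_pt that by (simp add: idx_def bij_betw_def)
  have o': "o' k < 2 * n" "odd (o' k)" "o' k = k \<or> o' k = ?\<pi> k" "o' (?\<pi> k) = o' k" if k: "k < 2 * n" for k
    using N.in_range[OF k] N.parity[OF k] N.involution[OF k] k unfolding o'_def by auto
  have o'_eq: "o' k = o' l \<longleftrightarrow> l = k \<or> l = ?\<pi> k" if "k < 2 * n" "l < 2 * n" for k l
  proof
    assume "o' k = o' l"
    then have "o' k = l \<or> o' k = ?\<pi> l" using o'(3)[OF that(2)] by metis
    then have "o' k = l \<or> ?\<pi> (o' k) = l" using N.involution[OF that(2)] by metis
    then show "l = k \<or> l = ?\<pi> k" using o'(3)[OF that(1)] N.involution[OF that(1)] by metis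
  next
    assume "l = k \<or> l = ?\<pi> k"
    then show "o' k = o' l" using o'(4)[OF that(1)] by auto
  qed
  have ch_idx: "2 * ch p - 1 = o' (idx p)" "ch p \<in> {1..n}" if "p \<in> cut_pts" for p
  proof -
    have "idx p < 2 * n" using idx[OF that] length_times by simp
    from o'(1,2)[OF this] show "2 * ch p - 1 = o' (idx p)" "ch p \<in> {1..n}" unfolding ch_def by (auto elim!: oddE)
  qed
  note succ = N.block_succ_orbits
  have b: "cut_b D C i \<in> cut_pts \<and> idx (cut_b D C i) = 2 * i - 1 \<and> 2 * i - 1 < 2 * n" if "i \<in> {1..n}" for i
  proof -
    have "2 * i - 1 < length ts" using that length_times by auto
    then show ?thesis using cut_ab[OF that] cut_pt_in idx_pt length_times by metis
  qed
  have a: "cut_a D C (N.target i) \<in> cut_pts \<and> idx (cut_a D C (N.target i)) = ?\<pi> (2 * i - 1)" if i: "i \<in> {1..n}" for i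
  proof -
    have "?\<pi> (2 * i - 1) < length ts" using N.in_range[of "2 * i - 1"] b[OF i] length_times by simp
    moreover have "cut_a D C (N.target i) = cut_pt (?\<pi> (2 * i - 1))" using cut_ab[OF N.target(1)[OF i]] N.target(2)[OF i] by simp
    ultimately show ?thesis using cut_pt_in idx_pt by simp
  qed
  have o_odd: "o' (2 * i - 1) = 2 * i - 1" if "i \<in> {1..n}" for i using that by (auto simp: o'_def)
  show ?thesis
  proof (rule that[of N.orbits ch])
    show "N.orbits \<in> NC n" by (rule N.orbits_in_NC)
    show "ch p \<in> {1..n}" if "p \<in> cut_pts" for p using ch_idx(2)[OF that] .
    show "p = cut_b D C (ch p) \<or> p = cut_a D C (block_succ N.orbits (ch p))" if p: "p \<in> cut_pts" for p
    proof -
      note i = ch_idx[OF p]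
      have k: "idx p < 2 * n" using idx[OF p] length_times by simp
      have "idx p = 2 * ch p - 1 \<or> idx p = ?\<pi> (2 * ch p - 1)"
        using o'(3)[OF k] N.involution[OF k] unfolding i(1) by metis
      then have "idx p = idx (cut_b D C (ch p)) \<or> idx p = idx (cut_a D C (N.target (ch p)))"
        using a[OF i(2)] b[OF i(2)] by metis
      then show ?thesis using idx p a[OF i(2)] b[OF i(2)] succ[OF i(2)] by metis
    qed
    show "cut_b D C i \<in> cut_pts \<and> ch (cut_b D C i) = i" if i: "i \<in> {1..n}" for i
      using b[OF i] o_odd[OF i] i unfolding ch_def by auto
    show "cut_a D C (block_succ N.orbits i) \<in> cut_pts \<and> ch (cut_a D C (block_succ N.orbits i)) = i" if i: "i \<in> {1..n}" for i
      using a[OF i] b[OF i] o'(4)[of "2 * i - 1"] o_odd[OF i] i succ[OF i] unfolding ch_def by auto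
    show "ch p = ch q \<longleftrightarrow> fst (far q) \<in> strand' \<beta> p" if pq: "p \<in> cut_pts" "q \<in> cut_pts" for p q
    proof -
      have k: "idx p < 2 * n" "idx q < 2 * n" using idx pq length_times by simp_all
      have "ch p = ch q \<longleftrightarrow> o' (idx p) = o' (idx q)"
        using ch_idx[OF pq(1)] ch_idx[OF pq(2)] unfolding ch_def by metis
      also have "\<dots> \<longleftrightarrow> idx q = idx p \<or> idx q = ?\<pi> (idx p)" by (rule o'_eq[OF k])
      also have "\<dots> \<longleftrightarrow> fst (far (cut_pt (idx q))) \<in> strand' \<beta> (cut_pt (idx p))"
        using strand'_cut_pt[of "idx p" "idx q"] k length_times by simp
      finally show ?thesis using idx pq by simp
    qed
  qed
qed

end

section \<open>Circles of a diagram whose far side is replaced by chords\<close>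

lemma mates_at_bivalent:
  assumes "v \<notin> set (crossings K)"
  shows "mates_at K \<alpha> v = {(d, d'). fst d \<in> edges K \<and> fst d' \<in> edges K \<and> end_pt d = v \<and> end_pt d' = v \<and> snd d' = (\<not> snd d)}"
    (is "_ = ?R")
proof (intro equalityI subsetI)
  fix x assume "x \<in> mates_at K \<alpha> v"
  then show "x \<in> ?R" using assms by (auto simp: mates_at_def Let_def end_pt_def)
next
  fix x assume x: "x \<in> ?R"
  obtain e b f c where "x = ((e, b), (f, c))" by (metis prod.exhaust)
  then show "x \<in> mates_at K \<alpha> v" using x assms by (cases b) (auto simp: mates_at_def Let_def end_pt_def)
qed

lemma mates_at_cong: "(v \<in> \<alpha> \<longleftrightarrow> v \<in> \<alpha>') \<Longrightarrow> mates_at K \<alpha> v = mates_at K \<alpha>' v"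
  by (simp add: mates_at_def consistent_def)

lemma mates_cong: "\<alpha> \<inter> V = \<alpha>' \<inter> V \<Longrightarrow> mates K \<alpha> V = mates K \<alpha>' V"
  unfolding mates_def by (intro SUP_cong refl mates_at_cong) blast

lemma mates_Un: "mates K \<alpha> (V \<union> W) = mates K \<alpha> V \<union> mates K \<alpha> W"
  by (simp add: mates_def)

lemma (in cut_link) crossing_off_cut: "set (crossings D) \<inter> \<Gamma> = {}"
proof -
  have "x \<in> support D" if "x \<in> set (crossings D)" for x
    using crossing_edges(1,5)[OF that] pathfinish_in_path_image[of "over_in D x"] unfolding support_def by auto
  then have "set (crossings D) \<subseteq> support D" by blast
  then show ?thesis using cut_pts_vertices(2) unfolding cut_pts_def by blast
qed

text \<open>\<open>D'\<close> is obtained from the near part of \<open>D\<close> by joining the points of the cut by chords in the same way as the far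
  strands in the state \<open>\<beta>\<close> do.\<close>

locale closed_up_link = cut_link +
  fixes \<beta> :: "complex set" and ch :: "complex \<Rightarrow> nat" and I :: "nat set" and \<sigma> :: "nat \<Rightarrow> real \<Rightarrow> complex" and D' :: diagram
  assumes chord: "i \<in> I \<Longrightarrow> arc (\<sigma> i)" "i \<in> I \<Longrightarrow> path_image (\<sigma> i) \<subseteq> \<Gamma> \<union> S'"
      "i \<in> I \<Longrightarrow> path_image (\<sigma> i) \<inter> \<Gamma> = {pathstart (\<sigma> i), pathfinish (\<sigma> i)}"
    and chords_disjoint: "i \<in> I \<Longrightarrow> j \<in> I \<Longrightarrow> i \<noteq> j \<Longrightarrow> path_image (\<sigma> i) \<inter> path_image (\<sigma> j) = {}"
    and chord_ends: "i \<in> I \<Longrightarrow> pathstart (\<sigma> i) \<in> cut_pts" "i \<in> I \<Longrightarrow> pathfinish (\<sigma> i) \<in> cut_pts"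
      "i \<in> I \<Longrightarrow> passes D (pathstart (\<sigma> i)) (\<Gamma> \<union> S) (\<Gamma> \<union> S')"
      "i \<in> I \<Longrightarrow> passes D (pathfinish (\<sigma> i)) (\<Gamma> \<union> S') (\<Gamma> \<union> S)"
    and ch: "p \<in> cut_pts \<Longrightarrow> ch p \<in> I" "p \<in> cut_pts \<Longrightarrow> p = pathstart (\<sigma> (ch p)) \<or> p = pathfinish (\<sigma> (ch p))"
    and ch_eq: "p \<in> cut_pts \<Longrightarrow> q \<in> cut_pts \<Longrightarrow> ch p = ch q \<longleftrightarrow> fst (far q) \<in> strand' \<beta> p"
    and D': "edges D' = side S \<union> \<sigma> ` I" "set (crossings D') = set (crossings D) \<inter> S"
      "x \<in> set (crossings D') \<Longrightarrow> over_in D' x = over_in D x \<and> over_out D' x = over_out D x \<and>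
        under_in D' x = under_in D x \<and> under_out D' x = under_out D x"
begin

text \<open>The flag is opposite to that of the near end, since the orientation continues from the
  near edge into the chord or back.\<close>

definition chord_end :: "complex \<Rightarrow> (real \<Rightarrow> complex) \<times> bool" where
  "chord_end p = (\<sigma> (ch p), \<not> snd (near p))"

lemma ch_unique: "i \<in> I \<Longrightarrow> p \<in> cut_pts \<Longrightarrow> p \<in> path_image (\<sigma> i) \<Longrightarrow> i = ch p"
proof (rule ccontr)
  assume i: "i \<in> I" "p \<in> cut_pts" "p \<in> path_image (\<sigma> i)" "i \<noteq> ch p"
  have "p \<in> path_image (\<sigma> (ch p))" using ch(2)[OF i(2)] by (metis pathstart_in_path_image pathfinish_in_path_image)
  then show False using chords_disjoint[OF i(1) ch(1)[OF i(2)] i(4)] i(3) by blast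
qed

lemma chord_end: "p \<in> cut_pts \<Longrightarrow> end_pt (chord_end p) = p"
proof -
  assume p: "p \<in> cut_pts"
  note i = ch(1)[OF p]
  from ch(2)[OF p] show ?thesis
  proof
    assume a: "p = pathstart (\<sigma> (ch p))"
    then have "snd (near p)" using chord_ends(3)[OF i] near_far(7)[OF p] by metis
    then show ?thesis using a by (simp add: chord_end_def end_pt_def)
  next
    assume a: "p = pathfinish (\<sigma> (ch p))"
    then have "\<not> snd (near p)" using chord_ends(4)[OF i] near_far(8)[OF p] by metis
    then show ?thesis using a by (simp add: chord_end_def end_pt_def)
  qed
qed

lemma chord_end_unique:
  assumes i: "i \<in> I"
  shows "end_pt (\<sigma> i, b) \<in> cut_pts" "(\<sigma> i, b) = chord_end (end_pt (\<sigma> i, b))"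
proof -
  let ?p = "end_pt (\<sigma> i, b)"
  show p: "?p \<in> cut_pts" using chord_ends(1,2)[OF i] by (simp add: end_pt_def)
  have ip: "i = ch ?p" using ch_unique[OF i p] end_pt_in_image[of "(\<sigma> i, b)"] by simp
  have "b = (\<not> snd (near ?p))"
  proof (cases b)
    case True
    then have "?p = pathfinish (\<sigma> i)" by (simp add: end_pt_def)
    then show ?thesis using True chord_ends(4)[OF i] near_far(8)[OF p] by metis
  next
    case False
    then have "?p = pathstart (\<sigma> i)" by (simp add: end_pt_def)
    then show ?thesis using False chord_ends(3)[OF i] near_far(7)[OF p] by metis
  qed
  with ip show "(\<sigma> i, b) = chord_end ?p" unfolding chord_end_def by (rule arg_cong2[where f = "\<lambda>j c. (\<sigma> j, c)"])
qed

lemma chord_midpoint: "i \<in> I \<Longrightarrow> \<sigma> i (1/2) \<in> S'"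
proof -
  assume i: "i \<in> I"
  have inj: "inj_on (\<sigma> i) {0..1}" using chord(1)[OF i] by (simp add: arc_def)
  have m: "\<sigma> i (1/2) \<in> path_image (\<sigma> i)" by (simp add: path_image_def)
  have "\<sigma> i (1/2) \<noteq> \<sigma> i 0" "\<sigma> i (1/2) \<noteq> \<sigma> i 1" using inj_onD[OF inj, of "1/2" 0] inj_onD[OF inj, of "1/2" 1] by auto
  then have "\<sigma> i (1/2) \<notin> \<Gamma>" using chord(3)[OF i] m by (auto simp: pathstart_def pathfinish_def)
  then show ?thesis using chord(2)[OF i] m by blast
qed

lemma side_midpoint: "e \<in> side S \<Longrightarrow> e (1/2) \<in> S"
proof -
  assume e: "e \<in> side S"
  then have "open_arc e \<subseteq> S" using side_iff[of e] by (simp add: side_def)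
  moreover have "e (1/2) \<in> open_arc e" by auto
  ultimately show ?thesis by blast
qed

text \<open>The midpoints of near edges and of chords lie on different sides of the cut. For
  \<open>D'\<close> this takes the place of \<open>open_arc_disjoint\<close>, which concerns the
  edges of \<open>D\<close>.\<close>

lemma midpoint_unique:
  assumes "e \<in> edges D'" "f \<in> edges D'" "e (1/2) \<in> path_image f"
  shows "e = f"
proof -
  have "side T \<subseteq> edges D" for T by (auto simp: side_def)
  consider "e \<in> side S" "f \<in> side S" | i where "e \<in> side S" "i \<in> I" "f = \<sigma> i"
    | i where "f \<in> side S" "i \<in> I" "e = \<sigma> i" | i j where "i \<in> I" "j \<in> I" "e = \<sigma> i" "f = \<sigma> j"
    using assms(1,2) D'(1) by blast
  then show ?thesis
  proof cases
    case 1
    have "e (1/2) \<in> open_arc e" by auto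
    then have ne: "open_arc e \<inter> path_image f \<noteq> {}" using assms(3) by blast
    have ed: "e \<in> edges D" "f \<in> edges D" using 1 by (simp_all add: side_def)
    show ?thesis
    proof (rule ccontr)
      assume "e \<noteq> f"
      then show False using open_arc_disjoint[OF ed] ne by simp
    qed
  next
    case (2 i)
    then show ?thesis using side_midpoint[OF 2(1)] chord(2)[OF 2(2)] assms(3) side_sets(1,2) by blast
  next
    case (3 i)
    then have "e (1/2) \<in> S'" using chord_midpoint by blast
    moreover have "path_image f \<subseteq> \<Gamma> \<union> S" using 3 by (simp add: side_def)
    ultimately show ?thesis using assms(3) side_sets(1,3) by blast
  next
    case (4 i j)
    have "e (1/2) \<in> path_image e" by (simp add: path_image_def)
    then show ?thesis using chords_disjoint[OF 4(1,2)] 4 assms(3) by blast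
  qed
qed

lemma e3_range: "(\<lambda>p. \<sigma> (ch p)) ` cut_pts = \<sigma> ` I"
proof
  show "(\<lambda>p. \<sigma> (ch p)) ` cut_pts \<subseteq> \<sigma> ` I" using ch(1) by blast
  show "\<sigma> ` I \<subseteq> (\<lambda>p. \<sigma> (ch p)) ` cut_pts"
  proof
    fix e assume "e \<in> \<sigma> ` I"
    then obtain i where i: "i \<in> I" "e = \<sigma> i" by blast
    have "i = ch (pathstart (\<sigma> i))" by (rule ch_unique[OF i(1) chord_ends(1)[OF i(1)] pathstart_in_path_image])
    then show "e \<in> (\<lambda>p. \<sigma> (ch p)) ` cut_pts" using chord_ends(1)[OF i(1)] i(2) by (metis image_eqI)
  qed
qed

text \<open>With \<open>far\<close> this is the matching along the cut in \<open>D\<close>, with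
  \<open>chord_end\<close> the one in \<open>D'\<close>; the two diagrams are compared through this
  common form.\<close>

definition attached :: "(complex \<Rightarrow> (real \<Rightarrow> complex) \<times> bool) \<Rightarrow>
    (((real \<Rightarrow> complex) \<times> bool) \<times> ((real \<Rightarrow> complex) \<times> bool)) set" where
  "attached g = {(d, d'). \<exists>p\<in>cut_pts. d = near p \<and> d' = g p \<or> d = g p \<and> d' = near p}"

lemma mates_cut: "mates D \<gamma> \<Gamma> = attached far"
proof -
  have v: "mates_at D \<gamma> v = {(d, d'). v \<in> cut_pts \<and> (d = near v \<and> d' = far v \<or> d = far v \<and> d' = near v)}" if "v \<in> \<Gamma>" for v
  proof (cases "v \<in> cut_pts")
    case True
    note nf = near_far[OF True]
    have ed: "fst (near v) \<in> edges D" "fst (far v) \<in> edges D" using nf(1,2) by (simp_all add: side_def)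
    have "v \<notin> set (crossings D)" using cut_pts_vertices(2)[OF True] .
    note m = mates_at_bivalent[OF this, of \<gamma>]
    show ?thesis unfolding m
    proof (intro equalityI subsetI; clarify)
      fix e b f c assume a: "fst (e, b) \<in> edges D" "fst (f, c) \<in> edges D" "end_pt (f, c) = end_pt (e, b)" "v = end_pt (e, b)" "snd (f, c) = (\<not> snd (e, b))"
      have "(e, b) = near v \<or> (e, b) = far v" "(f, c) = near v \<or> (f, c) = far v" using nf(6) a(1-4) by auto
      moreover have "(e, b) \<noteq> (f, c)" using a(5) by auto
      ultimately show "end_pt (e, b) \<in> cut_pts \<and> ((e, b) = near (end_pt (e, b)) \<and> (f, c) = far (end_pt (e, b)) \<or> (e, b) = far (end_pt (e, b)) \<and> (f, c) = near (end_pt (e, b)))"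
        using True a(4) by metis
    next
      fix e b f c assume "(e, b) = near v \<and> (f, c) = far v \<or> (e, b) = far v \<and> (f, c) = near v"
      then show "fst (e, b) \<in> edges D \<and> fst (f, c) \<in> edges D \<and> end_pt (e, b) = v \<and> end_pt (f, c) = v \<and> snd (f, c) = (\<not> snd (e, b))"
        using ed nf(3-5) by metis
    qed
  next
    case False
    have "v \<notin> set (crossings D)" using crossing_off_cut that by blast
    note m = mates_at_bivalent[OF this, of \<gamma>]
    have "end_pt d \<noteq> v" if "fst d \<in> edges D" for d
      using end_in_support[of "fst d" "snd d"] that False \<open>v \<in> \<Gamma>\<close> by (auto simp: cut_pts_def)
    then show ?thesis unfolding m using False by blast
  qed
  have "mates D \<gamma> \<Gamma> = (\<Union>v\<in>\<Gamma>. {(d, d'). v \<in> cut_pts \<and> (d = near v \<and> d' = far v \<or> d = far v \<and> d' = near v)})"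
    unfolding mates_def using v by (intro SUP_cong) auto
  also have "\<dots> = attached far" unfolding attached_def cut_pts_def by blast
  finally show ?thesis .
qed

lemma ends_of_D':
  assumes "fst d \<in> edges D'"
  shows "fst d \<in> side S \<and> (end_pt d \<in> S \<or> end_pt d \<in> cut_pts \<and> d = near (end_pt d)) \<or>
    fst d \<in> \<sigma> ` I \<and> end_pt d \<in> cut_pts \<and> d = chord_end (end_pt d)"
proof (cases "fst d \<in> side S")
  case True
  then have ed: "fst d \<in> edges D" by (simp add: side_def)
  show ?thesis
  proof (cases "end_pt d \<in> S")
    case False
    then have c: "end_pt d \<in> cut_pts" using side_end[OF True, of "snd d"] by simp
    have "d = near (end_pt d) \<or> d = far (end_pt d)" using near_far(6)[OF c ed] by simp
    moreover have "fst (far (end_pt d)) \<notin> side S" using near_far(2)[OF c] sides_cover(2) by blast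
    ultimately have "d = near (end_pt d)" using True by metis
    then show ?thesis using True c by blast
  qed (use True in blast)
next
  case False
  then obtain i where i: "i \<in> I" "fst d = \<sigma> i" using assms D'(1) by blast
  then have "d = (\<sigma> i, snd d)" by (metis prod.collapse)
  then show ?thesis using chord_end_unique[OF i(1), of "snd d"] i by (metis imageI)
qed

lemma mates_near: "mates D' \<alpha> S = mates D \<alpha> S"
proof -
  have "mates_at D' \<alpha> v = mates_at D \<alpha> v" if v: "v \<in> S" for v
  proof (cases "v \<in> set (crossings D)")
    case True
    then have v': "v \<in> set (crossings D')" using v D'(2) by blast
    note f = D'(3)[OF v']
    have "positive_crossing D' v = positive_crossing D v"
      using f by (simp add: positive_crossing_def over_dir_def under_dir_def)
    then show ?thesis using True v' f by (simp add: mates_at_def consistent_def)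
  next
    case False
    then have v': "v \<notin> set (crossings D')" using D'(2) by blast
    have "fst d \<in> edges D' \<and> end_pt d = v \<longleftrightarrow> fst d \<in> edges D \<and> end_pt d = v" for d
    proof
      assume d: "fst d \<in> edges D' \<and> end_pt d = v"
      have "end_pt d \<notin> cut_pts" using d v side_sets(2) by (auto simp: cut_pts_def)
      then have "fst d \<in> side S" using ends_of_D'[of d] d by blast
      then show "fst d \<in> edges D \<and> end_pt d = v" using d by (simp add: side_def)
    next
      assume d: "fst d \<in> edges D \<and> end_pt d = v"
      then have "fst d \<in> side S" using end_in_side[of "fst d" "snd d"] v by simp
      then show "fst d \<in> edges D' \<and> end_pt d = v" using d D'(1) by blast
    qed
    then show ?thesis unfolding mates_at_bivalent[OF False] mates_at_bivalent[OF v'] by blast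
  qed
  then show ?thesis unfolding mates_def by (rule SUP_cong[OF refl])
qed

text \<open>The chords have both ends on the cut and the near edges end in \<open>S\<close> or on
  the cut, so no vertex of \<open>D'\<close> lies beyond it.\<close>

lemma mates_far: "mates D' \<alpha> S' = {}"
proof -
  have "mates_at D' \<alpha> v = {}" if v: "v \<in> S'" for v
  proof -
    have v': "v \<notin> set (crossings D')" using D'(2) v side_sets(1) by blast
    have "end_pt d \<noteq> v" if "fst d \<in> edges D'" for d
      using ends_of_D'[OF that] v side_sets(1,3) unfolding cut_pts_def by blast
    then show ?thesis unfolding mates_at_bivalent[OF v'] by blast
  qed
  then show ?thesis by (simp add: mates_def)
qed

lemma mates_chords: "mates D' \<alpha> \<Gamma> = attached chord_end"
proof -
  have v: "mates_at D' \<alpha> v = {(d, d'). v \<in> cut_pts \<and> (d = near v \<and> d' = chord_end v \<or> d = chord_end v \<and> d' = near v)}" if "v \<in> \<Gamma>" for v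
  proof -
    have vS: "v \<notin> S" using that side_sets(2) by blast
    then have "v \<notin> set (crossings D')" using D'(2) by blast
    note m = mates_at_bivalent[OF this, of \<alpha>]
    have snd: "snd (chord_end v) = (\<not> snd (near v))" by (simp add: chord_end_def)
    show ?thesis unfolding m
    proof (intro equalityI subsetI; clarify)
      fix e b f c assume a: "fst (e, b) \<in> edges D'" "fst (f, c) \<in> edges D'" "end_pt (f, c) = end_pt (e, b)" "v = end_pt (e, b)" "snd (f, c) = (\<not> snd (e, b))"
      have "v \<in> cut_pts \<and> ((e, b) = near v \<or> (e, b) = chord_end v)" "(f, c) = near v \<or> (f, c) = chord_end v"
        using ends_of_D'[OF a(1)] ends_of_D'[OF a(2)] vS unfolding a(3) a(4)[symmetric] by blast+
      moreover have "(e, b) \<noteq> (f, c)" using a(5) by auto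
      ultimately show "end_pt (e, b) \<in> cut_pts \<and> ((e, b) = near (end_pt (e, b)) \<and> (f, c) = chord_end (end_pt (e, b)) \<or> (e, b) = chord_end (end_pt (e, b)) \<and> (f, c) = near (end_pt (e, b)))"
        using a(4) by metis
    next
      fix e b f c assume a: "v \<in> cut_pts" "(e, b) = near v \<and> (f, c) = chord_end v \<or> (e, b) = chord_end v \<and> (f, c) = near v"
      have "fst (near v) \<in> edges D'" "fst (chord_end v) \<in> edges D'"
        using near_far(1)[OF a(1)] ch(1)[OF a(1)] D'(1) by (auto simp: chord_end_def)
      then show "fst (e, b) \<in> edges D' \<and> fst (f, c) \<in> edges D' \<and> end_pt (e, b) = v \<and> end_pt (f, c) = v \<and> snd (f, c) = (\<not> snd (e, b))"
        using a(2) near_far(3)[OF a(1)] chord_end[OF a(1)] snd by metis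
    qed
  qed
  have "mates D' \<alpha> \<Gamma> = (\<Union>v\<in>\<Gamma>. {(d, d'). v \<in> cut_pts \<and> (d = near v \<and> d' = chord_end v \<or> d = chord_end v \<and> d' = near v)})"
    unfolding mates_def using v by (intro SUP_cong) auto
  also have "\<dots> = attached chord_end" unfolding attached_def cut_pts_def by blast
  finally show ?thesis .
qed

abbreviation proj :: "(((real \<Rightarrow> complex) \<times> bool) \<times> ((real \<Rightarrow> complex) \<times> bool)) set \<Rightarrow> (real \<Rightarrow> complex) rel" where
  "proj M \<equiv> {(e, f). \<exists>b c. ((e, b), (f, c)) \<in> M}"

lemma proj_Un: "proj (M \<union> N) = proj M \<union> proj N"
  by blast

lemma proj_attached: "proj (attached g) = {(e, f). \<exists>p\<in>cut_pts. e = fst (near p) \<and> f = fst (g p) \<or> e = fst (g p) \<and> f = fst (near p)}"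
proof (intro equalityI subsetI; clarify)
  fix e f b c assume "((e, b), (f, c)) \<in> attached g"
  then obtain p where "p \<in> cut_pts" "(e, b) = near p \<and> (f, c) = g p \<or> (e, b) = g p \<and> (f, c) = near p" unfolding attached_def by blast
  then show "\<exists>p\<in>cut_pts. e = fst (near p) \<and> f = fst (g p) \<or> e = fst (g p) \<and> f = fst (near p)" by (metis fst_conv)
next
  fix e f p assume "p \<in> cut_pts" "e = fst (near p) \<and> f = fst (g p) \<or> e = fst (g p) \<and> f = fst (near p)"
  then have "((e, snd (near p)), (f, snd (g p))) \<in> attached g \<or> ((e, snd (g p)), (f, snd (near p))) \<in> attached g"
    unfolding attached_def by auto
  then show "\<exists>b c. ((e, b), (f, c)) \<in> attached g" by blast
qed

lemma far_strand: "proj (mates D \<beta> S') = end_matching.adj (mates D \<beta> S')"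
proof -
  interpret m: end_matching "side S'" "mates D \<beta> S'" by (rule far_matching)
  show ?thesis by (simp add: m.adj_def)
qed

lemma near_matching: "proj (mates D \<alpha> S) \<subseteq> side S \<times> side S" "sym (proj (mates D \<alpha> S))"
proof -
  interpret m: end_matching "side S" "mates D \<alpha> S"
    using end_in_side by (intro end_matching_mates) (auto simp: side_def)
  show "proj (mates D \<alpha> S) \<subseteq> side S \<times> side S" "sym (proj (mates D \<alpha> S))"
    using m.adj_E m.sym_adj by (simp_all add: m.adj_def)
qed

text \<open>The chord at \<open>p\<close> stands for the far strand at \<open>p\<close>, and
  \<open>match\<close> is the assumption \<open>ch_eq\<close> that chords imitate the far strands.
  Thus \<open>G.inner\<close> describes \<open>D'\<close> and \<open>G.outer\<close> describes
  \<open>D\<close>.\<close>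

sublocale G: glued_relations "side S" "side S'" cut_pts "\<lambda>p. fst (near p)" "\<lambda>p. fst (far p)" "\<lambda>p. \<sigma> (ch p)"
  "proj (mates D \<beta> S')"
proof
  interpret m: end_matching "side S'" "mates D \<beta> S'" by (rule far_matching)
  show "side S \<inter> side S' = {}" by (rule sides_cover)
  have "\<sigma> i \<notin> side S" if "i \<in> I" for i
    using chord_midpoint[OF that] side_midpoint[of "\<sigma> i"] side_sets(1) by blast
  then show "(\<lambda>p. \<sigma> (ch p)) ` cut_pts \<inter> side S = {}" unfolding e3_range by blast
  show "proj (mates D \<beta> S') \<subseteq> side S' \<times> side S'" "sym (proj (mates D \<beta> S'))"
    unfolding far_strand by (rule m.adj_E, rule m.sym_adj)
  show "fst (near p) \<in> side S" "fst (far p) \<in> side S'" if "p \<in> cut_pts" for p using near_far(1,2)[OF that] .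
  show "\<sigma> (ch p) = \<sigma> (ch q) \<longleftrightarrow> (fst (far p), fst (far q)) \<in> (proj (mates D \<beta> S'))\<^sup>*"
    if pq: "p \<in> cut_pts" "q \<in> cut_pts" for p q
  proof -
    have "\<sigma> (ch p) = \<sigma> (ch q) \<longleftrightarrow> ch p = ch q"
    proof
      assume eq: "\<sigma> (ch p) = \<sigma> (ch q)"
      show "ch p = ch q"
      proof (rule ccontr)
        assume "ch p \<noteq> ch q"
        then have "path_image (\<sigma> (ch p)) \<inter> path_image (\<sigma> (ch q)) = {}" using chords_disjoint ch(1) pq by blast
        then show False unfolding eq using pathstart_in_path_image by blast
      qed
    qed simp
    then show ?thesis unfolding ch_eq[OF pq] strand'_def m.strand_def far_strand by simp
  qed
qed

abbreviation near_rel :: "complex set \<Rightarrow> (real \<Rightarrow> complex) rel" where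
  "near_rel \<alpha> \<equiv> proj (mates D \<alpha> S)"

definition chord_classes :: "complex set \<Rightarrow> (real \<Rightarrow> complex) set set" where
  "chord_classes \<alpha> = (\<lambda>e. (G.inner (near_rel \<alpha>))\<^sup>* `` {e}) ` (side S \<union> (\<lambda>p. \<sigma> (ch p)) ` cut_pts)"

lemma UNIV_split: "UNIV = S \<union> S' \<union> \<Gamma>"
  using side_sets(4) by simp

lemma circles_D': "circles D' \<alpha> = pts ` chord_classes \<alpha>"
proof -
  have "mates D' \<alpha> UNIV = mates D \<alpha> S \<union> attached chord_end"
    unfolding UNIV_split mates_Un mates_near mates_far mates_chords by simp
  then have "joined D' \<alpha> \<union> (joined D' \<alpha>)\<inverse> = G.inner (near_rel \<alpha>)"
    unfolding joined_eq G.inner_def by (simp only: proj_Un proj_attached) (simp only: chord_end_def fst_conv)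
  then show ?thesis unfolding circles_eq chord_classes_def e3_range D'(1) image_image by simp
qed

lemma circles_D:
  assumes "\<alpha> \<subseteq> S" "\<beta> \<subseteq> S'"
  shows "circles D (\<alpha> \<union> \<beta>) = pts ` (G.\<Phi> ` chord_classes \<alpha> \<union> G.closed_classes)"
proof -
  have "mates D (\<alpha> \<union> \<beta>) S = mates D \<alpha> S" "mates D (\<alpha> \<union> \<beta>) S' = mates D \<beta> S'"
    by (rule mates_cong; use assms side_sets(1) in blast)+
  then have "mates D (\<alpha> \<union> \<beta>) UNIV = mates D \<alpha> S \<union> mates D \<beta> S' \<union> attached far"
    unfolding UNIV_split mates_Un mates_cut by simp
  then have "joined D (\<alpha> \<union> \<beta>) \<union> (joined D (\<alpha> \<union> \<beta>))\<inverse> = G.outer (near_rel \<alpha>)"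
    unfolding joined_eq G.outer_def by (simp only: proj_Un proj_attached)
  then have "circles D (\<alpha> \<union> \<beta>) = pts ` (\<lambda>e. (G.outer (near_rel \<alpha>))\<^sup>* `` {e}) ` (side S \<union> side S')"
    unfolding circles_eq sides_cover(1) image_image by simp
  then show ?thesis unfolding chord_classes_def G.classes_glued[OF near_matching] .
qed

lemma chord_class_edges: "K \<in> chord_classes \<alpha> \<Longrightarrow> K \<subseteq> edges D'"
  using G.inner_class_meets_E1(3)[OF near_matching] unfolding chord_classes_def D'(1) e3_range by blast

lemma edges_in_pts: "K \<subseteq> edges D' \<Longrightarrow> {e \<in> edges D'. path_image e \<subseteq> pts K} = K"
proof
  assume K: "K \<subseteq> edges D'"
  show "K \<subseteq> {e \<in> edges D'. path_image e \<subseteq> pts K}" using K by (auto simp: pts_def)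
  show "{e \<in> edges D'. path_image e \<subseteq> pts K} \<subseteq> K"
  proof
    fix e assume e: "e \<in> {e \<in> edges D'. path_image e \<subseteq> pts K}"
    have "e (1/2) \<in> path_image e" by (simp add: path_image_def)
    then obtain f where "f \<in> K" "e (1/2) \<in> path_image f" using e by (auto simp: pts_def)
    then show "e \<in> K" using midpoint_unique[of e f] e K by blast
  qed
qed

text \<open>\<open>G.\<Phi>\<close> as a map on circles, which are point sets; the edges of a circle
  of \<open>D'\<close> are recovered from its points by \<open>edges_in_pts\<close>.\<close>

definition glue :: "complex set \<Rightarrow> complex set" where
  "glue Z = pts (G.\<Phi> {e \<in> edges D'. path_image e \<subseteq> Z})"

lemma glue_pts: "K \<in> chord_classes \<alpha> \<Longrightarrow> glue (pts K) = pts (G.\<Phi> K)"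
  unfolding glue_def using edges_in_pts[OF chord_class_edges] by simp

lemma \<Phi>_edges: "G.\<Phi> K \<subseteq> edges D"
  using G.\<Phi>_subset sides_cover(1) by blast

lemma glue_inj: "inj_on glue (\<Union>\<alpha>. circles D' \<alpha>)"
proof (rule inj_onI)
  fix Z Z' assume Z: "Z \<in> (\<Union>\<alpha>. circles D' \<alpha>)" "Z' \<in> (\<Union>\<alpha>. circles D' \<alpha>)" and eq: "glue Z = glue Z'"
  from Z(1) obtain \<alpha> K where K1: "K \<in> chord_classes \<alpha>" "Z = pts K" unfolding circles_D' by auto
  from Z(2) obtain \<alpha>' K' where K2: "K' \<in> chord_classes \<alpha>'" "Z' = pts K'" unfolding circles_D' by auto
  note K = K1 K2
  have "pts (G.\<Phi> K) = pts (G.\<Phi> K')" using eq glue_pts[OF K(1)] glue_pts[OF K(3)] K by simp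
  then have eq': "G.\<Phi> K = G.\<Phi> K'" by (rule inj_onD[OF inj_pts]) (simp_all add: \<Phi>_edges)
  note C1 = G.inner_class_meets_E1[OF near_matching K(1)[unfolded chord_classes_def]]
    and C2 = G.inner_class_meets_E1[OF near_matching K(3)[unfolded chord_classes_def]]
  have "K = K'" by (rule G.\<Phi>_inj[OF C1(3) C1(2) C2(3) C2(2) eq'])
  then show "Z = Z'" using K by simp
qed

lemma closed_not_glued: "pts ` G.closed_classes \<inter> glue ` (\<Union>\<alpha>. circles D' \<alpha>) = {}"
proof -
  have False if "K \<in> chord_classes \<alpha>" "Q \<in> G.closed_classes" "pts Q = glue (pts K)" for K \<alpha> Q
  proof -
    have "pts Q = pts (G.\<Phi> K)" using that(3) glue_pts[OF that(1)] by simp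
    moreover have "Q \<subseteq> edges D" using G.closed_classes_subset[OF that(2)] sides_cover(1) by blast
    ultimately have "Q = G.\<Phi> K" by (intro inj_onD[OF inj_pts]) (simp_all add: \<Phi>_edges)
    then show False
      using that(2) G.\<Phi>_not_closed[OF G.inner_class_meets_E1(1)[OF near_matching that(1)[unfolded chord_classes_def]]] by simp
  qed
  then show ?thesis unfolding circles_D' by fastforce
qed

text \<open>\<open>\<Psi>\<close> and \<open>Cl\<close> depend on the far state but not on
  \<open>\<alpha>\<close>. For this reason the same identification of circles can be used along a
  whole row and respects the horizontal arrows.\<close>

theorem circles_glued:
  assumes "\<beta> \<subseteq> S'"
  shows "\<exists>\<Psi> Cl. inj_on \<Psi> (\<Union>\<alpha>. circles D' \<alpha>) \<and> Cl \<inter> \<Psi> ` (\<Union>\<alpha>. circles D' \<alpha>) = {} \<and>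
    (\<forall>\<alpha>\<subseteq>S. circles D (\<alpha> \<union> \<beta>) = \<Psi> ` circles D' \<alpha> \<union> Cl)"
proof -
  have "circles D (\<alpha> \<union> \<beta>) = glue ` circles D' \<alpha> \<union> pts ` G.closed_classes" if "\<alpha> \<subseteq> S" for \<alpha>
  proof -
    have "glue ` circles D' \<alpha> = pts ` G.\<Phi> ` chord_classes \<alpha>"
      unfolding circles_D' image_image using glue_pts by (intro image_cong refl) blast
    then show ?thesis unfolding circles_D[OF that assms] by (simp only: image_Un)
  qed
  then show ?thesis using glue_inj closed_not_glued by blast
qed

end

section \<open>Both kinds of surgery, and the assembly of rows and columns\<close>

lemma block_succ_in:
  assumes P: "P \<in> NC n" and i: "i \<in> {1..n}"
  shows "block_succ P i \<in> {1..n}"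
proof -
  have part: "partition_on {1..n} P" using P by (simp add: NC_def)
  then obtain B where B: "B \<in> P" "i \<in> B" using i partition_onD1 by blast
  have "(THE B. B \<in> P \<and> i \<in> B) = B"
  proof (rule the_equality)
    show "B' = B" if "B' \<in> P \<and> i \<in> B'" for B'
      using disjointD[OF partition_onD2[OF part], of B' B] that B by blast
  qed (use B in blast)
  then have bs: "block_succ P i = (if \<exists>j\<in>B. i < j then Min {j \<in> B. i < j} else Min B)"
    by (simp add: block_succ_def)
  have sub: "B \<subseteq> {1..n}" using partition_onD1[OF part] B(1) by blast
  then have fin: "finite B" using finite_subset by blast
  have "block_succ P i \<in> B"
  proof (cases "\<exists>j\<in>B. i < j")
    case True
    then have "Min {j \<in> B. i < j} \<in> {j \<in> B. i < j}" using fin by (intro Min_in) auto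
    then show ?thesis using bs True by simp
  next
    case False
    then show ?thesis using bs Min_in[OF fin] B(2) by auto
  qed
  then show ?thesis using sub by blast
qed

context admissible_cut_link
begin

text \<open>The common form of both kinds of surgery, seen from the retained side \<open>S\<close>.
  The ends of a chord are given as an unordered pair, since one kind reverses the chords; the
  orientation is fixed by the directions in which the diagram passes the cut.\<close>

definition side_surgery :: "nat set set \<Rightarrow> diagram \<Rightarrow> bool" where
  "side_surgery P D' \<longleftrightarrow> (\<exists>\<sigma>.
     (\<forall>i\<in>{1..n}. arc (\<sigma> i) \<and> {pathstart (\<sigma> i), pathfinish (\<sigma> i)} = {cut_b D C i, cut_a D C (block_succ P i)} \<and>
        path_image (\<sigma> i) \<subseteq> \<Gamma> \<union> S' \<and> path_image (\<sigma> i) \<inter> \<Gamma> = {pathstart (\<sigma> i), pathfinish (\<sigma> i)} \<and>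
        passes D (pathstart (\<sigma> i)) (\<Gamma> \<union> S) (\<Gamma> \<union> S') \<and> passes D (pathfinish (\<sigma> i)) (\<Gamma> \<union> S') (\<Gamma> \<union> S)) \<and>
     (\<forall>i\<in>{1..n}. \<forall>j\<in>{1..n}. i \<noteq> j \<longrightarrow> path_image (\<sigma> i) \<inter> path_image (\<sigma> j) = {}) \<and>
     closed_up_by D (\<Gamma> \<union> S) (\<sigma> ` {1..n}) D')"

lemma surgery_glued:
  assumes sur: "\<forall>P\<in>NC n. side_surgery P (K P)" and \<beta>: "\<beta> \<subseteq> S'"
  shows "\<exists>P \<Psi> Cl. P \<in> NC n \<and> inj_on \<Psi> (\<Union>\<alpha>. circles (K P) \<alpha>) \<and> Cl \<inter> \<Psi> ` (\<Union>\<alpha>. circles (K P) \<alpha>) = {} \<and>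
    (\<forall>\<alpha>\<subseteq>S. circles D (\<alpha> \<union> \<beta>) = \<Psi> ` circles (K P) \<alpha> \<union> Cl)"
proof -
  obtain P ch where P: "P \<in> NC n" and ch: "\<And>p. p \<in> cut_pts \<Longrightarrow> ch p \<in> {1..n}"
    "\<And>p. p \<in> cut_pts \<Longrightarrow> p = cut_b D C (ch p) \<or> p = cut_a D C (block_succ P (ch p))"
    "\<And>i. i \<in> {1..n} \<Longrightarrow> cut_b D C i \<in> cut_pts \<and> ch (cut_b D C i) = i"
    "\<And>i. i \<in> {1..n} \<Longrightarrow> cut_a D C (block_succ P i) \<in> cut_pts \<and> ch (cut_a D C (block_succ P i)) = i"
    "\<And>p q. p \<in> cut_pts \<Longrightarrow> q \<in> cut_pts \<Longrightarrow> ch p = ch q \<longleftrightarrow> fst (far q) \<in> strand' \<beta> p"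
    by (rule far_pattern[of \<beta>]) blast
  obtain \<sigma> where "\<forall>i\<in>{1..n}. arc (\<sigma> i) \<and> {pathstart (\<sigma> i), pathfinish (\<sigma> i)} = {cut_b D C i, cut_a D C (block_succ P i)} \<and>
        path_image (\<sigma> i) \<subseteq> \<Gamma> \<union> S' \<and> path_image (\<sigma> i) \<inter> \<Gamma> = {pathstart (\<sigma> i), pathfinish (\<sigma> i)} \<and>
        passes D (pathstart (\<sigma> i)) (\<Gamma> \<union> S) (\<Gamma> \<union> S') \<and> passes D (pathfinish (\<sigma> i)) (\<Gamma> \<union> S') (\<Gamma> \<union> S)"
    and disj: "\<forall>i\<in>{1..n}. \<forall>j\<in>{1..n}. i \<noteq> j \<longrightarrow> path_image (\<sigma> i) \<inter> path_image (\<sigma> j) = {}"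
    and cl: "closed_up_by D (\<Gamma> \<union> S) (\<sigma> ` {1..n}) (K P)"
    using bspec[OF sur P] unfolding side_surgery_def by blast
  then have \<sigma>: "arc (\<sigma> i)" "{pathstart (\<sigma> i), pathfinish (\<sigma> i)} = {cut_b D C i, cut_a D C (block_succ P i)}"
      "path_image (\<sigma> i) \<subseteq> \<Gamma> \<union> S'" "path_image (\<sigma> i) \<inter> \<Gamma> = {pathstart (\<sigma> i), pathfinish (\<sigma> i)}"
      "passes D (pathstart (\<sigma> i)) (\<Gamma> \<union> S) (\<Gamma> \<union> S')" "passes D (pathfinish (\<sigma> i)) (\<Gamma> \<union> S') (\<Gamma> \<union> S)" if "i \<in> {1..n}" for i
    using that by blast+
  have "closed_up_link D C S S' \<beta> ch {1..n} \<sigma> (K P)"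
  proof
    show "p = pathstart (\<sigma> (ch p)) \<or> p = pathfinish (\<sigma> (ch p))" if "p \<in> cut_pts" for p
      using ch(2)[OF that] \<sigma>(2)[OF ch(1)[OF that]] by blast
    have "{pathstart (\<sigma> i), pathfinish (\<sigma> i)} \<subseteq> cut_pts" if "i \<in> {1..n}" for i
      unfolding \<sigma>(2)[OF that] using ch(3,4)[OF that] by simp
    then show "pathstart (\<sigma> i) \<in> cut_pts" "pathfinish (\<sigma> i) \<in> cut_pts" if "i \<in> {1..n}" for i
      using that by simp_all
    show "edges (K P) = side S \<union> \<sigma> ` {1..n}" using cl by (simp add: closed_up_by_def side_def)
    show "set (crossings (K P)) = set (crossings D) \<inter> S" using cl crossing_off_cut by (auto simp: closed_up_by_def)
    show "over_in (K P) x = over_in D x \<and> over_out (K P) x = over_out D x \<and>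
        under_in (K P) x = under_in D x \<and> under_out (K P) x = under_out D x" if "x \<in> set (crossings (K P))" for x
      using cl that by (simp add: closed_up_by_def)
    show "path_image (\<sigma> i) \<inter> path_image (\<sigma> j) = {}" if "i \<in> {1..n}" "j \<in> {1..n}" "i \<noteq> j" for i j
      using disj that by blast
  qed (fact \<sigma> ch)+
  from closed_up_link.circles_glued[OF this \<beta>] obtain \<Psi> Cl where
    "inj_on \<Psi> (\<Union>\<alpha>. circles (K P) \<alpha>) \<and> Cl \<inter> \<Psi> ` (\<Union>\<alpha>. circles (K P) \<alpha>) = {} \<and>
      (\<forall>\<alpha>\<subseteq>S. circles D (\<alpha> \<union> \<beta>) = \<Psi> ` circles (K P) \<alpha> \<union> Cl)" by (elim exE)
  from conjI[OF P this] show ?thesis by - (rule exI, rule exI, rule exI, assumption)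
qed

lemma glued_circles_surgery:
  assumes sur: "\<forall>P\<in>NC n. side_surgery P (K P)"
  shows "\<exists>pt \<Psi> Cl. glued_circles D (set (crossings D) \<inter> S) (set (crossings D) \<inter> S') (NC n) K pt \<Psi> Cl"
proof -
  define gl where "gl \<beta> = (\<lambda>(P, \<Psi>, Cl). P \<in> NC n \<and> inj_on \<Psi> (\<Union>\<alpha>. circles (K P) \<alpha>) \<and>
    Cl \<inter> \<Psi> ` (\<Union>\<alpha>. circles (K P) \<alpha>) = {} \<and> (\<forall>\<alpha>\<subseteq>S. circles D (\<alpha> \<union> \<beta>) = \<Psi> ` circles (K P) \<alpha> \<union> Cl))" for \<beta>
  define t where "t \<beta> = (SOME t. gl \<beta> t)" for \<beta>
  define pt \<Psi> Cl where "pt \<beta> = fst (t \<beta>)" and "\<Psi> \<beta> = fst (snd (t \<beta>))" and "Cl \<beta> = snd (snd (t \<beta>))" for \<beta>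
  have gl: "pt \<beta> \<in> NC n" "inj_on (\<Psi> \<beta>) (\<Union>\<alpha>. circles (K (pt \<beta>)) \<alpha>)"
    "Cl \<beta> \<inter> \<Psi> \<beta> ` (\<Union>\<alpha>. circles (K (pt \<beta>)) \<alpha>) = {}"
    "\<And>\<alpha>. \<alpha> \<subseteq> S \<Longrightarrow> circles D (\<alpha> \<union> \<beta>) = \<Psi> \<beta> ` circles (K (pt \<beta>)) \<alpha> \<union> Cl \<beta>"
    if \<beta>: "\<beta> \<subseteq> set (crossings D) \<inter> S'" for \<beta>
  proof -
    have "\<beta> \<subseteq> S'" using \<beta> by blast
    from surgery_glued[OF sur this] obtain P \<psi> c where
      "P \<in> NC n \<and> inj_on \<psi> (\<Union>\<alpha>. circles (K P) \<alpha>) \<and> c \<inter> \<psi> ` (\<Union>\<alpha>. circles (K P) \<alpha>) = {} \<and>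
        (\<forall>\<alpha>\<subseteq>S. circles D (\<alpha> \<union> \<beta>) = \<psi> ` circles (K P) \<alpha> \<union> c)" by (elim exE)
    then have "gl \<beta> (P, \<psi>, c)" unfolding gl_def prod.case .
    then have "gl \<beta> (t \<beta>)" unfolding t_def by (rule someI)
    then have "gl \<beta> (pt \<beta>, \<Psi> \<beta>, Cl \<beta>)" by (simp add: pt_def \<Psi>_def Cl_def)
    then have g: "pt \<beta> \<in> NC n \<and> inj_on (\<Psi> \<beta>) (\<Union>\<alpha>. circles (K (pt \<beta>)) \<alpha>) \<and>
      Cl \<beta> \<inter> \<Psi> \<beta> ` (\<Union>\<alpha>. circles (K (pt \<beta>)) \<alpha>) = {} \<and>
      (\<forall>\<alpha>\<subseteq>S. circles D (\<alpha> \<union> \<beta>) = \<Psi> \<beta> ` circles (K (pt \<beta>)) \<alpha> \<union> Cl \<beta>)" unfolding gl_def prod.case .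
    then show "pt \<beta> \<in> NC n" "inj_on (\<Psi> \<beta>) (\<Union>\<alpha>. circles (K (pt \<beta>)) \<alpha>)"
      "Cl \<beta> \<inter> \<Psi> \<beta> ` (\<Union>\<alpha>. circles (K (pt \<beta>)) \<alpha>) = {}"
      "\<And>\<alpha>. \<alpha> \<subseteq> S \<Longrightarrow> circles D (\<alpha> \<union> \<beta>) = \<Psi> \<beta> ` circles (K (pt \<beta>)) \<alpha> \<union> Cl \<beta>"
      by simp_all
  qed
  have cl: "\<exists>E. closed_up_by D (\<Gamma> \<union> S) E (K P)" if "P \<in> NC n" for P
    using bspec[OF sur that] unfolding side_surgery_def by blast
  have "glued_circles D (set (crossings D) \<inter> S) (set (crossings D) \<inter> S') (NC n) K pt \<Psi> Cl"
  proof
    show "set (crossings D) \<inter> S \<union> set (crossings D) \<inter> S' = set (crossings D)"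
      using crossing_off_cut side_sets(4) by blast
    show "(set (crossings D) \<inter> S) \<inter> (set (crossings D) \<inter> S') = {}" using side_sets(1) by blast
    show "distinct (crossings D)" using link by (simp add: link_diagram_def)
    show "finite (circles D \<gamma>)" for \<gamma> by (rule finite_circles_link)
    show "set (crossings (K P)) = set (crossings D) \<inter> S" "distinct (crossings (K P))" if "P \<in> NC n" for P
      using cl[OF that] crossing_off_cut by (auto simp: closed_up_by_def)
    show "positive_crossing (K P) x \<longleftrightarrow> positive_crossing D x" if "P \<in> NC n" "x \<in> set (crossings D) \<inter> S" for P x
    proof -
      have "x \<in> set (crossings (K P))" "\<exists>E. closed_up_by D (\<Gamma> \<union> S) E (K P)" using cl[OF that(1)] that(2) by (auto simp: closed_up_by_def)
      then have "over_in (K P) x = over_in D x" "under_in (K P) x = under_in D x" by (auto simp: closed_up_by_def)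
      then show ?thesis by (simp add: positive_crossing_def over_dir_def under_dir_def)
    qed
    fix \<beta> assume \<beta>: "\<beta> \<subseteq> set (crossings D) \<inter> S'"
    show "pt \<beta> \<in> NC n" using gl(1)[OF \<beta>] .
    show "inj_on (\<Psi> \<beta>) (\<Union>\<alpha>\<in>Pow (set (crossings D) \<inter> S). circles (K (pt \<beta>)) \<alpha>)"
      by (rule inj_on_subset[OF gl(2)[OF \<beta>]]) blast
    show "Cl \<beta> \<inter> \<Psi> \<beta> ` (\<Union>\<alpha>\<in>Pow (set (crossings D) \<inter> S). circles (K (pt \<beta>)) \<alpha>) = {}"
      using gl(3)[OF \<beta>] by blast
    show "circles D (\<alpha> \<union> \<beta>) = \<Psi> \<beta> ` circles (K (pt \<beta>)) \<alpha> \<union> Cl \<beta>" if "\<alpha> \<subseteq> set (crossings D) \<inter> S" for \<alpha>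
      using gl(4)[OF \<beta>] that by blast
  qed
  then show ?thesis by blast
qed

end

theorem theorem1p1:
  fixes L :: diagram and C :: "real \<Rightarrow> complex" and R1 R2 :: "complex set"
    and L1 L2 :: "nat set set \<Rightarrow> diagram"
  assumes "link_diagram L"
    and "admissible_cut L C"
    and "cut_discs L C R1 R2"
    and "\<And>P. P \<in> NC (cut_size L C) \<Longrightarrow> surgery1 L C R1 R2 P (L1 P)"
    and "\<And>P. P \<in> NC (cut_size L C) \<Longrightarrow> surgery2 L C R1 R2 P (L2 P)"
  shows "\<exists>A :: (nat, 'k::field) dcpx.
    double_complex A \<and>
    (\<forall>q. linear_combination (NC (cut_size L C)) (\<lambda>P. khovanov (L1 P)) (row_cpx A q)) \<and>
    (\<forall>p. linear_combination (NC (cut_size L C)) (\<lambda>P. khovanov (L2 P)) (column_cpx A p)) \<and>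
    homotopy_equivalent_cpx (total_complex A) (khovanov L)"
proof -
  let ?n = "cut_size L C" and ?\<Gamma> = "path_image C"
  obtain S1 S2 where R: "R1 = ?\<Gamma> \<union> S1" "R2 = ?\<Gamma> \<union> S2"
    and sides: "S1 = inside ?\<Gamma> \<and> S2 = outside ?\<Gamma> \<or> S1 = outside ?\<Gamma> \<and> S2 = inside ?\<Gamma>"
    using assms(3) unfolding cut_discs_def inner_disc_def outer_disc_def by blast
  have tc: "transversal_cut L C" using assms(2) by (simp add: admissible_cut_def)
  \<comment> \<open>The development is used twice, with the side of \<open>R1\<close> retained for
    the rows and the side of \<open>R2\<close> retained for the columns.\<close>
  interpret A: admissible_cut_link L C S1 S2 by unfold_locales (use assms(1,2) tc sides in auto)
  interpret B: admissible_cut_link L C S2 S1 by unfold_locales (use assms(1,2) tc sides in auto)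
  have pass: "passes L (cut_a L C i) R2 R1" "passes L (cut_b L C i) R1 R2" if "i \<in> {1..?n}" for i
    using assms(3) that by (simp_all add: cut_discs_def)
  have "\<forall>P\<in>NC ?n. A.side_surgery P (L1 P)"
  proof
    fix P assume P: "P \<in> NC ?n"
    obtain \<sigma> where \<sigma>: "chord_system L C R2 P \<sigma>" "closed_up_by L R1 (\<sigma> ` {1..?n}) (L1 P)"
      using assms(4)[OF P] unfolding surgery1_def by blast
    show "A.side_surgery P (L1 P)"
      unfolding A.side_surgery_def
      by (rule exI[of _ \<sigma>])
        (use \<sigma> pass block_succ_in[OF P] in \<open>auto simp: chord_system_def regular_arc_def R\<close>)
  qed
  from A.glued_circles_surgery[OF this] obtain pt1 \<Psi>1 Cl1 where
    "glued_circles L (set (crossings L) \<inter> S1) (set (crossings L) \<inter> S2) (NC ?n) L1 pt1 \<Psi>1 Cl1" by blast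
  then interpret G1: glued_circles L "set (crossings L) \<inter> S1" "set (crossings L) \<inter> S2" "NC ?n" L1 pt1 \<Psi>1 Cl1 .
  have "\<forall>P\<in>NC ?n. B.side_surgery P (L2 P)"
  proof
    fix P assume P: "P \<in> NC ?n"
    obtain \<sigma> where \<sigma>: "chord_system L C R1 P \<sigma>" "closed_up_by L R2 ((\<lambda>i. reversepath (\<sigma> i)) ` {1..?n}) (L2 P)"
      using assms(5)[OF P] unfolding surgery2_def by blast
    show "B.side_surgery P (L2 P)"
      unfolding B.side_surgery_def
      by (rule exI[of _ "\<lambda>i. reversepath (\<sigma> i)"])
        (use \<sigma> pass block_succ_in[OF P] in \<open>auto simp: chord_system_def regular_arc_def R arc_reversepath insert_commute\<close>)
  qed
  from B.glued_circles_surgery[OF this] obtain pt2 \<Psi>2 Cl2 where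
    "glued_circles L (set (crossings L) \<inter> S2) (set (crossings L) \<inter> S1) (NC ?n) L2 pt2 \<Psi>2 Cl2" by blast
  then interpret G2: glued_circles L "set (crossings L) \<inter> S2" "set (crossings L) \<inter> S1" "NC ?n" L2 pt2 \<Psi>2 Cl2 .
  let ?X1 = "set (crossings L) \<inter> S1" and ?X2 = "set (crossings L) \<inter> S2" and ?r = "before (crossings L)"
  note r = tournament_before[of "crossings L"] and cube = A.surgery_cube_link
  let ?A = "cube_dcpx L ?r ?X1 ?X2 :: (_, 'k) dcpx"
  have A: "double_complex ?A" by (rule double_complex_cube[OF cube r G1.X])
  obtain A' :: "(nat, 'k) dcpx" and \<phi> where A': "double_complex A'"
    and row: "\<And>q. signed_bijection (row_cpx A' q) (row_cpx ?A q) \<phi> (\<lambda>_. 1)"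
    and col: "\<And>p. signed_bijection (column_cpx A' p) (column_cpx ?A p) \<phi> (\<lambda>_. 1)"
    and tot: "signed_bijection (total_complex A') (total_complex ?A) \<phi> (\<lambda>_. 1)"
    by (rule double_complex_encode_nat[OF A]) blast
  have "linear_combination (NC ?n) (\<lambda>P. khovanov (L1 P)) (row_cpx A' q)" for q
    by (rule G1.row_linear_combination[OF r chain_complex_row[OF A] row chain_complex_row[OF A']])
  moreover have "linear_combination (NC ?n) (\<lambda>P. khovanov (L2 P)) (column_cpx A' p)" for p
  \<comment> \<open>Columns are rows of the flipped double complex, and flipping \<open>?A\<close>
    exchanges the roles of \<open>?X1\<close> and \<open>?X2\<close>.\<close>
  proof (rule G2.row_linear_combination[OF r _ col[of p, unfolded column_eq_row_flip[of ?A] flip_cube_dcpx]])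
    show "chain_complex (row_cpx (cube_dcpx L ?r ?X2 ?X1 :: (_, 'k) dcpx) p)"
      using chain_complex_row[OF double_complex_flip[OF A]] by (simp add: flip_cube_dcpx)
    show "chain_complex (column_cpx A' p)"
      unfolding column_eq_row_flip by (rule chain_complex_row[OF double_complex_flip[OF A']])
  qed
  \<comment> \<open>The equivalence is an isomorphism: a relabelling of the basis followed by a
    change of signs.\<close>
  moreover have "homotopy_equivalent_cpx (total_complex A') (khovanov L :: (_, 'k) cpx)"
  proof -
    obtain \<eta> where "signed_bijection (total_complex ?A) (khovanov L :: (_, 'k) cpx) id \<eta>"
      using total_cube_signed_bijection[OF cube G1.X] by blast
    from signed_bijection_imp_homotopy_equivalent[OF chain_complex_total[OF A'] signed_bijection_trans[OF tot this]]
    show ?thesis .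
  qed
  ultimately show ?thesis using A' by blast
qed

end
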